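(* Assume the standing setting and assumption in the context. Fix $\gamma,L\in\mathbb N$. There exist constants $C,C',M_0>0$ such that for all $M\ge M_0$ and all $x\in\mathbb Z^d$ with $|x|_1\ge C'M^2$, $$\mathbb E\big[\nu_x[M,\infty)\big]\ \ge\ \Big[\mu[M,\gamma M]^{C}\,\mu[M,\infty)^{CM}\Big]\ \vee\ \Big[\sum_{i=0}^L \gamma^{-i}\,\mu[\gamma^iM,\gamma^{i+1}M]^{C\gamma^i M}\Big].$$ Moreover, for all $M\ge M_0$, $$\liminf_{|x|\to\infty}\mathbb E\big[\nu_x[M,\infty)\big]\ \ge\ \Big[\mu[M,\gamma M]^{C}\,\mu[M,\infty)^{CM}\Big]\ \vee\ \Big[\sum_{i=0}^\infty \gamma^{-i}\,\mu[\gamma^iM,\gamma^{i+1}M]^{C\gamma^i M}\Big].$$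
   Context: Setting: $d\ge2$; $\mathcal E^d$ nearest-neighbor edges of $\mathbb Z^d$; $\{\tau_e\}$ i.i.d. non-negative with law $\mu$, distribution function $F$, essential infimum $r$. Standing assumption: $F(r)<p_c(d)$ if $r=0$ and $F(r)<\vec p_c(d)$ if $r>0$ ($p_c(d)$, $\vec p_c(d)$: critical probabilities of Bernoulli bond and oriented bond percolation on $\mathbb Z^d$). $T(\gamma)=\sum_{e\in\gamma}\tau_e$; $T(x,y)$ is the infimum over vertex self-avoiding paths from $x$ to $y$; geodesics attain it. Fix a deterministic ordering of all finite vertex self-avoiding paths and let $\pi^{(x)}$ be the first geodesic from $0$ to $x$ in this ordering. The empirical distribution is $\nu_x(B)=\frac{1}{|\pi^{(x)}|}\#\{e\in\pi^{(x)}:\tau_e\in B\}$ for Borel $B\subset\mathbb R_{\ge0}$, where $|\pi^{(x)}|$ is the number of edges. $a\vee b=\max(a,b)$.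
   Formalization: The integer γ is required to be at least 2: for γ=0 the factor γ^{-i} is undefined, and for γ=1 the infinite sum diverges, so the second bound fails, whenever μ has atoms at arbitrarily large M. *)

theory Defs
  imports "HOL-Probability.Probability"
begin

definition l1norm :: "int ^ 'd::finite \<Rightarrow> int" where
  "l1norm x = (\<Sum>i\<in>UNIV. \<bar>x $ i\<bar>)"

definition lattice_edges :: "(int ^ 'd::finite) set set" where
  "lattice_edges = {{u, v} | u v. l1norm (u - v) = 1}"

definition bernoulli_bond :: "real \<Rightarrow> ((int ^ 'd::finite) set \<Rightarrow> bool) measure" where
  "bernoulli_bond p = PiM lattice_edges (\<lambda>_. measure_pmf (bernoulli_pmf p))"

definition open_adj :: "((int ^ 'd::finite) set \<Rightarrow> bool) \<Rightarrow> (int ^ 'd) rel" where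
  "open_adj w = {(u, v). {u, v} \<in> lattice_edges \<and> w {u, v}}"

definition oriented_open_adj :: "((int ^ 'd::finite) set \<Rightarrow> bool) \<Rightarrow> (int ^ 'd) rel" where
  "oriented_open_adj w = {(u, v). {u, v} \<in> lattice_edges \<and> w {u, v} \<and> (\<forall>i. u $ i \<le> v $ i)}"

definition perc_theta :: "'d::finite itself \<Rightarrow> real \<Rightarrow> real" where
  "perc_theta _ p = measure (bernoulli_bond p :: ((int ^ 'd) set \<Rightarrow> bool) measure)
      {w \<in> space (bernoulli_bond p). infinite ((open_adj w)\<^sup>* `` {0 :: int ^ 'd})}"

definition oriented_perc_theta :: "'d::finite itself \<Rightarrow> real \<Rightarrow> real" where
  "oriented_perc_theta _ p = measure (bernoulli_bond p :: ((int ^ 'd) set \<Rightarrow> bool) measure)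
      {w \<in> space (bernoulli_bond p). infinite ((oriented_open_adj w)\<^sup>* `` {0 :: int ^ 'd})}"

definition bond_pc :: "'d::finite itself \<Rightarrow> real" where
  "bond_pc t = Sup {p \<in> {0..1}. perc_theta t p = 0}"

definition oriented_bond_pc :: "'d::finite itself \<Rightarrow> real" where
  "oriented_bond_pc t = Sup {p \<in> {0..1}. oriented_perc_theta t p = 0}"

definition distF :: "real measure \<Rightarrow> real \<Rightarrow> real" where
  "distF \<mu> t = measure \<mu> {..t}"

definition ess_inf_law :: "real measure \<Rightarrow> real" where
  "ess_inf_law \<mu> = Sup {a. measure \<mu> {..<a} = 0}"

definition standing_assumption :: "'d::finite itself \<Rightarrow> real measure \<Rightarrow> bool" where
  "standing_assumption t \<mu> =
     (let r = ess_inf_law \<mu> in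
       (r = 0 \<longrightarrow> distF \<mu> r < bond_pc t) \<and> (r > 0 \<longrightarrow> distF \<mu> r < oriented_bond_pc t))"

definition fpp_space :: "real measure \<Rightarrow> ((int ^ 'd::finite) set \<Rightarrow> real) measure" where
  "fpp_space \<mu> = PiM lattice_edges (\<lambda>_. \<mu>)"

definition sa_path :: "(int ^ 'd::finite) list \<Rightarrow> bool" where
  "sa_path p \<longleftrightarrow> p \<noteq> [] \<and> distinct p \<and>
     (\<forall>i. Suc i < length p \<longrightarrow> {p ! i, p ! Suc i} \<in> lattice_edges)"

definition path_edges :: "(int ^ 'd::finite) list \<Rightarrow> (int ^ 'd) set set" where
  "path_edges p = {{p ! i, p ! Suc i} | i. Suc i < length p}"

definition path_time :: "((int ^ 'd::finite) set \<Rightarrow> real) \<Rightarrow> (int ^ 'd) list \<Rightarrow> real" where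
  "path_time w p = (\<Sum>e\<in>path_edges p. w e)"

definition passage_time :: "((int ^ 'd::finite) set \<Rightarrow> real) \<Rightarrow> int ^ 'd \<Rightarrow> int ^ 'd \<Rightarrow> real" where
  "passage_time w x y = Inf {path_time w p | p. sa_path p \<and> hd p = x \<and> last p = y}"

definition geodesic :: "((int ^ 'd::finite) set \<Rightarrow> real) \<Rightarrow> int ^ 'd \<Rightarrow> int ^ 'd \<Rightarrow> (int ^ 'd) list \<Rightarrow> bool" where
  "geodesic w x y p \<longleftrightarrow> sa_path p \<and> hd p = x \<and> last p = y \<and> path_time w p = passage_time w x y"

definition first_geodesic :: "((int ^ 'd::finite) list \<Rightarrow> nat) \<Rightarrow> ((int ^ 'd) set \<Rightarrow> real)
     \<Rightarrow> int ^ 'd \<Rightarrow> (int ^ 'd) list" where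
  "first_geodesic pord w x = arg_min pord (geodesic w 0 x)"

definition empirical :: "((int ^ 'd::finite) list \<Rightarrow> nat) \<Rightarrow> ((int ^ 'd) set \<Rightarrow> real)
     \<Rightarrow> int ^ 'd \<Rightarrow> real set \<Rightarrow> real" where
  "empirical pord w x B =
     (let \<pi> = first_geodesic pord w x in
        real (card {e \<in> path_edges \<pi>. w e \<in> B}) / real (card (path_edges \<pi>)))"

end

(*
  Follow a geodesic pi from 0 to x and cut it into blocks of length about C M.  By the standing
  assumption, a positive fraction of the blocks pi[a,b] is slow: T(a,b) exceeds
  (r + eps)|a - b|_1 + gamma M.  For a slow block choose an l^1-shortest path between a and b and keep
  its part sigma between the first and the last visit of pi.  Resample the O(M) edges near sigma: one
  edge of sigma gets a weight in [M, gamma M], the others weights at most r + eps, and all other edges at interior vertices of sigma weights at least M.  The detour along sigma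
  is now cheaper than pi, so every new geodesic uses a resampled edge; as it cannot end in the interior
  of sigma, it must then use a resampled edge of weight at least M.  Summing over the positions and the
  shapes of sigma, whose exponential number is absorbed by mu[M,oo)^(CM), gives
  E nu_x[M,oo) >= mu[M, gamma M] mu[M,oo)^(CM).  Applied at the levels gamma^i M this controls each term
  of the sum, and a sum with weights gamma^(-i) is at most twice its largest term.

  That so many blocks are slow rests on the sharpness of the percolation transition, in the finite-volume
  form of Duminil-Copin and Tassion, and on a Peierls argument over the boxes visited by a path; a
  block that is not slow would contain long paths of weights close to r, oriented ones if r > 0.  The
  linear upper bound on T(0,x), available without moments, comes from a Peierls argument for cuts in a
  quadrant.
*)
theory Submission
  imports Defs
begin

section \<open>Expectations over finite Bernoulli configurations\<close>

text \<open>The event produced by resampling has probability exponentially small in M, yet the bound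
  must not depend on x. This works because shortcuts sit at about |x|_1 / M places while geodesics
  have length at most a constant times |x|_1: the factor |x|_1 cancels in the average. The length
  bound is also required after resampling, where regularity of the weights is no longer known; it
  survives because at most |x|_1 edges are modified and each spoils at most one of the disjoint
  segments that make long paths slow. The window [M, gamma M] on one edge keeps the detour
  affordable; a weight that is merely at least M could make it useless. Weights up to r + eps are
  allowed along the detour because r need not be an atom. No moment is assumed, so everything is
  done on an event of probability at least 1/2 (3/4 for regularity and 3/4 for a cheap path to x),
  over which an independent copy of the weights is averaged.\<close>

definition bexp :: "real \<Rightarrow> 'a set \<Rightarrow> ('a set \<Rightarrow> real) \<Rightarrow> real" where
  "bexp p E f = (\<Sum>A\<in>Pow E. p ^ card A * (1 - p) ^ card (E - A) * f A)"

lemma bexp_empty [simp]: "bexp p {} f = f {}"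
  by (simp add: bexp_def)

lemma bexp_insert:
  assumes "finite E" "e \<notin> E"
  shows "bexp p (insert e E) f = p * bexp p E (\<lambda>A. f (insert e A)) + (1 - p) * bexp p E f"
proof -
  have inj: "inj_on (insert e) (Pow E)"
    using assms(2) by (auto simp: inj_on_def)
  have disj: "Pow E \<inter> insert e ` Pow E = {}"
    using assms(2) by auto
  have 1: "(\<Sum>A\<in>insert e ` Pow E. p ^ card A * (1 - p) ^ card (insert e E - A) * f A)
      = p * bexp p E (\<lambda>A. f (insert e A))"
  proof -
    have "p ^ card (insert e A) * (1 - p) ^ card (insert e E - insert e A) * f (insert e A)
        = p * (p ^ card A * (1 - p) ^ card (E - A) * f (insert e A))" if "A \<in> Pow E" for A
    proof -
      have "finite A" "e \<notin> A" "insert e E - insert e A = E - A"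
        using that assms by (auto intro: finite_subset)
      then show ?thesis by (simp only: card_insert_disjoint power_Suc mult.assoc not_False_eq_True)
    qed
    then show ?thesis
      unfolding sum.reindex[OF inj] bexp_def sum_distrib_left o_def by (intro sum.cong refl)
  qed
  have 2: "(\<Sum>A\<in>Pow E. p ^ card A * (1 - p) ^ card (insert e E - A) * f A) = (1 - p) * bexp p E f"
  proof -
    have "p ^ card A * (1 - p) ^ card (insert e E - A) * f A
        = (1 - p) * (p ^ card A * (1 - p) ^ card (E - A) * f A)" if "A \<in> Pow E" for A
    proof -
      have "insert e E - A = insert e (E - A)" "e \<notin> E - A" "finite (E - A)"
        using that assms by auto
      then show ?thesis by simp
    qed
    then show ?thesis
      unfolding bexp_def sum_distrib_left by (intro sum.cong refl)
  qed
  show ?thesis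
    unfolding bexp_def[of p "insert e E"] Pow_insert
    using 1 2 disj assms by (subst sum.union_disjoint) auto
qed

lemma bexp_remove:
  assumes "finite E" "e \<in> E"
  shows "bexp p E f = p * bexp p (E - {e}) (\<lambda>A. f (insert e A)) + (1 - p) * bexp p (E - {e}) f"
  using bexp_insert[of "E - {e}" e p f] assms by (simp add: insert_absorb)

lemma bexp_cong:
  assumes "\<And>A. A \<subseteq> E \<Longrightarrow> f A = g A"
  shows "bexp p E f = bexp p E g"
  unfolding bexp_def using assms by (intro sum.cong) auto

lemma bexp_mono:
  assumes "\<And>A. A \<subseteq> E \<Longrightarrow> f A \<le> g A" "0 \<le> p" "p \<le> 1"
  shows "bexp p E f \<le> bexp p E g"
  unfolding bexp_def using assms by (intro sum_mono mult_left_mono) auto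

lemma bexp_const: "finite E \<Longrightarrow> bexp p E (\<lambda>_. c) = c"
  by (induction E rule: finite_induct) (simp_all add: bexp_insert algebra_simps)

lemma bexp_nonneg: "(\<And>A. A \<subseteq> E \<Longrightarrow> 0 \<le> f A) \<Longrightarrow> 0 \<le> p \<Longrightarrow> p \<le> 1 \<Longrightarrow> 0 \<le> bexp p E f"
  unfolding bexp_def by (intro sum_nonneg mult_nonneg_nonneg) auto

lemma bexp_sum: "bexp p E (\<lambda>A. \<Sum>i\<in>I. f i A) = (\<Sum>i\<in>I. bexp p E (f i))"
  unfolding bexp_def by (simp add: sum_distrib_left sum.swap[of _ _ I])

lemma bexp_diff: "bexp p E (\<lambda>A. f A - g A) = bexp p E f - bexp p E g"
  unfolding bexp_def by (simp add: algebra_simps sum_subtractf)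

lemma bexp_image:
  assumes "inj_on h E"
  shows "bexp p (h ` E) f = bexp p E (\<lambda>A. f (h ` A))"
proof -
  have "inj_on ((`) h) (Pow E)"
    using assms by (rule inj_on_image_Pow)
  moreover have "card (h ` A) = card A" "card (h ` E - h ` A) = card (E - A)" if "A \<subseteq> E" for A
  proof -
    show "card (h ` A) = card A"
      using assms that by (meson card_image inj_on_subset)
    have "h ` E - h ` A = h ` (E - A)"
      using assms that by (metis Diff_subset inj_on_image_set_diff)
    then show "card (h ` E - h ` A) = card (E - A)"
      using assms by (metis Diff_subset card_image inj_on_subset)
  qed
  ultimately show ?thesis
    unfolding bexp_def image_Pow_surj[OF refl, symmetric]
    by (subst sum.reindex) (auto intro!: sum.cong)
qed

text \<open>The product structure of the law, by induction on E: each new edge is seen by exactly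
  one of the two factors.\<close>

lemma bexp_indep:
  assumes "finite E"
  shows "bexp p E (\<lambda>A. f (A \<inter> F) * g (A - F)) = bexp p (E \<inter> F) f * bexp p (E - F) g"
  using assms
proof (induction E arbitrary: f g rule: finite_induct)
  case (insert e E)
  show ?case
  proof (cases "e \<in> F")
    case True
    then have eq: "insert e E \<inter> F = insert e (E \<inter> F)" "insert e E - F = E - F"
      by auto
    have "bexp p (insert e E) (\<lambda>A. f (A \<inter> F) * g (A - F)) =
        p * bexp p E (\<lambda>A. f (insert e (A \<inter> F)) * g (A - F)) + (1 - p) * bexp p E (\<lambda>A. f (A \<inter> F) * g (A - F))"
      using insert.hyps True by (simp add: bexp_insert)
    also have "\<dots> = bexp p (insert e E \<inter> F) f * bexp p (insert e E - F) g"
      using insert.IH[of "\<lambda>A. f (insert e A)" g] insert.IH[of f g] insert.hyps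
      unfolding eq by (simp add: bexp_insert algebra_simps)
    finally show ?thesis .
  next
    case False
    then have eq: "insert e E \<inter> F = E \<inter> F" "insert e E - F = insert e (E - F)"
      by auto
    have "bexp p (insert e E) (\<lambda>A. f (A \<inter> F) * g (A - F)) =
        p * bexp p E (\<lambda>A. f (A \<inter> F) * g (insert e (A - F))) + (1 - p) * bexp p E (\<lambda>A. f (A \<inter> F) * g (A - F))"
      using insert.hyps False by (simp add: bexp_insert insert_Diff_if)
    also have "\<dots> = bexp p (insert e E \<inter> F) f * bexp p (insert e E - F) g"
      using insert.IH[of f "\<lambda>A. g (insert e A)"] insert.IH[of f g] insert.hyps
      unfolding eq by (simp add: bexp_insert algebra_simps)
    finally show ?thesis .
  qed
qed simp

lemma bexp_marginal:
  assumes "finite E" "F \<subseteq> E" "\<And>A. A \<subseteq> E \<Longrightarrow> f A = f (A \<inter> F)"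
  shows "bexp p E f = bexp p F f"
proof -
  have "bexp p E f = bexp p E (\<lambda>A. f (A \<inter> F) * 1)"
    using assms(3) by (intro bexp_cong) simp
  also have "\<dots> = bexp p (E \<inter> F) f * bexp p (E - F) (\<lambda>_. 1)"
    using bexp_indep[OF assms(1), of p f F "\<lambda>_. 1"] .
  finally show ?thesis
    using assms(1,2) by (simp add: bexp_const Int_absorb1)
qed

lemma bexp_indep2:
  assumes "finite E" "F \<subseteq> E" "G \<subseteq> E" "F \<inter> G = {}"
    and "\<And>A. A \<subseteq> E \<Longrightarrow> f A = f (A \<inter> F)" "\<And>A. A \<subseteq> E \<Longrightarrow> g A = g (A \<inter> G)"
  shows "bexp p E (\<lambda>A. f A * g A) = bexp p F f * bexp p G g"
proof -
  have "g A = g (A - F)" if "A \<subseteq> E" for A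
  proof -
    have "(A - F) \<inter> G = A \<inter> G" using assms(4) by auto
    then show ?thesis using assms(6)[OF that] assms(6)[of "A - F"] that by (metis Diff_subset order_trans)
  qed
  then have "bexp p E (\<lambda>A. f A * g A) = bexp p E (\<lambda>A. f (A \<inter> F) * g (A - F))"
    using assms(5) by (intro bexp_cong) simp
  also have "\<dots> = bexp p (E \<inter> F) f * bexp p (E - F) g"
    by (rule bexp_indep[OF assms(1)])
  also have "bexp p (E - F) g = bexp p G g"
  proof (rule bexp_marginal)
    show "g A = g (A \<inter> G)" if "A \<subseteq> E - F" for A
      using assms(6)[of A] that by blast
  qed (use assms in auto)
  finally show ?thesis
    using assms(2) by (simp add: Int_absorb1)
qed

lemma bexp_prod:
  assumes "finite V" "finite E" "\<And>v. v \<in> V \<Longrightarrow> F v \<subseteq> E"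
    and "\<And>u v. u \<in> V \<Longrightarrow> v \<in> V \<Longrightarrow> u \<noteq> v \<Longrightarrow> F u \<inter> F v = {}"
    and "\<And>v A. v \<in> V \<Longrightarrow> A \<subseteq> E \<Longrightarrow> f v A = f v (A \<inter> F v)"
  shows "bexp p E (\<lambda>A. \<Prod>v\<in>V. f v A) = (\<Prod>v\<in>V. bexp p (F v) (f v))"
  using assms(1,3,4,5)
proof (induction V rule: finite_induct)
  case empty
  then show ?case using assms(2) by (simp add: bexp_const)
next
  case (insert v V)
  let ?G = "\<Union>u\<in>V. F u"
  have dep: "(\<Prod>u\<in>V. f u A) = (\<Prod>u\<in>V. f u (A \<inter> ?G))" if "A \<subseteq> E" for A
  proof (rule prod.cong)
    fix u assume u: "u \<in> V"
    then have "A \<inter> ?G \<inter> F u = A \<inter> F u" by auto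
    then show "f u A = f u (A \<inter> ?G)"
      using insert.prems(3)[of u A] insert.prems(3)[of u "A \<inter> ?G"] u that
      by (metis insertCI le_infI1)
  qed simp
  have "F v \<inter> ?G = {}"
    using insert.prems(2) insert.hyps(2) by fastforce
  then have "bexp p E (\<lambda>A. f v A * (\<Prod>u\<in>V. f u A)) = bexp p (F v) (f v) * bexp p ?G (\<lambda>A. \<Prod>u\<in>V. f u A)"
  proof (intro bexp_indep2)
    show "f v A = f v (A \<inter> F v)" if "A \<subseteq> E" for A
      using insert.prems(3) that by simp
  qed (use insert.prems(1) assms(2) dep in auto)
  also have "bexp p ?G (\<lambda>A. \<Prod>u\<in>V. f u A) = bexp p E (\<lambda>A. \<Prod>u\<in>V. f u A)"
    using insert.prems(1) assms(2) dep by (intro bexp_marginal[symmetric]) auto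
  also have "\<dots> = (\<Prod>v\<in>V. bexp p (F v) (f v))"
    using insert.prems by (intro insert.IH) auto
  finally show ?case using insert.hyps by simp
qed

text \<open>Russo's formula, for arbitrary f. As a finite sum \<open>bexp\<close> is a polynomial in
  p, which is why the percolation part is carried out with it rather than in an infinite product
  space.\<close>

lemma bexp_deriv:
  assumes "finite E"
  shows "((\<lambda>p. bexp p E f) has_real_derivative
    (\<Sum>e\<in>E. bexp p (E - {e}) (\<lambda>A. f (insert e A) - f A))) (at p)"
  using assms
proof (induction E arbitrary: f rule: finite_induct)
  case (insert e E)
  let ?d = "\<lambda>f. \<Sum>x\<in>E. bexp p (E - {x}) (\<lambda>A. f (insert x A) - f A)"
  have "((\<lambda>p. p * bexp p E (\<lambda>A. f (insert e A)) + (1 - p) * bexp p E f) has_real_derivative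
      bexp p E (\<lambda>A. f (insert e A)) + ?d (\<lambda>A. f (insert e A)) * p + ((0 - 1) * bexp p E f + ?d f * (1 - p))) (at p)"
    using insert.IH[of "\<lambda>A. f (insert e A)"] insert.IH[of f]
    by (auto intro!: derivative_eq_intros)
  moreover have "bexp p (insert e E - {x}) (\<lambda>A. f (insert x A) - f A)
      = p * bexp p (E - {x}) (\<lambda>A. f (insert e (insert x A)) - f (insert e A))
        + (1 - p) * bexp p (E - {x}) (\<lambda>A. f (insert x A) - f A)" if "x \<in> E" for x
  proof -
    have "insert e E - {x} = insert e (E - {x})" using that insert.hyps by auto
    then show ?thesis
      using insert.hyps by (simp add: bexp_insert insert_commute)
  qed
  then have "(\<Sum>x\<in>insert e E. bexp p (insert e E - {x}) (\<lambda>A. f (insert x A) - f A))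
     = bexp p E (\<lambda>A. f (insert e A)) + ?d (\<lambda>A. f (insert e A)) * p + ((0 - 1) * bexp p E f + ?d f * (1 - p))"
    using insert.hyps by (simp add: sum.distrib sum_distrib_left bexp_diff mult_ac)
  ultimately show ?case
    using insert.hyps by (simp add: bexp_insert)
qed simp

section \<open>Lattice geometry and bond percolation in finite volume\<close>

lemma bij_betw_vec_PiE: "bij_betw vec_nth {y :: 'a ^ 'd::finite. \<forall>i. y $ i \<in> S i} (PiE UNIV S)"
  by (rule bij_betwI[where g = "\<lambda>f. \<chi> i. f i"]) (auto simp: PiE_def Pi_def vec_eq_iff)

lemma finite_vec_box: "(\<And>i. finite (S i)) \<Longrightarrow> finite {y :: 'a ^ 'd::finite. \<forall>i. y $ i \<in> S i}"
  using bij_betw_finite[OF bij_betw_vec_PiE[of S]] by (simp add: finite_PiE)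

lemma card_vec_box: "card {y :: 'a ^ 'd::finite. \<forall>i. y $ i \<in> S i} = (\<Prod>i\<in>UNIV. card (S i))"
  using bij_betw_same_card[OF bij_betw_vec_PiE[of S]] by (simp add: card_PiE)

text \<open>An open ball in the sup norm: \<open>near 0 a\<close> is empty, \<open>near 1 a\<close>
  contains only a, and \<open>near 2 a\<close> contains all lattice neighbours of a. Strictness
  makes the radii \<open>Suc m\<close> and \<open>Suc n\<close> compose to
  \<open>Suc (m + n)\<close>.\<close>

definition near :: "nat \<Rightarrow> int ^ 'd::finite \<Rightarrow> (int ^ 'd) set" where
  "near n a = {y. \<forall>i. \<bar>y $ i - a $ i\<bar> < int n}"

lemma near_eq: "near n a = {y. \<forall>i. y $ i \<in> {a $ i - int n <..< a $ i + int n}}"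
proof -
  have "\<bar>x - y\<bar> < int n \<longleftrightarrow> x \<in> {y - int n <..< y + int n}" for x y by auto
  then show ?thesis unfolding near_def by simp
qed

lemma finite_near [simp]: "finite (near n (a :: int ^ 'd::finite))"
  unfolding near_eq by (rule finite_vec_box) simp

lemma card_near_le: "card (near n (a :: int ^ 'd::finite)) \<le> (2 * n) ^ CARD('d)"
proof -
  have "card (near n a) = (\<Prod>i\<in>(UNIV::'d set). card {a $ i - int n <..< a $ i + int n})"
    unfolding near_eq by (rule card_vec_box)
  also have "\<dots> \<le> (\<Prod>i\<in>(UNIV::'d set). 2 * n)"
    by (intro prod_mono) auto
  finally show ?thesis by simp
qed

lemma near_mono: "m \<le> n \<Longrightarrow> near m a \<subseteq> near n a"
  unfolding near_def by (auto intro: less_le_trans)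

lemma near_sym: "y \<in> near n a \<longleftrightarrow> a \<in> near n y"
  unfolding near_def by (simp add: abs_minus_commute)

lemma near_trans: "y \<in> near (Suc m) a \<Longrightarrow> z \<in> near (Suc n) y \<Longrightarrow> z \<in> near (Suc (m + n)) a"
proof -
  assume y: "y \<in> near (Suc m) a" and z: "z \<in> near (Suc n) y"
  have "\<bar>z $ i - a $ i\<bar> < int (Suc (m + n))" for i
  proof -
    have "\<bar>y $ i - a $ i\<bar> < int (Suc m)" "\<bar>z $ i - y $ i\<bar> < int (Suc n)"
      using y z unfolding near_def by auto
    then show ?thesis by linarith
  qed
  then show ?thesis unfolding near_def by simp
qed

lemma near_self [simp]: "a \<in> near n a \<longleftrightarrow> 0 < n"
  unfolding near_def by simp

lemma l1norm_nonneg [simp]: "0 \<le> l1norm x"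
  unfolding l1norm_def by (intro sum_nonneg) simp

lemma l1norm_zero [simp]: "l1norm 0 = 0"
  unfolding l1norm_def by simp

lemma l1norm_eq_0_iff [simp]: "l1norm x = 0 \<longleftrightarrow> x = 0"
  unfolding l1norm_def by (simp add: sum_nonneg_eq_0_iff vec_eq_iff)

lemma l1norm_minus_commute: "l1norm (x - y) = l1norm (y - x)"
  unfolding l1norm_def by (simp add: abs_minus_commute)

lemma l1norm_triangle: "l1norm (x + y) \<le> l1norm x + l1norm y"
  unfolding l1norm_def by (simp flip: sum.distrib) (intro sum_mono, simp add: abs_triangle_ineq)

lemma l1norm_triangle_diff: "l1norm (x - z) \<le> l1norm (x - y) + l1norm (y - z)"
  using l1norm_triangle[of "x - y" "y - z"] by simp

lemma abs_component_le_l1norm: "\<bar>x $ i\<bar> \<le> l1norm x"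
  unfolding l1norm_def by (rule member_le_sum) auto

lemma near_l1norm: "l1norm (y - a) < int n \<Longrightarrow> y \<in> near n a"
  unfolding near_def using abs_component_le_l1norm[of "y - a"] by (auto intro: le_less_trans)

lemma lattice_edge_iff [simp]: "{u, v} \<in> lattice_edges \<longleftrightarrow> l1norm (u - v) = 1"
  unfolding lattice_edges_def using l1norm_minus_commute[of u v]
  by (auto simp: doubleton_eq_iff)

lemma lattice_edgeE:
  assumes "e \<in> lattice_edges"
  obtains u v where "e = {u, v}" "l1norm (u - v) = 1" "u \<noteq> v"
  using assms unfolding lattice_edges_def by force

lemma edge_near: "l1norm (u - v) = 1 \<Longrightarrow> v \<in> near 2 u"
  by (rule near_l1norm) (simp add: l1norm_minus_commute)

lemma countable_lattice_edges: "countable (lattice_edges :: (int ^ 'd::finite) set set)"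
proof -
  have "lattice_edges \<subseteq> (\<lambda>(u, v). {u, v}) ` (UNIV :: ((int ^ 'd) \<times> (int ^ 'd)) set)"
    by (auto simp: lattice_edges_def)
  then show ?thesis
    by (rule countable_subset) simp
qed

definition edges_at :: "(int ^ 'd::finite) set \<Rightarrow> (int ^ 'd) set set" where
  "edges_at V = {e \<in> lattice_edges. e \<inter> V \<noteq> {}}"

definition edges_in :: "(int ^ 'd::finite) set \<Rightarrow> (int ^ 'd) set set" where
  "edges_in V = {e \<in> lattice_edges. e \<subseteq> V}"

lemma edges_at_subset: "edges_at V \<subseteq> (\<Union>u\<in>V. (\<lambda>v. {u, v}) ` near 2 u)"
proof
  fix e assume e: "e \<in> edges_at V"
  then obtain u v where uv: "e = {u, v}" "l1norm (u - v) = 1"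
    unfolding edges_at_def lattice_edges_def by auto
  then have "l1norm (v - u) = 1" by (simp add: l1norm_minus_commute)
  with uv have "v \<in> near 2 u" "u \<in> near 2 v" "e = {v, u}"
    by (auto intro: edge_near)
  with uv(1) e show "e \<in> (\<Union>u\<in>V. (\<lambda>v. {u, v}) ` near 2 u)"
    unfolding edges_at_def by blast
qed

lemma finite_edges_at [simp]: "finite V \<Longrightarrow> finite (edges_at V)"
  by (rule finite_subset[OF edges_at_subset]) simp

lemma card_edges_at_le: "finite V \<Longrightarrow> card (edges_at (V :: (int ^ 'd::finite) set)) \<le> card V * 4 ^ CARD('d)"
proof -
  assume V: "finite V"
  have "card (edges_at V) \<le> card (\<Union>u\<in>V. (\<lambda>v. {u, v}) ` near 2 u)"
    using V by (intro card_mono edges_at_subset) auto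
  also have "\<dots> \<le> (\<Sum>u\<in>V. card ((\<lambda>v. {u, v}) ` near 2 u))"
    by (rule card_UN_le[OF V])
  also have "\<dots> \<le> (\<Sum>u\<in>V. 4 ^ CARD('d))"
  proof (rule sum_mono)
    fix u :: "int ^ 'd"
    show "card ((\<lambda>v. {u, v}) ` near 2 u) \<le> 4 ^ CARD('d)"
      using card_image_le[of "near 2 u" "\<lambda>v. {u, v}"] card_near_le[of 2 u] by simp
  qed
  finally show ?thesis by simp
qed

lemma edges_in_subset: "edges_in V \<subseteq> edges_at V"
  unfolding edges_in_def edges_at_def by (auto elim!: lattice_edgeE)

lemma finite_edges_in [simp]: "finite V \<Longrightarrow> finite (edges_in V)"
  by (meson edges_in_subset finite_edges_at finite_subset)

section \<open>Finite-volume connection events and the differential inequality\<close>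

definition full_arcs :: "(int ^ 'd::finite) rel" where
  "full_arcs = {(u, v). {u, v} \<in> lattice_edges}"

text \<open>The undirected edge carries the state, while D selects the directions in which it may be
  crossed. Unoriented and oriented percolation thus become one theory with different D.\<close>

definition open_arcs :: "(int ^ 'd::finite) rel \<Rightarrow> (int ^ 'd) set set \<Rightarrow> (int ^ 'd) rel" where
  "open_arcs D A = {(u, v). (u, v) \<in> D \<and> {u, v} \<in> A}"

definition far :: "(int ^ 'd::finite) rel \<Rightarrow> (int ^ 'd) set set \<Rightarrow> nat \<Rightarrow> int ^ 'd \<Rightarrow> bool" where
  "far D A n a \<longleftrightarrow> (\<exists>y. (a, y) \<in> (open_arcs D A)\<^sup>* \<and> y \<notin> near n a)"

definition conn :: "(int ^ 'd::finite) rel \<Rightarrow> (int ^ 'd) set set \<Rightarrow> (int ^ 'd) set \<Rightarrow> int ^ 'd \<Rightarrow> bool" where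
  "conn D A S x \<longleftrightarrow> (0, x) \<in> (open_arcs D A \<inter> S \<times> S)\<^sup>*"

definition bdry :: "(int ^ 'd::finite) rel \<Rightarrow> (int ^ 'd) set \<Rightarrow> (int ^ 'd) rel" where
  "bdry D S = {(x, y). (x, y) \<in> D \<and> x \<in> S \<and> y \<notin> S}"

text \<open>The functional of Duminil-Copin and Tassion; a finite set with value below 1 forces exponential decay.\<close>
definition phi :: "(int ^ 'd::finite) rel \<Rightarrow> real \<Rightarrow> (int ^ 'd) set \<Rightarrow> real" where
  "phi D p S = p * (\<Sum>(x, y)\<in>bdry D S. bexp p (edges_in S) (\<lambda>A. of_bool (conn D A S x)))"

definition theta :: "(int ^ 'd::finite) rel \<Rightarrow> nat \<Rightarrow> real \<Rightarrow> real" where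
  "theta D n p = bexp p (edges_at (near n 0)) (\<lambda>A. of_bool (far D A n 0))"

lemma open_arcs_mono: "A \<subseteq> B \<Longrightarrow> open_arcs D A \<subseteq> open_arcs D B"
  unfolding open_arcs_def by auto

lemma far_mono: "A \<subseteq> B \<Longrightarrow> far D A n a \<Longrightarrow> far D B n a"
  unfolding far_def by (meson open_arcs_mono rtrancl_mono subsetD)

lemma arc_edge: "D \<subseteq> full_arcs \<Longrightarrow> (u, v) \<in> D \<Longrightarrow> l1norm (u - v) = 1"
  unfolding full_arcs_def by auto

lemma finite_bdry [simp]:
  assumes "D \<subseteq> full_arcs" "finite S"
  shows "finite (bdry D S)"
proof (rule finite_subset)
  show "bdry D S \<subseteq> Sigma S (near 2)"
    unfolding bdry_def using arc_edge[OF assms(1)] by (auto intro: edge_near)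
qed (use assms(2) in auto)

text \<open>Up to its first exit from the ball, a path crosses only edges that meet the
  ball.\<close>

lemma far_local:
  assumes "D \<subseteq> full_arcs"
  shows "far D A n a \<longleftrightarrow> far D (A \<inter> edges_at (near n a)) n a"
proof
  let ?B = "A \<inter> edges_at (near n a)"
  assume "far D A n a"
  then obtain y where y: "(a, y) \<in> (open_arcs D A)\<^sup>*" "y \<notin> near n a"
    unfolding far_def by auto
  from y(1) have "far D ?B n a \<or> (a, y) \<in> (open_arcs D ?B)\<^sup>*"
  proof (induction rule: rtrancl_induct)
    case (step z z')
    show ?case
    proof (cases "far D ?B n a")
      case False
      with step.IH have z: "(a, z) \<in> (open_arcs D ?B)\<^sup>*" by simp
      with False have "z \<in> near n a" unfolding far_def by auto
      with step.hyps(2) assms have "(z, z') \<in> open_arcs D ?B"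
        unfolding open_arcs_def edges_at_def full_arcs_def by auto
      with z show ?thesis by (auto intro: rtrancl_into_rtrancl)
    qed simp
  qed simp
  with y(2) show "far D ?B n a" unfolding far_def by auto
next
  assume "far D (A \<inter> edges_at (near n a)) n a"
  then show "far D A n a" by (rule far_mono[rotated]) simp
qed

text \<open>The vertices that cannot escape from the ball. Exploring from outside reveals this set,
  and its boundary carries the pivotal edges.\<close>

definition sinks :: "(int ^ 'd::finite) rel \<Rightarrow> (int ^ 'd) set set \<Rightarrow> nat \<Rightarrow> (int ^ 'd) set" where
  "sinks D A n = {x. \<forall>y. (x, y) \<in> (open_arcs D A)\<^sup>* \<longrightarrow> y \<in> near n 0}"

lemma sinks_subset: "sinks D A n \<subseteq> near n 0"
  unfolding sinks_def by auto

lemma zero_in_sinks: "0 \<in> sinks D A n \<longleftrightarrow> \<not> far D A n 0"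
  unfolding sinks_def far_def by auto

text \<open>A vertex outside S escapes along a path that never enters S, and no open arc leads out
  of S. Hence the event that the sinks are S is decided by the edges not contained in S.\<close>

lemma sinks_dep:
  assumes "A - edges_in S = B - edges_in S" "sinks D A n = S" "D \<subseteq> full_arcs"
  shows "sinks D B n = S"
proof -
  have arcAB: "(u, v) \<in> open_arcs D B" if "(u, v) \<in> open_arcs D A" "u \<notin> S \<or> v \<notin> S" for u v
    using that assms(1) unfolding open_arcs_def edges_in_def by blast
  have arcBA: "(u, v) \<in> open_arcs D A" if "(u, v) \<in> open_arcs D B" "u \<notin> S \<or> v \<notin> S" for u v
    using that assms(1) unfolding open_arcs_def edges_in_def by blast
  have 1: "x \<notin> sinks D B n" if "x \<notin> S" for x
  proof -
    from that assms(2) obtain y where y: "(x, y) \<in> (open_arcs D A)\<^sup>*" "y \<notin> near n 0"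
      unfolding sinks_def by auto
    from y(1) have "(x, y) \<in> (open_arcs D B)\<^sup>*"
    proof (induction rule: converse_rtrancl_induct)
      case (step z z')
      have "(z, y) \<in> (open_arcs D A)\<^sup>*" using step.hyps by auto
      with y(2) assms(2) have "z \<notin> S" unfolding sinks_def by auto
      with step show ?case by (meson arcAB converse_rtrancl_into_rtrancl)
    qed simp
    with y(2) show ?thesis unfolding sinks_def by auto
  qed
  \<comment> \<open>An arc leaving S that is open in B would be open in A as well, and its tail
    would then escape in A.\<close>
  have 2: "y \<in> S" if "(x, y) \<in> (open_arcs D B)\<^sup>*" "x \<in> S" for x y
    using that
  proof (induction rule: rtrancl_induct)
    case (step z z')
    show ?case
    proof (rule ccontr)
      assume "z' \<notin> S"
      then have "(z, z') \<in> open_arcs D A" using arcBA step by auto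
      moreover from \<open>z' \<notin> S\<close> assms(2) obtain y where "(z', y) \<in> (open_arcs D A)\<^sup>*" "y \<notin> near n 0"
        unfolding sinks_def by auto
      ultimately have "z \<notin> S"
        using assms(2) unfolding sinks_def by (auto intro: converse_rtrancl_into_rtrancl)
      then show False using step by simp
    qed
  qed
  have "S \<subseteq> near n 0" using assms(2) sinks_subset by blast
  with 1 2 show ?thesis unfolding sinks_def by blast
qed

lemma conn_dep:
  assumes "A \<inter> edges_in S = B \<inter> edges_in S" "D \<subseteq> full_arcs"
  shows "conn D A S x \<longleftrightarrow> conn D B S x"
proof -
  have "open_arcs D A \<inter> S \<times> S = open_arcs D B \<inter> S \<times> S"
    using assms unfolding open_arcs_def edges_in_def full_arcs_def by blast
  then show ?thesis unfolding conn_def by simp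
qed

lemma conn_imp_reach: "conn D A S x \<Longrightarrow> (0, x) \<in> (open_arcs D A)\<^sup>*"
  unfolding conn_def by (meson Int_lower1 rtrancl_mono subsetD)

lemma conn_in: "conn D A S x \<Longrightarrow> 0 \<in> S \<Longrightarrow> x \<in> S"
  unfolding conn_def by (erule rtranclE) auto

text \<open>Opening a boundary arc joins a vertex reached from 0 inside the set to one that escapes,
  so its edge is closed and pivotal. Exactly one endpoint lies in the set, so the edge determines
  the arc.\<close>

lemma pivotal_count:
  fixes D :: "(int ^ 'd::finite) rel"
  assumes D: "D \<subseteq> full_arcs" and n: "0 < n" and far: "\<not> far D A n 0"
  defines "E \<equiv> edges_at (near n (0 :: int ^ 'd))"
  shows "card {(x, y) \<in> bdry D (sinks D A n). conn D A (sinks D A n) x}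
    \<le> card {e \<in> E. e \<notin> A \<and> \<not> far D A n 0 \<and> far D (insert e A) n 0}"
proof (rule card_inj_on_le)
  let ?S = "sinks D A n"
  let ?X = "{(x, y) \<in> bdry D ?S. conn D A ?S x}"
  show "inj_on (\<lambda>(x, y). {x, y}) ?X"
    by (auto simp: inj_on_def bdry_def doubleton_eq_iff)
  show "(\<lambda>(x, y). {x, y}) ` ?X \<subseteq> {e \<in> E. e \<notin> A \<and> \<not> far D A n 0 \<and> far D (insert e A) n 0}"
  proof safe
    fix x y assume xy: "(x, y) \<in> bdry D ?S" and c: "conn D A ?S x"
    then have xy': "(x, y) \<in> D" "x \<in> ?S" "y \<notin> ?S" unfolding bdry_def by auto
    have "x \<in> near n 0" using xy'(2) sinks_subset by blast
    then show "{x, y} \<in> E"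
      unfolding E_def edges_at_def using arc_edge[OF D xy'(1)] by auto
    from xy'(3) obtain z where z: "(y, z) \<in> (open_arcs D A)\<^sup>*" "z \<notin> near n 0"
      unfolding sinks_def by auto
    show False if "{x, y} \<in> A"
    proof -
      have "(x, y) \<in> open_arcs D A" using xy'(1) that unfolding open_arcs_def by auto
      from this z(1) have "(x, z) \<in> (open_arcs D A)\<^sup>*" by (rule converse_rtrancl_into_rtrancl)
      with xy'(2) z(2) show False unfolding sinks_def by auto
    qed
    let ?R = "open_arcs D (insert {x, y} A)"
    have mono: "(open_arcs D A)\<^sup>* \<subseteq> ?R\<^sup>*"
      by (intro rtrancl_mono open_arcs_mono) auto
    have "(0, x) \<in> ?R\<^sup>*" using conn_imp_reach[OF c] mono by auto
    moreover have "(x, y) \<in> ?R" using xy'(1) unfolding open_arcs_def by auto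
    moreover have "(y, z) \<in> ?R\<^sup>*" using z(1) mono by auto
    ultimately have "(0, z) \<in> ?R\<^sup>*" by auto
    with z(2) show "far D (insert {x, y} A) n 0" unfolding far_def by auto
  qed (use far in auto)
  show "finite {e \<in> E. e \<notin> A \<and> \<not> far D A n 0 \<and> far D (insert e A) n 0}"
    unfolding E_def by simp
qed

lemma sum_of_bool_card: "finite A \<Longrightarrow> (\<Sum>x\<in>A. of_bool (P x)) = real (card {x \<in> A. P x})"
  by (simp add: of_bool_def sum.If_cases Int_def conj_commute)

text \<open>The inequality \<theta>' \<ge> 1 - \<theta>, the right-hand side of the statement being
  \<theta>' by Russo's formula. On the event that 0 is a sink, condition on the set S of sinks:
  connections inside S are independent of it, so the expected number of pivotal edges is at least
  \<open>phi D p S\<close>, hence at least 1.\<close>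

lemma theta_deriv_ge:
  fixes D :: "(int ^ 'd::finite) rel"
  assumes D: "D \<subseteq> full_arcs" and n: "0 < n" and p: "0 < p" "p < 1"
    and phi: "\<And>S. finite S \<Longrightarrow> 0 \<in> S \<Longrightarrow> 1 \<le> phi D p S"
  defines "E \<equiv> edges_at (near n (0 :: int ^ 'd))"
  shows "1 - theta D n p \<le>
    (\<Sum>e\<in>E. bexp p (E - {e}) (\<lambda>A. of_bool (far D (insert e A) n 0) - of_bool (far D A n 0)))"
proof -
  let ?piv = "\<lambda>e A. e \<notin> A \<and> \<not> far D A n 0 \<and> far D (insert e A) n 0"
  let ?Q = "{S. S \<subseteq> near n (0 :: int ^ 'd) \<and> 0 \<in> S}"
  have finE [simp]: "finite E" unfolding E_def by simp
  have finQ: "finite ?Q" by simp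
  \<comment> \<open>The counted edge is required to be closed, which produces a factor 1 - p; it is
    bounded by 1.\<close>
  have step1: "bexp p E (\<lambda>A. of_bool (?piv e A))
      \<le> bexp p (E - {e}) (\<lambda>A. of_bool (far D (insert e A) n 0) - of_bool (far D A n 0))" if "e \<in> E" for e
  proof -
    have "bexp p E (\<lambda>A. of_bool (?piv e A)) = (1 - p) * bexp p (E - {e}) (\<lambda>A. of_bool (?piv e A))"
      using that bexp_const[of "E - {e}" p 0]
      by (subst bexp_remove[of E e]) (simp_all del: de_Morgan_conj not_not)
    also have "\<dots> \<le> 1 * bexp p (E - {e}) (\<lambda>A. of_bool (?piv e A))"
      using p by (intro mult_right_mono bexp_nonneg) auto
    also have "\<dots> \<le> bexp p (E - {e}) (\<lambda>A. of_bool (far D (insert e A) n 0) - of_bool (far D A n 0))"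
      unfolding mult_1 using p far_mono[of _ "insert e _" D n 0]
      by (intro bexp_mono) (auto simp: of_bool_def)
    finally show ?thesis .
  qed
  have step2: "(\<Sum>S\<in>?Q. \<Sum>(x, y)\<in>bdry D S. of_bool (sinks D A n = S) * of_bool (conn D A S x))
      \<le> (\<Sum>e\<in>E. of_bool (?piv e A) :: real)" for A
  proof (cases "far D A n 0")
    case True
    then have "0 \<notin> sinks D A n" by (simp add: zero_in_sinks)
    then have "(\<Sum>S\<in>?Q. \<Sum>(x, y)\<in>bdry D S. of_bool (sinks D A n = S) * of_bool (conn D A S x) :: real) = 0"
      by (intro sum.neutral) auto
    then show ?thesis by (simp add: sum_nonneg)
  next
    case False
    let ?S = "sinks D A n"
    have S: "?S \<in> ?Q" "finite ?S"
      using False sinks_subset[of D A n] finite_subset[OF sinks_subset[of D A n]] by (auto simp: zero_in_sinks)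
    have "(\<Sum>S\<in>?Q. \<Sum>(x, y)\<in>bdry D S. of_bool (sinks D A n = S) * of_bool (conn D A S x) :: real)
        = (\<Sum>S\<in>?Q. if S = ?S then \<Sum>(x, y)\<in>bdry D ?S. of_bool (conn D A ?S x) else 0)"
      by (intro sum.cong) auto
    also have "\<dots> = (\<Sum>z\<in>bdry D ?S. of_bool (conn D A ?S (fst z)))"
      using S finQ by (simp add: case_prod_beta')
    also have "\<dots> = real (card {z \<in> bdry D ?S. conn D A ?S (fst z)})"
      using S D by (subst sum_of_bool_card) auto
    also have "{z \<in> bdry D ?S. conn D A ?S (fst z)} = {(x, y) \<in> bdry D ?S. conn D A ?S x}"
      by auto
    also have "real (card \<dots>) \<le> real (card {e \<in> E. ?piv e A})"
      using pivotal_count[OF D n False] unfolding E_def by simp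
    also have "\<dots> = (\<Sum>e\<in>E. of_bool (?piv e A))"
      by (subst sum_of_bool_card) auto
    finally show ?thesis .
  qed
  have step3: "bexp p E (\<lambda>A. of_bool (sinks D A n = S) * of_bool (conn D A S x))
      = bexp p E (\<lambda>A. of_bool (sinks D A n = S)) * bexp p (edges_in S) (\<lambda>A. of_bool (conn D A S x))"
    if S: "S \<in> ?Q" for S x
  proof -
    have sub: "edges_in S \<subseteq> E"
      using S edges_in_subset[of S] unfolding E_def edges_at_def by auto
    have dep: "sinks D A n = S \<longleftrightarrow> sinks D (A \<inter> (E - edges_in S)) n = S" if "A \<subseteq> E" for A
    proof -
      have "A - edges_in S = A \<inter> (E - edges_in S) - edges_in S" using that by auto
      then show ?thesis
        using sinks_dep[of A S "A \<inter> (E - edges_in S)" D n] sinks_dep[of "A \<inter> (E - edges_in S)" S A D n] D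
        by auto
    qed
    have "bexp p E (\<lambda>A. of_bool (sinks D A n = S) * of_bool (conn D A S x))
      = bexp p (E - edges_in S) (\<lambda>A. of_bool (sinks D A n = S)) * bexp p (edges_in S) (\<lambda>A. of_bool (conn D A S x))"
    proof (rule bexp_indep2)
      show "(of_bool (conn D A S x) :: real) = of_bool (conn D (A \<inter> edges_in S) S x)" for A
        using conn_dep[of A S "A \<inter> edges_in S" D x] D by simp
    qed (use sub dep in auto)
    also have "bexp p (E - edges_in S) (\<lambda>A. of_bool (sinks D A n = S)) = bexp p E (\<lambda>A. of_bool (sinks D A n = S))"
      using dep by (intro bexp_marginal[symmetric]) auto
    finally show ?thesis .
  qed
  have step4: "1 \<le> (\<Sum>(x, y)\<in>bdry D S. bexp p (edges_in S) (\<lambda>A. of_bool (conn D A S x)))" if "S \<in> ?Q" for S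
  proof -
    have "finite S" using that finite_subset[OF _ finite_near] by auto
    then have "1 \<le> phi D p S" using phi that by auto
    also have "\<dots> \<le> 1 * (\<Sum>(x, y)\<in>bdry D S. bexp p (edges_in S) (\<lambda>A. of_bool (conn D A S x)))"
      unfolding phi_def using p by (intro mult_right_mono sum_nonneg) (auto intro!: bexp_nonneg)
    finally show ?thesis by simp
  qed
  have "1 - theta D n p = bexp p E (\<lambda>A. 1 - of_bool (far D A n 0))"
    unfolding theta_def E_def[symmetric] by (simp add: bexp_diff bexp_const)
  also have "\<dots> = bexp p E (\<lambda>A. \<Sum>S\<in>?Q. of_bool (sinks D A n = S))"
  proof (rule bexp_cong)
    fix A
    have "(\<Sum>S\<in>?Q. of_bool (sinks D A n = S) :: real) = (\<Sum>S\<in>?Q. if S = sinks D A n then 1 else 0)"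
      by (intro sum.cong) auto
    also have "\<dots> = of_bool (0 \<in> sinks D A n)"
      using sinks_subset[of D A n] finQ by simp
    finally show "1 - of_bool (far D A n 0) = (\<Sum>S\<in>?Q. of_bool (sinks D A n = S) :: real)"
      by (simp add: zero_in_sinks)
  qed
  also have "\<dots> = (\<Sum>S\<in>?Q. bexp p E (\<lambda>A. of_bool (sinks D A n = S)) * 1)"
    by (simp only: bexp_sum mult_1_right)
  also have "\<dots> \<le> (\<Sum>S\<in>?Q. bexp p E (\<lambda>A. of_bool (sinks D A n = S)) *
      (\<Sum>(x, y)\<in>bdry D S. bexp p (edges_in S) (\<lambda>A. of_bool (conn D A S x))))"
    using p step4 by (intro sum_mono mult_left_mono bexp_nonneg) auto
  also have "\<dots> = (\<Sum>S\<in>?Q. \<Sum>(x, y)\<in>bdry D S. bexp p E (\<lambda>A. of_bool (sinks D A n = S) * of_bool (conn D A S x)))"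
    by (intro sum.cong refl) (simp add: step3 sum_distrib_left case_prod_beta')
  also have "\<dots> = bexp p E (\<lambda>A. \<Sum>S\<in>?Q. \<Sum>(x, y)\<in>bdry D S. of_bool (sinks D A n = S) * of_bool (conn D A S x))"
    by (simp add: bexp_sum case_prod_beta')
  also have "\<dots> \<le> bexp p E (\<lambda>A. \<Sum>e\<in>E. of_bool (?piv e A))"
    using p step2 by (intro bexp_mono) auto
  also have "\<dots> = (\<Sum>e\<in>E. bexp p E (\<lambda>A. of_bool (?piv e A)))"
    by (rule bexp_sum)
  also have "\<dots> \<le> (\<Sum>e\<in>E. bexp p (E - {e}) (\<lambda>A. of_bool (far D (insert e A) n 0) - of_bool (far D A n 0)))"
    by (intro sum_mono step1)
  finally show ?thesis .
qed

lemma bexp_mono_set: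
  assumes "finite F" "G \<subseteq> F" "0 \<le> p" "p \<le> 1" "\<And>A. A \<subseteq> F \<Longrightarrow> f (A \<inter> G) \<le> f A"
  shows "bexp p G f \<le> bexp p F f"
proof -
  have "bexp p G f = bexp p G (\<lambda>A. f (A \<inter> G))"
    by (intro bexp_cong) (simp add: Int_absorb2)
  also have "\<dots> = bexp p F (\<lambda>A. f (A \<inter> G))"
    using assms by (intro bexp_marginal[symmetric]) auto
  also have "\<dots> \<le> bexp p F f"
    using assms by (intro bexp_mono) auto
  finally show ?thesis .
qed

section \<open>Translations and reflections of the lattice\<close>

lemma far_transform:
  assumes "bij \<rho>" "\<And>u v. (\<rho> u, \<rho> v) \<in> D' \<longleftrightarrow> (u, v) \<in> D"
    and "\<And>y. \<rho> y \<in> near n (\<rho> a) \<longleftrightarrow> y \<in> near n a"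
  shows "far D' ((`) \<rho> ` A) n (\<rho> a) \<longleftrightarrow> far D A n a"
proof -
  have inj: "inj \<rho>" and surj: "surj \<rho>" using assms(1) by (auto simp: bij_def)
  have arc: "(\<rho> u, \<rho> v) \<in> open_arcs D' ((`) \<rho> ` A) \<longleftrightarrow> (u, v) \<in> open_arcs D A" for u v
  proof -
    have "{\<rho> u, \<rho> v} \<in> (`) \<rho> ` A \<longleftrightarrow> {u, v} \<in> A"
    proof -
      have "inj ((`) \<rho>)" using inj by (meson inj_image_eq_iff injI)
      from inj_image_mem_iff[OF this, of "{u, v}" A] show ?thesis by simp
    qed
    then show ?thesis unfolding open_arcs_def using assms(2) by simp
  qed
  have 1: "(\<rho> a, \<rho> y) \<in> (open_arcs D' ((`) \<rho> ` A))\<^sup>*" if "(a, y) \<in> (open_arcs D A)\<^sup>*" for y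
    using that by (induction rule: rtrancl_induct) (auto intro: rtrancl_into_rtrancl simp: arc)
  have 2: "\<exists>y. z = \<rho> y \<and> (a, y) \<in> (open_arcs D A)\<^sup>*" if "(\<rho> a, z) \<in> (open_arcs D' ((`) \<rho> ` A))\<^sup>*" for z
    using that
  proof (induction rule: rtrancl_induct)
    case (step z z')
    then obtain y where y: "z = \<rho> y" "(a, y) \<in> (open_arcs D A)\<^sup>*" by auto
    obtain y' where y': "z' = \<rho> y'" using surj by auto
    with step.hyps(2) y have "(y, y') \<in> open_arcs D A" by (simp add: arc)
    with y y' show ?case by (auto intro: rtrancl_into_rtrancl)
  qed auto
  show ?thesis
    unfolding far_def using 1 2 assms(3) by blast
qed

text \<open>A reflection in coordinate hyperplanes followed by a translation. These maps carry 0 to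
  any base point and the positive orthant to any orthant, so that a single \<open>theta\<close>
  controls all of them.\<close>

definition signed :: "('d::finite \<Rightarrow> int) \<Rightarrow> int ^ 'd \<Rightarrow> int ^ 'd \<Rightarrow> int ^ 'd" where
  "signed s b u = (\<chi> i. b $ i + s i * u $ i)"

text \<open>The map is an automorphism of the lattice that sends balls to balls, and a bijection of
  edges preserves the law.\<close>

lemma bexp_far_signed:
  fixes a :: "int ^ 'd::finite"
  assumes s: "\<And>i. s i \<in> {1, -1}" and D: "\<And>u v. (signed s b u, signed s b v) \<in> D' \<longleftrightarrow> (u, v) \<in> D"
  shows "bexp p (edges_at (near n (signed s b a))) (\<lambda>A. of_bool (far D' A n (signed s b a)))
    = bexp p (edges_at (near n a)) (\<lambda>A. of_bool (far D A n a))"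
proof -
  let ?r = "signed s b"
  have ss: "s i * s i = 1" "\<bar>s i\<bar> = 1" for i using s[of i] by auto
  have bij: "bij ?r"
    by (rule o_bij[of "\<lambda>u. \<chi> i. s i * (u $ i - b $ i)"])
      (auto simp: signed_def fun_eq_iff vec_eq_iff ss mult.assoc[symmetric])
  have norm: "l1norm (?r u - ?r v) = l1norm (u - v)" for u v
    unfolding l1norm_def signed_def
    by (simp add: right_diff_distrib[symmetric] abs_mult ss)
  have near: "?r y \<in> near n (?r x) \<longleftrightarrow> y \<in> near n x" for x y
    unfolding near_def signed_def by (simp add: right_diff_distrib[symmetric] abs_mult ss)
  have nearim: "?r ` near n a = near n (?r a)"
    using near bij by (auto simp: bij_def surj_def) (metis image_eqI)
  have inj: "inj ?r" using bij by (simp add: bij_def)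
  have lat: "?r ` e \<in> lattice_edges \<longleftrightarrow> e \<in> lattice_edges" for e
  proof
    assume "?r ` e \<in> lattice_edges"
    then obtain x y where xy: "?r ` e = {x, y}" "l1norm (x - y) = 1" by (auto elim: lattice_edgeE)
    obtain u v where uv: "x = ?r u" "y = ?r v" using bij by (metis bij_pointE)
    then have "?r ` e = ?r ` {u, v}" using xy by simp
    then have "e = {u, v}" using inj by (simp only: inj_image_eq_iff)
    with xy uv show "e \<in> lattice_edges" by (simp add: norm)
  next
    assume "e \<in> lattice_edges"
    then show "?r ` e \<in> lattice_edges" by (auto elim!: lattice_edgeE simp: norm)
  qed
  have "edges_at (near n (?r a)) = (`) ?r ` edges_at (near n a)"
  proof safe
    fix e assume e: "e \<in> edges_at (near n (?r a))"
    obtain f where f: "e = ?r ` f" using bij by (metis bij_def subset_UNIV subset_imageE)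
    show "e \<in> (`) ?r ` edges_at (near n a)"
      using e unfolding f edges_at_def nearim[symmetric]
      by (auto simp: lat image_Int[OF inj, symmetric])
  next
    fix e assume "e \<in> edges_at (near n a)"
    then show "?r ` e \<in> edges_at (near n (?r a))"
      unfolding edges_at_def nearim[symmetric] by (auto simp: lat)
  qed
  moreover have "inj_on ((`) ?r) X" for X
    using inj by (meson inj_image_eq_iff inj_onI)
  ultimately have "bexp p (edges_at (near n (?r a))) (\<lambda>A. of_bool (far D' A n (?r a)))
      = bexp p (edges_at (near n a)) (\<lambda>A. of_bool (far D' ((`) ?r ` A) n (?r a)))"
    by (simp add: bexp_image)
  then show ?thesis
    using far_transform[OF bij D near] by simp
qed

definition transl_inv :: "(int ^ 'd::finite) rel \<Rightarrow> bool" where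
  "transl_inv D \<longleftrightarrow> (\<forall>u v b. (b + u, b + v) \<in> D \<longleftrightarrow> (u, v) \<in> D)"

lemma bexp_far_transl:
  assumes "transl_inv D"
  shows "bexp p (edges_at (near n b)) (\<lambda>A. of_bool (far D A n b)) = theta D n p"
proof -
  have *: "signed (\<lambda>_. 1) b u = b + u" for u
    by (simp add: signed_def vec_eq_iff)
  show ?thesis
    using bexp_far_signed[of "\<lambda>_. 1" b D D p n 0] assms unfolding theta_def transl_inv_def * by simp
qed

section \<open>Exploration of the cluster of 0 inside a finite set\<close>

definition cluster :: "(int ^ 'd::finite) rel \<Rightarrow> (int ^ 'd) set set \<Rightarrow> (int ^ 'd) set \<Rightarrow> (int ^ 'd) set" where
  "cluster D A S = {x. conn D A S x}"

lemma cluster_subset: "0 \<in> S \<Longrightarrow> cluster D A S \<subseteq> S"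
  unfolding cluster_def using conn_in by auto

lemma cluster_step: "x \<in> cluster D A S \<Longrightarrow> x \<in> S \<Longrightarrow> y \<in> S \<Longrightarrow> (x, y) \<in> open_arcs D A \<Longrightarrow> y \<in> cluster D A S"
  unfolding cluster_def conn_def by (auto intro: rtrancl_into_rtrancl)

text \<open>Exploring the cluster of 0 inside S reveals only the edges of S that touch the
  cluster.\<close>

lemma cluster_dep:
  assumes "D \<subseteq> full_arcs" "cluster D A S = C" "0 \<in> S"
    and AB: "A \<inter> (edges_in S \<inter> edges_at C) = B \<inter> (edges_in S \<inter> edges_at C)"
  shows "cluster D B S = C"
proof -
  have arc: "(u, v) \<in> open_arcs D A \<longleftrightarrow> (u, v) \<in> open_arcs D B" if "u \<in> C" "u \<in> S" "v \<in> S" for u v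
  proof (cases "(u, v) \<in> D")
    case True
    then have "{u, v} \<in> edges_in S \<inter> edges_at C"
      using that assms(1) unfolding edges_in_def edges_at_def full_arcs_def by auto
    with AB show ?thesis unfolding open_arcs_def by blast
  qed (simp add: open_arcs_def)
  have 0: "0 \<in> C" using assms(2) unfolding cluster_def conn_def by auto
  have "x \<in> cluster D B S" if "x \<in> C" for x
  proof -
    have "(0, x) \<in> (open_arcs D A \<inter> S \<times> S)\<^sup>*"
      using that assms(2) unfolding cluster_def conn_def by auto
    then have "x \<in> cluster D B S \<and> x \<in> C"
    proof (induction rule: rtrancl_induct)
      case base
      then show ?case using 0 unfolding cluster_def conn_def by auto
    next
      case (step z z')
      then have "z' \<in> C" using assms(2) cluster_step[of z D A S z'] by auto
      with step show ?case using arc[of z z'] cluster_step[of z D B S z'] by auto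
    qed
    then show ?thesis by simp
  qed
  moreover have "x \<in> C" if "x \<in> cluster D B S" for x
  proof -
    have "(0, x) \<in> (open_arcs D B \<inter> S \<times> S)\<^sup>*"
      using that unfolding cluster_def conn_def by auto
    then show "x \<in> C"
    proof (induction rule: rtrancl_induct)
      case (step z z')
      then show ?case using arc[of z z'] cluster_step[of z D A S z'] assms(2) by auto
    qed (rule 0)
  qed
  ultimately show ?thesis by auto
qed

text \<open>Cut a long path at its last vertex in the cluster. The next vertex must lie outside S,
  since otherwise it would belong to the cluster, and the rest of the path uses no edge at the
  cluster. That next vertex has sup-distance at most L from 0, so the rest still has to travel
  distance n.\<close>

lemma far_split:
  assumes D: "D \<subseteq> full_arcs" and S: "0 \<in> S" "S \<subseteq> near L 0" and far: "far D A (n + L) 0"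
  shows "\<exists>(x, y)\<in>bdry D S. x \<in> cluster D A S \<and> {x, y} \<in> A \<and> far D (A - edges_at (cluster D A S)) n y"
proof -
  let ?C = "cluster D A S"
  obtain z where z: "(0, z) \<in> (open_arcs D A)\<^sup>*" "z \<notin> near (n + L) 0"
    using far unfolding far_def by auto
  from z(1) have "z \<in> ?C \<or> (\<exists>(x, y)\<in>bdry D S. x \<in> ?C \<and> {x, y} \<in> A \<and> (y, z) \<in> (open_arcs D (A - edges_at ?C))\<^sup>*)"
    (is "_ \<or> ?P z")
  proof (induction rule: rtrancl_induct)
    case base
    then show ?case unfolding cluster_def conn_def by auto
  next
    case (step z z')
    consider "z' \<in> ?C" | "z' \<notin> ?C" "z \<in> ?C" | "z' \<notin> ?C" "z \<notin> ?C" by auto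
    then show ?case
    proof cases
      case 2
      then have "z \<in> S" using cluster_subset S(1) by auto
      with 2 step.hyps(2) have "z' \<notin> S" using cluster_step[of z D A S z'] by auto
      with \<open>z \<in> S\<close> step.hyps(2) have "(z, z') \<in> bdry D S" "{z, z'} \<in> A"
        unfolding bdry_def open_arcs_def by auto
      with 2 have "?P z'" by (intro bexI[of _ "(z, z')"]) auto
      then show ?thesis by simp
    next
      case 3
      with step.IH obtain x y where xy: "(x, y) \<in> bdry D S" "x \<in> ?C" "{x, y} \<in> A"
        "(y, z) \<in> (open_arcs D (A - edges_at ?C))\<^sup>*" by auto
      have "(z, z') \<in> open_arcs D (A - edges_at ?C)"
        using step.hyps(2) 3 unfolding open_arcs_def edges_at_def by auto
      with xy(4) have "(y, z') \<in> (open_arcs D (A - edges_at ?C))\<^sup>*" by (rule rtrancl_into_rtrancl)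
      with xy have "?P z'" by (intro bexI[of _ "(x, y)"]) auto
      then show ?thesis by simp
    qed simp
  qed
  moreover have "z \<notin> ?C"
    using z(2) S cluster_subset[OF S(1), of D A] near_mono[of L "n + L" 0] by auto
  ultimately obtain x y where xy: "(x, y) \<in> bdry D S" "x \<in> ?C" "{x, y} \<in> A"
    "(y, z) \<in> (open_arcs D (A - edges_at ?C))\<^sup>*" by auto
  have "z \<notin> near n y"
  proof
    assume zy: "z \<in> near n y"
    have "x \<in> near L 0" "y \<in> near 2 x"
      using xy(1) S(2) arc_edge[OF D] by (auto simp: bdry_def intro: edge_near)
    have "\<bar>z $ i\<bar> < int (n + L)" for i
    proof -
      have "\<bar>x $ i\<bar> < int L" "\<bar>y $ i - x $ i\<bar> < 2" "\<bar>z $ i - y $ i\<bar> < int n"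
        using \<open>x \<in> near L 0\<close> \<open>y \<in> near 2 x\<close> zy unfolding near_def by auto
      then show ?thesis by linarith
    qed
    then show False using z(2) unfolding near_def by auto
  qed
  with xy show ?thesis unfolding far_def by (intro bexI[of _ "(x, y)"]) auto
qed

lemma theta_bounds:
  fixes D :: "(int ^ 'd::finite) rel"
  assumes p: "0 \<le> p" "p \<le> 1"
  shows "0 \<le> theta D n p" "theta D n p \<le> 1"
proof -
  show "0 \<le> theta D n p" unfolding theta_def using p by (intro bexp_nonneg) auto
  have "theta D n p \<le> bexp p (edges_at (near n (0 :: int ^ 'd))) (\<lambda>A. 1)"
    unfolding theta_def using p by (intro bexp_mono) auto
  then show "theta D n p \<le> 1" by (simp add: bexp_const)
qed

text \<open>Sum over the explored cluster C and the exit arc of \<open>far_split\<close>. The three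
  events involved live on disjoint edge sets: the edges of S at C, the exit edge (it touches C but
  is not contained in S), and the edges away from C.\<close>

lemma theta_step:
  fixes D :: "(int ^ 'd::finite) rel"
  assumes D: "D \<subseteq> full_arcs" "transl_inv D" and p: "0 \<le> p" "p \<le> 1" and S: "0 \<in> S" "S \<subseteq> near L 0"
  shows "theta D (n + L) p \<le> phi D p S * theta D n p"
proof -
  define E where "E = edges_at (near (n + L) (0 :: int ^ 'd))"
  have finE [simp]: "finite E" unfolding E_def by simp
  have finS [simp]: "finite S" using S(2) finite_subset finite_near by blast
  have near_nL: "near L 0 \<subseteq> near (n + L) (0 :: int ^ 'd)" by (rule near_mono) simp
  let ?g = "\<lambda>x y C A. of_bool (cluster D A S = C) * (of_bool ({x, y} \<in> A) * of_bool (far D (A - edges_at C) n y)) :: real"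
  have pointwise: "of_bool (far D A (n + L) 0) \<le> (\<Sum>(x, y)\<in>bdry D S. \<Sum>C\<in>{C\<in>Pow S. x \<in> C}. ?g x y C A)" for A
  proof (cases "far D A (n + L) 0")
    case True
    then obtain x y where xy: "(x, y) \<in> bdry D S" "x \<in> cluster D A S" "{x, y} \<in> A"
      "far D (A - edges_at (cluster D A S)) n y"
      using far_split[OF D(1) S True] by auto
    have "1 = ?g x y (cluster D A S) A" using xy by simp
    also have "\<dots> \<le> (\<Sum>C\<in>{C\<in>Pow S. x \<in> C}. ?g x y C A)"
      using xy cluster_subset[OF S(1), of D A] by (intro member_le_sum) auto
    also have "\<dots> \<le> (\<Sum>(x, y)\<in>bdry D S. \<Sum>C\<in>{C\<in>Pow S. x \<in> C}. ?g x y C A)"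
    proof -
      let ?h = "\<lambda>z. \<Sum>C\<in>{C\<in>Pow S. fst z \<in> C}. ?g (fst z) (snd z) C A"
      have "?h (x, y) \<le> (\<Sum>z\<in>bdry D S. ?h z)"
        using xy(1) D(1) by (intro member_le_sum sum_nonneg) auto
      then show ?thesis by (simp only: case_prod_beta' fst_conv snd_conv)
    qed
    finally show ?thesis using True by simp
  qed (auto intro!: sum_nonneg)
  have term_bound: "bexp p E (?g x y C) \<le> bexp p E (\<lambda>A. of_bool (cluster D A S = C)) * (p * theta D n p)"
    if xy: "(x, y) \<in> bdry D S" and C: "C \<subseteq> S" "x \<in> C" for x y C
  proof -
    let ?F = "edges_in S \<inter> edges_at C" and ?G = "E - edges_at C"
    have x: "x \<in> near L 0" and e: "l1norm (x - y) = 1" and y: "y \<notin> S"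
      using xy S(2) arc_edge[OF D(1)] unfolding bdry_def by auto
    have eE: "{x, y} \<in> E" "{x, y} \<in> edges_at C" "{x, y} \<notin> ?F"
      using x e y near_nL C unfolding E_def edges_at_def edges_in_def by auto
    have FE: "?F \<subseteq> E"
      using S(2) near_nL edges_in_subset[of S] unfolding E_def edges_at_def by blast
    have "bexp p E (?g x y C) = bexp p ?F (\<lambda>A. of_bool (cluster D A S = C)) *
        bexp p (insert {x, y} ?G) (\<lambda>A. of_bool ({x, y} \<in> A) * of_bool (far D (A - edges_at C) n y))"
    proof (rule bexp_indep2)
      show "(of_bool (cluster D A S = C) :: real) = of_bool (cluster D (A \<inter> ?F) S = C)" for A
        using cluster_dep[OF D(1), of A S C "A \<inter> ?F"] cluster_dep[OF D(1), of "A \<inter> ?F" S C A] S(1) by auto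
      show "of_bool ({x, y} \<in> A) * of_bool (far D (A - edges_at C) n y) =
          (of_bool ({x, y} \<in> A \<inter> insert {x, y} ?G) * of_bool (far D (A \<inter> insert {x, y} ?G - edges_at C) n y) :: real)"
        if "A \<subseteq> E" for A
      proof -
        have "A \<inter> insert {x, y} ?G - edges_at C = A - edges_at C" using that eE by auto
        then show ?thesis by simp
      qed
    qed (use FE eE in auto)
    also have "bexp p ?F (\<lambda>A. of_bool (cluster D A S = C)) = bexp p E (\<lambda>A. of_bool (cluster D A S = C))"
      using cluster_dep[OF D(1), of _ S C] S(1) FE by (intro bexp_marginal[symmetric]) auto
    also have "bexp p (insert {x, y} ?G) (\<lambda>A. of_bool ({x, y} \<in> A) * of_bool (far D (A - edges_at C) n y))
       = p * bexp p ?G (\<lambda>A. of_bool (far D (A - edges_at C) n y))"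
    proof -
      have "bexp p ?G (\<lambda>A. of_bool ({x, y} \<in> A) * of_bool (far D (A - edges_at C) n y)) = bexp p ?G (\<lambda>A. 0)"
        using eE by (intro bexp_cong) auto
      moreover have "insert {x, y} A - edges_at C = A - edges_at C" for A using eE by auto
      ultimately show ?thesis using eE by (simp add: bexp_insert bexp_const)
    qed
    \<comment> \<open>Giving the edges at C back to the path can only increase the probability;
      translation invariance then moves y to 0.\<close>
    also have "bexp p ?G (\<lambda>A. of_bool (far D (A - edges_at C) n y)) \<le> theta D n p"
    proof -
      have "bexp p ?G (\<lambda>A. of_bool (far D (A - edges_at C) n y)) \<le> bexp p ?G (\<lambda>A. of_bool (far D A n y))"
        using p far_mono[of "_ - edges_at C" _ D n y] by (intro bexp_mono) auto
      also have "\<dots> \<le> bexp p E (\<lambda>A. of_bool (far D A n y))"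
        using p far_mono[of "_ \<inter> ?G" _ D n y] by (intro bexp_mono_set) auto
      also have "\<dots> = bexp p (edges_at (near n y)) (\<lambda>A. of_bool (far D A n y))"
      proof (rule bexp_marginal)
        have "near n y \<subseteq> near (n + L) 0"
        proof
          fix z assume z: "z \<in> near n y"
          have "\<bar>z $ i\<bar> < int (n + L)" for i
          proof -
            have "\<bar>x $ i\<bar> < int L" "\<bar>y $ i - x $ i\<bar> < 2" "\<bar>z $ i - y $ i\<bar> < int n"
              using x edge_near[OF e] z unfolding near_def by auto
            then show ?thesis by linarith
          qed
          then show "z \<in> near (n + L) 0" unfolding near_def by simp
        qed
        then show "edges_at (near n y) \<subseteq> E" unfolding E_def edges_at_def by auto
      qed (use far_local[OF D(1)] in auto)
      also have "\<dots> = theta D n p" by (rule bexp_far_transl[OF D(2)])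
      finally show ?thesis .
    qed
    finally show ?thesis
      using p by (simp add: mult_left_mono bexp_nonneg)
  qed
  have conn_eq: "(\<Sum>C\<in>{C\<in>Pow S. x \<in> C}. bexp p E (\<lambda>A. of_bool (cluster D A S = C)))
      = bexp p (edges_in S) (\<lambda>A. of_bool (conn D A S x))" for x
  proof -
    have "(\<Sum>C\<in>{C\<in>Pow S. x \<in> C}. bexp p E (\<lambda>A. of_bool (cluster D A S = C)))
        = bexp p E (\<lambda>A. \<Sum>C\<in>{C\<in>Pow S. x \<in> C}. of_bool (cluster D A S = C))"
      by (simp only: bexp_sum)
    also have "\<dots> = bexp p E (\<lambda>A. of_bool (conn D A S x))"
    proof (rule bexp_cong)
      fix A
      have "(\<Sum>C\<in>{C\<in>Pow S. x \<in> C}. of_bool (cluster D A S = C) :: real)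
          = (\<Sum>C\<in>{C\<in>Pow S. x \<in> C}. if C = cluster D A S then 1 else 0)"
        by (intro sum.cong) auto
      also have "\<dots> = of_bool (x \<in> cluster D A S)"
        using cluster_subset[OF S(1), of D A] by (subst sum.delta) auto
      finally show "(\<Sum>C\<in>{C\<in>Pow S. x \<in> C}. of_bool (cluster D A S = C) :: real) = of_bool (conn D A S x)"
        by (simp add: cluster_def)
    qed
    also have "\<dots> = bexp p (edges_in S) (\<lambda>A. of_bool (conn D A S x))"
    proof (rule bexp_marginal)
      show "edges_in S \<subseteq> E"
        using S(2) near_nL edges_in_subset[of S] unfolding E_def edges_at_def by blast
      show "(of_bool (conn D A S x) :: real) = of_bool (conn D (A \<inter> edges_in S) S x)" for A
        using conn_dep[of A S "A \<inter> edges_in S" D x] D by simp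
    qed simp
    finally show ?thesis .
  qed
  have "theta D (n + L) p = bexp p E (\<lambda>A. of_bool (far D A (n + L) 0))"
    unfolding theta_def E_def ..
  also have "\<dots> \<le> bexp p E (\<lambda>A. \<Sum>(x, y)\<in>bdry D S. \<Sum>C\<in>{C\<in>Pow S. x \<in> C}. ?g x y C A)"
    using p pointwise by (intro bexp_mono) auto
  also have "\<dots> = (\<Sum>(x, y)\<in>bdry D S. \<Sum>C\<in>{C\<in>Pow S. x \<in> C}. bexp p E (?g x y C))"
    by (simp only: bexp_sum case_prod_beta')
  also have "\<dots> \<le> (\<Sum>(x, y)\<in>bdry D S. \<Sum>C\<in>{C\<in>Pow S. x \<in> C}.
      bexp p E (\<lambda>A. of_bool (cluster D A S = C)) * (p * theta D n p))"
    using term_bound by (intro sum_mono) (auto simp: case_prod_beta' intro!: sum_mono)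
  also have "\<dots> = (\<Sum>(x, y)\<in>bdry D S. bexp p (edges_in S) (\<lambda>A. of_bool (conn D A S x)) * (p * theta D n p))"
    by (simp only: sum_distrib_right[symmetric] conn_eq)
  also have "\<dots> = phi D p S * theta D n p"
    unfolding phi_def by (simp add: sum_distrib_right sum_distrib_left case_prod_beta' mult_ac)
  finally show ?thesis .
qed

section \<open>Sharpness of the phase transition\<close>

lemma theta_mono:
  fixes D :: "(int ^ 'd::finite) rel"
  assumes "0 \<le> p" "p \<le> q" "q \<le> 1"
  shows "theta D n p \<le> theta D n q"
  unfolding theta_def
proof (rule DERIV_nonneg_imp_nondecreasing[OF assms(2)])
  fix x assume "p \<le> x" "x \<le> q"
  then have x: "0 \<le> x" "x \<le> 1" using assms by auto
  let ?E = "edges_at (near n (0 :: int ^ 'd))"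
  have "0 \<le> (\<Sum>e\<in>?E. bexp x (?E - {e}) (\<lambda>A. of_bool (far D (insert e A) n 0) - of_bool (far D A n 0)))"
    using x far_mono[of _ "insert _ _" D n 0]
    by (intro sum_nonneg bexp_nonneg) (auto simp: of_bool_def)
  then show "\<exists>y. ((\<lambda>p. bexp p ?E (\<lambda>A. of_bool (far D A n 0))) has_real_derivative y) (at x) \<and> 0 \<le> y"
    using bexp_deriv[of ?E "\<lambda>A. of_bool (far D A n 0)" x] by auto
qed

text \<open>Otherwise \<theta>' \<ge> 1 - \<theta> on the whole interval, and by the mean value
  theorem \<open>theta D n p2\<close> stays bounded away from 0 as n grows.\<close>

lemma exists_phi_less_1:
  fixes D :: "(int ^ 'd::finite) rel"
  assumes D: "D \<subseteq> full_arcs" and p: "0 \<le> p1" "p1 < p2" "p2 \<le> 1"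
    and lim: "(\<lambda>n. theta D n p2) \<longlonglongrightarrow> 0"
  shows "\<exists>\<xi> S. p1 < \<xi> \<and> \<xi> < p2 \<and> finite S \<and> 0 \<in> S \<and> phi D \<xi> S < 1"
proof (rule ccontr)
  assume contr: "\<not> ?thesis"
  then have phi: "1 \<le> phi D \<xi> S" if "p1 < \<xi>" "\<xi> < p2" "finite S" "0 \<in> S" for \<xi> S
    using that contr by (meson linorder_not_le)
  have "(p2 - p1) * (1 - theta D n p2) \<le> theta D n p2" if n: "0 < n" for n
  proof -
    let ?E = "edges_at (near n (0 :: int ^ 'd))"
    let ?d = "\<lambda>p. \<Sum>e\<in>?E. bexp p (?E - {e}) (\<lambda>A. of_bool (far D (insert e A) n 0) - of_bool (far D A n 0))"
    obtain \<xi> where xi: "p1 < \<xi>" "\<xi> < p2" "theta D n p2 - theta D n p1 = (p2 - p1) * ?d \<xi>"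
      using MVT2[OF p(2), of "theta D n" ?d] bexp_deriv[of ?E] unfolding theta_def by auto
    have "1 - theta D n p2 \<le> 1 - theta D n \<xi>"
      using theta_mono[of \<xi> p2 D n] xi p by simp
    also have "\<dots> \<le> ?d \<xi>"
      using xi p phi by (intro theta_deriv_ge[OF D n]) auto
    finally have "(p2 - p1) * (1 - theta D n p2) \<le> (p2 - p1) * ?d \<xi>"
      using p by (intro mult_left_mono) auto
    with xi(3) theta_bounds(1)[of p1 D n] p show ?thesis by linarith
  qed
  moreover have "(\<lambda>n. (p2 - p1) * (1 - theta D n p2)) \<longlonglongrightarrow> (p2 - p1) * (1 - 0)"
    by (intro tendsto_intros lim)
  ultimately have "(p2 - p1) * (1 - 0) \<le> 0"
    using lim by (elim LIMSEQ_le[OF _ lim]) (auto intro!: exI[of _ 1])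
  with p show False by simp
qed

lemma power_mult_exp_decay:
  fixes c :: real
  assumes "0 < c" "c < 1"
  shows "(\<lambda>k. real k ^ d * c ^ k) \<longlonglongrightarrow> 0"
proof -
  define b where "b = - ln c"
  have b: "0 < b" using assms unfolding b_def by simp
  have "((\<lambda>x. x ^ d / exp x) \<longlongrightarrow> (0::real)) at_top"
    by (rule tendsto_power_div_exp_0)
  moreover have "filterlim (\<lambda>k. b * real k) at_top sequentially"
    using b by (intro filterlim_tendsto_pos_mult_at_top[OF tendsto_const] filterlim_real_sequentially)
  ultimately have "(\<lambda>k. (b * real k) ^ d / exp (b * real k)) \<longlonglongrightarrow> 0"
    by (rule filterlim_compose)
  then have "(\<lambda>k. (1 / b ^ d) * ((b * real k) ^ d / exp (b * real k))) \<longlonglongrightarrow> (1 / b ^ d) * 0"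
    by (intro tendsto_intros)
  moreover have "(1 / b ^ d) * ((b * real k) ^ d / exp (b * real k)) = real k ^ d * c ^ k" for k
  proof -
    have "exp (b * real k) = inverse (c ^ k)"
      using assms unfolding b_def by (simp add: exp_minus exp_of_nat2_mult)
    then show ?thesis using b by (simp add: power_mult_distrib field_simps)
  qed
  ultimately show ?thesis by simp
qed

text \<open>One finite S with \<open>phi\<close> below 1 gives geometric decay along the radii 1 + k
  L, which beats any polynomial. A polynomial prefactor is wanted because a union bound over a box
  of side N will cost N^d.\<close>

lemma subcritical_decay:
  fixes D :: "(int ^ 'd::finite) rel"
  assumes D: "D \<subseteq> full_arcs" "transl_inv D" and p: "0 \<le> p1" "p1 < p2" "p2 \<le> 1"
    and lim: "(\<lambda>n. theta D n p2) \<longlonglongrightarrow> 0" and eta: "0 < \<eta>"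
  shows "\<exists>N>0. real N ^ d * theta D N p1 < \<eta>"
proof -
  obtain \<xi> S where xi: "p1 < \<xi>" "\<xi> < p2" "finite S" "0 \<in> S" "phi D \<xi> S < 1"
    using exists_phi_less_1[OF D(1) p lim] by blast
  \<comment> \<open>The value of \<open>phi\<close> may be 0; the maximum keeps the rate positive,
    as \<open>power_mult_exp_decay\<close> takes its logarithm.\<close>
  define c where "c = max (1/2) (phi D \<xi> S)"
  have c: "0 < c" "c < 1" "phi D \<xi> S \<le> c" using xi unfolding c_def by auto
  define L where "L = Suc (nat (\<Sum>x\<in>S. l1norm x))"
  have SL: "S \<subseteq> near L 0"
  proof
    fix x assume "x \<in> S"
    then have "l1norm x \<le> (\<Sum>x\<in>S. l1norm x)" using xi(3) by (intro member_le_sum) auto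
    then show "x \<in> near L 0" unfolding L_def by (intro near_l1norm) (simp add: sum_nonneg)
  qed
  have dec: "theta D (1 + k * L) \<xi> \<le> c ^ k" for k
  proof (induction k)
    case 0
    then show ?case using theta_bounds(2)[of \<xi>] xi p by simp
  next
    case (Suc k)
    have "theta D (1 + k * L + L) \<xi> \<le> phi D \<xi> S * theta D (1 + k * L) \<xi>"
      using xi p by (intro theta_step[OF D _ _ _ SL]) auto
    also have "\<dots> \<le> c * c ^ k"
      using c Suc theta_bounds(1)[of \<xi> D "1 + k * L"] xi p by (intro mult_mono) auto
    finally show ?case by (simp add: algebra_simps)
  qed
  have "(\<lambda>k. real (1 + L) ^ d * (real k ^ d * c ^ k)) \<longlonglongrightarrow> real (1 + L) ^ d * 0"
    using c by (intro tendsto_intros power_mult_exp_decay)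
  then have "\<forall>\<^sub>F k in sequentially. real (1 + L) ^ d * (real k ^ d * c ^ k) < \<eta>"
    using eta by (intro order_tendstoD(2)) auto
  then have "\<forall>\<^sub>F k in sequentially. real (1 + L) ^ d * (real k ^ d * c ^ k) < \<eta> \<and> 1 \<le> k"
    by (intro eventually_conj eventually_ge_at_top)
  then obtain k where k: "real (1 + L) ^ d * (real k ^ d * c ^ k) < \<eta>" "1 \<le> k"
    by (auto simp: eventually_sequentially)
  have "real (1 + k * L) ^ d * theta D (1 + k * L) p1 \<le> (real (1 + L) * real k) ^ d * c ^ k"
  proof (intro mult_mono power_mono)
    have "1 + k * L \<le> (1 + L) * k" using k(2) by (simp add: algebra_simps)
    then show "real (1 + k * L) \<le> real (1 + L) * real k" by (metis of_nat_le_iff of_nat_mult)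
    show "theta D (1 + k * L) p1 \<le> c ^ k"
      using theta_mono[of p1 \<xi> D "1 + k * L"] dec[of k] xi p by simp
    show "0 \<le> theta D (1 + k * L) p1" using theta_bounds(1)[of p1 D "1 + k * L"] p by simp
  qed auto
  also have "\<dots> < \<eta>" using k(1) by (simp add: power_mult_distrib mult_ac)
  finally show ?thesis by (intro exI[of _ "1 + k * L"]) auto
qed

text \<open>The bridge from product measures to \<open>bexp\<close>: an event that depends only on
  which of finitely many coordinates lie in Q is a percolation event with parameter
  \<open>measure M Q\<close>. It serves Bernoulli edges with Q = \<open>{True}\<close> and weights
  with Q = \<open>{..t}\<close>.\<close>

lemma measure_PiM_pattern:
  fixes M :: "'b measure"
  assumes M: "prob_space M" and Q: "Q \<in> sets M" and E: "finite E" "E \<subseteq> I"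
  shows "{w \<in> space (PiM I (\<lambda>_. M)). f {e \<in> E. w e \<in> Q}} \<in> sets (PiM I (\<lambda>_. M))" (is "?X \<in> _")
    and "measure (PiM I (\<lambda>_. M)) {w \<in> space (PiM I (\<lambda>_. M)). f {e \<in> E. w e \<in> Q}}
      = bexp (measure M Q) E (\<lambda>A. of_bool (f A))"
proof -
  interpret M: prob_space M by (rule M)
  interpret P: product_prob_space "\<lambda>_. M" I by unfold_locales
  let ?P = "PiM I (\<lambda>_. M)"
  define X where "X A = {w \<in> space ?P. \<forall>e\<in>E. w e \<in> (if e \<in> A then Q else space M - Q)}" for A
  have XE: "X A = {w \<in> space ?P. {e \<in> E. w e \<in> Q} = A}" if "A \<subseteq> E" for A
  proof -
    have "(\<forall>e\<in>E. w e \<in> (if e \<in> A then Q else space M - Q)) \<longleftrightarrow> {e \<in> E. w e \<in> Q} = A" if "w \<in> space ?P" for w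
    proof -
      have "w e \<in> space M" if "e \<in> E" for e
        using that E(2) \<open>w \<in> space ?P\<close> by (auto simp: space_PiM PiE_iff)
      then show ?thesis using \<open>A \<subseteq> E\<close> by auto
    qed
    then show ?thesis unfolding X_def by (intro Collect_cong conj_cong refl)
  qed
  have Xs: "X A \<in> sets ?P" for A
    unfolding X_def using E Q by (intro sets.sets_Collect_finite_All sets_Collect_single'[of _ I "\<lambda>_. M" "\<lambda>x. x \<in> _"]) auto
  have decomp: "?X = (\<Union>A\<in>{A \<in> Pow E. f A}. X A)"
    using XE by auto
  show "?X \<in> sets ?P"
    unfolding decomp using Xs E by (intro sets.finite_UN) auto
  have Xm: "measure ?P (X A) = measure M Q ^ card A * (1 - measure M Q) ^ card (E - A)" if A: "A \<subseteq> E" for A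
  proof -
    have "emeasure ?P (X A) = (\<Prod>e\<in>E. emeasure M (if e \<in> A then Q else space M - Q))"
      unfolding X_def using E Q by (intro P.emeasure_PiM_Collect) auto
    also have "\<dots> = ennreal (\<Prod>e\<in>E. measure M (if e \<in> A then Q else space M - Q))"
      by (simp add: M.emeasure_eq_measure prod_ennreal)
    finally have "measure ?P (X A) = (\<Prod>e\<in>E. if e \<in> A then measure M Q else 1 - measure M Q)"
      using Q M.prob_compl[of Q] unfolding measure_def[of ?P]
      by (simp add: prod_nonneg if_distrib[of "measure M"] cong: if_cong)
    also have "\<dots> = measure M Q ^ card A * (1 - measure M Q) ^ card (E - A)"
      using A E by (simp add: prod.If_cases Int_absorb1 Diff_eq)
    finally show ?thesis .
  qed
  have "measure ?P ?X = (\<Sum>A\<in>{A \<in> Pow E. f A}. measure ?P (X A))"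
    unfolding decomp
  proof (rule P.finite_measure_finite_Union)
    show "disjoint_family_on X {A \<in> Pow E. f A}"
      using XE by (auto simp: disjoint_family_on_def)
  qed (use E Xs in auto)
  also have "\<dots> = (\<Sum>A\<in>{A \<in> Pow E. f A}. measure M Q ^ card A * (1 - measure M Q) ^ card (E - A))"
    using Xm by (intro sum.cong) auto
  also have "\<dots> = bexp (measure M Q) E (\<lambda>A. of_bool (f A))"
    unfolding bexp_def using E by (intro sum.mono_neutral_cong_left) auto
  finally show "measure ?P ?X = bexp (measure M Q) E (\<lambda>A. of_bool (f A))" .
qed

lemma infinite_cluster_iff: "infinite ((open_arcs D A)\<^sup>* `` {a}) \<longleftrightarrow> (\<forall>n. far D A n a)"
proof
  assume inf: "infinite ((open_arcs D A)\<^sup>* `` {a})"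
  show "\<forall>n. far D A n a"
  proof (rule ccontr)
    assume "\<not> (\<forall>n. far D A n a)"
    then obtain n where "(open_arcs D A)\<^sup>* `` {a} \<subseteq> near n a" unfolding far_def by auto
    with inf finite_subset finite_near show False by blast
  qed
next
  assume far: "\<forall>n. far D A n a"
  show "infinite ((open_arcs D A)\<^sup>* `` {a})"
  proof
    let ?S = "(open_arcs D A)\<^sup>* `` {a}"
    assume fin: "finite ?S"
    have "?S \<subseteq> near (Suc (nat (\<Sum>x\<in>?S. l1norm (x - a)))) a"
    proof
      fix x assume "x \<in> ?S"
      then have "l1norm (x - a) \<le> (\<Sum>x\<in>?S. l1norm (x - a))" using fin by (intro member_le_sum) auto
      then show "x \<in> near (Suc (nat (\<Sum>x\<in>?S. l1norm (x - a)))) a"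
        by (intro near_l1norm) (simp add: sum_nonneg)
    qed
    with far show False unfolding far_def by blast
  qed
qed

text \<open>An infinite cluster is one that reaches every distance, so this is continuity of measure
  from above.\<close>

lemma theta_tendsto:
  fixes D :: "(int ^ 'd::finite) rel"
  assumes D: "D \<subseteq> full_arcs" and p: "0 \<le> p" "p \<le> 1"
  shows "(\<lambda>n. theta D n p) \<longlonglongrightarrow>
    measure (bernoulli_bond p) {w \<in> space (bernoulli_bond p). infinite ((open_arcs D {e. w e})\<^sup>* `` {0})}"
proof -
  let ?P = "bernoulli_bond p :: ((int ^ 'd) set \<Rightarrow> bool) measure"
  let ?E = "\<lambda>n. edges_at (near n (0 :: int ^ 'd))"
  interpret P: prob_space ?P
    unfolding bernoulli_bond_def by (intro prob_space_PiM measure_pmf.prob_space_axioms)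
  define F where "F n = {w \<in> space ?P. far D {e. w e} n 0}" for n
  have Feq: "F n = {w \<in> space ?P. far D {e \<in> ?E n. w e \<in> {True}} n 0}" for n
    unfolding F_def using far_local[OF D, of "{e. _ e}" n 0] by (auto simp: Int_def conj_commute)
  have sub: "?E n \<subseteq> lattice_edges" for n unfolding edges_at_def by auto
  have Fs: "F n \<in> sets ?P" for n
    unfolding Feq bernoulli_bond_def
    by (intro measure_PiM_pattern(1)) (auto simp: sub measure_pmf.prob_space_axioms)
  have Fm: "measure ?P (F n) = theta D n p" for n
    unfolding Feq bernoulli_bond_def theta_def
    using p by (subst measure_PiM_pattern(2)) (auto simp: sub measure_pmf.prob_space_axioms measure_pmf_single)
  have "decseq F"
    unfolding decseq_def F_def far_def using near_mono by blast
  then have "(\<lambda>n. measure ?P (F n)) \<longlonglongrightarrow> measure ?P (\<Inter>n. F n)"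
    using Fs by (intro P.finite_Lim_measure_decseq) auto
  moreover have "(\<Inter>n. F n) = {w \<in> space ?P. infinite ((open_arcs D {e. w e})\<^sup>* `` {0})}"
    unfolding F_def infinite_cluster_iff by auto
  ultimately show ?thesis using Fm by simp
qed

definition dir_arcs :: "('d::finite \<Rightarrow> int) \<Rightarrow> (int ^ 'd) rel" where
  "dir_arcs s = {(u, v). {u, v} \<in> lattice_edges \<and> (\<forall>i. s i * u $ i \<le> s i * v $ i)}"

lemma full_arcs_props: "full_arcs \<subseteq> full_arcs" "transl_inv full_arcs"
  by (auto simp: full_arcs_def transl_inv_def)

lemma dir_arcs_props: "dir_arcs s \<subseteq> full_arcs" "transl_inv (dir_arcs s)"
  by (auto simp: full_arcs_def dir_arcs_def transl_inv_def distrib_left)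

lemma open_adj_eq: "open_adj w = open_arcs full_arcs {e. w e}"
  by (auto simp: open_adj_def open_arcs_def full_arcs_def)

lemma oriented_open_adj_eq: "oriented_open_adj w = open_arcs (dir_arcs (\<lambda>_. 1)) {e. w e}"
  by (auto simp: oriented_open_adj_def open_arcs_def dir_arcs_def)

lemma bexp_zero: "finite E \<Longrightarrow> bexp 0 E f = f {}"
  by (induction E rule: finite_induct) (simp_all add: bexp_insert)

text \<open>A critical value given as a supremum only provides some p2 > p1 without percolation. The
  gap between p1 and p2 is what the sharpness argument consumes.\<close>

lemma subcritical_from_Sup:
  fixes D :: "(int ^ 'd::finite) rel"
  assumes D: "D \<subseteq> full_arcs" "transl_inv D"
    and th: "\<And>p. th p = measure (bernoulli_bond p) {w \<in> space (bernoulli_bond p). infinite ((open_arcs D {e. w e})\<^sup>* `` {0 :: int ^ 'd})}"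
    and p1: "0 \<le> p1" "p1 < Sup {p \<in> {0..1}. th p = 0}" and eta: "0 < \<eta>"
  shows "\<exists>N>0. real N ^ d * theta D N p1 < \<eta>"
proof -
  \<comment> \<open>The supremum is informative only if the set is nonempty; p = 0 belongs to
    it.\<close>
  have "(\<lambda>n. theta D n 0) \<longlonglongrightarrow> th 0"
    unfolding th by (rule theta_tendsto[OF D(1)]) auto
  moreover have "theta D n 0 = 0" if "0 < n" for n
  proof -
    have "(open_arcs D {})\<^sup>* = Id" by (simp add: open_arcs_def)
    then have "\<not> far D {} n 0" using that unfolding far_def by auto
    then show ?thesis unfolding theta_def by (simp add: bexp_zero)
  qed
  then have "(\<lambda>n. theta D n 0) \<longlonglongrightarrow> 0"
    by (intro tendsto_eventually eventually_sequentiallyI[of 1]) auto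
  ultimately have "th 0 = 0" by (rule LIMSEQ_unique)
  then have "0 \<in> {p \<in> {0..1}. th p = 0}" by simp
  then have "{p \<in> {0..1}. th p = 0} \<noteq> {}" by blast
  moreover have "bdd_above {p \<in> {0..1}. th p = 0}" by (auto intro!: bdd_aboveI[of _ 1])
  ultimately obtain p2 where p2: "p1 < p2" "0 \<le> p2" "p2 \<le> 1" "th p2 = 0"
    using p1(2) by (auto simp: less_cSup_iff)
  have "(\<lambda>n. theta D n p2) \<longlonglongrightarrow> 0"
    using theta_tendsto[OF D(1) p2(2,3)] p2(4) unfolding th by simp
  then show ?thesis by (intro subcritical_decay[OF D p1(1) p2(1,3) _ eta])
qed

lemma subcritical_bond:
  assumes "0 \<le> p1" "p1 < bond_pc TYPE('d::finite)" "0 < \<eta>"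
  shows "\<exists>N>0. real N ^ d * theta (full_arcs :: (int ^ 'd) rel) N p1 < \<eta>"
  using assms unfolding bond_pc_def
  by (intro subcritical_from_Sup[OF full_arcs_props, of "perc_theta TYPE('d)"])
    (auto simp: perc_theta_def open_adj_eq)

lemma subcritical_oriented:
  assumes "0 \<le> p1" "p1 < oriented_bond_pc TYPE('d::finite)" "0 < \<eta>"
  shows "\<exists>N>0. real N ^ d * theta (dir_arcs (\<lambda>_. 1) :: (int ^ 'd) rel) N p1 < \<eta>"
  using assms unfolding oriented_bond_pc_def
  by (intro subcritical_from_Sup[OF dir_arcs_props, of "oriented_perc_theta TYPE('d)"])
    (auto simp: oriented_perc_theta_def oriented_open_adj_eq)

section \<open>Coarse graining of self-avoiding paths\<close>

text \<open>Summing over positions instead of edges makes the times of consecutive stretches add up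
  without any injectivity argument.\<close>

definition seg_time :: "((int ^ 'd::finite) set \<Rightarrow> real) \<Rightarrow> (int ^ 'd) list \<Rightarrow> nat \<Rightarrow> nat \<Rightarrow> real" where
  "seg_time w p i j = (\<Sum>k\<in>{i..<j}. w {p ! k, p ! Suc k})"

lemma sa_path_edge: "sa_path p \<Longrightarrow> Suc i < length p \<Longrightarrow> {p ! i, p ! Suc i} \<in> lattice_edges"
  unfolding sa_path_def by blast

lemma path_edges_image: "path_edges p = (\<lambda>i. {p ! i, p ! Suc i}) ` {..<length p - 1}"
  unfolding path_edges_def by auto

lemma finite_path_edges [simp]: "finite (path_edges p)"
  by (simp add: path_edges_image)

lemma inj_path_edges:
  assumes "distinct p"
  shows "inj_on (\<lambda>i. {p ! i, p ! Suc i}) {..<length p - 1}"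
proof (rule inj_onI)
  fix i j assume "i \<in> {..<length p - 1}" "j \<in> {..<length p - 1}" "{p ! i, p ! Suc i} = {p ! j, p ! Suc j}"
  then have ij: "i < length p" "Suc i < length p" "j < length p" "Suc j < length p"
    and "p ! i = p ! j \<or> (p ! i = p ! Suc j \<and> p ! Suc i = p ! j)"
    by (auto simp: doubleton_eq_iff)
  then show "i = j" using nth_eq_iff_index_eq[OF assms] by auto
qed

lemma path_time_seg: "distinct p \<Longrightarrow> path_time w p = seg_time w p 0 (length p - 1)"
  unfolding path_time_def path_edges_image seg_time_def
  by (subst sum.reindex[OF inj_path_edges]) (auto simp: atLeast0LessThan)

lemma card_path_edges: "distinct p \<Longrightarrow> card (path_edges p) = length p - 1"
  unfolding path_edges_image by (subst card_image[OF inj_path_edges]) auto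

lemma path_edges_subset: "sa_path p \<Longrightarrow> path_edges p \<subseteq> lattice_edges"
  unfolding path_edges_def using sa_path_edge by auto

lemma l1norm_path_le:
  assumes "sa_path p" "i \<le> j" "j < length p"
  shows "l1norm (p ! i - p ! j) \<le> int (j - i)"
  using assms(2,3)
proof (induction j rule: dec_induct)
  case (step k)
  have "l1norm (p ! k - p ! Suc k) = 1" using sa_path_edge[OF assms(1), of k] step by simp
  moreover have "l1norm (p ! i - p ! k) \<le> int (k - i)" using step by simp
  ultimately show ?case
    using l1norm_triangle_diff[of "p ! i" "p ! Suc k" "p ! k"] step.hyps by simp
qed simp

lemma rtrancl_along:
  assumes "i \<le> j" "\<And>k. i \<le> k \<Longrightarrow> k < j \<Longrightarrow> (p ! k, p ! Suc k) \<in> R"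
  shows "(p ! i, p ! j) \<in> R\<^sup>*"
  using assms by (induction j rule: dec_induct) (auto intro: rtrancl_into_rtrancl)

lemma seg_time_ge:
  assumes "sa_path p" "j < length p" "\<And>e. e \<in> lattice_edges \<Longrightarrow> r \<le> w e"
    and k: "i \<le> k" "k < j" "r + \<delta> \<le> w {p ! k, p ! Suc k}"
  shows "r * real (j - i) + \<delta> \<le> seg_time w p i j"
proof -
  have ge: "r \<le> w {p ! l, p ! Suc l}" if "l < j" for l
    using assms(3)[OF sa_path_edge[OF assms(1), of l]] that assms(2) by simp
  have "seg_time w p i j = w {p ! k, p ! Suc k} + (\<Sum>l\<in>{i..<j} - {k}. w {p ! l, p ! Suc l})"
    unfolding seg_time_def using k by (intro sum.remove) auto
  moreover have "(\<Sum>l\<in>{i..<j} - {k}. r) \<le> (\<Sum>l\<in>{i..<j} - {k}. w {p ! l, p ! Suc l})"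
    using ge by (intro sum_mono) auto
  moreover have "(\<Sum>l\<in>{i..<j} - {k}. r) = r * real (j - i) - r"
    using k by (simp add: card_Diff_singleton of_nat_diff algebra_simps)
  ultimately show ?thesis using k by simp
qed

text \<open>Measured with the signs s, each step advances by at most 1. The total advance equals the
  number of steps, so every step advances by exactly 1 and no coordinate ever moves
  backwards.\<close>

lemma monotone_of_shortest:
  fixes p :: "(int ^ 'd::finite) list"
  assumes "sa_path p" "i \<le> j" "j < length p" and eq: "l1norm (p ! i - p ! j) = int (j - i)"
  defines "s \<equiv> \<lambda>c. if p ! i $ c \<le> p ! j $ c then 1 else - 1 :: int"
  assumes k: "i \<le> k" "k < j"
  shows "s c * p ! k $ c \<le> s c * p ! Suc k $ c"
proof -
  let ?g = "\<lambda>k. \<Sum>c\<in>UNIV. s c * (p ! Suc k $ c - p ! k $ c)"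
  have step: "l1norm (p ! k - p ! Suc k) = 1" if "k < j" for k
    using sa_path_edge[OF assms(1), of k] that assms(3) by simp
  have le: "s c * (p ! Suc k $ c - p ! k $ c) \<le> \<bar>(p ! k - p ! Suc k) $ c\<bar>" for k c
    unfolding s_def by auto
  have g1: "?g k \<le> 1" if "k < j" for k
  proof -
    have "?g k \<le> (\<Sum>c\<in>UNIV. \<bar>(p ! k - p ! Suc k) $ c\<bar>)" by (intro sum_mono le)
    then show ?thesis using step[OF that] unfolding l1norm_def by linarith
  qed
  have "(\<Sum>k\<in>{i..<j}. ?g k) = (\<Sum>c\<in>UNIV. s c * (\<Sum>k\<in>{i..<j}. p ! Suc k $ c - p ! k $ c))"
    by (simp add: sum_distrib_left sum.swap[of _ "{i..<j}"])
  also have "\<dots> = (\<Sum>c\<in>UNIV. s c * (p ! j $ c - p ! i $ c))"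
    using sum_Suc_diff'[OF assms(2), of "\<lambda>k. p ! k $ _"] by simp
  also have "\<dots> = l1norm (p ! i - p ! j)"
    unfolding l1norm_def s_def by (intro sum.cong) auto
  finally have sum_eq: "(\<Sum>k\<in>{i..<j}. 1 - ?g k) = 0"
    using eq assms(2) by (simp add: sum_subtractf)
  have "1 - ?g k = 0"
  proof -
    have "\<forall>k\<in>{i..<j}. 1 - ?g k = 0"
      using sum_eq g1 by (subst (asm) sum_nonneg_eq_0_iff) auto
    then show ?thesis using k by auto
  qed
  then have "(\<Sum>c\<in>UNIV. \<bar>(p ! k - p ! Suc k) $ c\<bar> - s c * (p ! Suc k $ c - p ! k $ c)) = 0"
    using step[OF k(2)] unfolding l1norm_def by (simp add: sum_subtractf)
  then have "\<forall>c\<in>UNIV. \<bar>(p ! k - p ! Suc k) $ c\<bar> - s c * (p ! Suc k $ c - p ! k $ c) = 0"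
    using le by (subst (asm) sum_nonneg_eq_0_iff) auto
  then have "0 \<le> s c * (p ! Suc k $ c - p ! k $ c)"
    by (metis UNIV_I abs_ge_zero eq_iff_diff_eq_0)
  then show ?thesis by (simp add: right_diff_distrib)
qed

definition signs :: "('d::finite \<Rightarrow> int) set" where
  "signs = PiE UNIV (\<lambda>_. {1, -1})"

lemma finite_signs [simp]: "finite signs"
  unfolding signs_def by (simp add: finite_PiE)

lemma signs_iff: "s \<in> signs \<longleftrightarrow> (\<forall>i. s i \<in> {1, -1})"
  unfolding signs_def by (auto simp: PiE_iff)

text \<open>The case r = 0: a segment whose weights are all at most t would be a low path from its
  start to distance N.\<close>

lemma crossing_excess_zero:
  fixes p :: "(int ^ 'd::finite) list"
  assumes p: "sa_path p" "i \<le> j" "j < length p" "p ! j \<notin> near N (p ! i)"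
    and w: "\<And>e. e \<in> lattice_edges \<Longrightarrow> 0 \<le> w e"
    and far: "\<not> far full_arcs {e \<in> lattice_edges. w e \<le> t} N (p ! i)"
  shows "t \<le> seg_time w p i j"
proof -
  have "\<exists>k. i \<le> k \<and> k < j \<and> t < w {p ! k, p ! Suc k}"
  proof (rule ccontr)
    assume "\<nexists>k. i \<le> k \<and> k < j \<and> t < w {p ! k, p ! Suc k}"
    then have "(p ! k, p ! Suc k) \<in> open_arcs full_arcs {e \<in> lattice_edges. w e \<le> t}" if "i \<le> k" "k < j" for k
      using that sa_path_edge[OF p(1), of k] p(3) unfolding open_arcs_def full_arcs_def by force
    from rtrancl_along[OF p(2) this] far p(4) show False unfolding far_def by blast
  qed
  then obtain k where "i \<le> k" "k < j" "t < w {p ! k, p ! Suc k}" by auto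
  then show ?thesis
    using seg_time_ge[OF p(1,3), of 0 w i k t] w by simp
qed

text \<open>For r > 0 there are two sources of excess. A segment that is not l^1-shortest has an
  extra edge, worth r \<ge> \<delta>. An l^1-shortest one is monotone, and the absence of oriented
  low paths forces some weight above r + \<delta>.\<close>

lemma crossing_excess_pos:
  fixes p :: "(int ^ 'd::finite) list" and r \<delta> :: real
  assumes p: "sa_path p" "i \<le> j" "j < length p" "p ! j \<notin> near N (p ! i)"
    and w: "\<And>e. e \<in> lattice_edges \<Longrightarrow> r \<le> w e" and r: "0 < r" "\<delta> \<le> r"
    and far: "\<And>s. s \<in> signs \<Longrightarrow> \<not> far (dir_arcs s) {e \<in> lattice_edges. w e \<le> r + \<delta>} N (p ! i)"
  shows "r * l1norm (p ! i - p ! j) + \<delta> \<le> seg_time w p i j"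
proof (cases "l1norm (p ! i - p ! j) = int (j - i)")
  case True
  define s where "s = (\<lambda>c. if p ! i $ c \<le> p ! j $ c then 1 else - 1 :: int)"
  have "\<exists>k. i \<le> k \<and> k < j \<and> r + \<delta> < w {p ! k, p ! Suc k}"
  proof (rule ccontr)
    assume neg: "\<nexists>k. i \<le> k \<and> k < j \<and> r + \<delta> < w {p ! k, p ! Suc k}"
    have "(p ! k, p ! Suc k) \<in> open_arcs (dir_arcs s) {e \<in> lattice_edges. w e \<le> r + \<delta>}" if k: "i \<le> k" "k < j" for k
    proof -
      have "w {p ! k, p ! Suc k} \<le> r + \<delta>" "{p ! k, p ! Suc k} \<in> lattice_edges"
        using neg k sa_path_edge[OF p(1), of k] p(3) by force+
      then show ?thesis
        using monotone_of_shortest[OF p(1-3) True k] unfolding open_arcs_def dir_arcs_def s_def by auto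
    qed
    from rtrancl_along[OF p(2) this] p(4)
    have "far (dir_arcs s) {e \<in> lattice_edges. w e \<le> r + \<delta>} N (p ! i)" unfolding far_def by blast
    moreover have "s \<in> signs" unfolding signs_iff s_def by auto
    ultimately show False using far by simp
  qed
  then obtain k where "i \<le> k" "k < j" "r + \<delta> < w {p ! k, p ! Suc k}" by auto
  then show ?thesis
    using seg_time_ge[OF p(1,3), of r w i k \<delta>] w True by simp
next
  case False
  then have "l1norm (p ! i - p ! j) + 1 \<le> int (j - i)"
    using l1norm_path_le[OF p(1-3)] by simp
  then have "real_of_int (l1norm (p ! i - p ! j) + 1) \<le> real (j - i)"
    by linarith
  then have "r * (l1norm (p ! i - p ! j) + 1) \<le> r * real (j - i)"
    using r(1) by (intro mult_left_mono) auto
  moreover have "r * real (j - i) \<le> seg_time w p i j"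
  proof -
    have "(\<Sum>k\<in>{i..<j}. r) \<le> seg_time w p i j"
      unfolding seg_time_def using w sa_path_edge[OF p(1)] p(3) by (intro sum_mono) auto
    then show ?thesis by (simp add: mult.commute)
  qed
  ultimately show ?thesis using r(2) by (simp add: algebra_simps)
qed

section \<open>Boxes of side N and disjoint crossings\<close>

definition bx :: "nat \<Rightarrow> int ^ 'd::finite \<Rightarrow> int ^ 'd" where
  "bx N u = (\<chi> c. u $ c div int N)"

lemma bx_fibre: "0 < N \<Longrightarrow> {u. bx N u = v} = {u. \<forall>c. u $ c \<in> {int N * v $ c ..< int N * v $ c + int N}}"
proof -
  assume N: "0 < N"
  have "x div int N = y \<longleftrightarrow> x \<in> {int N * y ..< int N * y + int N}" for x y
  proof
    assume "x div int N = y"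
    then have "int N * y + x mod int N = x" using mult_div_mod_eq[of "int N" x] by simp
    moreover have "0 \<le> x mod int N" "x mod int N < int N" using N by simp_all
    ultimately show "x \<in> {int N * y ..< int N * y + int N}"
      unfolding atLeastLessThan_iff by linarith
  next
    assume "x \<in> {int N * y ..< int N * y + int N}"
    then show "x div int N = y"
      using N by (intro int_div_pos_eq[of _ _ _ "x - int N * y"]) auto
  qed
  then show ?thesis unfolding bx_def by (simp add: vec_eq_iff)
qed

lemma finite_bx_fibre [simp]: "0 < N \<Longrightarrow> finite {u. bx N u = v}"
  by (simp only: bx_fibre) (rule finite_vec_box, simp)

lemma card_bx_fibre: "0 < N \<Longrightarrow> card {u :: int ^ 'd::finite. bx N u = v} = N ^ CARD('d)"
  by (simp only: bx_fibre card_vec_box) simp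

lemma bx_adj:
  assumes "0 < N" "l1norm (u - v) = 1"
  shows "bx N v \<in> near 2 (bx N u)"
proof -
  have "\<bar>v $ c div int N - u $ c div int N\<bar> < 2" for c
  proof -
    have "\<bar>v $ c - u $ c\<bar> \<le> 1"
      using assms(2) abs_component_le_l1norm[of "u - v" c] by auto
    then have "v $ c \<le> u $ c + int N" "u $ c \<le> v $ c + int N" using assms(1) by auto
    then have "v $ c div int N \<le> (u $ c + int N) div int N" "u $ c div int N \<le> (v $ c + int N) div int N"
      using assms(1) \<open>v $ c \<le> u $ c + int N\<close> \<open>u $ c \<le> v $ c + int N\<close> by (intro zdiv_mono1; simp)+
    then show ?thesis using assms(1) by simp
  qed
  then show ?thesis unfolding near_def bx_def by simp
qed

text \<open>Distinct indices congruent modulo 4 differ by at least 4 in some coordinate, so points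
  of the two boxes are more than 2 N apart there.\<close>

lemma separated_boxes:
  fixes u v :: "int ^ 'd::finite"
  assumes N: "0 < N" and ne: "bx N u \<noteq> bx N v" and md: "\<And>c. bx N u $ c mod 4 = bx N v $ c mod 4"
  shows "near (Suc N) u \<inter> near (Suc N) v = {}"
proof (rule ccontr)
  assume "near (Suc N) u \<inter> near (Suc N) v \<noteq> {}"
  then obtain z where z: "z \<in> near (Suc N) u" "z \<in> near (Suc N) v" by auto
  obtain c where c: "bx N u $ c \<noteq> bx N v $ c" using ne by (auto simp: vec_eq_iff)
  obtain q where "bx N u $ c - bx N v $ c = 4 * q"
    using md[of c] by (metis dvdE mod_eq_dvd_iff)
  with c have gap: "bx N u $ c \<ge> bx N v $ c + 4 \<or> bx N v $ c \<ge> bx N u $ c + 4" by presburger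
  have uu: "int N * (bx N u $ c) \<le> u $ c" "u $ c < int N * (bx N u $ c) + int N"
    using bx_fibre[OF N, of "bx N u"] by auto
  have vv: "int N * (bx N v $ c) \<le> v $ c" "v $ c < int N * (bx N v $ c) + int N"
    using bx_fibre[OF N, of "bx N v"] by auto
  have zz: "\<bar>z $ c - u $ c\<bar> \<le> int N" "\<bar>z $ c - v $ c\<bar> \<le> int N"
    using z[unfolded near_def, simplified, THEN spec, of c] by auto
  from gap show False
  proof
    assume "bx N u $ c \<ge> bx N v $ c + 4"
    then have "int N * (bx N v $ c + 4) \<le> int N * (bx N u $ c)" by (intro mult_left_mono) auto
    then show False using uu vv zz N by (simp add: algebra_simps)
  next
    assume "bx N v $ c \<ge> bx N u $ c + 4"
    then have "int N * (bx N u $ c + 4) \<le> int N * (bx N v $ c)" by (intro mult_left_mono) auto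
    then show False using uu vv zz N by (simp add: algebra_simps)
  qed
qed

text \<open>Bounds the number of possible sets of visited boxes by a number of walks: each new element is inserted as a
  detour from its predecessor and back.\<close>
lemma covering_walk:
  assumes "xs \<noteq> []" "successively R xs" "symp R"
  shows "\<exists>l. hd l = hd xs \<and> set l = set xs \<and> length l = 2 * card (set xs) - 1 \<and> l \<noteq> [] \<and> successively R l"
  using assms(1,2)
proof (induction xs rule: rev_nonempty_induct)
  case (single x)
  then show ?case by (intro exI[of _ "[x]"]) auto
next
  case (snoc y xs)
  then obtain l where l: "hd l = hd xs" "set l = set xs" "length l = 2 * card (set xs) - 1" "l \<noteq> []" "successively R l"
    by (auto simp: successively_append_iff)
  show ?case
  proof (cases "y \<in> set xs")
    case True
    then show ?thesis using l snoc.hyps by (intro exI[of _ l]) (auto simp: insert_absorb)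
  next
    case False
    have R: "R (last xs) y" using snoc.prems snoc.hyps by (simp add: successively_append_iff)
    have "last xs \<in> set l" using l(2) snoc.hyps by simp
    then obtain l1 l2 where l12: "l = l1 @ last xs # l2" by (meson split_list)
    let ?l = "l1 @ last xs # y # last xs # l2"
    have "successively R ?l"
      using l(5) R sympD[OF assms(3) R] unfolding l12
      by (auto simp: successively_append_iff successively_Cons)
    moreover have "hd ?l = hd (xs @ [y])" using l(1) snoc.hyps unfolding l12 by (cases l1) auto
    moreover have "set ?l = set (xs @ [y])" using l(2) unfolding l12 by auto
    moreover have "length ?l = 2 * card (set (xs @ [y])) - 1"
      using l(3) False snoc.hyps unfolding l12 by (cases "card (set xs)") auto
    ultimately show ?thesis by blast
  qed
qed

lemma card_walks_le:
  fixes R :: "'a \<Rightarrow> 'a \<Rightarrow> bool"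
  assumes "\<And>x. finite {y. R x y}" "\<And>x. card {y. R x y} \<le> K"
  shows "finite {l. length l = Suc n \<and> hd l = x \<and> successively R l} \<and>
    card {l. length l = Suc n \<and> hd l = x \<and> successively R l} \<le> K ^ n"
proof (induction n arbitrary: x)
  case 0
  have "{l. length l = Suc 0 \<and> hd l = x \<and> successively R l} = {[x]}"
    by (auto simp: length_Suc_conv)
  then show ?case by simp
next
  case (Suc n)
  let ?W = "\<lambda>n x. {l. length l = Suc n \<and> hd l = x \<and> successively R l}"
  have eq: "?W (Suc n) x = (\<Union>y\<in>{y. R x y}. (#) x ` ?W n y)"
  proof safe
    fix l assume "length l = Suc (Suc n)" "x = hd l" "successively R l"
    then obtain y l' where "l = x # y # l'" "length l' = n" "R x y" "successively R (y # l')"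
      by (auto simp: length_Suc_conv)
    then show "l \<in> (\<Union>y\<in>{y. R (hd l) y}. (#) (hd l) ` ?W n y)" by auto
  qed (auto simp: length_Suc_conv)
  have "card (?W (Suc n) x) \<le> (\<Sum>y\<in>{y. R x y}. card ((#) x ` ?W n y))"
    unfolding eq by (rule card_UN_le[OF assms(1)])
  also have "\<dots> \<le> (\<Sum>y\<in>{y. R x y}. K ^ n)"
    using Suc by (intro sum_mono) (auto intro: order_trans[OF card_image_le])
  also have "\<dots> \<le> K * K ^ n" using assms(2)[of x] by simp
  finally show ?case unfolding eq using Suc assms(1) by auto
qed

lemma pigeonhole_class:
  assumes "finite A" "finite B" "g ` A \<subseteq> B" "card B \<le> K" "B \<noteq> {}"
  shows "\<exists>b\<in>B. card A \<le> K * card {a \<in> A. g a = b}"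
proof (rule ccontr)
  assume neg: "\<not> ?thesis"
  have "card A = card (\<Union>b\<in>B. {a \<in> A. g a = b})"
    using assms(3) by (intro arg_cong[where f = card]) auto
  also have "\<dots> \<le> (\<Sum>b\<in>B. card {a \<in> A. g a = b})"
    by (rule card_UN_le[OF assms(2)])
  finally have 1: "card A \<le> (\<Sum>b\<in>B. card {a \<in> A. g a = b})" .
  have "K * card A \<le> (\<Sum>b\<in>B. K * card {a \<in> A. g a = b})"
    using 1 by (simp add: sum_distrib_left[symmetric])
  also have "\<dots> < (\<Sum>b\<in>B. card A)"
    using neg assms(2,5) by (intro sum_strict_mono) auto
  also have "\<dots> \<le> K * card A" using assms(4) by simp
  finally show False by simp
qed

definition mod4 :: "int ^ 'd::finite \<Rightarrow> int ^ 'd" where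
  "mod4 v = (\<chi> c. v $ c mod 4)"

lemma mod4_class:
  fixes Z :: "(int ^ 'd::finite) set"
  assumes "finite Z"
  shows "\<exists>Y\<subseteq>Z. card Z \<le> 4 ^ CARD('d) * card Y \<and> (\<forall>u\<in>Y. \<forall>v\<in>Y. mod4 u = mod4 v)"
proof -
  let ?B = "{v :: int ^ 'd. \<forall>c. v $ c \<in> {0..<4}}"
  have "\<exists>b\<in>?B. card Z \<le> 4 ^ CARD('d) * card {a \<in> Z. mod4 a = b}"
  proof (rule pigeonhole_class[OF assms])
    show "finite ?B" by (rule finite_vec_box) simp
    show "card ?B \<le> 4 ^ CARD('d)" unfolding card_vec_box by simp
    show "mod4 ` Z \<subseteq> ?B" by (auto simp: mod4_def)
    show "?B \<noteq> {}" by (auto intro!: exI[of _ 0])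
  qed
  then obtain b where "card Z \<le> 4 ^ CARD('d) * card {a \<in> Z. mod4 a = b}" by auto
  then show ?thesis by (intro exI[of _ "{a \<in> Z. mod4 a = b}"]) auto
qed

definition disjoint_segs :: "(int ^ 'd::finite) list \<Rightarrow> (nat \<times> nat) set \<Rightarrow> bool" where
  "disjoint_segs p J \<longleftrightarrow> finite J \<and> (\<forall>(i, j)\<in>J. i < j \<and> j < length p) \<and>
     (\<forall>(i, j)\<in>J. \<forall>(i', j')\<in>J. (i, j) \<noteq> (i', j') \<longrightarrow> j < i' \<or> j' < i)"

text \<open>From one visit to each box of Y, follow p until it first leaves the ball of radius N.
  These stretches stay in pairwise disjoint enlarged balls and are therefore disjoint. At most one
  box has no exit, because the end of p would lie in its ball; this is the + 1.\<close>

lemma disjoint_crossings: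
  fixes p :: "(int ^ 'd::finite) list"
  assumes p: "sa_path p" and N: "0 < N" and Y: "Y \<subseteq> bx N ` set p"
    and md: "\<And>u v. u \<in> Y \<Longrightarrow> v \<in> Y \<Longrightarrow> mod4 u = mod4 v"
  shows "\<exists>J. disjoint_segs p J \<and> card Y \<le> card J + 1 \<and>
    (\<forall>(i, j)\<in>J. bx N (p ! i) \<in> Y \<and> p ! j \<notin> near N (p ! i))"
proof -
  have finY: "finite Y" using Y finite_subset by blast
  have "\<exists>i. i < length p \<and> bx N (p ! i) = v" if "v \<in> Y" for v
    using Y that by (metis (no_types, lifting) image_iff in_set_conv_nth subsetD)
  then obtain I where I: "\<And>v. v \<in> Y \<Longrightarrow> I v < length p \<and> bx N (p ! I v) = v" by metis
  have sep: "near (Suc N) (p ! I u) \<inter> near (Suc N) (p ! I v) = {}" if "u \<in> Y" "v \<in> Y" "u \<noteq> v" for u v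
  proof (rule separated_boxes[OF N])
    show "bx N (p ! I u) \<noteq> bx N (p ! I v)" using I that by simp
    show "bx N (p ! I u) $ c mod 4 = bx N (p ! I v) $ c mod 4" for c
      using md[OF that(1,2)] I that unfolding mod4_def by (simp add: vec_eq_iff)
  qed
  define ex where "ex v j \<longleftrightarrow> I v < j \<and> j < length p \<and> p ! j \<notin> near N (p ! I v)" for v j
  define Y' where "Y' = {v \<in> Y. \<exists>j. ex v j}"
  define T where "T v = (LEAST j. ex v j)" for v
  have T: "ex v (T v)" if "v \<in> Y'" for v
    using that unfolding Y'_def T_def by (auto intro: LeastI)
  \<comment> \<open>Before the exit p stays in \<open>near N\<close>; the exit vertex is one step
    further, hence the radius \<open>Suc N\<close>.\<close>
  have inside: "p ! k \<in> near (Suc N) (p ! I v)" if v: "v \<in> Y'" and k: "I v \<le> k" "k \<le> T v" for v k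
  proof -
    have before: "p ! l \<in> near N (p ! I v)" if "I v \<le> l" "l < T v" for l
    proof (cases "l = I v")
      case False
      have "\<not> ex v l" using not_less_Least that(2) unfolding T_def by blast
      then show ?thesis using False that T[OF v] unfolding ex_def by auto
    qed (use N in simp)
    show ?thesis
    proof (cases "k < T v")
      case True
      then show ?thesis using before[OF k(1)] near_mono[of N "Suc N"] by auto
    next
      case False
      then have k': "k = T v" "I v < k" using k T[OF v] unfolding ex_def by auto
      then obtain l where l: "k = Suc l" "I v \<le> l" by (metis less_imp_Suc_add le_add1 add_Suc_right)
      have "p ! l \<in> near (Suc (N - 1)) (p ! I v)" using before[of l] l k' N by simp
      moreover have "p ! k \<in> near (Suc 1) (p ! l)"
        using sa_path_edge[OF p, of l] l k' T[OF v] edge_near[of "p ! l" "p ! k"] unfolding ex_def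
        by (simp add: numeral_2_eq_2)
      ultimately show ?thesis using near_trans[of "p ! l" "N - 1" _ "p ! k" 1] N by simp
    qed
  qed
  define J where "J = (\<lambda>v. (I v, T v)) ` Y'"
  have segs: "T u < I v \<or> T v < I u" if "u \<in> Y'" "v \<in> Y'" "u \<noteq> v" for u v
  proof (rule ccontr)
    assume "\<not> ?thesis"
    then have "I v \<le> T u" "I u \<le> T v" by auto
    moreover have "I u < T u" "I v < T v" using T that unfolding ex_def by auto
    ultimately have "p ! (max (I u) (I v)) \<in> near (Suc N) (p ! I u)" "p ! (max (I u) (I v)) \<in> near (Suc N) (p ! I v)"
      using that by (auto intro!: inside)
    then show False using sep[of u v] that unfolding Y'_def by auto
  qed
  have injJ: "inj_on (\<lambda>v. (I v, T v)) Y'"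
    using I unfolding Y'_def inj_on_def by (metis (mono_tags, lifting) Pair_inject mem_Collect_eq)
  have "disjoint_segs p J"
    unfolding disjoint_segs_def
  proof (intro conjI)
    show "finite J" unfolding J_def Y'_def using finY by simp
    show "\<forall>(i, j)\<in>J. i < j \<and> j < length p" unfolding J_def using T unfolding ex_def by auto
    show "\<forall>(i, j)\<in>J. \<forall>(i', j')\<in>J. (i, j) \<noteq> (i', j') \<longrightarrow> j < i' \<or> j' < i"
      unfolding J_def using segs by auto
  qed
  moreover have "card Y \<le> card J + 1"
  proof -
    have "u = v" if "u \<in> Y - Y'" "v \<in> Y - Y'" for u v
    proof (rule ccontr)
      assume "u \<noteq> v"
      have "p ! (length p - 1) \<in> near (Suc N) (p ! I v)" if "v \<in> Y - Y'" for v
      proof (cases "I v = length p - 1")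
        case False
        then have "I v < length p - 1" "length p - 1 < length p" using I[of v] that by auto
        then have "p ! (length p - 1) \<in> near N (p ! I v)" using that unfolding Y'_def ex_def by auto
        then show ?thesis using near_mono[of N "Suc N"] by auto
      qed simp
      from this[of u] this[of v] sep[of u v] that \<open>u \<noteq> v\<close> show False by auto
    qed
    then have "card (Y - Y') \<le> 1"
      by (metis One_nat_def card.empty card_1_singleton_iff card_le_Suc0_iff_eq finite_Diff finY)
    moreover have "card Y' = card J" unfolding J_def using injJ by (simp add: card_image)
    moreover have "card (Y - Y') = card Y - card Y'"
      using finY unfolding Y'_def by (intro card_Diff_subset) auto
    ultimately show ?thesis by linarith
  qed
  moreover have "\<forall>(i, j)\<in>J. bx N (p ! i) \<in> Y \<and> p ! j \<notin> near N (p ! i)"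
    unfolding J_def using T I unfolding ex_def Y'_def by auto
  ultimately show ?thesis by blast
qed

lemma card_boxes_visited:
  fixes p :: "(int ^ 'd::finite) list"
  assumes "distinct p" "0 < N"
  shows "length p \<le> N ^ CARD('d) * card (bx N ` set p)"
proof -
  have "card (set p) \<le> card (\<Union>v\<in>bx N ` set p. {u. bx N u = v})"
    using assms(2) by (intro card_mono) auto
  also have "\<dots> \<le> (\<Sum>v\<in>bx N ` set p. card {u :: int ^ 'd. bx N u = v})"
    by (rule card_UN_le) simp
  also have "\<dots> = N ^ CARD('d) * card (bx N ` set p)"
    using assms(2) by (simp add: card_bx_fibre)
  finally show ?thesis using assms(1) by (simp add: distinct_card)
qed

lemma boxes_walk:
  assumes p: "sa_path p" and N: "0 < N"
  shows "\<exists>l. hd l = bx N (hd p) \<and> set l = bx N ` set p \<and> length l = 2 * card (bx N ` set p) - 1 \<and> l \<noteq> [] \<and>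
    successively (\<lambda>u v. v \<in> near 2 u) l"
proof -
  have "successively (\<lambda>u v. v \<in> near 2 u) (map (bx N) p)"
    unfolding successively_conv_nth using sa_path_edge[OF p] bx_adj[OF N] by auto
  moreover have "symp (\<lambda>u v. v \<in> near 2 u)" by (auto simp: symp_def near_sym)
  moreover have "p \<noteq> []" using p unfolding sa_path_def by simp
  ultimately show ?thesis
    using covering_walk[of "map (bx N) p" "\<lambda>u v. v \<in> near 2 u"] by (simp add: hd_map)
qed

section \<open>Excess of passage times over the minimal speed\<close>

text \<open>The set under the supremum is bounded because the sets \<open>{..<real n}\<close>
  exhaust the line, and it contains its supremum by continuity of measure from below.\<close>

lemma ess_inf_law_props:
  assumes "prob_space \<mu>" "sets \<mu> = sets borel" "measure \<mu> {0..} = 1"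
  shows "0 \<le> ess_inf_law \<mu>" "measure \<mu> {..<ess_inf_law \<mu>} = 0"
    and "0 < \<epsilon> \<Longrightarrow> 0 < measure \<mu> {0..ess_inf_law \<mu> + \<epsilon>}"
proof -
  interpret prob_space \<mu> by (rule assms(1))
  note [measurable_cong] = assms(2)
  have sets [simp]: "{..<a} \<in> sets \<mu>" "{..a} \<in> sets \<mu>" "{a..} \<in> sets \<mu>" "{a..b} \<in> sets \<mu>" for a b :: real
    using assms(2) by auto
  have space: "space \<mu> = UNIV" using sets_eq_imp_space_eq[OF assms(2)] by simp
  let ?S = "{a. measure \<mu> {..<a} = 0}"
  have "measure \<mu> {..<0} = 0"
  proof -
    have "UNIV - {0..} = {..<(0::real)}" by auto
    then show ?thesis using prob_compl[of "{0..}"] assms(3) space by simp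
  qed
  then have zero: "0 \<in> ?S" by simp
  have down: "b \<in> ?S" if "a \<in> ?S" "b \<le> a" for a b
  proof -
    have "measure \<mu> {..<b} \<le> measure \<mu> {..<a}" using that by (intro finite_measure_mono) auto
    then show ?thesis using that(1) by (simp add: measure_le_0_iff)
  qed
  have bdd: "bdd_above ?S"
  proof -
    have "(\<lambda>n. measure \<mu> {..<real n}) \<longlonglongrightarrow> measure \<mu> (\<Union>n. {..<real n})"
      by (rule finite_Lim_measure_incseq) (auto simp: incseq_def)
    moreover have "(\<Union>n. {..<real n}) = UNIV" using reals_Archimedean2 by auto
    ultimately have "(\<lambda>n. measure \<mu> {..<real n}) \<longlonglongrightarrow> 1" using prob_space space by simp
    then have "\<forall>\<^sub>F n in sequentially. 0 < measure \<mu> {..<real n}" by (rule order_tendstoD) simp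
    then obtain n where "0 < measure \<mu> {..<real n}" by (auto simp: eventually_sequentially)
    then have "a \<le> real n" if "a \<in> ?S" for a using down[OF that, of "real n"] by force
    then show ?thesis by (auto intro!: bdd_aboveI[of _ "real n"])
  qed
  show nonneg: "0 \<le> ess_inf_law \<mu>"
    unfolding ess_inf_law_def using zero bdd by (rule cSup_upper)
  define r where "r = ess_inf_law \<mu>"
  have below: "a \<in> ?S" if a: "a < r" for a
  proof -
    have "\<exists>b\<in>?S. a < b"
      using a zero bdd less_cSup_iff[of ?S a] unfolding r_def ess_inf_law_def by blast
    then show ?thesis using down by (meson less_imp_le)
  qed
  have "(\<lambda>n. measure \<mu> {..<r - 1 / Suc n}) \<longlonglongrightarrow> measure \<mu> (\<Union>n. {..<r - 1 / Suc n})"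
    by (rule finite_Lim_measure_incseq) (auto simp: incseq_def frac_le intro: order_less_le_trans)
  moreover have "(\<Union>n. {..<r - 1 / Suc n}) = {..<r}"
  proof safe
    fix x assume "x < r"
    then obtain n where "1 / Suc n < r - x" by (metis diff_gt_0_iff_gt nat_approx_posE)
    then show "x \<in> (\<Union>n. {..<r - 1 / Suc n})" by (auto intro!: exI[of _ n])
  next
    fix x and n :: nat assume "x < r - 1 / Suc n"
    moreover have "0 < 1 / real (Suc n)" by simp
    ultimately show "x < r" by linarith
  qed
  moreover have "measure \<mu> {..<r - 1 / Suc n} = 0" for n using below[of "r - 1 / Suc n"] by simp
  ultimately show "measure \<mu> {..<ess_inf_law \<mu>} = 0"
    unfolding r_def by (simp add: LIMSEQ_const_iff)
  assume e: "0 < \<epsilon>"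
  have "r + \<epsilon> \<notin> ?S"
  proof
    assume "r + \<epsilon> \<in> ?S"
    then have "r + \<epsilon> \<le> r" unfolding r_def ess_inf_law_def using bdd by (rule cSup_upper)
    with e show False by simp
  qed
  then have "0 < measure \<mu> {..<r + \<epsilon>}" using measure_nonneg[of \<mu> "{..<r + \<epsilon>}"] by (auto simp: less_le)
  also have "\<dots> \<le> measure \<mu> ({..<0} \<union> {0..r + \<epsilon>})" by (intro finite_measure_mono) auto
  also have "\<dots> \<le> measure \<mu> {..<0} + measure \<mu> {0..r + \<epsilon>}" by (intro measure_Un_le) auto
  finally show "0 < measure \<mu> {0..ess_inf_law \<mu> + \<epsilon>}"
    using \<open>measure \<mu> {..<0} = 0\<close> unfolding r_def by simp
qed

text \<open>Room above r: by right continuity the strict inequality of the standing assumption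
  survives for the edges of weight at most r + \<epsilon>, so edges of nearly minimal weight are
  still subcritical.\<close>

lemma distF_right_cont:
  assumes "prob_space \<mu>" "sets \<mu> = sets borel" "distF \<mu> r < c"
  shows "\<exists>\<delta>>0. \<forall>\<epsilon>. 0 < \<epsilon> \<longrightarrow> \<epsilon> \<le> \<delta> \<longrightarrow> measure \<mu> {..r + \<epsilon>} < c"
proof -
  interpret prob_space \<mu> by (rule assms(1))
  have sets [simp]: "{..a} \<in> sets \<mu>" for a :: real using assms(2) by auto
  have "(\<lambda>n. measure \<mu> {..r + 1 / Suc n}) \<longlonglongrightarrow> measure \<mu> (\<Inter>n. {..r + 1 / Suc n})"
    by (rule finite_Lim_measure_decseq) (auto simp: decseq_def frac_le intro: order_trans)
  moreover have "(\<Inter>n. {..r + 1 / Suc n}) = {..r}"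
  proof safe
    fix x assume x: "x \<in> (\<Inter>n. {..r + 1 / Suc n})"
    show "x \<le> r"
    proof (rule ccontr)
      assume "\<not> x \<le> r"
      then obtain n where "1 / Suc n < x - r" by (metis diff_gt_0_iff_gt nat_approx_posE not_le)
      moreover have "x \<le> r + 1 / Suc n" using x by auto
      ultimately show False by simp
    qed
  next
    fix x and n :: nat assume "x \<le> r"
    moreover have "0 < 1 / real (Suc n)" by simp
    ultimately show "x \<le> r + 1 / Suc n" by linarith
  qed
  ultimately have "\<forall>\<^sub>F n in sequentially. measure \<mu> {..r + 1 / Suc n} < c"
    using assms(3) unfolding distF_def by (auto intro: order_tendstoD)
  then obtain n where n: "measure \<mu> {..r + 1 / Suc n} < c" by (auto simp: eventually_sequentially)
  have "measure \<mu> {..r + \<epsilon>} < c" if "\<epsilon> \<le> 1 / Suc n" for \<epsilon>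
    using finite_measure_mono[of "{..r + \<epsilon>}" "{..r + 1 / Suc n}"] that n by auto
  then show ?thesis by (intro exI[of _ "1 / Suc n"]) auto
qed

text \<open>Merges the two cases of the standing assumption, so that the rest of the argument is
  uniform in r. For r = 0 the family is \<open>full_arcs\<close> alone; for r > 0 it consists of one
  oriented lattice per orthant, all equivalent under reflections.\<close>

lemma exists_arc_family:
  fixes \<mu> :: "real measure"
  assumes mu: "prob_space \<mu>" "sets \<mu> = sets borel" "measure \<mu> {0..} = 1"
    and std: "standing_assumption TYPE('d::finite) \<mu>"
  defines "r \<equiv> ess_inf_law \<mu>"
  shows "\<exists>(\<D> :: (int ^ 'd) rel set) (D0 :: (int ^ 'd) rel) t \<delta>. finite \<D> \<and> 0 < \<delta> \<and> (\<forall>D\<in>\<D>. D \<subseteq> full_arcs) \<and>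
    (\<forall>D\<in>\<D>. \<forall>u n p. bexp p (edges_at (near n u)) (\<lambda>A. of_bool (far D A n u)) = theta D0 n p) \<and>
    (\<forall>\<eta>>0. \<exists>N>0. real N ^ CARD('d) * theta D0 N (measure \<mu> {..t}) < \<eta>) \<and>
    (\<forall>w p i j N. (\<forall>e\<in>lattice_edges. r \<le> w e) \<longrightarrow> sa_path p \<longrightarrow> i \<le> j \<longrightarrow> j < length p \<longrightarrow>
       p ! j \<notin> near N (p ! i) \<longrightarrow> (\<forall>D\<in>\<D>. \<not> far D {e \<in> lattice_edges. w e \<le> t} N (p ! i)) \<longrightarrow>
       r * l1norm (p ! i - p ! j) + \<delta> \<le> seg_time w p i j)"
proof (cases "r = 0")
  case True
  then have "distF \<mu> 0 < bond_pc TYPE('d)" using std unfolding standing_assumption_def r_def by (simp add: Let_def)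
  from distF_right_cont[OF mu(1,2) this] obtain \<delta> where d: "0 < \<delta>" "measure \<mu> {..\<delta>} < bond_pc TYPE('d)" by auto
  show ?thesis
  proof (intro exI conjI)
    show "finite {full_arcs :: (int ^ 'd) rel}" "\<forall>D\<in>{full_arcs :: (int ^ 'd) rel}. D \<subseteq> full_arcs" "0 < \<delta>"
      using d by auto
    show "\<forall>D\<in>{full_arcs :: (int ^ 'd) rel}. \<forall>u n p. bexp p (edges_at (near n u)) (\<lambda>A. of_bool (far D A n u)) = theta (full_arcs :: (int ^ 'd) rel) n p"
      by (simp add: bexp_far_transl[OF full_arcs_props(2)])
    show "\<forall>\<eta>>0. \<exists>N>0. real N ^ CARD('d) * theta (full_arcs :: (int ^ 'd) rel) N (measure \<mu> {..\<delta>}) < \<eta>"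
      using subcritical_bond[OF _ d(2)] by auto
    show "\<forall>w p i j N. (\<forall>e\<in>lattice_edges. r \<le> w e) \<longrightarrow> sa_path p \<longrightarrow> i \<le> j \<longrightarrow> j < length p \<longrightarrow>
       p ! j \<notin> near N (p ! i) \<longrightarrow> (\<forall>D\<in>{full_arcs :: (int ^ 'd) rel}. \<not> far D {e \<in> lattice_edges. w e \<le> \<delta>} N (p ! i)) \<longrightarrow>
       r * l1norm (p ! i - p ! j) + \<delta> \<le> seg_time w p i j"
      unfolding True using crossing_excess_zero[where 'd = 'd] by simp
  qed
next
  case False
  then have r: "0 < r" using ess_inf_law_props(1)[OF mu] unfolding r_def by simp
  then have "distF \<mu> r < oriented_bond_pc TYPE('d)" using std unfolding standing_assumption_def r_def by (simp add: Let_def)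
  from distF_right_cont[OF mu(1,2) this] obtain \<delta>' where d': "0 < \<delta>'"
    "\<And>\<epsilon>. 0 < \<epsilon> \<Longrightarrow> \<epsilon> \<le> \<delta>' \<Longrightarrow> measure \<mu> {..r + \<epsilon>} < oriented_bond_pc TYPE('d)" by auto
  \<comment> \<open>An extra edge on a segment is worth only r, so \<delta> must not exceed
    r.\<close>
  define \<delta> where "\<delta> = min \<delta>' r"
  have d: "0 < \<delta>" "\<delta> \<le> r" "measure \<mu> {..r + \<delta>} < oriented_bond_pc TYPE('d)"
    using d' r unfolding \<delta>_def by auto
  show ?thesis
  proof (intro exI conjI)
    show "finite (dir_arcs ` signs :: (int ^ 'd) rel set)" "0 < \<delta>" using d by auto
    show "\<forall>D\<in>dir_arcs ` signs :: (int ^ 'd) rel set. D \<subseteq> full_arcs" using dir_arcs_props by auto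
    show "\<forall>D\<in>dir_arcs ` signs :: (int ^ 'd) rel set. \<forall>u n p. bexp p (edges_at (near n u)) (\<lambda>A. of_bool (far D A n u))
        = theta (dir_arcs (\<lambda>_. 1) :: (int ^ 'd) rel) n p"
    proof safe
      fix s :: "'d \<Rightarrow> int" and u :: "int ^ 'd" and n p assume s: "s \<in> signs"
      have ss: "s i * s i = 1" "\<bar>s i\<bar> = 1" for i using s unfolding signs_iff by (metis abs_minus_cancel abs_one empty_iff insertE minus_mult_minus mult_1)+
      have norm: "l1norm (signed s u x - signed s u y) = l1norm (x - y)" for x y
        unfolding l1norm_def signed_def by (simp add: right_diff_distrib[symmetric] abs_mult ss)
      have "bexp p (edges_at (near n (signed s u 0))) (\<lambda>A. of_bool (far (dir_arcs s) A n (signed s u 0)))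
          = bexp p (edges_at (near n 0)) (\<lambda>A. of_bool (far (dir_arcs (\<lambda>_. 1)) A n (0 :: int ^ 'd)))"
        using s norm ss by (intro bexp_far_signed)
          (auto simp: signs_iff dir_arcs_def signed_def distrib_left mult.assoc[symmetric])
      moreover have "signed s u 0 = u" by (simp add: signed_def vec_eq_iff)
      ultimately show "bexp p (edges_at (near n u)) (\<lambda>A. of_bool (far (dir_arcs s) A n u)) = theta (dir_arcs (\<lambda>_. 1) :: (int ^ 'd) rel) n p"
        unfolding theta_def by simp
    qed
    show "\<forall>\<eta>>0. \<exists>N>0. real N ^ CARD('d) * theta (dir_arcs (\<lambda>_. 1) :: (int ^ 'd) rel) N (measure \<mu> {..r + \<delta>}) < \<eta>"
      using subcritical_oriented[OF _ d(3)] by auto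
    show "\<forall>w p i j N. (\<forall>e\<in>lattice_edges. r \<le> w e) \<longrightarrow> sa_path p \<longrightarrow> i \<le> j \<longrightarrow> j < length p \<longrightarrow>
       p ! j \<notin> near N (p ! i) \<longrightarrow> (\<forall>D\<in>dir_arcs ` signs :: (int ^ 'd) rel set. \<not> far D {e \<in> lattice_edges. w e \<le> r + \<delta>} N (p ! i)) \<longrightarrow>
       r * l1norm (p ! i - p ! j) + \<delta> \<le> seg_time w p i j"
      using crossing_excess_pos[where 'd = 'd, OF _ _ _ _ _ r d(2)] by simp
  qed
qed

section \<open>Bad boxes and the Peierls estimate\<close>

definition bad :: "(int ^ 'd::finite) rel set \<Rightarrow> nat \<Rightarrow> int ^ 'd \<Rightarrow> (int ^ 'd) set set \<Rightarrow> bool" where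
  "bad \<D> N v A \<longleftrightarrow> (\<exists>u. bx N u = v \<and> (\<exists>D\<in>\<D>. far D A N u))"

text \<open>The edges on which badness of the box depends: finitely many, and disjoint from those of
  any other box in the same class modulo 4.\<close>

definition reg :: "nat \<Rightarrow> int ^ 'd::finite \<Rightarrow> (int ^ 'd) set set" where
  "reg N v = edges_at (\<Union>u\<in>{u. bx N u = v}. near N u)"

lemma finite_reg [simp]: "0 < N \<Longrightarrow> finite (reg N v)"
  unfolding reg_def by simp

lemma near_in_reg: "bx N u = v \<Longrightarrow> edges_at (near N u) \<subseteq> reg N v"
  unfolding reg_def edges_at_def by auto

lemma bad_local:
  assumes "\<And>D. D \<in> \<D> \<Longrightarrow> D \<subseteq> full_arcs" "reg N v \<subseteq> F"
  shows "bad \<D> N v A \<longleftrightarrow> bad \<D> N v (A \<inter> F)"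
proof -
  have "far D A N u \<longleftrightarrow> far D (A \<inter> F) N u" if "D \<in> \<D>" "bx N u = v" for D u
  proof -
    have "A \<inter> F \<inter> edges_at (near N u) = A \<inter> edges_at (near N u)"
      using near_in_reg[OF that(2)] assms(2) by auto
    then show ?thesis
      using far_local[OF assms(1)[OF that(1)], of A N u] far_local[OF assms(1)[OF that(1)], of "A \<inter> F" N u] by simp
  qed
  then show ?thesis unfolding bad_def by blast
qed

text \<open>Two balls can share an edge without sharing a vertex; this is why
  \<open>separated_boxes\<close> allows the margin \<open>Suc N\<close>.\<close>

lemma reg_disjoint:
  assumes N: "0 < N" and "mod4 v = mod4 v'" "v \<noteq> v'"
  shows "reg N v \<inter> reg N v' = {}"
proof (rule ccontr)
  assume "reg N v \<inter> reg N v' \<noteq> {}"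
  then obtain e where e: "e \<in> reg N v" "e \<in> reg N v'" by auto
  obtain x u where x: "x \<in> e" "bx N u = v" "x \<in> near N u" using e(1) unfolding reg_def edges_at_def by blast
  obtain y u' where y: "y \<in> e" "bx N u' = v'" "y \<in> near N u'" using e(2) unfolding reg_def edges_at_def by blast
  have "e \<in> lattice_edges" using e(1) unfolding reg_def edges_at_def by simp
  then have "x = y \<or> l1norm (y - x) = 1"
    using x(1) y(1) by (elim lattice_edgeE) (auto simp: l1norm_minus_commute)
  then have "x \<in> near 2 y" using edge_near by auto
  then have "x \<in> near (Suc 1) y" by (simp add: numeral_2_eq_2)
  with y(3) N have "x \<in> near (Suc N) u'" using near_trans[of y "N - 1" u' x 1] by simp
  moreover have "x \<in> near (Suc N) u" using x(3) near_mono[of N "Suc N"] by auto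
  moreover have "near (Suc N) u \<inter> near (Suc N) u' = {}"
    using assms x(2) y(2) by (intro separated_boxes) (auto simp: mod4_def vec_eq_iff)
  ultimately show False by auto
qed

text \<open>A union bound over the N^d starting points in the box and over the arc relations of the
  family.\<close>

lemma bexp_bad_le:
  fixes \<D> :: "(int ^ 'd::finite) rel set"
  assumes N: "0 < N" and p: "0 \<le> p" "p \<le> 1" and fin: "finite \<D>"
    and th: "\<And>D u. D \<in> \<D> \<Longrightarrow> bexp p (edges_at (near N u)) (\<lambda>A. of_bool (far D A N u)) = th"
    and D: "\<And>D. D \<in> \<D> \<Longrightarrow> D \<subseteq> full_arcs"
  shows "bexp p (reg N v) (\<lambda>A. of_bool (bad \<D> N v A)) \<le> real N ^ CARD('d) * (real (card \<D>) * th)"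
proof -
  have "bexp p (reg N v) (\<lambda>A. of_bool (bad \<D> N v A))
      \<le> bexp p (reg N v) (\<lambda>A. \<Sum>u\<in>{u. bx N u = v}. \<Sum>D\<in>\<D>. of_bool (far D A N u))"
  proof (rule bexp_mono)
    fix A
    show "of_bool (bad \<D> N v A) \<le> (\<Sum>u\<in>{u. bx N u = v}. \<Sum>D\<in>\<D>. of_bool (far D A N u) :: real)"
    proof (cases "bad \<D> N v A")
      case True
      then obtain u D where u: "bx N u = v" "D \<in> \<D>" "far D A N u" unfolding bad_def by auto
      have "1 = (of_bool (far D A N u) :: real)" using u by simp
      also have "\<dots> \<le> (\<Sum>D\<in>\<D>. of_bool (far D A N u))" using u fin by (intro member_le_sum) auto
      also have "\<dots> \<le> (\<Sum>u\<in>{u. bx N u = v}. \<Sum>D\<in>\<D>. of_bool (far D A N u))"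
        using u N by (intro member_le_sum[of u _ "\<lambda>u. \<Sum>D\<in>\<D>. of_bool (far D A N u)"]) (auto intro: sum_nonneg)
      finally show ?thesis using True by simp
    qed (simp add: sum_nonneg)
  qed (use p in auto)
  also have "\<dots> = (\<Sum>u\<in>{u. bx N u = v}. \<Sum>D\<in>\<D>. bexp p (reg N v) (\<lambda>A. of_bool (far D A N u)))"
    by (simp only: bexp_sum)
  also have "\<dots> = (\<Sum>u\<in>{u. bx N u = v}. \<Sum>D\<in>\<D>. th)"
  proof (intro sum.cong refl)
    fix u D assume u: "u \<in> {u. bx N u = v}" and DD: "D \<in> \<D>"
    have "bexp p (reg N v) (\<lambda>A. of_bool (far D A N u)) = bexp p (edges_at (near N u)) (\<lambda>A. of_bool (far D A N u))"
      using N u near_in_reg[of N u v] far_local[OF D[OF DD]] by (intro bexp_marginal) auto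
    then show "bexp p (reg N v) (\<lambda>A. of_bool (far D A N u)) = th" using th[OF DD] by simp
  qed
  also have "\<dots> = real N ^ CARD('d) * (real (card \<D>) * th)"
    using card_bx_fibre[OF N, of v] by simp
  finally show ?thesis .
qed

text \<open>Some class modulo 4 contains a fraction at least 4^(-d) of Z, and its boxes are
  independent. The exponent 2 * 4^d in the hypothesis converts this fraction, together with k \<le>
  2 |Z|, back into \<zeta>^k.\<close>

lemma all_bad_le:
  fixes \<D> :: "(int ^ 'd::finite) rel set" and \<mu> :: "real measure"
  assumes mu: "prob_space \<mu>" "sets \<mu> = sets borel" and N: "0 < N"
    and D: "\<And>D. D \<in> \<D> \<Longrightarrow> D \<subseteq> full_arcs"
    and eta: "\<And>v. bexp (measure \<mu> {..t}) (reg N v) (\<lambda>A. of_bool (bad \<D> N v A)) \<le> \<zeta> ^ (2 * 4 ^ CARD('d))"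
    and zeta: "0 \<le> \<zeta>" "\<zeta> \<le> 1" and Z: "finite Z" "k \<le> 2 * card Z"
  defines "X \<equiv> {w \<in> space (fpp_space \<mu>). \<forall>v\<in>Z. bad \<D> N v {e \<in> lattice_edges. w e \<le> t}}"
  shows "X \<in> sets (fpp_space \<mu>)" "measure (fpp_space \<mu>) X \<le> \<zeta> ^ k"
proof -
  interpret mu: prob_space \<mu> by (rule mu(1))
  have tset: "{..t} \<in> sets \<mu>" using mu(2) by simp
  let ?E = "\<lambda>Z. \<Union>v\<in>Z. reg N v"
  let ?p = "measure \<mu> {..t}"
  have Xeq: "{w \<in> space (fpp_space \<mu>). \<forall>v\<in>Z. bad \<D> N v {e \<in> lattice_edges. w e \<le> t}}
     = {w \<in> space (fpp_space \<mu>). \<forall>v\<in>Z. bad \<D> N v {e \<in> ?E Z. w e \<in> {..t}}}" for Z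
  proof -
    have "bad \<D> N v {e \<in> lattice_edges. w e \<le> t} \<longleftrightarrow> bad \<D> N v {e \<in> ?E Z. w e \<in> {..t}}" if "v \<in> Z" for v w
    proof -
      have "{e \<in> lattice_edges. w e \<le> t} \<inter> ?E Z = {e \<in> ?E Z. w e \<in> {..t}}"
        unfolding reg_def edges_at_def by auto
      moreover have "reg N v \<subseteq> ?E Z" using that by auto
      ultimately show ?thesis using bad_local[of \<D> N v "?E Z" "{e \<in> lattice_edges. w e \<le> t}"] D by simp
    qed
    then show ?thesis by auto
  qed
  have E: "finite (?E Z)" "?E Z \<subseteq> lattice_edges" if "finite Z" for Z
    using that N by (simp, auto simp: reg_def edges_at_def)
  show Xs: "X \<in> sets (fpp_space \<mu>)"
    unfolding X_def Xeq unfolding fpp_space_def using E[OF Z(1)] by (intro measure_PiM_pattern(1)[OF mu(1) tset]) auto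
  obtain Y where Y: "Y \<subseteq> Z" "card Z \<le> 4 ^ CARD('d) * card Y" "\<forall>u\<in>Y. \<forall>v\<in>Y. mod4 u = mod4 v"
    using mod4_class[OF Z(1)] by auto
  have finY: "finite Y" using Y(1) Z(1) finite_subset by auto
  interpret P: prob_space "fpp_space \<mu> :: ((int ^ 'd) set \<Rightarrow> real) measure"
    unfolding fpp_space_def by (intro prob_space_PiM mu(1))
  have "measure (fpp_space \<mu>) X \<le> measure (fpp_space \<mu>) {w \<in> space (fpp_space \<mu>). \<forall>v\<in>Y. bad \<D> N v {e \<in> ?E Y. w e \<in> {..t}}}"
  proof (rule P.finite_measure_mono)
    show "X \<subseteq> {w \<in> space (fpp_space \<mu>). \<forall>v\<in>Y. bad \<D> N v {e \<in> ?E Y. w e \<in> {..t}}}"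
      unfolding Xeq[of Y, symmetric] X_def using Y(1) by auto
    show "{w \<in> space (fpp_space \<mu>). \<forall>v\<in>Y. bad \<D> N v {e \<in> ?E Y. w e \<in> {..t}}} \<in> P.events"
      unfolding fpp_space_def using E[OF finY] by (intro measure_PiM_pattern(1)[OF mu(1) tset]) auto
  qed
  also have "\<dots> = bexp ?p (?E Y) (\<lambda>A. of_bool (\<forall>v\<in>Y. bad \<D> N v A))"
    unfolding fpp_space_def using E[OF finY] by (intro measure_PiM_pattern(2)[OF mu(1) tset]) auto
  also have "\<dots> = bexp ?p (?E Y) (\<lambda>A. \<Prod>v\<in>Y. of_bool (bad \<D> N v A))"
  proof (rule bexp_cong)
    fix A
    show "of_bool (\<forall>v\<in>Y. bad \<D> N v A) = (\<Prod>v\<in>Y. of_bool (bad \<D> N v A) :: real)"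
      using finY by (induction Y rule: finite_induct) auto
  qed
  also have "\<dots> = (\<Prod>v\<in>Y. bexp ?p (reg N v) (\<lambda>A. of_bool (bad \<D> N v A)))"
  proof (rule bexp_prod[OF finY E(1)[OF finY]])
    show "reg N v \<subseteq> ?E Y" if "v \<in> Y" for v using that by blast
    show "reg N u \<inter> reg N v = {}" if "u \<in> Y" "v \<in> Y" "u \<noteq> v" for u v
      using Y(3)[rule_format, OF that(1,2)] that(3) by (rule reg_disjoint[OF N])
    show "(of_bool (bad \<D> N v A) :: real) = of_bool (bad \<D> N v (A \<inter> reg N v))" for v A
      by (rule arg_cong[where f = of_bool], rule bad_local[OF D]) auto
  qed
  also have "\<dots> \<le> (\<Prod>v\<in>Y. \<zeta> ^ (2 * 4 ^ CARD('d)))"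
    using eta by (intro prod_mono) (auto intro!: bexp_nonneg)
  also have "\<dots> = \<zeta> ^ (2 * 4 ^ CARD('d) * card Y)"
    by (simp add: power_mult)
  also have "\<dots> \<le> \<zeta> ^ k"
    using zeta Z(2) Y(2) by (intro power_decreasing) auto
  finally show "measure (fpp_space \<mu>) X \<le> \<zeta> ^ k" .
qed

text \<open>For k + 1 distinct boxes there are at most 16^(d k) covering walks and 2^(k + 1) choices
  of a bad subset. With \<zeta> = 1 / (32 * 16^d) the union bound leaves (1/16)^(k + 1), and the sum
  over k is 1/15.\<close>

lemma peierls_boxes:
  fixes \<D> :: "(int ^ 'd::finite) rel set" and \<mu> :: "real measure"
  assumes mu: "prob_space \<mu>" "sets \<mu> = sets borel" and N: "0 < N"
    and D: "\<And>D. D \<in> \<D> \<Longrightarrow> D \<subseteq> full_arcs"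
    and eta: "\<And>v. bexp (measure \<mu> {..t}) (reg N v) (\<lambda>A. of_bool (bad \<D> N v A)) \<le> (1 / (32 * 16 ^ CARD('d))) ^ (2 * 4 ^ CARD('d))"
  shows "\<exists>F\<in>sets (fpp_space \<mu>). measure (fpp_space \<mu>) F \<le> 1 / 4 \<and>
    (\<forall>w\<in>space (fpp_space \<mu>) - F. \<forall>l. l \<noteq> [] \<longrightarrow> hd l = 0 \<longrightarrow> successively (\<lambda>u v. v \<in> near 2 u) l \<longrightarrow>
      length l = 2 * card (set l) - 1 \<longrightarrow>
      2 * card {v \<in> set l. bad \<D> N v {e \<in> lattice_edges. w e \<le> t}} < card (set l))"
proof -
  let ?P = "fpp_space \<mu> :: ((int ^ 'd) set \<Rightarrow> real) measure"
  interpret P: prob_space ?P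
    unfolding fpp_space_def by (intro prob_space_PiM mu(1))
  define \<zeta> :: real where "\<zeta> = 1 / (32 * 16 ^ CARD('d))"
  have zeta: "0 \<le> \<zeta>" "\<zeta> \<le> 1"
  proof -
    have "1 \<le> (16::real) ^ CARD('d)" by (rule one_le_power) simp
    then have "1 \<le> 32 * (16::real) ^ CARD('d)" by linarith
    then show "0 \<le> \<zeta>" "\<zeta> \<le> 1" unfolding \<zeta>_def by (auto simp: divide_simps)
  qed
  define X where "X Z = {w \<in> space ?P. \<forall>v\<in>Z. bad \<D> N v {e \<in> lattice_edges. w e \<le> t}}" for Z
  note X = all_bad_le[OF mu N D eta[folded \<zeta>_def] zeta, folded X_def]
  define W where "W k = {l :: (int ^ 'd) list. length l = Suc (2 * k) \<and> hd l = 0 \<and> successively (\<lambda>u v. v \<in> near 2 u) l}" for k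
  define I where "I k = (SIGMA l : {l \<in> W k. card (set l) = Suc k}. {Z \<in> Pow (set l). Suc k \<le> 2 * card Z})" for k
  have "card {v. v \<in> near 2 (u :: int ^ 'd)} \<le> 4 ^ CARD('d)" for u using card_near_le[of 2 u] by simp
  then have W: "finite (W k)" "card (W k) \<le> (4 ^ CARD('d)) ^ (2 * k)" for k
    unfolding W_def using card_walks_le[of "\<lambda>u v. v \<in> near 2 u" "4 ^ CARD('d)" "2 * k" "0 :: int ^ 'd"] by auto
  have I: "finite (I k)" "card (I k) \<le> (16 ^ CARD('d)) ^ k * 2 ^ Suc k" for k
  proof -
    have Zs: "card {Z \<in> Pow (set l). Suc k \<le> 2 * card Z} \<le> 2 ^ Suc k" if "card (set l) = Suc k" for l :: "(int ^ 'd) list"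
      using card_mono[of "Pow (set l)" "{Z \<in> Pow (set l). Suc k \<le> 2 * card Z}"] that
      by (auto simp: card_Pow)
    show "finite (I k)" unfolding I_def using W(1)[of k] by (intro finite_SigmaI) auto
    have "card (I k) = (\<Sum>l\<in>{l \<in> W k. card (set l) = Suc k}. card {Z \<in> Pow (set l). Suc k \<le> 2 * card Z})"
      unfolding I_def using W(1)[of k] by (subst card_SigmaI) auto
    also have "\<dots> \<le> (\<Sum>l\<in>{l \<in> W k. card (set l) = Suc k}. 2 ^ Suc k)"
      using Zs by (intro sum_mono) auto
    also have "\<dots> \<le> card (W k) * 2 ^ Suc k"
      using W(1)[of k] by (auto intro!: card_mono)
    also have "\<dots> \<le> (4 ^ CARD('d)) ^ (2 * k) * 2 ^ Suc k" using W(2)[of k] by simp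
    also have "(4 ^ CARD('d)) ^ (2 * k) = (((4 :: nat) ^ 2) ^ CARD('d)) ^ k"
      unfolding power_mult[symmetric] by (simp only: mult_ac)
    also have "4 ^ 2 = (16 :: nat)" by simp
    finally show "card (I k) \<le> (16 ^ CARD('d)) ^ k * 2 ^ Suc k" .
  qed
  define F where "F k = (\<Union>(l, Z)\<in>I k. X Z)" for k
  have IZ: "finite Z" "Suc k \<le> 2 * card Z" if "(l, Z) \<in> I k" for l Z k
    using that unfolding I_def by (auto intro: finite_subset)
  have Fs: "F k \<in> sets ?P" for k
    unfolding F_def using I(1) IZ by (intro sets.finite_UN) (auto intro!: X(1))
  have Fm: "measure ?P (F k) \<le> (1 / 16) ^ Suc k" for k
  proof -
    have "measure ?P (F k) \<le> (\<Sum>z\<in>I k. measure ?P (case z of (l, Z) \<Rightarrow> X Z))"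
      unfolding F_def using I(1) IZ by (intro measure_UNION_le) (auto intro!: X(1))
    also have "\<dots> \<le> (\<Sum>z\<in>I k. \<zeta> ^ Suc k)"
    proof (rule sum_mono)
      fix z assume "z \<in> I k"
      then show "measure ?P (case z of (l, Z) \<Rightarrow> X Z) \<le> \<zeta> ^ Suc k"
        using IZ[of "fst z" "snd z" k] by (auto simp: case_prod_beta' simp del: power_Suc intro!: X(2))
    qed
    also have "\<dots> = real (card (I k)) * \<zeta> ^ Suc k" by simp
    also have "\<dots> \<le> real ((16 ^ CARD('d)) ^ k * 2 ^ Suc k) * \<zeta> ^ Suc k"
      using I(2)[of k] zeta by (intro mult_right_mono) (auto simp only: of_nat_le_iff zero_le_power)
    also have "\<dots> \<le> real ((16 ^ CARD('d)) ^ Suc k * 2 ^ Suc k) * \<zeta> ^ Suc k"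
      using zeta by (intro mult_right_mono) (auto simp only: of_nat_le_iff zero_le_power intro!: mult_right_mono power_increasing one_le_power)
    also have "\<dots> = (16 ^ CARD('d) * 2 * \<zeta>) ^ Suc k" by (simp add: power_mult_distrib)
    also have "16 ^ CARD('d) * 2 * \<zeta> = 1 / 16" unfolding \<zeta>_def by (simp add: field_simps)
    finally show ?thesis .
  qed
  have sm: "(\<lambda>k. (1 / 16 :: real) ^ Suc k) sums (1 / 16 * (1 / (1 - 1 / 16)))"
    using sums_mult[OF geometric_sums[of "1 / 16 :: real"], of "1 / 16"] by simp
  have summ: "summable (\<lambda>k. measure ?P (F k))"
    using Fm by (intro summable_comparison_test'[OF sums_summable[OF sm]]) auto
  have "measure ?P (\<Union>k. F k) \<le> (\<Sum>k. measure ?P (F k))"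
    using Fs by (intro P.finite_measure_subadditive_countably summ) auto
  also have "\<dots> \<le> (\<Sum>k. (1 / 16) ^ Suc k)"
    using Fm by (intro suminf_le summ sums_summable[OF sm])
  also have "\<dots> \<le> 1 / 4" using sums_unique[OF sm] by simp
  finally have meas: "measure ?P (\<Union>k. F k) \<le> 1 / 4" .
  show ?thesis
  proof (intro bexI[of _ "\<Union>k. F k"] conjI meas ballI allI impI)
    show "(\<Union>k. F k) \<in> sets ?P" using Fs by auto
    fix w l
    assume w: "w \<in> space ?P - (\<Union>k. F k)" and l: "l \<noteq> []" "hd l = (0 :: int ^ 'd)"
      "successively (\<lambda>u v. v \<in> near 2 u) l" "length l = 2 * card (set l) - 1"
    have "card (set l) \<noteq> 0" using l(1) by simp
    then obtain k where k: "card (set l) = Suc k" using not0_implies_Suc by blast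
    let ?Z = "{v \<in> set l. bad \<D> N v {e \<in> lattice_edges. w e \<le> t}}"
    show "2 * card ?Z < card (set l)"
    proof (rule ccontr)
      assume "\<not> 2 * card ?Z < card (set l)"
      then have "(l, ?Z) \<in> I k" using l k unfolding I_def W_def by auto
      moreover have "w \<in> X ?Z" using w unfolding X_def by auto
      ultimately have "w \<in> F k" unfolding F_def by auto
      then show False using w by auto
    qed
  qed
qed

text \<open>More than half of the boxes visited are not bad, and one class modulo 4 of these
  supplies disjoint crossings, each with excess \<delta>. A self-avoiding path spends at most N^d
  vertices per box, so the number of crossings is proportional to its length.\<close>

lemma many_excess_segments:
  fixes \<mu> :: "real measure"
  assumes mu: "prob_space \<mu>" "sets \<mu> = sets borel" "measure \<mu> {0..} = 1"
    and std: "standing_assumption TYPE('d::finite) \<mu>"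
  defines "r \<equiv> ess_inf_law \<mu>"
  shows "\<exists>\<kappa> \<delta>. 0 < \<kappa> \<and> 0 < \<delta> \<and> (\<exists>G\<in>sets (fpp_space \<mu>). 3 / 4 \<le> measure (fpp_space \<mu>) G \<and>
    (\<forall>w\<in>G. (\<forall>e\<in>lattice_edges. r \<le> w e) \<and>
      (\<forall>p :: (int ^ 'd) list. sa_path p \<longrightarrow> hd p = 0 \<longrightarrow> 1 \<le> \<kappa> * real (length p - 1) \<longrightarrow>
        (\<exists>J. disjoint_segs p J \<and> \<kappa> * real (length p - 1) \<le> real (card J) \<and>
          (\<forall>(i, j)\<in>J. r * l1norm (p ! i - p ! j) + \<delta> \<le> seg_time w p i j)))))"
proof -
  interpret mu: prob_space \<mu> by (rule mu(1))
  let ?P = "fpp_space \<mu> :: ((int ^ 'd) set \<Rightarrow> real) measure"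
  interpret P: product_prob_space "\<lambda>_. \<mu>" "lattice_edges :: (int ^ 'd) set set" by unfold_locales
  interpret P': prob_space ?P unfolding fpp_space_def by (rule P.P.prob_space_axioms)
  obtain \<D> :: "(int ^ 'd) rel set" and D0 :: "(int ^ 'd) rel" and t \<delta> where fam0: "finite \<D>" "0 < \<delta>" "\<forall>D\<in>\<D>. D \<subseteq> full_arcs"
    "\<forall>D\<in>\<D>. \<forall>u n p. bexp p (edges_at (near n u)) (\<lambda>A. of_bool (far D A n u)) = theta D0 n p"
    "\<forall>\<eta>>0. \<exists>N>0. real N ^ CARD('d) * theta D0 N (measure \<mu> {..t}) < \<eta>"
    "\<forall>w p i j N. (\<forall>e\<in>lattice_edges. r \<le> w e) \<longrightarrow> sa_path p \<longrightarrow> i \<le> j \<longrightarrow> j < length p \<longrightarrow>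
       p ! j \<notin> near N (p ! i) \<longrightarrow> (\<forall>D\<in>\<D>. \<not> far D {e \<in> lattice_edges. w e \<le> t} N (p ! i)) \<longrightarrow>
       r * l1norm (p ! i - p ! j) + \<delta> \<le> seg_time w p i j"
    using exists_arc_family[OF mu std, folded r_def] by (elim exE conjE) (rule that)
  note fam = fam0(1,2) fam0(3)[rule_format] fam0(4)[rule_format] fam0(5)[rule_format] fam0(6)[rule_format]
  define \<eta> :: real where "\<eta> = (1 / (32 * 16 ^ CARD('d))) ^ (2 * 4 ^ CARD('d))"
  have "0 < \<eta> / (real (card \<D>) + 1)" unfolding \<eta>_def by simp
  from fam(5)[OF this] obtain N where N: "0 < N" "real N ^ CARD('d) * theta D0 N (measure \<mu> {..t}) < \<eta> / (real (card \<D>) + 1)" by auto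
  have th0: "0 \<le> theta D0 N (measure \<mu> {..t})" by (intro theta_bounds) auto
  have bad_small: "bexp (measure \<mu> {..t}) (reg N v) (\<lambda>A. of_bool (bad \<D> N v A)) \<le> \<eta>" for v
  proof -
    have "bexp (measure \<mu> {..t}) (reg N v) (\<lambda>A. of_bool (bad \<D> N v A))
        \<le> real N ^ CARD('d) * (real (card \<D>) * theta D0 N (measure \<mu> {..t}))"
      by (rule bexp_bad_le[OF N(1) _ _ fam(1) fam(4) fam(3)]) auto
    also have "\<dots> \<le> (real N ^ CARD('d) * theta D0 N (measure \<mu> {..t})) * (real (card \<D>) + 1)"
      using th0 by (simp add: algebra_simps)
    also have "\<dots> \<le> \<eta>" using N(2) by (simp add: field_simps)
    finally show ?thesis .
  qed
  obtain F where F: "F \<in> sets ?P" "measure ?P F \<le> 1 / 4"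
    "\<forall>w\<in>space ?P - F. \<forall>l. l \<noteq> [] \<longrightarrow> hd l = 0 \<longrightarrow> successively (\<lambda>u v. v \<in> near 2 u) l \<longrightarrow>
      length l = 2 * card (set l) - 1 \<longrightarrow>
      2 * card {v \<in> set l. bad \<D> N v {e \<in> lattice_edges. w e \<le> t}} < card (set l)"
    using peierls_boxes[OF mu(1,2) N(1) fam(3) bad_small[unfolded \<eta>_def]] by blast
  define R where "R = {w \<in> space ?P. \<forall>e\<in>lattice_edges. r \<le> w e}"
  have Rs: "R \<in> sets ?P"
    unfolding R_def fpp_space_def using mu(2)
    by (intro sets.sets_Collect_countable_All' countable_lattice_edges sets_Collect_single')
      (use sets_eq_imp_space_eq[OF mu(2)] in \<open>simp_all add: mu(2) atLeast_def[symmetric]\<close>)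
  have Rm: "measure ?P R = 1"
  proof -
    have ae: "AE x in \<mu>. r \<le> x"
    proof (rule AE_I)
      show "{x \<in> space \<mu>. \<not> r \<le> x} \<subseteq> {..<r}" by auto
      show "emeasure \<mu> {..<r} = 0" using ess_inf_law_props(2)[OF mu] by (simp add: mu.emeasure_eq_measure r_def)
    qed (simp add: mu(2))
    have "AE w in ?P. \<forall>e\<in>lattice_edges. r \<le> w e"
      unfolding AE_ball_countable[OF countable_lattice_edges] fpp_space_def
      using P.AE_component[OF _ ae] by auto
    then show ?thesis using Rs unfolding R_def by (subst P'.prob_Collect_eq_1) auto
  qed
  define G where "G = R - F"
  have Gm: "3 / 4 \<le> measure ?P G"
  proof -
    have "1 \<le> measure ?P (G \<union> F)"
      unfolding Rm[symmetric] G_def using Rs F(1) by (intro P'.finite_measure_mono) auto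
    also have "\<dots> \<le> measure ?P G + measure ?P F"
      using Rs F(1) unfolding G_def by (intro measure_Un_le) auto
    finally show ?thesis using F(2) by simp
  qed
  define K where "K = N ^ CARD('d) * 4 ^ CARD('d)"
  have K: "0 < K" unfolding K_def using N(1) by simp
  have key: "\<exists>J. disjoint_segs p J \<and> 1 / (4 * real K) * real (length p - 1) \<le> real (card J) \<and>
      (\<forall>(i, j)\<in>J. r * l1norm (p ! i - p ! j) + \<delta> \<le> seg_time w p i j)"
    if w: "w \<in> G" and p: "sa_path p" "hd p = 0" and long: "1 \<le> 1 / (4 * real K) * real (length p - 1)"
    for w and p :: "(int ^ 'd) list"
  proof -
    let ?A = "{e \<in> lattice_edges. w e \<le> t}" and ?W = "bx N ` set p"
    obtain l where l: "hd l = bx N (hd p)" "set l = ?W" "length l = 2 * card ?W - 1" "l \<noteq> []"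
      "successively (\<lambda>u v. v \<in> near 2 u) l"
      using boxes_walk[OF p(1) N(1)] by blast
    have "bx N 0 = 0" by (simp add: bx_def vec_eq_iff)
    then have badc: "2 * card {v \<in> ?W. bad \<D> N v ?A} < card ?W"
      using F(3)[rule_format, of w l] l p(2) w unfolding G_def R_def by simp
    let ?good = "{v \<in> ?W. \<not> bad \<D> N v ?A}"
    have "card ?W = card {v \<in> ?W. bad \<D> N v ?A} + card ?good"
      by (subst card_Un_disjoint[symmetric]) (auto intro!: arg_cong[where f = card])
    with badc have good: "card ?W < 2 * card ?good" by linarith
    obtain Y where Y: "Y \<subseteq> ?good" "card ?good \<le> 4 ^ CARD('d) * card Y" "\<forall>u\<in>Y. \<forall>v\<in>Y. mod4 u = mod4 v"
      using mod4_class[of ?good] by auto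
    obtain J where J: "disjoint_segs p J" "card Y \<le> card J + 1" "\<forall>(i, j)\<in>J. bx N (p ! i) \<in> Y \<and> p ! j \<notin> near N (p ! i)"
      using disjoint_crossings[OF p(1) N(1), of Y] Y by blast
    have "length p \<le> N ^ CARD('d) * card ?W"
      using card_boxes_visited[of p N] p(1) N(1) unfolding sa_path_def by blast
    also have "\<dots> \<le> N ^ CARD('d) * (2 * (4 ^ CARD('d) * card Y))"
      using good Y(2) by (intro mult_left_mono) auto
    also have "\<dots> = 2 * K * card Y" unfolding K_def by (simp add: mult_ac)
    finally have "length p - 1 \<le> 2 * K * card Y" by simp
    then have "real (length p - 1) \<le> real (2 * K * card Y)" by (rule of_nat_mono)
    also have "\<dots> = 2 * real K * real (card Y)" by simp
    also have "\<dots> \<le> 2 * real K * (real (card J) + 1)"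
      using J(2) by (intro mult_left_mono) auto
    finally have "real (length p - 1) / (2 * real K) \<le> real (card J) + 1"
      using K by (simp add: field_simps)
    \<comment> \<open>The lower bound on the length absorbs the + 1: x \<le> |J| + 1 and x \<ge> 2
      give x / 2 \<le> |J|, which turns 1 / (2 K) into 1 / (4 K).\<close>
    then have cJ: "1 / (4 * real K) * real (length p - 1) \<le> real (card J)"
    proof -
      have "real (length p - 1) / (2 * real K) = 2 * (1 / (4 * real K) * real (length p - 1))" by simp
      with long \<open>real (length p - 1) / (2 * real K) \<le> real (card J) + 1\<close> show ?thesis by linarith
    qed
    have "r * l1norm (p ! i - p ! j) + \<delta> \<le> seg_time w p i j" if ij: "(i, j) \<in> J" for i j
    proof -
      have "i < j" "j < length p" using J(1) ij unfolding disjoint_segs_def by auto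
      moreover have "p ! j \<notin> near N (p ! i)" "\<not> bad \<D> N (bx N (p ! i)) ?A" using J(3) ij Y(1) by auto
      ultimately show ?thesis
        using w p(1) unfolding G_def R_def bad_def by (intro fam(6)) auto
    qed
    with J(1) cJ show ?thesis by auto
  qed
  have "\<forall>w\<in>G. (\<forall>e\<in>lattice_edges. r \<le> w e) \<and>
      (\<forall>p :: (int ^ 'd) list. sa_path p \<longrightarrow> hd p = 0 \<longrightarrow> 1 \<le> 1 / (4 * real K) * real (length p - 1) \<longrightarrow>
        (\<exists>J. disjoint_segs p J \<and> 1 / (4 * real K) * real (length p - 1) \<le> real (card J) \<and>
          (\<forall>(i, j)\<in>J. r * l1norm (p ! i - p ! j) + \<delta> \<le> seg_time w p i j)))"
  proof (intro ballI conjI allI impI)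
    show "r \<le> w e" if "w \<in> G" "e \<in> lattice_edges" for w e
      using that unfolding G_def R_def by auto
  qed (rule key)
  moreover have "0 < 1 / (4 * real K)" "G \<in> sets ?P" using K Rs F(1) unfolding G_def by auto
  ultimately have "0 < 1 / (4 * real K) \<and> 0 < \<delta> \<and> (\<exists>G\<in>sets ?P. 3 / 4 \<le> measure ?P G \<and>
    (\<forall>w\<in>G. (\<forall>e\<in>lattice_edges. r \<le> w e) \<and>
      (\<forall>p :: (int ^ 'd) list. sa_path p \<longrightarrow> hd p = 0 \<longrightarrow> 1 \<le> 1 / (4 * real K) * real (length p - 1) \<longrightarrow>
        (\<exists>J. disjoint_segs p J \<and> 1 / (4 * real K) * real (length p - 1) \<le> real (card J) \<and>
          (\<forall>(i, j)\<in>J. r * l1norm (p ! i - p ! j) + \<delta> \<le> seg_time w p i j)))))"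
    by (intro conjI bexI[of _ G] fam(2) Gm)
  then show ?thesis by (intro exI)
qed

section \<open>Cuts of the quadrant and chemical distance\<close>

text \<open>Loop erasure: if the new first vertex already occurs in the list, restart at that
  occurrence.\<close>

lemma relpow_distinct_list:
  assumes "(x, y) \<in> R ^^ k"
  shows "\<exists>l. l \<noteq> [] \<and> hd l = x \<and> last l = y \<and> distinct l \<and> successively (\<lambda>u v. (u, v) \<in> R) l \<and> length l \<le> Suc k"
  using assms
proof (induction k arbitrary: x)
  case 0
  then show ?case by (intro exI[of _ "[x]"]) auto
next
  case (Suc k)
  then obtain z where z: "(x, z) \<in> R" "(z, y) \<in> R ^^ k" by (meson relpow_Suc_E2)
  from Suc.IH[OF z(2)] obtain l where l: "l \<noteq> []" "hd l = z" "last l = y" "distinct l"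
    "successively (\<lambda>u v. (u, v) \<in> R) l" "length l \<le> Suc k" by auto
  show ?case
  proof (cases "x \<in> set l")
    case True
    then obtain l1 l2 where "l = l1 @ x # l2" by (meson split_list)
    then show ?thesis
      using l by (intro exI[of _ "x # l2"]) (auto simp: successively_append_iff)
  next
    case False
    then show ?thesis
      using l z(1) by (intro exI[of _ "x # l"]) (auto simp: successively_Cons)
  qed
qed

section \<open>Edges, faces and cuts of the quadrant\<close>

type_synonym qedge = "(nat \<times> nat) \<times> bool"

fun src :: "qedge \<Rightarrow> nat \<times> nat" where
  "src (v, d) = v"

fun tgt :: "qedge \<Rightarrow> nat \<times> nat" where
  "tgt ((a, b), d) = (if d then (a, Suc b) else (Suc a, b))"

definition square :: "nat \<times> nat \<Rightarrow> qedge set" where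
  "square s = (case s of (a, b) \<Rightarrow> {((a, b), False), ((Suc a, b), True), ((a, Suc b), False), ((a, b), True)})"

text \<open>Adjacency in the planar dual: both edges lie on a common unit square. Chains of adjacent
  edges play the role of dual paths.\<close>

definition fadj :: "qedge \<Rightarrow> qedge \<Rightarrow> bool" where
  "fadj e f \<longleftrightarrow> (\<exists>s. e \<in> square s \<and> f \<in> square s)"

definition cut :: "(nat \<times> nat) set \<Rightarrow> qedge set" where
  "cut A = {e. (src e \<in> A) \<noteq> (tgt e \<in> A)}"

text \<open>F has an even number of edges around every square, that is, F is a closed 1-cochain
  modulo 2.\<close>

definition even_squares :: "qedge set \<Rightarrow> bool" where
  "even_squares F \<longleftrightarrow> (\<forall>a b. ((((a, b), False) \<in> F) \<noteq> (((Suc a, b), True) \<in> F)) =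
     ((((a, b), True) \<in> F) \<noteq> (((a, Suc b), False) \<in> F)))"

lemma even_squares_cut: "even_squares (cut A)"
  unfolding even_squares_def cut_def by auto

text \<open>Closed cochains on the quadrant are exact. The potential \<open>g\<close> counts modulo
  2 the edges of F on the path that first follows the axis and then goes up; evenness on squares
  extends its property from vertical edges and the axis to all horizontal edges.\<close>

lemma even_squares_imp_cut:
  assumes "even_squares F"
  shows "\<exists>B. F = cut B"
proof -
  define h where "h a = (\<Sum>i<a. of_bool (((i, 0), False) \<in> F) :: nat)" for a
  define v where "v a b = (\<Sum>j<b. of_bool (((a, j), True) \<in> F) :: nat)" for a b
  define g where "g a b = odd (h a + v a b)" for a b
  have vert: "(g a b \<noteq> g a (Suc b)) = (((a, b), True) \<in> F)" for a b
    unfolding g_def v_def by auto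
  have hor: "(g a b \<noteq> g (Suc a) b) = (((a, b), False) \<in> F)" for a b
  proof (induction b)
    case 0
    then show ?case unfolding g_def v_def h_def by auto
  next
    case (Suc b)
    then show ?case
      using vert[of a b] vert[of "Suc a" b] assms unfolding even_squares_def by blast
  qed
  have "F = cut {(a, b). g a b}"
  proof (rule set_eqI)
    fix e :: qedge
    obtain a b d where e: "e = ((a, b), d)" by (metis prod.exhaust)
    show "e \<in> F \<longleftrightarrow> e \<in> cut {(a, b). g a b}"
      using vert[of a b] hor[of a b] unfolding e cut_def by (cases d) auto
  qed
  then show ?thesis by blast
qed

definition comp :: "qedge set \<Rightarrow> qedge \<Rightarrow> qedge set" where
  "comp P e = {f. (e, f) \<in> {(x, y). fadj x y \<and> x \<in> P \<and> y \<in> P}\<^sup>*}"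

lemma comp_self [simp]: "e \<in> comp P e"
  unfolding comp_def by simp

lemma comp_subset: "e \<in> P \<Longrightarrow> comp P e \<subseteq> P"
  unfolding comp_def by (auto elim: rtranclE)

lemma comp_closed: "x \<in> comp P e \<Longrightarrow> x \<in> P \<Longrightarrow> y \<in> P \<Longrightarrow> fadj x y \<Longrightarrow> y \<in> comp P e"
  unfolding comp_def by (auto intro: rtrancl_into_rtrancl)

lemma comp_eq:
  assumes "f \<in> comp P e"
  shows "comp P f = comp P e"
proof -
  let ?R = "{(x, y). fadj x y \<and> x \<in> P \<and> y \<in> P}"
  have "sym ?R" by (auto simp: sym_def fadj_def)
  then have "sym (?R\<^sup>*)" by (rule sym_rtrancl)
  then have "(f, e) \<in> ?R\<^sup>*" using assms unfolding comp_def by (auto dest: symD)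
  then show ?thesis using assms unfolding comp_def by auto
qed

text \<open>The edges of P on one square are mutually adjacent, so a component contains all of them
  or none.\<close>

lemma even_squares_comp:
  assumes "even_squares P" "e \<in> P"
  shows "even_squares (comp P e)"
  unfolding even_squares_def
proof (intro allI)
  fix a b
  let ?S = "square (a, b)"
  have mem: "x \<in> comp P e \<longleftrightarrow> x \<in> P" if "x \<in> ?S" "y \<in> ?S" "y \<in> comp P e" for x y
    using that comp_closed[of y P e x] comp_subset[OF assms(2)] unfolding fadj_def by blast
  let ?x1 = "((a, b), False)" and ?x2 = "((Suc a, b), True)" and ?x3 = "((a, Suc b), False)" and ?x4 = "((a, b), True)"
  have S: "?S = {?x1, ?x2, ?x3, ?x4}" unfolding square_def by simp
  show "((?x1 \<in> comp P e) \<noteq> (?x2 \<in> comp P e)) = ((?x4 \<in> comp P e) \<noteq> (?x3 \<in> comp P e))"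
  proof (cases "\<exists>y\<in>?S. y \<in> comp P e")
    case True
    then have "x \<in> comp P e \<longleftrightarrow> x \<in> P" if "x \<in> ?S" for x using mem that by blast
    then show ?thesis using assms(1) unfolding S even_squares_def by simp
  next
    case False
    then show ?thesis unfolding S by auto
  qed
qed

lemma segment_parity: "odd (card {i. i < n \<and> ((i, 0), False) \<in> cut A}) = (((0, 0) \<in> A) \<noteq> ((n, 0) \<in> A))"
proof (induction n)
  case (Suc n)
  have eq: "{i. i < Suc n \<and> ((i, 0), False) \<in> cut A} =
      (if ((n, 0), False) \<in> cut A then insert n {i. i < n \<and> ((i, 0), False) \<in> cut A} else {i. i < n \<and> ((i, 0), False) \<in> cut A})"
    by (auto simp: less_Suc_eq)
  have "((n, 0), False) \<in> cut A \<longleftrightarrow> ((n, 0) \<in> A) \<noteq> ((Suc n, 0) \<in> A)"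
    unfolding cut_def by simp
  then show ?case unfolding eq using Suc by auto
qed simp

text \<open>Every face-connected component of a cut meets each square in an even number of edges, hence is itself a cut.
  By parity one of these components already separates the endpoints.\<close>
lemma separating_component:
  assumes "(0, 0) \<in> A" "(n, 0) \<notin> A"
  shows "\<exists>i<n. ((i, 0), False) \<in> cut A \<and> (\<exists>B. comp (cut A) ((i, 0), False) = cut B \<and> ((0, 0) \<in> B) \<noteq> ((n, 0) \<in> B))"
proof (rule ccontr)
  assume neg: "\<not> ?thesis"
  let ?P = "cut A"
  let ?S = "{i. i < n \<and> ((i, 0), False) \<in> ?P}"
  define C where "C i = {j \<in> ?S. ((j, 0), False) \<in> comp ?P ((i, 0), False)}" for i
  have ev: "even (card (C i))" if i: "i \<in> ?S" for i
  proof -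
    obtain B where B: "comp ?P ((i, 0), False) = cut B"
      using even_squares_imp_cut[OF even_squares_comp[OF even_squares_cut]] i by blast
    then have "((0, 0) \<in> B) = ((n, 0) \<in> B)" using neg i by blast
    then have "even (card {j. j < n \<and> ((j, 0), False) \<in> cut B})" using segment_parity[of n B] by simp
    moreover have "C i = {j. j < n \<and> ((j, 0), False) \<in> cut B}"
      unfolding C_def B[symmetric] using comp_subset[of "((i, 0), False)" ?P] i by auto
    ultimately show ?thesis by simp
  qed
  have "even (card (\<Union> (C ` ?S)))"
  proof (rule dvd_partition)
    show "finite (\<Union> (C ` ?S))" by (rule finite_subset[of _ "{..<n}"]) (auto simp: C_def)
    show "\<forall>c\<in>C ` ?S. 2 dvd card c" using ev by auto
    show "\<forall>c1\<in>C ` ?S. \<forall>c2\<in>C ` ?S. c1 \<noteq> c2 \<longrightarrow> c1 \<inter> c2 = {}"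
    proof (intro ballI impI)
      fix c1 c2 assume "c1 \<in> C ` ?S" "c2 \<in> C ` ?S" "c1 \<noteq> c2"
      then obtain i j where ij: "c1 = C i" "c2 = C j" by auto
      show "c1 \<inter> c2 = {}"
      proof (rule ccontr)
        assume "c1 \<inter> c2 \<noteq> {}"
        then obtain k where "k \<in> C i" "k \<in> C j" using ij by auto
        then have "comp ?P ((i, 0), False) = comp ?P ((j, 0), False)"
          using comp_eq unfolding C_def by blast
        then show False using \<open>c1 \<noteq> c2\<close> ij unfolding C_def by simp
      qed
    qed
  qed
  moreover have "\<Union> (C ` ?S) = ?S" unfolding C_def by auto
  moreover have "odd (card ?S)" using segment_parity[of n A] assms by simp
  ultimately show False by simp
qed

section \<open>Balls of the open subgraph and chains of closed edges\<close>

definition qstep :: "qedge set \<Rightarrow> (nat \<times> nat) rel" where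
  "qstep Q = {(u, v). \<exists>e\<in>Q. (u = src e \<and> v = tgt e) \<or> (u = tgt e \<and> v = src e)}"

definition qball :: "qedge set \<Rightarrow> nat \<Rightarrow> (nat \<times> nat) set" where
  "qball Q t = {v. \<exists>k\<le>t. ((0, 0), v) \<in> qstep Q ^^ k}"

definition fchain :: "qedge \<Rightarrow> qedge list \<Rightarrow> bool" where
  "fchain e c \<longleftrightarrow> c \<noteq> [] \<and> hd c = e \<and> distinct c \<and> successively fadj c"

text \<open>The edges reached by a dual chain that is closed before its last edge. No ball or cut
  appears in the definition, so one set of attached edges serves the boundaries of all balls
  simultaneously.\<close>

definition attached :: "qedge set \<Rightarrow> qedge \<Rightarrow> qedge set" where
  "attached Q e = {last c | c. fchain e c \<and> set (butlast c) \<inter> Q = {}}"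

lemma qball_step:
  assumes "u \<in> qball Q t" "(u, v) \<in> qstep Q"
  shows "v \<in> qball Q (Suc t)"
proof -
  obtain k where k: "k \<le> t" "((0, 0), u) \<in> qstep Q ^^ k" using assms(1) unfolding qball_def by auto
  have "((0, 0), v) \<in> qstep Q ^^ Suc k" using k(2) assms(2) by (rule relpow_Suc_I)
  moreover have "Suc k \<le> Suc t" using k(1) by simp
  ultimately show ?thesis unfolding qball_def by blast
qed

lemma qball_mono: "s \<le> t \<Longrightarrow> qball Q s \<subseteq> qball Q t"
  unfolding qball_def using le_trans by blast

text \<open>An open edge that meets the ball of radius s lies inside the ball of radius s + 1, hence
  crosses no later boundary.\<close>

lemma open_in_one_cut:
  assumes "e \<in> Q" "e \<in> cut (qball Q s)" "e \<in> cut (qball Q t)"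
  shows "s = t"
proof -
  have "False" if "s < t" "e \<in> cut (qball Q s)" "e \<in> cut (qball Q t)" for s t
  proof -
    have st: "(src e, tgt e) \<in> qstep Q" "(tgt e, src e) \<in> qstep Q"
      using assms(1) unfolding qstep_def by auto
    have "src e \<in> qball Q s \<or> tgt e \<in> qball Q s" using that(2) unfolding cut_def by auto
    then have "src e \<in> qball Q t \<and> tgt e \<in> qball Q t"
      using qball_step st qball_mono[of "Suc s" t Q] qball_mono[of s t Q] that(1) by (meson Suc_leI less_imp_le subsetD)
    then show False using that(3) unfolding cut_def by auto
  qed
  then show ?thesis using assms by (meson linorder_neqE_nat)
qed

lemma comp_chain:
  assumes "f \<in> comp P e"
  shows "\<exists>c. fchain e c \<and> last c = f \<and> (e \<in> P \<longrightarrow> set c \<subseteq> P)"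
proof -
  let ?R = "{(x, y). fadj x y \<and> x \<in> P \<and> y \<in> P}"
  obtain k where "(e, f) \<in> ?R ^^ k" using assms unfolding comp_def by (auto simp: rtrancl_power)
  from relpow_distinct_list[OF this] obtain c where c: "c \<noteq> []" "hd c = e" "last c = f" "distinct c"
    "successively (\<lambda>u v. (u, v) \<in> ?R) c" by auto
  have 1: "successively fadj c" by (rule successively_mono[OF c(5)]) auto
  have 2: "set c \<subseteq> P" if "e \<in> P"
    using c(1,2,5) that
  proof (induction c arbitrary: e)
    case (Cons x c)
    show ?case
    proof (cases c)
      case (Cons y c')
      then show ?thesis using Cons.prems Cons.IH[of y] by auto
    qed (use Cons.prems in auto)
  qed simp
  show ?thesis using c 1 2 unfolding fchain_def by blast
qed

text \<open>A chain of P-edges starting at e never leaves the component of e. This lets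
  \<open>comp_chain\<close> return a chain that stays in the component and not merely in P.\<close>

lemma comp_idem:
  assumes "f \<in> comp P e"
  shows "f \<in> comp (comp P e) e"
proof -
  let ?R = "{(x, y). fadj x y \<and> x \<in> P \<and> y \<in> P}"
  have "(e, f) \<in> ?R\<^sup>*" using assms unfolding comp_def by simp
  then show ?thesis
  proof (induction rule: rtrancl_induct)
    case (step x y)
    have "x \<in> comp P e" using step.hyps(1) unfolding comp_def by simp
    moreover have "(e, y) \<in> ?R\<^sup>*" using step.hyps by (rule rtrancl_into_rtrancl)
    then have "y \<in> comp P e" unfolding comp_def by simp
    ultimately show ?case using comp_closed[of x "comp P e" e y] step by simp
  qed simp
qed

text \<open>Stop a chain from e to f at its first open edge.\<close>

lemma attached_of_comp:
  assumes f: "f \<in> comp P e" "f \<in> Q" and e: "e \<in> P"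
  shows "\<exists>g\<in>attached Q e \<inter> Q. g \<in> P"
proof -
  obtain c where c: "fchain e c" "last c = f" "set c \<subseteq> P" using comp_chain[OF f(1)] e by auto
  have "c \<noteq> []" using c(1) unfolding fchain_def by simp
  then have "\<exists>x\<in>set c. x \<in> Q" using f(2) c(2) last_in_set by blast
  then obtain c1 g c2 where g: "c = c1 @ g # c2" "g \<in> Q" "\<forall>x\<in>set c1. x \<notin> Q"
    by (rule split_list_first_propE)
  have "fchain e (c1 @ [g])"
  proof -
    have "successively fadj (c1 @ [g])" "distinct (c1 @ [g])"
      using c(1) unfolding fchain_def g(1) by (simp_all add: successively_append_iff)
    moreover have "hd (c1 @ [g]) = e" using c(1) unfolding fchain_def g(1) by (cases c1) simp_all
    ultimately show ?thesis unfolding fchain_def by simp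
  qed
  then have "g \<in> attached Q e" unfolding attached_def using g(3)
    by (intro CollectI exI[of _ "c1 @ [g]"]) auto
  then show ?thesis using g c(3) by auto
qed

lemma fadj_pos:
  assumes "fadj e f"
  shows "fst (src f) \<le> Suc (fst (src e))" "fst (src e) \<le> Suc (fst (src f))"
    "snd (src f) \<le> Suc (snd (src e))" "snd (src e) \<le> Suc (snd (src f))"
  using assms unfolding fadj_def square_def by auto

lemma fchain_pos:
  assumes "fchain e c"
  shows "fst (src (last c)) + 1 \<le> fst (src e) + length c \<and> fst (src e) + 1 \<le> fst (src (last c)) + length c \<and>
    snd (src (last c)) + 1 \<le> snd (src e) + length c"
  using assms
proof (induction c arbitrary: e)
  case (Cons x c)
  show ?case
  proof (cases c)
    case Nil
    then show ?thesis using Cons.prems unfolding fchain_def by auto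
  next
    case (Cons y c')
    then have "fchain y c" "fadj e y" "x = e" using Cons.prems unfolding fchain_def by auto
    with Cons.IH[of y] fadj_pos[of e y] Cons show ?thesis by auto
  qed
qed (simp add: fchain_def)

text \<open>The path up the column over 0 to height h, along row h and down the column over n joins
  the two points, so it crosses the cut.\<close>

lemma detour_crossing:
  assumes "((0, 0) \<in> B) \<noteq> ((n, 0) \<in> B)"
  shows "\<exists>f\<in>cut B. (\<exists>b. f = ((0, b), True)) \<or> (\<exists>a. f = ((a, h), False)) \<or> (\<exists>b. f = ((n, b), True))"
proof (rule ccontr)
  assume neg: "\<not> ?thesis"
  have 1: "((0, b) \<in> B) = ((0, 0) \<in> B)" for b
  proof (induction b)
    case (Suc b)
    have "((0, b), True) \<notin> cut B" using neg by blast
    then show ?case using Suc unfolding cut_def by auto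
  qed simp
  have 2: "((a, h) \<in> B) = ((0, h) \<in> B)" for a
  proof (induction a)
    case (Suc a)
    have "((a, h), False) \<notin> cut B" using neg by blast
    then show ?case using Suc unfolding cut_def by auto
  qed simp
  have 3: "((n, b) \<in> B) = ((n, 0) \<in> B)" for b
  proof (induction b)
    case (Suc b)
    have "((n, b), True) \<notin> cut B" using neg by blast
    then show ?case using Suc unfolding cut_def by auto
  qed simp
  show False using 1[of h] 2[of n] 3[of h] assms by blast
qed

text \<open>While (n, 0) is outside the ball of radius t, some component of the boundary of the ball
  separates it from the origin and starts on the axis. The component is not entirely closed, because
  it would contain a long closed chain on its way to the detour; so it yields an open attached edge.
  Different t yield different edges, which bounds t by their number.\<close>

lemma quadrant_distance:
  assumes long: "\<And>i c. i < n \<Longrightarrow> fchain ((i, 0), False) c \<Longrightarrow> length c = min (Suc i) (n - i) \<Longrightarrow> set c \<inter> Q \<noteq> {}"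
    and fin: "finite (\<Union>i<n. attached Q ((i, 0), False))"
  shows "(n, 0) \<in> qball Q (card (\<Union>i<n. attached Q ((i, 0), False)))"
proof (rule ccontr)
  let ?U = "\<Union>i<n. attached Q ((i, 0), False)"
  assume "(n, 0) \<notin> qball Q (card ?U)"
  then have out: "(n, 0) \<notin> qball Q t" if "t \<le> card ?U" for t
    using qball_mono[OF that] by auto
  have "\<exists>g\<in>?U. g \<in> Q \<and> g \<in> cut (qball Q t)" if t: "t \<le> card ?U" for t
  proof -
    let ?P = "cut (qball Q t)"
    have "(0, 0) \<in> qball Q t" unfolding qball_def by (auto intro!: exI[of _ 0])
    from separating_component[OF this out[OF t]] obtain i B where i: "i < n" "((i, 0), False) \<in> ?P"
      "comp ?P ((i, 0), False) = cut B" "((0, 0) \<in> B) \<noteq> ((n, 0) \<in> B)" by auto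
    have "\<exists>f\<in>comp ?P ((i, 0), False). f \<in> Q"
    proof (rule ccontr)
      assume closed: "\<not> ?thesis"
      \<comment> \<open>A dual chain from the i-th axis edge needs at least h edges to reach either
        column or row h.\<close>
      define h where "h = min (Suc i) (n - i)"
      obtain f where f: "f \<in> comp ?P ((i, 0), False)"
        "(\<exists>b. f = ((0, b), True)) \<or> (\<exists>a. f = ((a, h), False)) \<or> (\<exists>b. f = ((n, b), True))"
        using detour_crossing[OF i(4), of h] i(3) by auto
      have ee: "((i, 0), False) \<in> comp ?P ((i, 0), False)" by simp
      obtain c where c: "fchain ((i, 0), False) c" "last c = f" "set c \<subseteq> comp ?P ((i, 0), False)"
        using comp_chain[OF comp_idem[OF f(1)]] ee by blast
      have "h \<le> length c"
        using fchain_pos[OF c(1)] f(2) i(1) unfolding c(2) h_def by auto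
      moreover have "h \<noteq> 0" using i(1) unfolding h_def by simp
      moreover have "fchain ((i, 0), False) (take h c)" if "h \<noteq> 0"
        using c(1) that unfolding fchain_def
        by (auto simp: hd_take distinct_take) (metis append_take_drop_id successively_append_iff)
      ultimately have "set (take h c) \<inter> Q \<noteq> {}"
        using long[OF i(1), of "take h c"] unfolding h_def by simp
      then show False using closed c(3) set_take_subset[of h c] by blast
    qed
    then obtain f where "f \<in> comp ?P ((i, 0), False)" "f \<in> Q" by auto
    from attached_of_comp[OF this i(2)] i(1) show ?thesis by blast
  qed
  then have "\<forall>t\<in>{..card ?U}. \<exists>g. g \<in> ?U \<and> g \<in> Q \<and> g \<in> cut (qball Q t)"
    by (intro ballI) (simp only: atMost_iff Bex_def)
  from bchoice[OF this] obtain g where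
    g: "\<forall>t\<in>{..card ?U}. g t \<in> ?U \<and> g t \<in> Q \<and> g t \<in> cut (qball Q t)" by (elim exE)
  have "inj_on g {..card ?U}"
  proof (rule inj_onI)
    fix s t assume st: "s \<in> {..card ?U}" "t \<in> {..card ?U}" "g s = g t"
    then show "s = t" using g[rule_format, OF st(1)] g[rule_format, OF st(2)] by (intro open_in_one_cut[of "g s" Q]) simp_all
  qed
  \<comment> \<open>The radii 0, ..., card U are one more than the edges available.\<close>
  then have "card {..card ?U} \<le> card ?U"
    by (rule card_inj_on_le) (use g fin in blast)+
  then show False by simp
qed

section \<open>Linear growth of passage times\<close>

text \<open>Three candidate squares with four edges each. On the axes truncated subtraction repeats
  a square, so the list of candidates stays valid.\<close>

lemma card_fadj_le: "finite {f. fadj e f} \<and> card {f. fadj e f} \<le> 12"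
proof -
  obtain a b d where e: "e = ((a, b), d)" by (metis prod.exhaust)
  have sub: "{f. fadj e f} \<subseteq> square (a, b) \<union> square (a, b - 1) \<union> square (a - 1, b)"
  proof
    fix f assume "f \<in> {f. fadj e f}"
    then obtain s where s: "e \<in> square s" "f \<in> square s" unfolding fadj_def by auto
    then have "s = (a, b) \<or> s = (a, b - 1) \<or> s = (a - 1, b)"
      unfolding e square_def by (cases s) auto
    with s(2) show "f \<in> square (a, b) \<union> square (a, b - 1) \<union> square (a - 1, b)" by blast
  qed
  have sq: "finite (square s)" "card (square s) \<le> 4" for s
    unfolding square_def by (auto split: prod.split simp: card_insert_if)
  have "card {f. fadj e f} \<le> card (square (a, b) \<union> square (a, b - 1) \<union> square (a - 1, b))"
    using sq(1) by (intro card_mono sub) auto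
  also have "\<dots> \<le> 4 + 4 + 4"
    using sq(2) by (meson add_mono card_Un_le order_trans)
  finally show ?thesis using finite_subset[OF sub] sq(1) by auto
qed

definition chains :: "qedge \<Rightarrow> nat \<Rightarrow> qedge list set" where
  "chains e m = {c. fchain e c \<and> length c = Suc m}"

lemma card_chains_le: "finite (chains e m)" "card (chains e m) \<le> 12 ^ m"
proof -
  have w: "finite {l. length l = Suc m \<and> hd l = e \<and> successively fadj l}"
    "card {l. length l = Suc m \<and> hd l = e \<and> successively fadj l} \<le> 12 ^ m"
    using card_walks_le[of fadj 12 m e] card_fadj_le by auto
  have sub: "chains e m \<subseteq> {l. length l = Suc m \<and> hd l = e \<and> successively fadj l}"
    unfolding chains_def fchain_def by auto
  show "finite (chains e m)" using w(1) sub finite_subset by blast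
  show "card (chains e m) \<le> 12 ^ m" using card_mono[OF w(1) sub] w(2) by simp
qed

text \<open>The minimum is one of the two distances to the ends, so two geometric series with sum at
  most 2 dominate.\<close>

lemma sum_min_geometric: "(\<Sum>i<n. (1 / 2 :: real) ^ min i (n - Suc i)) \<le> 4"
proof -
  have geo: "(\<Sum>i<n. (1 / 2 :: real) ^ i) \<le> 2"
    by (simp add: sum_gp_strict)
  have "(\<Sum>i<n. (1 / 2 :: real) ^ min i (n - Suc i)) \<le> (\<Sum>i<n. (1 / 2) ^ i + (1 / 2) ^ (n - Suc i))"
    by (intro sum_mono) (auto simp: min_def)
  also have "\<dots> = (\<Sum>i<n. (1 / 2 :: real) ^ i) + (\<Sum>i<n. (1 / 2) ^ i)"
    by (simp add: sum.distrib sum.nat_diff_reindex[of "\<lambda>i. (1 / 2 :: real) ^ i"])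
  finally show ?thesis using geo by simp
qed

text \<open>An attached edge is the last edge of some counted chain, so edges inject into chains.
  The count is a series in \<open>ennreal\<close>, so finiteness of the union is a consequence:
  first all its finite subsets are bounded by B.\<close>

lemma card_attached_le:
  fixes B :: nat
  assumes cnt: "(\<Sum>i<n. \<Sum>m. \<Sum>c\<in>chains ((i, 0), False) m. of_bool (set (butlast c) \<inter> Q = {}) :: ennreal) \<le> of_nat B"
  shows "finite (\<Union>i<n. attached Q ((i, 0), False)) \<and> card (\<Union>i<n. attached Q ((i, 0), False)) \<le> B"
proof -
  let ?U = "\<Union>i<n. attached Q ((i, 0), False)"
  have small: "card V \<le> B" if V: "finite V" "V \<subseteq> ?U" for V
  proof -
    have "\<forall>v\<in>V. \<exists>z. fst z < n \<and> fchain ((fst z, 0), False) (snd z) \<and> last (snd z) = v \<and> set (butlast (snd z)) \<inter> Q = {}"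
      using V(2) unfolding attached_def by fastforce
    from bchoice[OF this] obtain z where z: "\<forall>v\<in>V. fst (z v) < n \<and> fchain ((fst (z v), 0), False) (snd (z v)) \<and>
        last (snd (z v)) = v \<and> set (butlast (snd (z v))) \<inter> Q = {}" by (elim exE)
    define M where "M = Suc (Max ((\<lambda>v. length (snd (z v))) ` V))"
    let ?G = "\<lambda>i m. {c \<in> chains ((i, 0), False) m. set (butlast c) \<inter> Q = {}}"
    let ?T = "SIGMA i:{..<n}. SIGMA m:{..<M}. ?G i m"
    have finG: "finite (?G i m)" for i m using card_chains_le(1) by auto
    have "card V \<le> card ?T"
    proof (rule card_inj_on_le)
      let ?h = "\<lambda>v. (fst (z v), length (snd (z v)) - 1, snd (z v))"
      show "inj_on ?h V" using z by (intro inj_onI) (metis Pair_inject)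
      show "?h ` V \<subseteq> ?T"
      proof (rule image_subsetI)
        fix v assume v: "v \<in> V"
        have "length (snd (z v)) < M"
          unfolding M_def using v V(1) by (simp add: less_Suc_eq_le)
        moreover have "length (snd (z v)) \<noteq> 0" using z v unfolding fchain_def by auto
        ultimately show "?h v \<in> ?T" using z v unfolding chains_def by auto
      qed
      show "finite ?T" using finG by (intro finite_SigmaI) auto
    qed
    also have "card ?T = (\<Sum>i<n. \<Sum>m<M. card (?G i m))"
      using finG by (subst card_SigmaI) (auto intro!: sum.cong card_SigmaI finite_SigmaI)
    finally have "of_nat (card V) \<le> (of_nat (\<Sum>i<n. \<Sum>m<M. card (?G i m)) :: ennreal)"
      by (simp only: of_nat_le_iff)
    also have "\<dots> = (\<Sum>i<n. \<Sum>m<M. \<Sum>c\<in>chains ((i, 0), False) m. of_bool (set (butlast c) \<inter> Q = {}))"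
      using card_chains_le(1) by (simp add: of_bool_def sum.If_cases Int_def conj_commute)
    also have "\<dots> \<le> (\<Sum>i<n. \<Sum>m. \<Sum>c\<in>chains ((i, 0), False) m. of_bool (set (butlast c) \<inter> Q = {}))"
      by (intro sum_mono sum_le_suminf) auto
    also note cnt
    finally show ?thesis by simp
  qed
  have "finite ?U"
  proof (rule ccontr)
    assume "infinite ?U"
    then obtain V where "V \<subseteq> ?U" "finite V" "card V = Suc B" by (meson infinite_arbitrarily_large)
    with small[of V] show False by simp
  qed
  with small show ?thesis by auto
qed

text \<open>Two exceptional events: in \<open>L\<close> a closed chain from the axis is long enough
  to reach its detour, with probability at most 4 \<epsilon>; in \<open>T\<close> the number of
  attached chains reaches K times its mean bound 2 n, with probability at most 1 / K by Markov.
  There are at most 12^m chains with m + 1 edges, so \<epsilon> \<le> 1/24 makes all series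
  geometric with ratio 1/2.\<close>

lemma quadrant_prob:
  fixes \<mu> :: "real measure" and \<iota> :: "qedge \<Rightarrow> (int ^ 'd::finite) set"
  assumes mu: "prob_space \<mu>" "sets \<mu> = sets borel"
    and \<iota>: "inj \<iota>" "range \<iota> \<subseteq> lattice_edges" and eps: "measure \<mu> {D0<..} \<le> \<epsilon>" "\<epsilon> \<le> 1 / 24" and K: "0 < K" and n: "0 < n"
  shows "\<exists>G\<in>sets (fpp_space \<mu>). 1 - 4 * \<epsilon> - 1 / real K \<le> measure (fpp_space \<mu>) G \<and>
    (\<forall>w\<in>G. (n, 0) \<in> qball {e. w (\<iota> e) \<le> D0} (2 * n * K))"
proof -
  let ?P = "fpp_space \<mu> :: ((int ^ 'd) set \<Rightarrow> real) measure"
  interpret mu: prob_space \<mu> by (rule mu(1))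
  interpret P: product_prob_space "\<lambda>_. \<mu>" "lattice_edges :: (int ^ 'd) set set" by unfold_locales
  interpret P': prob_space ?P unfolding fpp_space_def by (rule P.P.prob_space_axioms)
  have eps0: "0 \<le> \<epsilon>" using eps(1) measure_nonneg[of \<mu> "{D0<..}"] by linarith
  define cl where "cl F = {w \<in> space ?P. \<forall>x\<in>\<iota> ` F. w x \<in> {D0<..}}" for F
  have cl: "cl F \<in> sets ?P" "emeasure ?P (cl F) \<le> ennreal (\<epsilon> ^ card F)" if F: "finite F" for F
  proof -
    have J: "\<iota> ` F \<subseteq> lattice_edges" "finite (\<iota> ` F)" using \<iota>(2) F by auto
    have s: "{D0<..} \<in> sets \<mu>" using mu(2) by simp
    show "cl F \<in> sets ?P"
      unfolding cl_def fpp_space_def using J s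
      by (intro sets.sets_Collect_finite_All sets_Collect_single'[of _ lattice_edges "\<lambda>_. \<mu>" "\<lambda>x. x \<in> {D0<..}"]) auto
    have "emeasure ?P (cl F) = (\<Prod>x\<in>\<iota> ` F. emeasure \<mu> {D0<..})"
      unfolding cl_def fpp_space_def using J s by (intro P.emeasure_PiM_Collect) auto
    also have "\<dots> = ennreal (measure \<mu> {D0<..} ^ card F)"
      using \<iota>(1) by (simp add: mu.emeasure_eq_measure ennreal_power card_image inj_on_subset[of \<iota> UNIV F])
    also have "\<dots> \<le> ennreal (\<epsilon> ^ card F)"
      using eps(1) by (intro ennreal_leI power_mono) auto
    finally show "emeasure ?P (cl F) \<le> ennreal (\<epsilon> ^ card F)" .
  qed
  have clm: "measure ?P (cl F) \<le> \<epsilon> ^ card F" if "finite F" for F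
    using cl(2)[OF that] eps0 by (simp add: P'.emeasure_eq_measure)
  have pow: "12 ^ m * \<epsilon> ^ m \<le> (1 / 2) ^ m" for m
  proof -
    have "(12 * \<epsilon>) ^ m \<le> (1 / 2) ^ m" using eps(2) eps0 by (intro power_mono) auto
    then show ?thesis by (simp only: power_mult_distrib)
  qed
  let ?Q = "\<lambda>w. {e. w (\<iota> e) \<le> D0}"
  have clQ: "w \<in> cl F \<longleftrightarrow> F \<inter> ?Q w = {}" if "w \<in> space ?P" for w F
    using that unfolding cl_def by (auto simp: not_le)
  \<comment> \<open>\<open>chains\<close> counts steps rather than edges, so
    \<open>Suc (h i)\<close> is the length min (i + 1) (n - i) demanded by
    \<open>quadrant_distance\<close>.\<close>
  define h where "h i = min i (n - Suc i)" for i
  define L where "L = (\<Union>i<n. \<Union>c\<in>chains ((i, 0), False) (h i). cl (set c))"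
  have Ls: "L \<in> sets ?P"
    unfolding L_def using card_chains_le(1) cl(1) by (intro sets.finite_UN) auto
  have Lm: "measure ?P L \<le> 4 * \<epsilon>"
  proof -
    have "measure ?P L \<le> (\<Sum>i<n. measure ?P (\<Union>c\<in>chains ((i, 0), False) (h i). cl (set c)))"
      unfolding L_def using card_chains_le(1) cl(1) by (intro measure_UNION_le sets.finite_UN) auto
    also have "\<dots> \<le> (\<Sum>i<n. \<epsilon> * (1 / 2) ^ h i)"
    proof (rule sum_mono)
      fix i
      have "measure ?P (\<Union>c\<in>chains ((i, 0), False) (h i). cl (set c))
          \<le> (\<Sum>c\<in>chains ((i, 0), False) (h i). measure ?P (cl (set c)))"
        using card_chains_le(1) cl(1) by (intro measure_UNION_le) auto
      also have "\<dots> \<le> (\<Sum>c\<in>chains ((i, 0), False) (h i). \<epsilon> ^ Suc (h i))"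
      proof (rule sum_mono)
        fix c assume "c \<in> chains ((i, 0), False) (h i)"
        then have "card (set c) = Suc (h i)" unfolding chains_def fchain_def by (simp add: distinct_card)
        then show "measure ?P (cl (set c)) \<le> \<epsilon> ^ Suc (h i)" using clm[of "set c"] by simp
      qed
      also have "\<dots> = real (card (chains ((i, 0), False) (h i))) * \<epsilon> ^ Suc (h i)" by simp
      also have "\<dots> \<le> real (12 ^ h i) * \<epsilon> ^ Suc (h i)"
        using card_chains_le(2) eps0 by (intro mult_right_mono of_nat_mono) auto
      also have "\<dots> = \<epsilon> * (12 ^ h i * \<epsilon> ^ h i)" by simp
      also have "\<dots> \<le> \<epsilon> * (1 / 2) ^ h i" using pow eps0 by (intro mult_left_mono)
      finally show "measure ?P (\<Union>c\<in>chains ((i, 0), False) (h i). cl (set c)) \<le> \<epsilon> * (1 / 2) ^ h i" .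
    qed
    also have "\<dots> \<le> \<epsilon> * 4"
      unfolding sum_distrib_left[symmetric] h_def using sum_min_geometric eps0 by (intro mult_left_mono) auto
    finally show ?thesis by simp
  qed
  define f where "f w = (\<Sum>i<n. \<Sum>m. \<Sum>c\<in>chains ((i, 0), False) m. indicator (cl (set (butlast c))) w :: ennreal)" for w
  have [measurable]: "cl (set c) \<in> sets ?P" for c by (rule cl(1)) simp
  have fm [measurable]: "f \<in> borel_measurable ?P" unfolding f_def by measurable
  have "(\<integral>\<^sup>+w. f w \<partial>?P) = (\<Sum>i<n. \<Sum>m. \<Sum>c\<in>chains ((i, 0), False) m. emeasure ?P (cl (set (butlast c))))"
    unfolding f_def by (simp add: nn_integral_sum nn_integral_suminf)
  also have "\<dots> \<le> (\<Sum>i<n. \<Sum>m. ennreal ((1 / 2) ^ m))"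
  proof (intro sum_mono suminf_le summableI)
    fix i m
    have "(\<Sum>c\<in>chains ((i, 0), False) m. emeasure ?P (cl (set (butlast c)))) \<le> (\<Sum>c\<in>chains ((i, 0), False) m. ennreal (\<epsilon> ^ m))"
    proof (rule sum_mono)
      fix c assume "c \<in> chains ((i, 0), False) m"
      then have "card (set (butlast c)) = m"
        unfolding chains_def fchain_def by (simp add: distinct_card distinct_butlast)
      then show "emeasure ?P (cl (set (butlast c))) \<le> ennreal (\<epsilon> ^ m)" using cl(2)[of "set (butlast c)"] by simp
    qed
    also have "\<dots> = ennreal (real (card (chains ((i, 0), False) m)) * \<epsilon> ^ m)"
      using eps0 by (simp add: ennreal_mult ennreal_of_nat_eq_real_of_nat)
    also have "\<dots> \<le> ennreal (real (12 ^ m) * \<epsilon> ^ m)"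
      using card_chains_le(2) eps0 by (intro ennreal_leI mult_right_mono of_nat_mono) auto
    also have "\<dots> \<le> ennreal ((1 / 2) ^ m)" using pow by (intro ennreal_leI) simp
    finally show "(\<Sum>c\<in>chains ((i, 0), False) m. emeasure ?P (cl (set (butlast c)))) \<le> ennreal ((1 / 2) ^ m)" .
  qed
  also have "\<dots> = (\<Sum>i<n. ennreal 2)"
    using geometric_sums[of "1 / 2 :: real"] by (intro sum.cong refl suminf_ennreal_eq) auto
  also have "\<dots> = ennreal (2 * real n)" by (simp add: ennreal_of_nat_eq_real_of_nat ennreal_mult mult.commute)
  finally have Ef: "(\<integral>\<^sup>+w. f w \<partial>?P) \<le> ennreal (2 * real n)" .
  define c where "c = 1 / (2 * real n * real K)"
  have c: "0 < c" unfolding c_def using n K by simp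
  define T where "T = {w \<in> space ?P. 1 \<le> ennreal c * f w}"
  have Ts: "T \<in> sets ?P" unfolding T_def by measurable
  have Tm: "measure ?P T \<le> 1 / real K"
  proof -
    have "emeasure ?P T \<le> ennreal c * (\<integral>\<^sup>+w. f w * indicator (space ?P) w \<partial>?P)"
      unfolding T_def by (rule nn_integral_Markov_inequality) auto
    also have "(\<integral>\<^sup>+w. f w * indicator (space ?P) w \<partial>?P) = (\<integral>\<^sup>+w. f w \<partial>?P)"
      by (intro nn_integral_cong) simp
    also have "ennreal c * \<dots> \<le> ennreal c * ennreal (2 * real n)" using Ef by (rule mult_left_mono) simp
    also have "\<dots> = ennreal (1 / real K)" using c n K unfolding c_def by (simp flip: ennreal_mult)
    finally show ?thesis by (simp add: P'.emeasure_eq_measure)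
  qed
  define G where "G = space ?P - L - T"
  show ?thesis
  proof (intro bexI[of _ G] conjI ballI)
    show Gs: "G \<in> sets ?P" unfolding G_def using Ls Ts by auto
    have "1 = measure ?P (space ?P)" by (simp add: P'.prob_space)
    also have "\<dots> \<le> measure ?P (G \<union> (L \<union> T))"
      using Gs Ls Ts sets.sets_into_space unfolding G_def by (intro P'.finite_measure_mono) auto
    also have "\<dots> \<le> measure ?P G + (measure ?P L + measure ?P T)"
      using Gs Ls Ts by (intro order_trans[OF measure_Un_le] add_left_mono measure_Un_le) auto
    finally show "1 - 4 * \<epsilon> - 1 / real K \<le> measure ?P G" using Lm Tm by linarith
    fix w assume w: "w \<in> G"
    then have wsp: "w \<in> space ?P" unfolding G_def by simp
    have "ennreal c * f w < 1" using w unfolding G_def T_def by auto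
    then have "f w \<le> of_nat (2 * n * K)"
    proof -
      have "f w = ennreal (1 / c) * (ennreal c * f w)"
        using c by (simp add: mult.assoc[symmetric] flip: ennreal_mult)
      also have "\<dots> \<le> ennreal (1 / c) * 1" using \<open>ennreal c * f w < 1\<close> by (intro mult_left_mono) auto
      also have "\<dots> = of_nat (2 * n * K)" unfolding c_def by (simp add: ennreal_of_nat_eq_real_of_nat)
      finally show ?thesis .
    qed
    moreover have "f w = (\<Sum>i<n. \<Sum>m. \<Sum>c\<in>chains ((i, 0), False) m. of_bool (set (butlast c) \<inter> ?Q w = {}))"
      unfolding f_def indicator_def clQ[OF wsp] by simp
    ultimately have U: "finite (\<Union>i<n. attached (?Q w) ((i, 0), False))"
      "card (\<Union>i<n. attached (?Q w) ((i, 0), False)) \<le> 2 * n * K"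
      using card_attached_le[where n = n and Q = "?Q w" and B = "2 * n * K"] by auto
    have "(n, 0) \<in> qball (?Q w) (card (\<Union>i<n. attached (?Q w) ((i, 0), False)))"
    proof (rule quadrant_distance[OF _ U(1)])
      fix i c assume ic: "i < n" "fchain ((i, 0), False) c" "length c = min (Suc i) (n - i)"
      then have "c \<in> chains ((i, 0), False) (h i)" unfolding chains_def h_def by auto
      then have "w \<notin> cl (set c)" using w ic(1) unfolding G_def L_def by auto
      then show "set c \<inter> ?Q w \<noteq> {}" using clQ[OF wsp] by auto
    qed
    then show "(n, 0) \<in> qball (?Q w) (2 * n * K)" using qball_mono[OF U(2)] by auto
  qed
qed

section \<open>Copies of the quadrant in the lattice\<close>

definition low_step :: "real \<Rightarrow> ((int ^ 'd::finite) set \<Rightarrow> real) \<Rightarrow> (int ^ 'd) rel" where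
  "low_step D0 w = {(u, v). {u, v} \<in> lattice_edges \<and> w {u, v} \<le> D0}"

text \<open>The quadrant with corner y in the plane of the directions c and j; s gives the sense of
  the axis along which the walk travels.\<close>

definition qmap :: "'d \<Rightarrow> 'd \<Rightarrow> int \<Rightarrow> int ^ 'd \<Rightarrow> nat \<times> nat \<Rightarrow> int ^ 'd::finite" where
  "qmap c j s y v = (\<chi> k. y $ k + (if k = c then s * int (fst v) else if k = j then int (snd v) else 0))"

lemma qmap_edge:
  assumes "c \<noteq> j" "\<bar>s\<bar> = 1"
  shows "{qmap c j s y (src e), qmap c j s y (tgt e)} \<in> lattice_edges"
proof -
  obtain a b d where e: "e = ((a, b), d)" by (metis prod.exhaust)
  define k where "k = (if d then j else c)"
  have "l1norm (qmap c j s y (src e) - qmap c j s y (tgt e)) = (\<Sum>i\<in>UNIV. if i = k then 1 else 0)"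
    unfolding l1norm_def e qmap_def k_def using assms
    by (intro sum.cong) (auto simp: algebra_simps)
  then show ?thesis by simp
qed

lemma inj_qmap:
  assumes "c \<noteq> j" "\<bar>s\<bar> = 1"
  shows "inj (qmap c j s y)"
proof (rule injI)
  fix u v assume eq: "qmap c j s y u = qmap c j s y v"
  have "s * int (fst u) = s * int (fst v)" using arg_cong[OF eq, of "\<lambda>z. z $ c"] by (simp add: qmap_def)
  moreover have "int (snd u) = int (snd v)" using arg_cong[OF eq, of "\<lambda>z. z $ j"] assms by (simp add: qmap_def)
  moreover have "s \<noteq> 0" using assms by auto
  ultimately show "u = v" by (simp add: prod_eq_iff)
qed

lemma inj_qmap_edge:
  assumes "c \<noteq> j" "\<bar>s\<bar> = 1"
  shows "inj (\<lambda>e. {qmap c j s y (src e), qmap c j s y (tgt e)})"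
proof (rule injI)
  fix e f assume "{qmap c j s y (src e), qmap c j s y (tgt e)} = {qmap c j s y (src f), qmap c j s y (tgt f)}"
  then have "(src e = src f \<and> tgt e = tgt f) \<or> (src e = tgt f \<and> tgt e = src f)"
    using inj_qmap[OF assms, of y] by (auto simp: doubleton_eq_iff inj_eq)
  moreover obtain a b d a' b' d' where "e = ((a, b), d)" "f = ((a', b'), d')" by (metis prod.exhaust)
  ultimately show "e = f" by (auto split: if_splits)
qed

text \<open>A single copy of the quadrant, with n = |z|, corrects one coordinate.\<close>

lemma stage_prob:
  fixes \<mu> :: "real measure" and y :: "int ^ 'd::finite"
  assumes mu: "prob_space \<mu>" "sets \<mu> = sets borel" and cj: "c \<noteq> j"
    and eps: "measure \<mu> {D0<..} \<le> \<epsilon>" "\<epsilon> \<le> 1 / 24" and K: "0 < K"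
  shows "\<exists>G\<in>sets (fpp_space \<mu>). 1 - 4 * \<epsilon> - 1 / real K \<le> measure (fpp_space \<mu>) G \<and>
    (\<forall>w\<in>G. \<exists>k\<le>2 * nat \<bar>z\<bar> * K. (y, \<chi> i. y $ i + (if i = c then z else 0)) \<in> low_step D0 w ^^ k)"
proof (cases "z = 0")
  case True
  interpret P: prob_space "fpp_space \<mu> :: ((int ^ 'd) set \<Rightarrow> real) measure"
    unfolding fpp_space_def by (intro prob_space_PiM mu(1))
  have "0 \<le> \<epsilon>" using eps(1) measure_nonneg[of \<mu> "{D0<..}"] by linarith
  then have "1 - 4 * \<epsilon> - 1 / real K \<le> 1" using zero_le_divide_1_iff[of "real K"] by linarith
  moreover have "(\<chi> i. y $ i + (if i = c then z else 0)) = y" using True by (simp add: vec_eq_iff)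
  ultimately show ?thesis
    by (intro bexI[of _ "space (fpp_space \<mu>)"] conjI ballI exI[of _ 0]) (auto simp: P.prob_space)
next
  case False
  define s where "s = sgn z"
  have s: "\<bar>s\<bar> = 1" "s * \<bar>z\<bar> = z" using False unfolding s_def by (auto simp: sgn_if abs_if)
  let ?v = "qmap c j s y"
  let ?i = "\<lambda>e. {?v (src e), ?v (tgt e)}"
  have r: "range ?i \<subseteq> lattice_edges" using qmap_edge[OF cj s(1)] by (intro image_subsetI)
  have z: "0 < nat \<bar>z\<bar>" using False by simp
  from quadrant_prob[OF mu inj_qmap_edge[OF cj s(1)] r eps K z]
  obtain G where G: "G \<in> sets (fpp_space \<mu>)" "1 - 4 * \<epsilon> - 1 / real K \<le> measure (fpp_space \<mu>) G"
    "\<forall>w\<in>G. (nat \<bar>z\<bar>, 0) \<in> qball {e. w (?i e) \<le> D0} (2 * nat \<bar>z\<bar> * K)"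
    by (elim bexE conjE)
  have "\<exists>k\<le>2 * nat \<bar>z\<bar> * K. (y, \<chi> i. y $ i + (if i = c then z else 0)) \<in> low_step D0 w ^^ k" if w: "w \<in> G" for w
  proof -
    let ?Q = "{e. w (?i e) \<le> D0}"
    obtain k where k: "k \<le> 2 * nat \<bar>z\<bar> * K" "((0, 0), (nat \<bar>z\<bar>, 0)) \<in> qstep ?Q ^^ k"
      using G(3) w unfolding qball_def by auto
    have step: "(?v u, ?v v) \<in> low_step D0 w" if "(u, v) \<in> qstep ?Q" for u v
      using that qmap_edge[OF cj s(1), of y] unfolding qstep_def low_step_def
      by (auto simp: insert_commute simp del: lattice_edge_iff)
    have "(?v u, ?v v) \<in> low_step D0 w ^^ k" if "(u, v) \<in> qstep ?Q ^^ k" for u v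
      using that
    proof (induction k arbitrary: v)
      case (Suc k)
      then show ?case using step by (meson relpow_Suc_E relpow_Suc_I)
    qed simp
    from this[OF k(2)] have "(?v (0, 0), ?v (nat \<bar>z\<bar>, 0)) \<in> low_step D0 w ^^ k" .
    moreover have "?v (0, 0) = y" by (simp add: qmap_def vec_eq_iff)
    moreover have "?v (nat \<bar>z\<bar>, 0) = (\<chi> i. y $ i + (if i = c then z else 0))"
      using s(2) by (simp add: qmap_def vec_eq_iff)
    ultimately show ?thesis using k(1) by auto
  qed
  with G show ?thesis by blast
qed

text \<open>The coordinates are corrected one after the other and the failure probabilities add.
  Dimension at least 2 supplies the auxiliary direction of each quadrant.\<close>

lemma walk_prob:
  fixes \<mu> :: "real measure" and x :: "int ^ 'd::finite"
  assumes mu: "prob_space \<mu>" "sets \<mu> = sets borel" and d: "2 \<le> CARD('d)"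
    and eps: "measure \<mu> {D0<..} \<le> \<epsilon>" "\<epsilon> \<le> 1 / 24" and K: "0 < K" and I: "finite I"
  shows "\<exists>G\<in>sets (fpp_space \<mu>). 1 - real (card I) * (4 * \<epsilon> + 1 / real K) \<le> measure (fpp_space \<mu>) G \<and>
    (\<forall>w\<in>G. \<exists>k\<le>2 * K * nat (\<Sum>i\<in>I. \<bar>x $ i\<bar>). (0, \<chi> i. if i \<in> I then x $ i else 0) \<in> low_step D0 w ^^ k)"
  using I
proof (induction I rule: finite_induct)
  case empty
  interpret P: prob_space "fpp_space \<mu> :: ((int ^ 'd) set \<Rightarrow> real) measure"
    unfolding fpp_space_def by (intro prob_space_PiM mu(1))
  have "(\<chi> i. 0) = (0 :: int ^ 'd)" by (simp add: vec_eq_iff)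
  then show ?case
    by (intro bexI[of _ "space (fpp_space \<mu>)"] conjI ballI exI[of _ 0]) (auto simp: P.prob_space)
next
  case (insert c I)
  interpret P: prob_space "fpp_space \<mu> :: ((int ^ 'd) set \<Rightarrow> real) measure"
    unfolding fpp_space_def by (intro prob_space_PiM mu(1))
  have "\<exists>j :: 'd. j \<noteq> c"
  proof (rule ccontr)
    assume "\<not> ?thesis"
    then have "(UNIV :: 'd set) = {c}" by auto
    then have "CARD('d) = card {c}" by (rule arg_cong)
    with d show False by simp
  qed
  then obtain j where cj: "c \<noteq> j" by metis
  let ?y = "\<chi> i. if i \<in> I then x $ i else 0"
  from insert.IH obtain G1 where G1: "G1 \<in> sets (fpp_space \<mu>)"
    "1 - real (card I) * (4 * \<epsilon> + 1 / real K) \<le> measure (fpp_space \<mu>) G1"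
    "\<forall>w\<in>G1. \<exists>k\<le>2 * K * nat (\<Sum>i\<in>I. \<bar>x $ i\<bar>). (0, ?y) \<in> low_step D0 w ^^ k" by (elim bexE conjE)
  from stage_prob[OF mu cj eps K, of "x $ c" ?y] obtain G2 where G2: "G2 \<in> sets (fpp_space \<mu>)"
    "1 - 4 * \<epsilon> - 1 / real K \<le> measure (fpp_space \<mu>) G2"
    "\<forall>w\<in>G2. \<exists>k\<le>2 * nat \<bar>x $ c\<bar> * K. (?y, \<chi> i. ?y $ i + (if i = c then x $ c else 0)) \<in> low_step D0 w ^^ k"
    by (elim bexE conjE)
  have yy: "(\<chi> i. ?y $ i + (if i = c then x $ c else 0)) = (\<chi> i. if i \<in> insert c I then x $ i else 0)"
    using insert.hyps by (auto simp: vec_eq_iff)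
  show ?case
  proof (intro bexI[of _ "G1 \<inter> G2"] conjI ballI)
    have "measure (fpp_space \<mu>) G1 + measure (fpp_space \<mu>) G2 \<le> measure (fpp_space \<mu>) (G1 \<inter> G2) + 1"
      using P.finite_measure_Union'[OF G1(1) G2(1)] P.finite_measure_Diff'[OF G2(1) G1(1)] P.prob_le_1[of "G1 \<union> G2"]
      by (simp add: Int_commute)
    then show "1 - real (card (insert c I)) * (4 * \<epsilon> + 1 / real K) \<le> measure (fpp_space \<mu>) (G1 \<inter> G2)"
      using G1(2) G2(2) insert.hyps by (simp add: algebra_simps)
    show "G1 \<inter> G2 \<in> sets (fpp_space \<mu>)" using G1(1) G2(1) by auto
    fix w assume w: "w \<in> G1 \<inter> G2"
    obtain k1 where k1: "k1 \<le> 2 * K * nat (\<Sum>i\<in>I. \<bar>x $ i\<bar>)" "(0, ?y) \<in> low_step D0 w ^^ k1" using G1(3) w by auto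
    obtain k2 where k2: "k2 \<le> 2 * nat \<bar>x $ c\<bar> * K" "(?y, \<chi> i. if i \<in> insert c I then x $ i else 0) \<in> low_step D0 w ^^ k2"
      using G2(3) w unfolding yy by auto
    have "(0, \<chi> i. if i \<in> insert c I then x $ i else 0) \<in> low_step D0 w ^^ (k1 + k2)"
      using k1(2) k2(2) unfolding relpow_add by auto
    moreover have "k1 + k2 \<le> 2 * K * nat (\<Sum>i\<in>insert c I. \<bar>x $ i\<bar>)"
      using k1(1) k2(1) insert.hyps by (simp add: nat_add_distrib sum_nonneg algebra_simps)
    ultimately show "\<exists>k\<le>2 * K * nat (\<Sum>i\<in>insert c I. \<bar>x $ i\<bar>). (0, \<chi> i. if i \<in> insert c I then x $ i else 0) \<in> low_step D0 w ^^ k"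
      by blast
  qed
qed

text \<open>With \<epsilon> = 1 / (32 d) and K = 8 d, the d stages fail with total probability at
  most 1/8 + 1/8. The weights enter only through a level D0 that they rarely exceed, which exists
  without any moment.\<close>

lemma linear_passage_time:
  fixes \<mu> :: "real measure"
  assumes mu: "prob_space \<mu>" "sets \<mu> = sets borel" and d: "2 \<le> CARD('d::finite)"
  shows "\<exists>D>0. \<forall>x :: int ^ 'd. \<exists>G\<in>sets (fpp_space \<mu>). 3 / 4 \<le> measure (fpp_space \<mu>) G \<and>
    (\<forall>w\<in>G. \<exists>p. sa_path p \<and> hd p = 0 \<and> last p = x \<and> path_time w p \<le> D * real_of_int (l1norm x))"
proof -
  interpret mu: prob_space \<mu> by (rule mu(1))
  define \<epsilon> :: real where "\<epsilon> = 1 / (32 * real (CARD('d)))"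
  define K where "K = 8 * CARD('d)"
  have dpos: "2 \<le> real (CARD('d))" using d by simp
  have eps: "0 < \<epsilon>" "\<epsilon> \<le> 1 / 24" using dpos unfolding \<epsilon>_def by (simp_all add: field_simps del: One_nat_def)
  have K: "0 < K" unfolding K_def using d by simp
  have "(\<lambda>n. measure \<mu> {real n<..}) \<longlonglongrightarrow> measure \<mu> (\<Inter>n. {real n<..})"
  proof (rule mu.finite_Lim_measure_decseq)
    show "range (\<lambda>n. {real n<..}) \<subseteq> mu.events" by (auto simp: mu(2))
    show "decseq (\<lambda>n. {real n<..})" by (auto simp: decseq_def)
  qed
  moreover have "(\<Inter>n. {real n<..}) = {}"
  proof -
    have "\<exists>n. \<not> real n < x" for x :: real using real_arch_simple[of x] by (auto simp: not_less)
    then show ?thesis by auto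
  qed
  ultimately have "(\<lambda>n. measure \<mu> {real n<..}) \<longlonglongrightarrow> 0" by simp
  then have "\<forall>\<^sub>F n in sequentially. measure \<mu> {real n<..} < \<epsilon>" using eps(1) by (intro order_tendstoD)
  then obtain n0 where n0: "measure \<mu> {real n0<..} < \<epsilon>" by (auto simp: eventually_sequentially)
  define D0 where "D0 = real n0"
  \<comment> \<open>The level D0 may be 0; adding 1 keeps D positive.\<close>
  define D where "D = (D0 + 1) * (2 * real K)"
  have D: "0 < D" unfolding D_def D0_def using K by simp
  have "\<exists>G\<in>sets (fpp_space \<mu>). 3 / 4 \<le> measure (fpp_space \<mu>) G \<and>
    (\<forall>w\<in>G. \<exists>p. sa_path p \<and> hd p = 0 \<and> last p = x \<and> path_time w p \<le> D * real_of_int (l1norm x))" for x :: "int ^ 'd"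
  proof -
    have "measure \<mu> {D0<..} \<le> \<epsilon>" using n0 unfolding D0_def by simp
    from walk_prob[OF mu d this eps(2) K, of UNIV x] obtain G where G: "G \<in> sets (fpp_space \<mu>)"
      "1 - real (CARD('d)) * (4 * \<epsilon> + 1 / real K) \<le> measure (fpp_space \<mu>) G"
      "\<forall>w\<in>G. \<exists>k\<le>2 * K * nat (\<Sum>i\<in>UNIV. \<bar>x $ i\<bar>). (0, \<chi> i. if i \<in> UNIV then x $ i else 0) \<in> low_step D0 w ^^ k"
      by (auto simp del: UNIV_I)
    have "real (CARD('d)) * (4 * \<epsilon> + 1 / real K) = 1 / 4"
      unfolding \<epsilon>_def K_def using dpos by (simp add: field_simps)
    then have Gm: "3 / 4 \<le> measure (fpp_space \<mu>) G" using G(2) by simp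
    have "\<exists>p. sa_path p \<and> hd p = 0 \<and> last p = x \<and> path_time w p \<le> D * real_of_int (l1norm x)" if w: "w \<in> G" for w
    proof -
      have "(\<chi> i. if i \<in> UNIV then x $ i else 0) = x" by (simp add: vec_eq_iff)
      then obtain k where k: "k \<le> 2 * K * nat (l1norm x)" "(0, x) \<in> low_step D0 w ^^ k"
        using G(3) w unfolding l1norm_def[symmetric] by auto
      from relpow_distinct_list[OF k(2)] obtain p where p: "p \<noteq> []" "hd p = 0" "last p = x" "distinct p"
        "successively (\<lambda>u v. (u, v) \<in> low_step D0 w) p" "length p \<le> Suc k" by auto
      have step: "{p ! i, p ! Suc i} \<in> lattice_edges \<and> w {p ! i, p ! Suc i} \<le> D0" if "Suc i < length p" for i
        using p(5) that unfolding successively_conv_nth low_step_def by auto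
      have "sa_path p" unfolding sa_path_def using p step by blast
      moreover have "path_time w p \<le> D * real_of_int (l1norm x)"
      proof -
        have "path_time w p = (\<Sum>i\<in>{0..<length p - 1}. w {p ! i, p ! Suc i})"
          unfolding path_time_seg[OF p(4)] seg_time_def ..
        also have "\<dots> \<le> (\<Sum>i\<in>{0..<length p - 1}. D0 + 1)"
        proof (rule sum_mono)
          fix i assume "i \<in> {0..<length p - 1}"
          then have "Suc i < length p" by auto
          then show "w {p ! i, p ! Suc i} \<le> D0 + 1" using step[of i] by auto
        qed
        also have "\<dots> = real (length p - 1) * (D0 + 1)" by simp
        also have "\<dots> \<le> real (2 * K * nat (l1norm x)) * (D0 + 1)"
          using p(6) k(1) unfolding D0_def by (intro mult_right_mono of_nat_mono) auto
        also have "\<dots> = D * real_of_int (l1norm x)" unfolding D_def by simp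
        finally show ?thesis .
      qed
      ultimately show ?thesis using p(2,3) by blast
    qed
    with G(1) Gm show ?thesis by blast
  qed
  with D show ?thesis by blast
qed

section \<open>Shortcuts along geodesics\<close>

lemma sa_path_rev: "sa_path p \<Longrightarrow> sa_path (rev p)"
  unfolding sa_path_def
proof (intro conjI allI impI; (elim conjE)?)
  fix i assume p: "\<forall>i. Suc i < length p \<longrightarrow> {p ! i, p ! Suc i} \<in> lattice_edges" and i: "Suc i < length (rev p)"
  let ?j = "length p - Suc (Suc i)"
  have "{p ! ?j, p ! Suc ?j} \<in> lattice_edges" using p i by simp
  moreover have "Suc ?j = length p - Suc i" using i by simp
  ultimately show "{rev p ! i, rev p ! Suc i} \<in> lattice_edges"
    using i by (simp add: rev_nth insert_commute del: lattice_edge_iff)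
qed auto

lemma sa_path_sub:
  assumes "sa_path p" "x \<le> y" "y < length p"
  defines "q \<equiv> take (Suc (y - x)) (drop x p)"
  shows "sa_path q" "hd q = p ! x" "last q = p ! y" "set q \<subseteq> set p" "length q = Suc (y - x)"
proof -
  show len: "length q = Suc (y - x)" using assms unfolding q_def by simp
  have nth: "q ! i = p ! (x + i)" if "i < length q" for i
    using that assms unfolding q_def by simp
  have ne: "q \<noteq> []" using len by auto
  show "hd q = p ! x" using nth[of 0] ne by (simp add: hd_conv_nth)
  show "last q = p ! y" using nth[of "y - x"] ne len assms by (simp add: last_conv_nth)
  show "set q \<subseteq> set p" unfolding q_def by (meson order_trans set_drop_subset set_take_subset)
  have "distinct q" using assms(1) unfolding q_def sa_path_def by simp
  moreover have "{q ! i, q ! Suc i} \<in> lattice_edges" if "Suc i < length q" for i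
    using sa_path_edge[OF assms(1), of "x + i"] nth[of i] nth[of "Suc i"] that len assms by simp
  ultimately show "sa_path q" unfolding sa_path_def using ne by simp
qed

lemma l1norm_step_towards:
  fixes a b :: "int ^ 'd::finite"
  assumes "a \<noteq> b"
  shows "\<exists>a'. l1norm (a - a') = 1 \<and> l1norm (a' - b) = l1norm (a - b) - 1"
proof -
  obtain c where c: "a $ c \<noteq> b $ c" using assms by (auto simp: vec_eq_iff)
  let ?a = "\<chi> i. if i = c then a $ i + sgn (b $ i - a $ i) else a $ i"
  have "l1norm (a - ?a) = (\<Sum>i\<in>UNIV. if i = c then 1 else 0)"
    unfolding l1norm_def using c by (intro sum.cong) (auto simp: sgn_if)
  moreover have "l1norm (?a - b) = (\<Sum>i\<in>UNIV. \<bar>(a - b) $ i\<bar> - (if i = c then 1 else 0))"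
    unfolding l1norm_def using c by (intro sum.cong) (auto simp: sgn_if abs_if)
  ultimately show ?thesis by (intro exI[of _ ?a]) (simp add: sum_subtractf l1norm_def)
qed

text \<open>Every new first vertex is strictly farther from b than all later ones, so the path is
  simple. The distance bound later locates the start of a shortcut.\<close>

lemma l1_geodesic:
  fixes a b :: "int ^ 'd::finite"
  shows "\<exists>p. sa_path p \<and> hd p = a \<and> last p = b \<and> length p = Suc (nat (l1norm (a - b))) \<and>
    (\<forall>v\<in>set p. l1norm (v - b) \<le> l1norm (a - b))"
proof (induction "nat (l1norm (a - b))" arbitrary: a)
  case 0
  then have "l1norm (a - b) = 0" using l1norm_nonneg[of "a - b"] by linarith
  then have "a = b" by simp
  then show ?case by (intro exI[of _ "[a]"]) (auto simp: sa_path_def)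
next
  case (Suc n)
  then have "a \<noteq> b" by auto
  then obtain a' where a': "l1norm (a - a') = 1" "l1norm (a' - b) = l1norm (a - b) - 1"
    using l1norm_step_towards by blast
  then have "n = nat (l1norm (a' - b))" using Suc.hyps(2) by simp
  from Suc.hyps(1)[OF this] obtain p where p: "sa_path p" "hd p = a'" "last p = b"
    "length p = Suc (nat (l1norm (a' - b)))" "\<forall>v\<in>set p. l1norm (v - b) \<le> l1norm (a' - b)" by auto
  have "p \<noteq> []" using p(1) unfolding sa_path_def by simp
  then have p0: "p ! 0 = a'" using p(2) by (simp add: hd_conv_nth)
  have "a \<notin> set p" using p(5) a'(2) by force
  then have "distinct (a # p)" using p(1) unfolding sa_path_def by simp
  moreover have "{(a # p) ! i, (a # p) ! Suc i} \<in> lattice_edges" if "Suc i < length (a # p)" for i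
  proof (cases i)
    case 0
    then show ?thesis using p0 a'(1) by simp
  next
    case (Suc k)
    then show ?thesis using sa_path_edge[OF p(1), of k] that by simp
  qed
  ultimately have "sa_path (a # p)" unfolding sa_path_def by blast
  moreover have "length (a # p) = Suc (nat (l1norm (a - b)))" using p(4) a'(2) Suc.hyps(2) by simp
  moreover have "\<forall>v\<in>set (a # p). l1norm (v - b) \<le> l1norm (a - b)" using p(5) a'(2) by fastforce
  ultimately show ?case using \<open>p \<noteq> []\<close> p(3) by (intro exI[of _ "a # p"]) simp
qed

text \<open>Besides the first edge of the path, these are the edges at its interior vertices.  Once those off the path
  are heavy, a geodesic that uses an edge of the path cannot leave it without using a heavy edge.\<close>
definition nbhd :: "(int ^ 'd::finite) list \<Rightarrow> (int ^ 'd) set set" where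
  "nbhd \<sigma> = insert {\<sigma> ! 0, \<sigma> ! 1} {e \<in> lattice_edges. \<exists>i. 0 < i \<and> Suc i < length \<sigma> \<and> \<sigma> ! i \<in> e}"

text \<open>The conditions on the indices before i and after j ensure that replacing the stretch of
  \<pi> by \<sigma> leaves a self-avoiding path. The inequality says that the replacement pays off
  as soon as the first edge of \<sigma> weighs at most B and the others at most s.\<close>

definition shortcut :: "((int ^ 'd::finite) set \<Rightarrow> real) \<Rightarrow> (int ^ 'd) list \<Rightarrow> real \<Rightarrow> real \<Rightarrow> (int ^ 'd) list \<Rightarrow> bool" where
  "shortcut w \<pi> s B \<sigma> \<longleftrightarrow> sa_path \<sigma> \<and> 2 \<le> length \<sigma> \<and> (\<exists>i j. i < j \<and> j < length \<pi> \<and> \<pi> ! i = hd \<sigma> \<and> \<pi> ! j = last \<sigma> \<and>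
     (\<forall>k<i. \<pi> ! k \<notin> set \<sigma>) \<and> (\<forall>k. j < k \<longrightarrow> k < length \<pi> \<longrightarrow> \<pi> ! k \<notin> set \<sigma>) \<and>
     s * real (length \<sigma> - 1) + B < seg_time w \<pi> i j)"

lemma seg_time_split: "i \<le> j \<Longrightarrow> j \<le> k \<Longrightarrow> seg_time w p i k = seg_time w p i j + seg_time w p j k"
  unfolding seg_time_def by (simp add: sum.atLeastLessThan_concat)

lemma seg_time_nonneg:
  assumes "sa_path p" "\<And>e. e \<in> lattice_edges \<Longrightarrow> 0 \<le> w e" "j < length p"
  shows "0 \<le> seg_time w p i j"
  unfolding seg_time_def
proof (rule sum_nonneg)
  fix k assume "k \<in> {i..<j}"
  then have "Suc k < length p" using assms(3) by simp
  then show "0 \<le> w {p ! k, p ! Suc k}" by (intro assms(2) sa_path_edge[OF assms(1)])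
qed

text \<open>Passing from i and j to the first and last visits of the l^1-path cannot decrease the
  time along \<pi> nor lengthen the detour, so slowness is inherited. These visits may occur in
  reverse order along the l^1-path, hence the reversal.\<close>

lemma exists_shortcut:
  fixes \<pi> :: "(int ^ 'd::finite) list"
  assumes \<pi>: "sa_path \<pi>" and ij: "i < j" "j < length \<pi>"
    and nonneg: "\<And>e. e \<in> lattice_edges \<Longrightarrow> 0 \<le> w e" and s: "0 \<le> s"
    and slow: "s * real_of_int (l1norm (\<pi> ! i - \<pi> ! j)) + B < seg_time w \<pi> i j"
  shows "\<exists>\<sigma>. shortcut w \<pi> s B \<sigma> \<and> int (length \<sigma> - 1) \<le> l1norm (\<pi> ! i - \<pi> ! j) \<and>
    l1norm (hd \<sigma> - \<pi> ! j) \<le> l1norm (\<pi> ! i - \<pi> ! j)"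
proof -
  obtain p where p: "sa_path p" "hd p = \<pi> ! i" "last p = \<pi> ! j" "length p = Suc (nat (l1norm (\<pi> ! i - \<pi> ! j)))"
    "\<forall>v\<in>set p. l1norm (v - \<pi> ! j) \<le> l1norm (\<pi> ! i - \<pi> ! j)" using l1_geodesic by blast
  have pne: "p \<noteq> []" using p(1) unfolding sa_path_def by simp
  define X where "X = {k. k < length \<pi> \<and> \<pi> ! k \<in> set p}"
  have iX: "i \<in> X" using p(2) pne ij unfolding X_def by (metis (mono_tags, lifting) hd_in_set mem_Collect_eq order_less_trans)
  have jX: "j \<in> X" using p(3) pne ij unfolding X_def by (metis (mono_tags, lifting) last_in_set mem_Collect_eq)
  have finX: "finite X" unfolding X_def by simp
  define a where "a = Min X"
  define b where "b = Max X"
  have ab: "a \<in> X" "b \<in> X" "a \<le> i" "j \<le> b"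
    unfolding a_def b_def using iX jX finX by (auto intro: Min_in Max_in)
  have before: "\<pi> ! k \<notin> set p" if "k < a" for k
    using that Min_le[OF finX, of k] ab(1) unfolding a_def X_def by fastforce
  have after: "\<pi> ! k \<notin> set p" if "b < k" "k < length \<pi>" for k
    using that Max_ge[OF finX, of k] unfolding b_def X_def by fastforce
  obtain x y where x: "x < length p" "p ! x = \<pi> ! a" and y: "y < length p" "p ! y = \<pi> ! b"
    using ab(1,2) unfolding X_def by (auto simp: in_set_conv_nth)
  have "\<pi> ! a \<noteq> \<pi> ! b"
    using \<pi> ab ij unfolding X_def sa_path_def by (auto simp: nth_eq_iff_index_eq)
  then have xy: "x \<noteq> y" using x y by auto
  have "\<exists>\<sigma>. sa_path \<sigma> \<and> 2 \<le> length \<sigma> \<and> hd \<sigma> = \<pi> ! a \<and> last \<sigma> = \<pi> ! b \<and> set \<sigma> \<subseteq> set p \<and> length \<sigma> \<le> length p"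
  proof (cases "x < y")
    case True
    then show ?thesis
      using sa_path_sub[OF p(1), of x y] x y by (intro exI[of _ "take (Suc (y - x)) (drop x p)"]) auto
  next
    case False
    then have yx: "y < x" using xy by simp
    let ?q = "take (Suc (x - y)) (drop y p)"
    note q = sa_path_sub[OF p(1), of y x]
    have "?q \<noteq> []" using yx x by auto
    then show ?thesis
      using q yx x y sa_path_rev[of ?q] by (intro exI[of _ "rev ?q"]) (auto simp: hd_rev last_rev)
  qed
  then obtain \<sigma> where \<sigma>: "sa_path \<sigma>" "2 \<le> length \<sigma>" "hd \<sigma> = \<pi> ! a" "last \<sigma> = \<pi> ! b" "set \<sigma> \<subseteq> set p" "length \<sigma> \<le> length p"
    by blast
  have len: "int (length \<sigma> - 1) \<le> l1norm (\<pi> ! i - \<pi> ! j)"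
    using \<sigma>(6) p(4) l1norm_nonneg[of "\<pi> ! i - \<pi> ! j"] by linarith
  have bl: "b < length \<pi>" using ab(2) unfolding X_def by simp
  have "seg_time w \<pi> a b = seg_time w \<pi> a i + seg_time w \<pi> i j + seg_time w \<pi> j b"
    using seg_time_split[of a i b w \<pi>] seg_time_split[of i j b w \<pi>] ab ij by simp
  moreover have "0 \<le> seg_time w \<pi> a i" "0 \<le> seg_time w \<pi> j b"
    using ij bl by (auto intro!: seg_time_nonneg[OF \<pi> nonneg])
  moreover have "s * real (length \<sigma> - 1) \<le> s * real_of_int (l1norm (\<pi> ! i - \<pi> ! j))"
  proof (intro mult_left_mono s)
    show "real (length \<sigma> - 1) \<le> real_of_int (l1norm (\<pi> ! i - \<pi> ! j))" using len by linarith
  qed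
  ultimately have "s * real (length \<sigma> - 1) + B < seg_time w \<pi> a b" using slow by linarith
  moreover have "a < b" using ab ij by simp
  ultimately have "shortcut w \<pi> s B \<sigma>"
    unfolding shortcut_def using \<sigma> bl before after by (intro conjI exI[of _ a] exI[of _ b]) auto
  moreover have "hd \<sigma> \<in> set p" using \<sigma> by (metis hd_in_set sa_path_def subsetD)
  ultimately show ?thesis using len p(5) by blast
qed

lemma nbhd_path_edges: "2 \<le> length \<sigma> \<Longrightarrow> sa_path \<sigma> \<Longrightarrow> path_edges \<sigma> \<subseteq> nbhd \<sigma>"
proof
  fix e assume \<sigma>: "2 \<le> length \<sigma>" "sa_path \<sigma>" and "e \<in> path_edges \<sigma>"
  then obtain i where i: "e = {\<sigma> ! i, \<sigma> ! Suc i}" "Suc i < length \<sigma>" unfolding path_edges_def by auto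
  show "e \<in> nbhd \<sigma>"
  proof (cases "i = 0")
    case False
    then show ?thesis unfolding nbhd_def i(1) using i(2) sa_path_edge[OF \<sigma>(2) i(2)] by auto
  qed (simp add: nbhd_def i(1))
qed

lemma nbhd_subset: "2 \<le> length \<sigma> \<Longrightarrow> sa_path \<sigma> \<Longrightarrow> nbhd \<sigma> \<subseteq> lattice_edges"
  unfolding nbhd_def using sa_path_edge[of \<sigma> 0] by auto

text \<open>Outside the replaced stretch \<pi> meets \<sigma> at most in its two ends, so the
  weights of \<pi> there are untouched by resampling.\<close>

lemma nbhd_avoid:
  assumes "sa_path \<sigma>" "2 \<le> length \<sigma>" "u \<notin> set \<sigma>" "v \<notin> set \<sigma> \<or> v = hd \<sigma> \<or> v = last \<sigma>"
  shows "{u, v} \<notin> nbhd \<sigma>"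
proof
  assume "{u, v} \<in> nbhd \<sigma>"
  then consider "{u, v} = {\<sigma> ! 0, \<sigma> ! 1}" | i where "0 < i" "Suc i < length \<sigma>" "\<sigma> ! i \<in> {u, v}"
    unfolding nbhd_def by auto
  then show False
  proof cases
    case 1
    then have "u \<in> {\<sigma> ! 0, \<sigma> ! 1}" by auto
    moreover have "\<sigma> ! 0 \<in> set \<sigma>" "\<sigma> ! 1 \<in> set \<sigma>" using assms(2) by (auto intro!: nth_mem)
    ultimately show False using assms(3) by auto
  next
    case (2 i)
    have "\<sigma> ! i \<in> set \<sigma>" using 2(2) by simp
    then have v: "\<sigma> ! i = v" "v = hd \<sigma> \<or> v = last \<sigma>" using 2(3) assms(3,4) by auto
    have d: "distinct \<sigma>" "\<sigma> \<noteq> []" using assms(1) unfolding sa_path_def by auto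
    have "\<sigma> ! i \<noteq> \<sigma> ! 0" "\<sigma> ! i \<noteq> \<sigma> ! (length \<sigma> - 1)"
      using 2 d by (auto simp: nth_eq_iff_index_eq)
    with v d(2) show False by (auto simp: hd_conv_nth last_conv_nth)
  qed
qed

text \<open>Splice \<sigma> into \<pi>. The outer parts keep their weights by
  \<open>nbhd_avoid\<close>, and the new middle part costs at most s (|\<sigma>| - 1) + B, less than
  the old one.\<close>

lemma shortcut_path:
  fixes \<pi> :: "(int ^ 'd::finite) list"
  assumes \<pi>: "sa_path \<pi>" and sc: "shortcut w \<pi> s B \<sigma>"
    and nonneg: "\<And>e. e \<in> lattice_edges \<Longrightarrow> 0 \<le> w' e" and s: "0 \<le> s"
    and off: "\<And>e. e \<in> lattice_edges \<Longrightarrow> e \<notin> nbhd \<sigma> \<Longrightarrow> w' e = w e"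
    and first: "w' {\<sigma> ! 0, \<sigma> ! 1} \<le> B"
    and low: "\<And>i. 0 < i \<Longrightarrow> Suc i < length \<sigma> \<Longrightarrow> w' {\<sigma> ! i, \<sigma> ! Suc i} \<le> s"
  shows "\<exists>p. sa_path p \<and> hd p = hd \<pi> \<and> last p = last \<pi> \<and> path_time w' p < path_time w \<pi>"
proof -
  obtain i j where \<sigma>: "sa_path \<sigma>" "2 \<le> length \<sigma>" and ij: "i < j" "j < length \<pi>" "\<pi> ! i = hd \<sigma>" "\<pi> ! j = last \<sigma>"
    and before: "\<And>k. k < i \<Longrightarrow> \<pi> ! k \<notin> set \<sigma>" and after: "\<And>k. j < k \<Longrightarrow> k < length \<pi> \<Longrightarrow> \<pi> ! k \<notin> set \<sigma>"
    and slow: "s * real (length \<sigma> - 1) + B < seg_time w \<pi> i j"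
    using sc unfolding shortcut_def by blast
  have d: "distinct \<pi>" "distinct \<sigma>" "\<sigma> \<noteq> []" "\<pi> \<noteq> []" using \<pi> \<sigma> unfolding sa_path_def by auto
  have \<sigma>0: "\<sigma> ! 0 = \<pi> ! i" and \<sigma>l: "\<sigma> ! (length \<sigma> - 1) = \<pi> ! j"
    using ij d(3) by (simp_all add: hd_conv_nth last_conv_nth)
  define p where "p = take i \<pi> @ \<sigma> @ drop (Suc j) \<pi>"
  define E1 where "E1 = (\<lambda>k. {\<pi> ! k, \<pi> ! Suc k}) ` {0..<i}"
  define E3 where "E3 = (\<lambda>k. {\<pi> ! k, \<pi> ! Suc k}) ` {j..<length \<pi> - 1}"
  have nth_p: "p ! k = (if k < i then \<pi> ! k else if k < i + length \<sigma> then \<sigma> ! (k - i) else \<pi> ! (Suc j + (k - i - length \<sigma>)))"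
    if "k < length p" for k
    using that ij unfolding p_def by (auto simp: nth_append min_def)
  have len_p: "length p = i + length \<sigma> + (length \<pi> - Suc j)" unfolding p_def using ij by simp
  have edges: "{p ! k, p ! Suc k} \<in> E1 \<union> path_edges \<sigma> \<union> E3" if k: "Suc k < length p" for k
  proof -
    \<comment> \<open>The second and fourth cases are the junctions, where the ends of \<sigma>
      coincide with the vertices i and j of \<pi>.\<close>
    consider "Suc k < i" | "Suc k = i" | "i \<le> k" "Suc k < i + length \<sigma>" | "Suc k = i + length \<sigma>" | "i + length \<sigma> \<le> k"
      by linarith
    then show ?thesis
    proof cases
      case 1
      then show ?thesis using nth_p[of k] nth_p[of "Suc k"] k unfolding E1_def by auto
    next
      case 2
      then have "{p ! k, p ! Suc k} = {\<pi> ! k, \<pi> ! Suc k}"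
        using nth_p[of k] nth_p[of "Suc k"] k \<sigma>0 \<sigma>(2) by auto
      then show ?thesis using 2 unfolding E1_def by auto
    next
      case 3
      then have "{p ! k, p ! Suc k} = {\<sigma> ! (k - i), \<sigma> ! Suc (k - i)}"
        using nth_p[of k] nth_p[of "Suc k"] k by (auto simp: Suc_diff_le)
      moreover have "Suc (k - i) < length \<sigma>" using 3 by linarith
      ultimately show ?thesis unfolding path_edges_def by blast
    next
      case 4
      then have k': "k = i + (length \<sigma> - 1)" using \<sigma>(2) by linarith
      have "\<not> k < i" "k < i + length \<sigma>" "k - i = length \<sigma> - 1" using k' \<sigma>(2) by auto
      then have "p ! k = \<pi> ! j" using nth_p[of k] k \<sigma>l by simp
      moreover have "p ! Suc k = \<pi> ! Suc j" using nth_p[of "Suc k"] k 4 by simp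
      moreover have "j < length \<pi> - 1" using k 4 len_p by simp
      ultimately show ?thesis unfolding E3_def by auto
    next
      case 5
      define m where "m = Suc j + (k - i - length \<sigma>)"
      have "p ! k = \<pi> ! m" "p ! Suc k = \<pi> ! Suc m"
        using nth_p[of k] nth_p[of "Suc k"] k 5 unfolding m_def by (auto simp: Suc_diff_le)
      moreover have "j \<le> m" "m < length \<pi> - 1" using k 5 len_p unfolding m_def by auto
      ultimately show ?thesis unfolding E3_def by auto
    qed
  qed
  have E13: "E1 \<subseteq> lattice_edges" "E3 \<subseteq> lattice_edges"
    unfolding E1_def E3_def using sa_path_edge[OF \<pi>] ij by auto
  have sub: "E1 \<union> path_edges \<sigma> \<union> E3 \<subseteq> lattice_edges" using E13 path_edges_subset[OF \<sigma>(1)] by blast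
  have "distinct p"
  proof -
    have "v \<notin> set \<sigma>" if "v \<in> set (take i \<pi>)" for v
    proof -
      obtain k where "k < i" "v = \<pi> ! k" using \<open>v \<in> set (take i \<pi>)\<close> unfolding in_set_conv_nth by auto
      then show ?thesis using before by simp
    qed
    then have "set (take i \<pi>) \<inter> set \<sigma> = {}" by blast
    moreover have "v \<notin> set \<sigma>" if "v \<in> set (drop (Suc j) \<pi>)" for v
    proof -
      obtain k where "k < length \<pi> - Suc j" "v = \<pi> ! (Suc j + k)"
        using \<open>v \<in> set (drop (Suc j) \<pi>)\<close> unfolding in_set_conv_nth by auto
      then show ?thesis using after[of "Suc j + k"] by simp
    qed
    then have "set (drop (Suc j) \<pi>) \<inter> set \<sigma> = {}" by blast
    moreover have "set (take i \<pi>) \<inter> set (drop (Suc j) \<pi>) = {}"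
      using ij d(1) by (intro set_take_disj_set_drop_if_distinct) auto
    ultimately show ?thesis unfolding p_def using d by auto
  qed
  moreover have "p \<noteq> []" unfolding p_def using d by simp
  ultimately have sap: "sa_path p" unfolding sa_path_def using edges sub by blast
  have hd: "hd p = hd \<pi>"
  proof (cases "i = 0")
    case True
    then show ?thesis unfolding p_def using ij(3) d by (simp add: hd_conv_nth[of \<pi>])
  next
    case False
    then show ?thesis unfolding p_def using d by simp
  qed
  have last: "last p = last \<pi>"
  proof (cases "Suc j = length \<pi>")
    case True
    then have "j = length \<pi> - 1" by simp
    then show ?thesis unfolding p_def using True ij(4) d by (simp add: last_conv_nth[of \<pi>])
  next
    case False
    then show ?thesis unfolding p_def using ij d by (simp add: last_append)
  qed
  have t1: "sum w' E1 = seg_time w \<pi> 0 i"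
  proof -
    have "sum w' E1 = (\<Sum>k\<in>{0..<i}. w' {\<pi> ! k, \<pi> ! Suc k})"
      unfolding E1_def using inj_path_edges[OF d(1)] ij
      by (subst sum.reindex) (auto intro: inj_on_subset)
    also have "\<dots> = seg_time w \<pi> 0 i"
      unfolding seg_time_def
    proof (intro sum.cong refl)
      fix k assume k: "k \<in> {0..<i}"
      have "\<pi> ! Suc k \<notin> set \<sigma> \<or> \<pi> ! Suc k = hd \<sigma>" using before[of "Suc k"] k ij by (cases "Suc k = i") auto
      then have "{\<pi> ! k, \<pi> ! Suc k} \<notin> nbhd \<sigma>" using before[of k] k by (intro nbhd_avoid[OF \<sigma>]) auto
      moreover have "{\<pi> ! k, \<pi> ! Suc k} \<in> lattice_edges" using sa_path_edge[OF \<pi>, of k] k ij by simp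
      ultimately show "w' {\<pi> ! k, \<pi> ! Suc k} = w {\<pi> ! k, \<pi> ! Suc k}" by (intro off)
    qed
    finally show ?thesis .
  qed
  have t3: "sum w' E3 = seg_time w \<pi> j (length \<pi> - 1)"
  proof -
    have "sum w' E3 = (\<Sum>k\<in>{j..<length \<pi> - 1}. w' {\<pi> ! k, \<pi> ! Suc k})"
      unfolding E3_def using inj_path_edges[OF d(1)] ij
      by (subst sum.reindex) (auto intro: inj_on_subset)
    also have "\<dots> = seg_time w \<pi> j (length \<pi> - 1)"
      unfolding seg_time_def
    proof (intro sum.cong refl)
      fix k assume k: "k \<in> {j..<length \<pi> - 1}"
      then have k': "Suc k < length \<pi>" by auto
      have "\<pi> ! k \<notin> set \<sigma> \<or> \<pi> ! k = last \<sigma>" using after[of k] k k' ij by (cases "k = j") auto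
      then have "{\<pi> ! Suc k, \<pi> ! k} \<notin> nbhd \<sigma>" using after[of "Suc k"] k k' by (intro nbhd_avoid[OF \<sigma>]) auto
      moreover have "{\<pi> ! k, \<pi> ! Suc k} \<in> lattice_edges" by (rule sa_path_edge[OF \<pi> k'])
      ultimately show "w' {\<pi> ! k, \<pi> ! Suc k} = w {\<pi> ! k, \<pi> ! Suc k}" by (intro off) (simp_all add: insert_commute)
    qed
    finally show ?thesis .
  qed
  have t2: "sum w' (path_edges \<sigma>) \<le> s * real (length \<sigma> - 1) + B"
  proof -
    have "sum w' (path_edges \<sigma>) = seg_time w' \<sigma> 0 1 + seg_time w' \<sigma> 1 (length \<sigma> - 1)"
      using path_time_seg[OF d(2), of w'] seg_time_split[of 0 1 "length \<sigma> - 1" w' \<sigma>] \<sigma>(2)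
      unfolding path_time_def by simp
    moreover have "seg_time w' \<sigma> 0 1 \<le> B" using first unfolding seg_time_def by simp
    moreover have "seg_time w' \<sigma> 1 (length \<sigma> - 1) \<le> (\<Sum>k\<in>{1..<length \<sigma> - 1}. s)"
      unfolding seg_time_def using low by (intro sum_mono) auto
    moreover have "(\<Sum>k\<in>{1..<length \<sigma> - 1}. s) \<le> s * real (length \<sigma> - 1)"
      using s by (simp add: mult.commute mult_left_mono)
    ultimately show ?thesis by linarith
  qed
  have fin: "finite E1" "finite E3" unfolding E1_def E3_def by auto
  have "path_time w' p \<le> sum w' (E1 \<union> path_edges \<sigma> \<union> E3)"
    unfolding path_time_def
  proof (rule sum_mono2)
    show "path_edges p \<subseteq> E1 \<union> path_edges \<sigma> \<union> E3" unfolding path_edges_def[of p] using edges by blast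
  qed (use fin sub nonneg in auto)
  also have "\<dots> \<le> sum w' E1 + sum w' (path_edges \<sigma>) + sum w' E3"
  proof -
    have "sum w' (E1 \<union> path_edges \<sigma> \<union> E3) \<le> sum w' (E1 \<union> path_edges \<sigma>) + sum w' E3"
      using fin E13(2) nonneg by (subst sum_Un) (auto intro!: sum_nonneg)
    moreover have "sum w' (E1 \<union> path_edges \<sigma>) \<le> sum w' E1 + sum w' (path_edges \<sigma>)"
      using fin E13(1) nonneg by (subst sum_Un) (auto intro!: sum_nonneg)
    ultimately show ?thesis by linarith
  qed
  also have "\<dots> < seg_time w \<pi> 0 i + seg_time w \<pi> i j + seg_time w \<pi> j (length \<pi> - 1)"
    using t1 t2 t3 slow by linarith
  also have "\<dots> = path_time w \<pi>"
    unfolding path_time_seg[OF d(1)]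
    using seg_time_split[of 0 i "length \<pi> - 1" w \<pi>] seg_time_split[of i j "length \<pi> - 1" w \<pi>] ij by simp
  finally show ?thesis using sap hd last by blast
qed

text \<open>Suppose that all edges of \<open>nbhd\<close> used by \<pi>' are light, hence edges of
  \<sigma> other than the first, and let k be the least index of one of them. The vertex
  \<open>\<sigma> ! k\<close> is interior and not an end of \<pi>', so \<pi>' has two distinct edges
  there. Both lie in \<open>nbhd\<close> and are thus light, but minimality of k leaves a single
  candidate.\<close>

lemma heavy_edge_used:
  fixes \<pi> \<pi>' :: "(int ^ 'd::finite) list"
  assumes \<pi>: "sa_path \<pi>" and sc: "shortcut w \<pi> s B \<sigma>"
    and \<pi>': "sa_path \<pi>'" "hd \<pi>' = hd \<pi>" "last \<pi>' = last \<pi>" "path_edges \<pi>' \<inter> nbhd \<sigma> \<noteq> {}"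
    and wall: "\<And>e. e \<in> nbhd \<sigma> \<Longrightarrow> (\<And>i. 0 < i \<Longrightarrow> Suc i < length \<sigma> \<Longrightarrow> e \<noteq> {\<sigma> ! i, \<sigma> ! Suc i}) \<Longrightarrow> M \<le> w' e"
  shows "\<exists>e\<in>path_edges \<pi>' \<inter> nbhd \<sigma>. M \<le> w' e"
proof (rule ccontr)
  assume neg: "\<not> ?thesis"
  obtain i j where \<sigma>: "sa_path \<sigma>" "2 \<le> length \<sigma>" and ij: "i < j" "j < length \<pi>" "\<pi> ! i = hd \<sigma>" "\<pi> ! j = last \<sigma>"
    and before: "\<And>k. k < i \<Longrightarrow> \<pi> ! k \<notin> set \<sigma>" and after: "\<And>k. j < k \<Longrightarrow> k < length \<pi> \<Longrightarrow> \<pi> ! k \<notin> set \<sigma>"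
    using sc unfolding shortcut_def by blast
  have d: "distinct \<pi>" "distinct \<sigma>" "\<sigma> \<noteq> []" "\<pi> \<noteq> []" "distinct \<pi>'" "\<pi>' \<noteq> []" using \<pi> \<sigma> \<pi>' unfolding sa_path_def by auto
  define P where "P k \<longleftrightarrow> 0 < k \<and> Suc k < length \<sigma> \<and> {\<sigma> ! k, \<sigma> ! Suc k} \<in> path_edges \<pi>'" for k
  have low: "\<exists>k. 0 < k \<and> Suc k < length \<sigma> \<and> e = {\<sigma> ! k, \<sigma> ! Suc k}" if "e \<in> path_edges \<pi>'" "e \<in> nbhd \<sigma>" for e
    using that wall[of e] neg by blast
  then have "\<exists>k. P k" unfolding P_def using \<pi>'(4) by blast
  then have Pk: "P (LEAST k. P k)" by (rule LeastI_ex)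
  define k where "k = (LEAST k. P k)"
  have k: "0 < k" "Suc k < length \<sigma>" "{\<sigma> ! k, \<sigma> ! Suc k} \<in> path_edges \<pi>'"
  proof -
    have "P k" using Pk by (simp only: k_def)
    then show "0 < k" "Suc k < length \<sigma>" "{\<sigma> ! k, \<sigma> ! Suc k} \<in> path_edges \<pi>'" unfolding P_def by auto
  qed
  let ?v = "\<sigma> ! k"
  have vs: "?v \<noteq> \<sigma> ! 0" "?v \<noteq> \<sigma> ! (length \<sigma> - 1)" "?v \<in> set \<sigma>"
    using k nth_eq_iff_index_eq[OF d(2), of k 0] nth_eq_iff_index_eq[OF d(2), of k "length \<sigma> - 1"] d(3) by auto
  \<comment> \<open>The ends of \<pi>' are those of \<pi>, and an end of \<pi> can meet \<sigma>
    only in an end of \<sigma>.\<close>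
  have vhd: "?v \<noteq> hd \<pi>'"
  proof
    assume "?v = hd \<pi>'"
    then have "\<pi> ! 0 = ?v" using \<pi>'(2) d(4) by (simp add: hd_conv_nth)
    then have "i = 0" using before[of 0] vs(3) by (cases i) auto
    then show False using \<open>\<pi> ! 0 = ?v\<close> ij(3) vs(1) d(3) by (simp add: hd_conv_nth)
  qed
  have vlast: "?v \<noteq> last \<pi>'"
  proof
    assume "?v = last \<pi>'"
    then have v: "\<pi> ! (length \<pi> - 1) = ?v" using \<pi>'(3) d(4) by (simp add: last_conv_nth)
    then have "\<not> j < length \<pi> - 1" using after[of "length \<pi> - 1"] vs(3) d(4) by auto
    then have "j = length \<pi> - 1" using ij(2) by linarith
    then show False using v ij(4) vs(2) d(3) by (simp add: last_conv_nth)
  qed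
  from k(3) obtain m where m0: "{\<sigma> ! k, \<sigma> ! Suc k} = {\<pi>' ! m, \<pi>' ! Suc m}" "Suc m < length \<pi>'"
    unfolding path_edges_def by auto
  then have "?v = \<pi>' ! m \<or> ?v = \<pi>' ! Suc m" by (auto simp: doubleton_eq_iff)
  then obtain q where q: "q < length \<pi>'" "?v = \<pi>' ! q" using m0(2) Suc_lessD by blast
  have q0: "0 < q" using q vhd d(6) by (cases q) (auto simp: hd_conv_nth)
  have ql: "Suc q < length \<pi>'"
  proof (rule ccontr)
    assume "\<not> ?thesis"
    then have "q = length \<pi>' - 1" using q(1) by linarith
    then show False using q(2) vlast d(6) by (simp add: last_conv_nth)
  qed
  let ?f1 = "{\<pi>' ! (q - 1), \<pi>' ! q}" and ?f2 = "{\<pi>' ! q, \<pi>' ! Suc q}"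
  have f: "?f1 \<in> path_edges \<pi>'" "?f2 \<in> path_edges \<pi>'"
  proof -
    have "{\<pi>' ! k, \<pi>' ! Suc k} \<in> path_edges \<pi>'" if "Suc k < length \<pi>'" for k
      using that unfolding path_edges_def by blast
    from this[of "q - 1"] this[of q] show "?f1 \<in> path_edges \<pi>'" "?f2 \<in> path_edges \<pi>'"
      using q0 ql by simp_all
  qed
  have f12: "?f1 \<noteq> ?f2"
  proof
    assume "?f1 = ?f2"
    then have "{\<pi>' ! (q - 1), \<pi>' ! Suc (q - 1)} = {\<pi>' ! q, \<pi>' ! Suc q}" using q0 by simp
    moreover have "q - 1 \<in> {..<length \<pi>' - 1}" "q \<in> {..<length \<pi>' - 1}" using ql by auto
    ultimately have "q - 1 = q" by (rule inj_onD[OF inj_path_edges[OF d(5)]])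
    then show False using q0 by simp
  qed
  have fn: "?f1 \<in> nbhd \<sigma>" "?f2 \<in> nbhd \<sigma>"
    unfolding nbhd_def using f path_edges_subset[OF \<pi>'(1)] k q(2) by auto
  have "g = {\<sigma> ! k, \<sigma> ! Suc k}" if g: "g \<in> path_edges \<pi>'" "g \<in> nbhd \<sigma>" "?v \<in> g" for g
  proof -
    obtain l where l: "0 < l" "Suc l < length \<sigma>" "g = {\<sigma> ! l, \<sigma> ! Suc l}" using low[OF g(1,2)] by auto
    have "P l" unfolding P_def using l g(1) by simp
    then have "k \<le> l" unfolding k_def by (rule Least_le)
    moreover have "k = l \<or> k = Suc l" using g(3) l k d(2) by (auto simp: nth_eq_iff_index_eq)
    ultimately show ?thesis using l by simp
  qed
  from this[OF f(1) fn(1)] this[OF f(2) fn(2)] q(2) f12 show False by auto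
qed

text \<open>A modified edge lies on at most one of the disjoint segments, so at least |J| - |N|
  segments keep their time under w'.\<close>

lemma seg_time_unmodified:
  assumes p: "sa_path p" and J: "disjoint_segs p J"
    and seg: "\<And>i j. (i, j) \<in> J \<Longrightarrow> \<delta> \<le> seg_time w p i j" and \<delta>: "0 \<le> \<delta>"
    and nonneg: "\<And>e. e \<in> lattice_edges \<Longrightarrow> 0 \<le> w' e"
    and N: "finite N" and off: "\<And>e. e \<in> lattice_edges \<Longrightarrow> e \<notin> N \<Longrightarrow> w' e = w e"
  shows "\<delta> * (real (card J) - real (card N)) \<le> path_time w' p"
proof -
  have d: "distinct p" using p unfolding sa_path_def by simp
  have finJ: "finite J" and inJ: "\<And>i j. (i, j) \<in> J \<Longrightarrow> i < j \<and> j < length p"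
    and disJ: "\<And>i j i' j'. (i, j) \<in> J \<Longrightarrow> (i', j') \<in> J \<Longrightarrow> (i, j) \<noteq> (i', j') \<Longrightarrow> j < i' \<or> j' < i"
    using J unfolding disjoint_segs_def by blast+
  let ?e = "\<lambda>k. {p ! k, p ! Suc k}"
  define J' where "J' = {(i, j) \<in> J. \<forall>k\<in>{i..<j}. ?e k \<notin> N}"
  have J'J: "J' \<subseteq> J" unfolding J'_def by auto
  have "\<forall>z\<in>J - J'. \<exists>k. k \<in> {fst z..<snd z} \<and> ?e k \<in> N" unfolding J'_def by auto
  from bchoice[OF this] obtain f where f: "\<forall>z\<in>J - J'. f z \<in> {fst z..<snd z} \<and> ?e (f z) \<in> N" by blast
  have "card (J - J') \<le> card N"
  proof (rule card_inj_on_le)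
    show "inj_on (\<lambda>z. ?e (f z)) (J - J')"
    proof (rule inj_onI)
      fix z z' assume z: "z \<in> J - J'" "z' \<in> J - J'" "?e (f z) = ?e (f z')"
      have r: "f z \<in> {fst z..<snd z}" "f z' \<in> {fst z'..<snd z'}" using f z by blast+
      have "snd z < length p" "snd z' < length p" using inJ[of "fst z" "snd z"] inJ[of "fst z'" "snd z'"] z by auto
      then have "f z \<in> {..<length p - 1}" "f z' \<in> {..<length p - 1}" using r by auto
      with z(3) have eq: "f z = f z'" using inj_onD[OF inj_path_edges[OF d]] by blast
      show "z = z'"
      proof (rule ccontr)
        assume "z \<noteq> z'"
        then have "snd z < fst z' \<or> snd z' < fst z"
          using disJ[of "fst z" "snd z" "fst z'" "snd z'"] z by auto
        then show False using r eq by auto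
      qed
    qed
    show "(\<lambda>z. ?e (f z)) ` (J - J') \<subseteq> N" using f by blast
  qed (rule N)
  then have cJ': "real (card J) - real (card N) \<le> real (card J')"
    using card_Diff_subset[OF finite_subset[OF J'J finJ] J'J] card_mono[OF finJ J'J] by linarith
  have "\<delta> * real (card J') = (\<Sum>z\<in>J'. \<delta>)" by simp
  also have "\<dots> \<le> (\<Sum>z\<in>J'. \<Sum>k\<in>{fst z..<snd z}. w' (?e k))"
  proof (rule sum_mono)
    fix z assume z: "z \<in> J'"
    obtain i j where ij: "z = (i, j)" by (cases z)
    have "(\<Sum>k\<in>{i..<j}. w' (?e k)) = seg_time w p i j"
      unfolding seg_time_def
    proof (intro sum.cong refl)
      fix k assume k: "k \<in> {i..<j}"
      have "Suc k < length p" using k inJ[of i j] z J'J ij by auto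
      then have "?e k \<in> lattice_edges" by (rule sa_path_edge[OF p])
      moreover have "?e k \<notin> N" using z k unfolding J'_def ij by auto
      ultimately show "w' (?e k) = w (?e k)" by (rule off)
    qed
    then show "\<delta> \<le> (\<Sum>k\<in>{fst z..<snd z}. w' (?e k))" using seg[of i j] z J'J ij by auto
  qed
  also have "\<dots> = (\<Sum>k\<in>(\<Union>z\<in>J'. {fst z..<snd z}). w' (?e k))"
  proof (rule sum.UNION_disjoint[symmetric])
    show "finite J'" using J'J finJ finite_subset by blast
    show "\<forall>z\<in>J'. \<forall>z'\<in>J'. z \<noteq> z' \<longrightarrow> {fst z..<snd z} \<inter> {fst z'..<snd z'} = {}"
    proof (intro ballI impI)
      fix z z' assume "z \<in> J'" "z' \<in> J'" "z \<noteq> z'"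
      then have "snd z < fst z' \<or> snd z' < fst z"
        using disJ[of "fst z" "snd z" "fst z'" "snd z'"] J'J by auto
      then show "{fst z..<snd z} \<inter> {fst z'..<snd z'} = {}" by auto
    qed
  qed simp
  also have "\<dots> \<le> (\<Sum>k\<in>{0..<length p - 1}. w' (?e k))"
  proof (rule sum_mono2)
    show "(\<Union>z\<in>J'. {fst z..<snd z}) \<subseteq> {0..<length p - 1}"
    proof
      fix k assume "k \<in> (\<Union>z\<in>J'. {fst z..<snd z})"
      then obtain z where "z \<in> J" "k < snd z" using J'J by auto
      then show "k \<in> {0..<length p - 1}" using inJ[of "fst z" "snd z"] by auto
    qed
    show "0 \<le> w' (?e k)" if "k \<in> {0..<length p - 1} - (\<Union>z\<in>J'. {fst z..<snd z})" for k
      using that by (intro nonneg sa_path_edge[OF p]) auto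
  qed simp
  also have "\<dots> = path_time w' p" unfolding path_time_seg[OF d] seg_time_def ..
  finally show ?thesis using mult_left_mono[OF cJ' \<delta>] by linarith
qed

section \<open>Existence of geodesics\<close>

lemma finite_bounded_paths: "finite {p :: (int ^ 'd::finite) list. sa_path p \<and> hd p = a \<and> length p \<le> L}"
proof (rule finite_subset)
  show "{p. sa_path p \<and> hd p = a \<and> length p \<le> L} \<subseteq> {p. set p \<subseteq> near (Suc L) a \<and> length p \<le> L}"
  proof safe
    fix p v assume p: "sa_path p" "length p \<le> L" "a = hd p" "v \<in> set p"
    then obtain k where k: "k < length p" "v = p ! k" by (auto simp: in_set_conv_nth)
    have "hd p = p ! 0" using k by (intro hd_conv_nth) auto
    then have "l1norm (p ! 0 - v) \<le> int k" using l1norm_path_le[OF p(1), of 0 k] k by simp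
    then show "v \<in> near (Suc L) (hd p)"
      using \<open>hd p = p ! 0\<close> k p(2) by (intro near_l1norm) (simp add: l1norm_minus_commute)
  qed
  show "finite {p. set p \<subseteq> near (Suc L) a \<and> length p \<le> L}"
    by (rule finite_lists_length_le) simp
qed

text \<open>The infimum runs over infinitely many paths. If cheap paths are short, only finitely
  many compete and a minimiser exists.\<close>

lemma geodesic_exists:
  fixes x :: "int ^ 'd::finite"
  assumes nonneg: "\<forall>e\<in>lattice_edges. 0 \<le> w e"
    and p0: "sa_path p0" "hd p0 = 0" "last p0 = x" "path_time w p0 \<le> A"
    and short: "\<forall>p. sa_path p \<longrightarrow> hd p = 0 \<longrightarrow> last p = x \<longrightarrow> path_time w p \<le> A \<longrightarrow> length p \<le> L"
  shows "\<exists>p. geodesic w 0 x p"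
    and "\<And>p. geodesic w 0 x p \<Longrightarrow> length p \<le> L"
    and "\<And>p q. geodesic w 0 x p \<Longrightarrow> sa_path q \<Longrightarrow> hd q = 0 \<Longrightarrow> last q = x \<Longrightarrow> path_time w p \<le> path_time w q"
proof -
  note nonneg = nonneg[rule_format] and short = short[rule_format]
  let ?S = "{path_time w p | p. sa_path p \<and> hd p = 0 \<and> last p = x}"
  have bdd: "bdd_below ?S"
    using path_edges_subset nonneg unfolding path_time_def by (auto intro!: bdd_belowI[of _ 0] sum_nonneg)
  have le: "passage_time w 0 x \<le> path_time w q" if "sa_path q" "hd q = 0" "last q = x" for q
    unfolding passage_time_def using that bdd by (intro cInf_lower) auto
  then show "\<And>p q. geodesic w 0 x p \<Longrightarrow> sa_path q \<Longrightarrow> hd q = 0 \<Longrightarrow> last q = x \<Longrightarrow> path_time w p \<le> path_time w q"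
    unfolding geodesic_def by simp
  show "length p \<le> L" if "geodesic w 0 x p" for p
    using that short[of p] le[OF p0(1-3)] p0(4) unfolding geodesic_def by auto
  let ?F = "{p. sa_path p \<and> hd p = 0 \<and> last p = x \<and> path_time w p \<le> A}"
  have "finite ?F"
    by (rule finite_subset[OF _ finite_bounded_paths[of 0 L]]) (use short in auto)
  moreover have "?F \<noteq> {}" using p0 by auto
  ultimately have am: "arg_min_on (path_time w) ?F \<in> ?F" "\<not> (\<exists>q\<in>?F. path_time w q < path_time w (arg_min_on (path_time w) ?F))"
    by (rule arg_min_if_finite)+
  define p where "p = arg_min_on (path_time w) ?F"
  have p: "p \<in> ?F" "\<And>q. q \<in> ?F \<Longrightarrow> path_time w p \<le> path_time w q"
    using am unfolding p_def[symmetric] by (auto simp: not_less)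
  have min: "path_time w p \<le> path_time w q" if "sa_path q" "hd q = 0" "last q = x" for q
    using p(1) p(2)[of q] that by (cases "path_time w q \<le> A") auto
  have "passage_time w 0 x = path_time w p"
    unfolding passage_time_def using p(1) min by (intro cInf_eq_minimum) auto
  then show "\<exists>p. geodesic w 0 x p" using p(1) unfolding geodesic_def by auto
qed

section \<open>Slow blocks along a path\<close>

lemma disjoint_segs_subset:
  assumes "disjoint_segs p J" "J' \<subseteq> J"
  shows "disjoint_segs p J'"
  unfolding disjoint_segs_def case_prod_beta'
proof (intro conjI ballI impI)
  show "finite J'" using assms finite_subset unfolding disjoint_segs_def by blast
  show "fst z < snd z" "snd z < length p" if "z \<in> J'" for z
    using assms that unfolding disjoint_segs_def by (auto simp: case_prod_beta')
  show "snd z < fst z' \<or> snd z' < fst z" if "z \<in> J'" "z' \<in> J'" "(fst z, snd z) \<noteq> (fst z', snd z')" for z z'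
  proof -
    have "z \<in> J" "z' \<in> J" using that assms(2) by auto
    then show ?thesis using assms(1) that(3) unfolding disjoint_segs_def case_prod_beta' by blast
  qed
qed

text \<open>Split off the rightmost segment. The gaps cost at least r per unit of l^1-distance, and
  the triangle inequality recombines the distances.\<close>

lemma excess_superadditive:
  fixes p :: "(int ^ 'd::finite) list" and r \<delta> :: real
  assumes p: "sa_path p" and w: "\<And>e. e \<in> lattice_edges \<Longrightarrow> r \<le> w e" and r: "0 \<le> r"
    and "disjoint_segs p J" "a \<le> b" "b < length p"
    and "\<And>i j. (i, j) \<in> J \<Longrightarrow> a \<le> i \<and> j \<le> b \<and> r * l1norm (p ! i - p ! j) + \<delta> \<le> seg_time w p i j"
  shows "r * l1norm (p ! a - p ! b) + \<delta> * real (card J) \<le> seg_time w p a b"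
  using assms(4-7)
proof (induction "card J" arbitrary: J b)
  have base: "r * l1norm (p ! a - p ! b) \<le> seg_time w p a b" if "a \<le> b" "b < length p" for a b
  proof -
    have "real_of_int (l1norm (p ! a - p ! b)) \<le> real (b - a)" using l1norm_path_le[OF p that] by linarith
    then have "r * l1norm (p ! a - p ! b) \<le> r * real (b - a)" using r by (intro mult_left_mono)
    also have "\<dots> = (\<Sum>k\<in>{a..<b}. r)" by simp
    also have "\<dots> \<le> seg_time w p a b"
      unfolding seg_time_def using that by (intro sum_mono w sa_path_edge[OF p]) auto
    finally show ?thesis .
  qed
  {
    case 0
    then have "J = {}" unfolding disjoint_segs_def by auto
    then show ?case using base 0 by simp
  next
    case (Suc n)
    have finJ: "finite J" and J: "\<And>i j. (i, j) \<in> J \<Longrightarrow> i < j \<and> j < length p"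
      and disJ: "\<And>i j i' j'. (i, j) \<in> J \<Longrightarrow> (i', j') \<in> J \<Longrightarrow> (i, j) \<noteq> (i', j') \<Longrightarrow> j < i' \<or> j' < i"
      using Suc.prems(1) unfolding disjoint_segs_def by blast+
    have ne: "J \<noteq> {}" using Suc.hyps(2) by auto
    have "Max (snd ` J) \<in> snd ` J" using finJ ne by (intro Max_in) auto
    then obtain i j where ij: "(i, j) \<in> J" "j = Max (snd ` J)" by auto
    have mx: "j' \<le> j" if "(i', j') \<in> J" for i' j'
      unfolding ij(2) using finJ that by (intro Max_ge) force+
    let ?J = "J - {(i, j)}"
    have a: "a \<le> i" "j \<le> b" "i < j" using Suc.prems(4)[OF ij(1)] J[OF ij(1)] by auto
    have cJ: "card J = Suc (card ?J)" using card_Suc_Diff1[OF finJ ij(1)] by simp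
    have "disjoint_segs p ?J" by (rule disjoint_segs_subset[OF Suc.prems(1)]) blast
    moreover have "a \<le> i' \<and> j' \<le> i \<and> r * l1norm (p ! i' - p ! j') + \<delta> \<le> seg_time w p i' j'" if "(i', j') \<in> ?J" for i' j'
    proof -
      have "j' < i" using disJ[OF ij(1), of i' j'] mx[of i' j'] J[of i' j'] that by auto
      then show ?thesis using Suc.prems(4)[of i' j'] that by auto
    qed
    ultimately have IH: "r * l1norm (p ! a - p ! i) + \<delta> * real (card ?J) \<le> seg_time w p a i"
      using Suc.hyps(2) cJ a Suc.prems(3) by (intro Suc.hyps(1)) auto
    have "l1norm (p ! a - p ! b) \<le> l1norm (p ! a - p ! i) + l1norm (p ! i - p ! j) + l1norm (p ! j - p ! b)"
      using l1norm_triangle_diff[of "p ! a" "p ! b" "p ! i"] l1norm_triangle_diff[of "p ! i" "p ! b" "p ! j"] by linarith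
    then have "real_of_int (l1norm (p ! a - p ! b)) \<le> real_of_int (l1norm (p ! a - p ! i) + l1norm (p ! i - p ! j) + l1norm (p ! j - p ! b))"
      by (simp only: of_int_le_iff)
    then have "r * l1norm (p ! a - p ! b) \<le> r * (l1norm (p ! a - p ! i) + l1norm (p ! i - p ! j) + l1norm (p ! j - p ! b))"
      using r by (intro mult_left_mono) auto
    moreover have "seg_time w p a b = seg_time w p a i + seg_time w p i j + seg_time w p j b"
      using seg_time_split[of a i b w p] seg_time_split[of i j b w p] a by simp
    moreover have "r * l1norm (p ! i - p ! j) + \<delta> \<le> seg_time w p i j" using Suc.prems(4)[OF ij(1)] by simp
    moreover have "r * l1norm (p ! j - p ! b) \<le> seg_time w p j b" using base a Suc.prems(3) by simp
    ultimately show ?case using IH unfolding cJ by (simp add: algebra_simps)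
  }
qed

lemma div_block: "0 < (l::nat) \<Longrightarrow> i div l * l \<le> i \<and> i < Suc (i div l) * l"
  by (metis div_times_less_eq_dividend dividend_less_div_times mult.commute mult_Suc)

text \<open>Segments that cross a block end (\<open>J1\<close>, at most one per full block) or start
  in the incomplete last block (\<open>J2\<close>, at most l) are few, so many blocks contain at
  least \<kappa> l / 4 segments. The excess \<delta> \<kappa> l / 4 of such a block is split evenly:
  one half raises the cost per edge from r to r + \<delta> \<kappa> / 8, the other pays B. Shortcuts
  are counted by the block ends, which are distinct vertices.\<close>

lemma many_shortcuts:
  fixes \<pi> :: "(int ^ 'd::finite) list" and r \<delta> \<kappa> B :: real
  assumes \<pi>: "sa_path \<pi>" and w: "\<And>e. e \<in> lattice_edges \<Longrightarrow> r \<le> w e" and r: "0 \<le> r"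
    and J: "disjoint_segs \<pi> J" "\<kappa> * real (length \<pi> - 1) \<le> real (card J)"
    and exc: "\<And>i j. (i, j) \<in> J \<Longrightarrow> r * l1norm (\<pi> ! i - \<pi> ! j) + \<delta> \<le> seg_time w \<pi> i j"
    and pos: "0 < \<delta>" "0 < \<kappa>" and l: "8 \<le> \<kappa> * real l" "16 * real l \<le> \<kappa> * real (length \<pi> - 1)"
    and B: "8 * B < \<delta> * \<kappa> * real l"
  shows "\<kappa> * real (length \<pi> - 1) / (2 * real l) \<le>
    real (card {a \<in> set \<pi>. \<exists>\<sigma>. shortcut w \<pi> (r + \<delta> * \<kappa> / 8) B \<sigma> \<and> length \<sigma> \<le> Suc l \<and> l1norm (hd \<sigma> - a) \<le> int l})"
proof -
  define m where "m = length \<pi> - 1"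
  define q where "q = m div l"
  let ?bk = "\<lambda>z. fst z div l"
  have l0: "0 < l" using l(1) pos(2) by (cases l) auto
  have ne: "\<pi> \<noteq> []" and d: "distinct \<pi>" using \<pi> unfolding sa_path_def by auto
  have finJ: "finite J" using J(1) unfolding disjoint_segs_def by blast
  have Jij: "fst z < snd z \<and> snd z \<le> m" if "z \<in> J" for z
    using J(1) that unfolding disjoint_segs_def m_def by auto
  have Jdis: "snd z < fst z' \<or> snd z' < fst z" if "z \<in> J" "z' \<in> J" "z \<noteq> z'" for z z'
    using J(1) that unfolding disjoint_segs_def case_prod_beta' prod_eq_iff by auto
  have fst_inj: "inj_on fst J"
    using Jdis Jij by (intro inj_onI) (metis less_asym)
  have bk: "?bk z * l \<le> fst z" "fst z < Suc (?bk z) * l" for z :: "nat \<times> nat"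
    using div_block[OF l0] by auto
  define Jin where "Jin = {z \<in> J. snd z \<le> Suc (?bk z) * l \<and> Suc (?bk z) * l \<le> m}"
  define J1 where "J1 = {z \<in> J. Suc (?bk z) * l < snd z}"
  define J2 where "J2 = {z \<in> J. snd z \<le> Suc (?bk z) * l \<and> m < Suc (?bk z) * l}"
  have ql: "q * l \<le> m" "m < Suc q * l" using div_block[OF l0, of m] unfolding q_def by auto
  have c1: "card J1 \<le> q"
  proof -
    have "inj_on ?bk J1"
    proof (rule inj_onI, rule ccontr)
      fix z z' assume z: "z \<in> J1" "z' \<in> J1" "?bk z = ?bk z'" "z \<noteq> z'"
      then have "snd z < fst z' \<or> snd z' < fst z" using Jdis unfolding J1_def by auto
      moreover have "Suc (?bk z) * l < snd z" "Suc (?bk z) * l < snd z'" using z unfolding J1_def by auto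
      moreover have "fst z < Suc (?bk z) * l" "fst z' < Suc (?bk z) * l" using bk(2)[of z] bk(2)[of z'] z(3) by simp_all
      ultimately show False by linarith
    qed
    moreover have "?bk ` J1 \<subseteq> {..<q}"
    proof (rule image_subsetI)
      fix z assume z: "z \<in> J1"
      then have "Suc (?bk z) * l < snd z" "snd z \<le> m" using Jij[of z] unfolding J1_def by blast+
      then have "Suc (?bk z) * l < Suc q * l" using ql(2) by linarith
      then show "?bk z \<in> {..<q}" using l0 by (metis Suc_less_eq lessThan_iff mult_less_cancel2)
    qed
    ultimately show ?thesis using card_inj_on_le[of ?bk J1 "{..<q}"] by simp
  qed
  have c2: "card J2 \<le> l"
  proof -
    have "fst ` J2 \<subseteq> {q * l..<Suc q * l}"
    proof (rule image_subsetI)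
      fix z assume z: "z \<in> J2"
      have "q * l < Suc (?bk z) * l" using z ql(1) unfolding J2_def by auto
      then have "q \<le> ?bk z" using l0 by (metis less_Suc_eq_le mult_less_cancel2)
      then have "q * l \<le> ?bk z * l" by (rule mult_le_mono1)
      then have "q * l \<le> fst z" using bk(1)[of z] by linarith
      moreover have "fst z < m" using Jij[of z] z unfolding J2_def by auto
      ultimately show "fst z \<in> {q * l..<Suc q * l}" using ql(2) unfolding atLeastLessThan_iff by linarith
    qed
    moreover have "inj_on fst J2" using fst_inj unfolding J2_def by (auto intro: inj_on_subset)
    ultimately show ?thesis using card_inj_on_le[of fst J2 "{q * l..<Suc q * l}"] by simp
  qed
  have "J = Jin \<union> (J1 \<union> J2)" unfolding Jin_def J1_def J2_def by auto
  then have "card J \<le> card Jin + (card J1 + card J2)"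
    by (metis card_Un_le add_left_mono order_trans)
  with c1 c2 have cJ: "card J \<le> card Jin + q + l" by linarith
  define C where "C t = {z \<in> Jin. ?bk z = t}" for t
  have finC: "finite (C t)" for t unfolding C_def Jin_def using finJ by auto
  have CJ: "C t \<subseteq> J" for t unfolding C_def Jin_def by auto
  have "Jin = (\<Union>t<q. C t)"
  proof -
    have "?bk z < q" if "z \<in> Jin" for z
    proof -
      have "Suc (?bk z) * l \<le> m" using that unfolding Jin_def by blast
      then have "Suc (?bk z) * l < Suc q * l" using ql(2) by linarith
      then show ?thesis using l0 by (metis Suc_less_eq mult_less_cancel2)
    qed
    then show ?thesis unfolding C_def by auto
  qed
  then have cJin: "card Jin \<le> (\<Sum>t<q. card (C t))" by (simp add: card_UN_le)
  have Cl: "card (C t) \<le> l" for t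
  proof -
    have "fst ` C t \<subseteq> {t * l..<Suc t * l}" unfolding C_def using bk by (auto simp del: mult_Suc)
    moreover have "inj_on fst (C t)" using fst_inj CJ by (rule inj_on_subset)
    ultimately show ?thesis using card_inj_on_le[of fst "C t" "{t * l..<Suc t * l}"] by simp
  qed
  define Good where "Good = {t \<in> {..<q}. \<kappa> * real l / 4 \<le> real (card (C t))}"
  have finG: "finite Good" unfolding Good_def by simp
  have "(\<Sum>t<q. real (card (C t))) \<le> (\<Sum>t<q. (if t \<in> Good then real l else 0) + \<kappa> * real l / 4)"
  proof (rule sum_mono)
    fix t assume "t \<in> {..<q}"
    moreover have "real (card (C t)) \<le> real l" using Cl by (rule of_nat_mono)
    moreover have "0 \<le> \<kappa> * real l / 4" using pos(2) by simp
    ultimately show "real (card (C t)) \<le> (if t \<in> Good then real l else 0) + \<kappa> * real l / 4"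
      unfolding Good_def by auto
  qed
  also have "\<dots> = real (card Good) * real l + real q * (\<kappa> * real l / 4)"
    unfolding Good_def by (simp add: sum.distrib sum.If_cases Int_def conj_commute)
  finally have sumC: "(\<Sum>t<q. real (card (C t))) \<le> real (card Good) * real l + real q * (\<kappa> * real l / 4)" .
  have qlr: "real q * real l \<le> real m" using ql(1) by (metis of_nat_le_iff of_nat_mult)
  have "\<kappa> * real m \<le> real (card Jin) + real q + real l"
    using J(2) cJ unfolding m_def[symmetric] by linarith
  also have "\<dots> \<le> (\<Sum>t<q. real (card (C t))) + real q + real l"
    using cJin by (simp flip: of_nat_sum)
  finally have main: "\<kappa> * real m \<le> real (card Good) * real l + real q * (\<kappa> * real l / 4) + real q + real l"
    using sumC by linarith
  \<comment> \<open>The terms q \<kappa> l / 4, q and l are at most 1/4, 1/8 and 1/16 of \<kappa> m,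
    together less than half.\<close>
  have "real q * (\<kappa> * real l) \<le> \<kappa> * real m"
    using mult_left_mono[OF qlr, of \<kappa>] pos(2) by (simp add: mult_ac)
  moreover have "8 * real q \<le> real q * (\<kappa> * real l)" using mult_left_mono[OF l(1), of "real q"] by simp
  moreover have "16 * real l \<le> \<kappa> * real m" using l(2) unfolding m_def .
  ultimately have "\<kappa> * real m / 2 \<le> real (card Good) * real l" using main by linarith
  then have cG: "\<kappa> * real m / (2 * real l) \<le> real (card Good)" using l0 by (simp add: field_simps)
  let ?V = "{a \<in> set \<pi>. \<exists>\<sigma>. shortcut w \<pi> (r + \<delta> * \<kappa> / 8) B \<sigma> \<and> length \<sigma> \<le> Suc l \<and> l1norm (hd \<sigma> - a) \<le> int l}"
  have tl: "Suc t * l < length \<pi>" if "t \<in> Good" for t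
  proof -
    have "Suc t \<le> q" using that unfolding Good_def by simp
    then have "Suc t * l \<le> q * l" by (rule mult_le_mono1)
    moreover have "m < length \<pi>" using ne unfolding m_def by simp
    ultimately show ?thesis using ql(1) by linarith
  qed
  have "card Good \<le> card ?V"
  proof (rule card_inj_on_le)
    show "inj_on (\<lambda>t. \<pi> ! (Suc t * l)) Good"
    proof (rule inj_onI)
      fix s t assume st: "s \<in> Good" "t \<in> Good" "\<pi> ! (Suc s * l) = \<pi> ! (Suc t * l)"
      then have "Suc s * l = Suc t * l" using nth_eq_iff_index_eq[OF d] tl by blast
      then show "s = t" using l0 by simp
    qed
    show "(\<lambda>t. \<pi> ! (Suc t * l)) ` Good \<subseteq> ?V"
    proof (rule image_subsetI)
      fix t assume t: "t \<in> Good"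
      let ?a = "t * l" and ?b = "Suc t * l"
      have ab: "?a < ?b" "?b < length \<pi>" using l0 tl[OF t] by auto
      have dC: "disjoint_segs \<pi> (C t)" by (rule disjoint_segs_subset[OF J(1) CJ])
      have "r * l1norm (\<pi> ! ?a - \<pi> ! ?b) + \<delta> * real (card (C t)) \<le> seg_time w \<pi> ?a ?b"
      proof (rule excess_superadditive[OF \<pi> w r dC])
        fix i j assume ij: "(i, j) \<in> C t"
        then have z: "(i, j) \<in> J" "i div l = t" "j \<le> Suc (i div l) * l" unfolding C_def Jin_def by auto
        show "?a \<le> i \<and> j \<le> ?b \<and> r * l1norm (\<pi> ! i - \<pi> ! j) + \<delta> \<le> seg_time w \<pi> i j"
          using z bk(1)[of "(i, j)"] exc by auto
      qed (use ab in auto)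
      moreover have "\<delta> * (\<kappa> * real l / 4) \<le> \<delta> * real (card (C t))"
        using t pos(1) unfolding Good_def by (intro mult_left_mono) auto
      ultimately have slow: "r * l1norm (\<pi> ! ?a - \<pi> ! ?b) + \<delta> * (\<kappa> * real l / 4) \<le> seg_time w \<pi> ?a ?b" by linarith
      have l1: "l1norm (\<pi> ! ?a - \<pi> ! ?b) \<le> int l"
        using l1norm_path_le[OF \<pi>, of ?a ?b] ab by simp
      have "\<delta> * \<kappa> / 8 * real_of_int (l1norm (\<pi> ! ?a - \<pi> ! ?b)) \<le> \<delta> * \<kappa> / 8 * real l"
        using l1 pos by (intro mult_left_mono) auto
      then have "(r + \<delta> * \<kappa> / 8) * real_of_int (l1norm (\<pi> ! ?a - \<pi> ! ?b)) + B < seg_time w \<pi> ?a ?b"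
        using slow B by (simp add: algebra_simps)
      moreover have "0 \<le> w e" if "e \<in> lattice_edges" for e using w[OF that] r by simp
      ultimately obtain \<sigma> where \<sigma>: "shortcut w \<pi> (r + \<delta> * \<kappa> / 8) B \<sigma>" "int (length \<sigma> - 1) \<le> l1norm (\<pi> ! ?a - \<pi> ! ?b)"
        "l1norm (hd \<sigma> - \<pi> ! ?b) \<le> l1norm (\<pi> ! ?a - \<pi> ! ?b)"
        using exists_shortcut[OF \<pi> ab, of w "r + \<delta> * \<kappa> / 8" B] r pos by auto
      have "length \<sigma> \<le> Suc l" using \<sigma>(2) l1 by linarith
      moreover have "\<pi> ! ?b \<in> set \<pi>" using ab by simp
      ultimately show "\<pi> ! ?b \<in> ?V" using \<sigma> l1 by auto
    qed
    show "finite ?V" by simp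
  qed
  with cG show ?thesis unfolding m_def by linarith
qed

section \<open>Effect of modified weights near a shortcut\<close>

lemma nbhd_edges_at: "sa_path \<sigma> \<Longrightarrow> 2 \<le> length \<sigma> \<Longrightarrow> nbhd \<sigma> \<subseteq> edges_at (set \<sigma>)"
proof
  fix e assume \<sigma>: "sa_path \<sigma>" "2 \<le> length \<sigma>" and e: "e \<in> nbhd \<sigma>"
  have "e \<in> lattice_edges" using nbhd_subset[OF \<sigma>(2,1)] e by blast
  moreover have "\<exists>v\<in>set \<sigma>. v \<in> e"
  proof (cases "e = {\<sigma> ! 0, \<sigma> ! 1}")
    case True
    moreover have "\<sigma> ! 0 \<in> set \<sigma>" using \<sigma>(2) by (intro nth_mem) linarith
    ultimately show ?thesis by (intro bexI[of _ "\<sigma> ! 0"]) auto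
  next
    case False
    then obtain i where "Suc i < length \<sigma>" "\<sigma> ! i \<in> e" using e unfolding nbhd_def by auto
    then show ?thesis by (intro bexI[of _ "\<sigma> ! i"]) auto
  qed
  ultimately show "e \<in> edges_at (set \<sigma>)" unfolding edges_at_def by blast
qed

lemma card_nbhd_le:
  fixes \<sigma> :: "(int ^ 'd::finite) list"
  assumes "sa_path \<sigma>" "2 \<le> length \<sigma>"
  shows "finite (nbhd \<sigma>)" "card (nbhd \<sigma>) \<le> length \<sigma> * 4 ^ CARD('d)"
proof -
  show "finite (nbhd \<sigma>)" using nbhd_edges_at[OF assms] finite_edges_at finite_subset by blast
  have "card (nbhd \<sigma>) \<le> card (edges_at (set \<sigma>))"
    by (intro card_mono nbhd_edges_at assms) simp
  also have "\<dots> \<le> card (set \<sigma>) * 4 ^ CARD('d)" by (rule card_edges_at_le) simp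
  also have "card (set \<sigma>) = length \<sigma>" using assms(1) unfolding sa_path_def by (simp add: distinct_card)
  finally show "card (nbhd \<sigma>) \<le> length \<sigma> * 4 ^ CARD('d)" by simp
qed

text \<open>The prescribed windows: a heavy but affordable first edge, cheap edges on the rest of
  \<sigma>, and a heavy wall around it.\<close>

definition target :: "real \<Rightarrow> real \<Rightarrow> real \<Rightarrow> (int ^ 'd::finite) list \<Rightarrow> (int ^ 'd) set \<Rightarrow> real set" where
  "target s M B \<sigma> e = (if e = {\<sigma> ! 0, \<sigma> ! 1} then {M..B} else if e \<in> path_edges \<sigma> then {0..s} else {M..})"

text \<open>The length bound is part of the event because a number of heavy edges is to be converted
  into a density.\<close>

definition success :: "((int ^ 'd::finite) list \<Rightarrow> nat) \<Rightarrow> int ^ 'd \<Rightarrow> real \<Rightarrow> nat \<Rightarrow> (int ^ 'd) list \<Rightarrow>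
    ((int ^ 'd) set \<Rightarrow> real) \<Rightarrow> bool" where
  "success pord x M L \<sigma> w \<longleftrightarrow> geodesic w 0 x (first_geodesic pord w x) \<and> length (first_geodesic pord w x) \<le> L \<and>
     (\<exists>e\<in>path_edges (first_geodesic pord w x) \<inter> nbhd \<sigma>. M \<le> w e)"

lemma first_geodesic_geodesic: "geodesic w 0 x p \<Longrightarrow> geodesic w 0 x (first_geodesic pord w x)"
  unfolding first_geodesic_def by (rule arg_min_natI)

definition regular :: "real \<Rightarrow> real \<Rightarrow> real \<Rightarrow> ((int ^ 'd::finite) set \<Rightarrow> real) \<Rightarrow> bool" where
  "regular r \<kappa> \<delta> w \<longleftrightarrow> (\<forall>e\<in>lattice_edges. r \<le> w e) \<and>
    (\<forall>p :: (int ^ 'd) list. sa_path p \<longrightarrow> hd p = 0 \<longrightarrow> 1 \<le> \<kappa> * real (length p - 1) \<longrightarrow>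
      (\<exists>J. disjoint_segs p J \<and> \<kappa> * real (length p - 1) \<le> real (card J) \<and>
        (\<forall>(i, j)\<in>J. r * l1norm (p ! i - p ! j) + \<delta> \<le> seg_time w p i j)))"

lemma path_length_ge:
  assumes "sa_path p" "hd p = 0" "last p = x"
  shows "real_of_int (l1norm x) \<le> real (length p - 1)"
proof -
  have ne: "p \<noteq> []" using assms(1) unfolding sa_path_def by simp
  then have "l1norm (p ! 0 - p ! (length p - 1)) \<le> int (length p - 1 - 0)"
    by (intro l1norm_path_le[OF assms(1)]) auto
  moreover have "p ! 0 = 0" "p ! (length p - 1) = x" using assms ne by (simp_all add: hd_conv_nth last_conv_nth)
  ultimately have "l1norm x \<le> int (length p - 1)" using l1norm_minus_commute[of 0 x] by simp
  then show ?thesis by linarith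
qed

text \<open>Regularity is known only for w. The modified edges spoil at most |x|_1 of the segments,
  and the + 1 in the constant pays for them. With N empty the lemma bounds the paths in w
  itself.\<close>

lemma regular_short:
  fixes w w' :: "(int ^ 'd::finite) set \<Rightarrow> real"
  assumes reg: "regular r \<kappa> \<delta> w" and r: "0 \<le> r" and pos: "0 < \<kappa>" "0 < \<delta>"
    and n: "1 \<le> \<kappa> * real_of_int (l1norm x)"
    and nonneg: "\<And>e. e \<in> lattice_edges \<Longrightarrow> 0 \<le> w' e"
    and N: "finite N" "real (card N) \<le> real_of_int (l1norm x)"
    and off: "\<And>e. e \<in> lattice_edges \<Longrightarrow> e \<notin> N \<Longrightarrow> w' e = w e"
    and p: "sa_path p" "hd p = 0" "last p = x" "path_time w' p \<le> D * real_of_int (l1norm x)"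
  shows "real (length p - 1) \<le> (D / \<delta> + 1) / \<kappa> * real_of_int (l1norm x)"
proof -
  have "\<kappa> * real_of_int (l1norm x) \<le> \<kappa> * real (length p - 1)"
    using path_length_ge[OF p(1-3)] pos by (intro mult_left_mono) auto
  then have "1 \<le> \<kappa> * real (length p - 1)" using n by linarith
  then obtain J where J: "disjoint_segs p J" "\<kappa> * real (length p - 1) \<le> real (card J)"
    "\<forall>(i, j)\<in>J. r * l1norm (p ! i - p ! j) + \<delta> \<le> seg_time w p i j"
    using reg p(1,2) unfolding regular_def by blast
  have seg: "\<delta> \<le> seg_time w p i j" if "(i, j) \<in> J" for i j
  proof -
    have "0 \<le> r * l1norm (p ! i - p ! j)" using r by simp
    moreover have "r * l1norm (p ! i - p ! j) + \<delta> \<le> seg_time w p i j" using J(3) that by auto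
    ultimately show ?thesis by linarith
  qed
  have "\<delta> * (real (card J) - real (card N)) \<le> path_time w' p"
    using pos nonneg off by (intro seg_time_unmodified[OF p(1) J(1) seg _ _ N(1)]) auto
  then have "\<delta> * (real (card J) - real (card N)) \<le> D * real_of_int (l1norm x)" using p(4) by simp
  then have "real (card J) \<le> D * real_of_int (l1norm x) / \<delta> + real_of_int (l1norm x)"
    using pos N(2) by (simp add: field_simps) (smt (verit) mult_left_mono)
  then have "\<kappa> * real (length p - 1) \<le> (D / \<delta> + 1) * real_of_int (l1norm x)" using J(2) by (simp add: algebra_simps)
  then show ?thesis using pos by (simp add: field_simps)
qed

text \<open>The detour brings the passage time under w' strictly below that under w. A geodesic of
  w' that avoided \<open>nbhd\<close> would have the same time under both, which is impossible;
  \<open>heavy_edge_used\<close> then applies.\<close>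

lemma resample_success:
  fixes w w' :: "(int ^ 'd::finite) set \<Rightarrow> real" and x :: "int ^ 'd"
  assumes reg: "regular r \<kappa> \<delta> w" and r: "0 \<le> r" and pos: "0 < \<kappa>" "0 < \<delta>" "0 \<le> s" "0 \<le> M"
    and n: "1 \<le> \<kappa> * real_of_int (l1norm x)"
    and p0: "sa_path p0" "hd p0 = 0" "last p0 = x" "path_time w p0 \<le> D * real_of_int (l1norm x)"
    and sc: "shortcut w (first_geodesic pord w x) s B \<sigma>"
    and N: "real (card (nbhd \<sigma>)) \<le> real_of_int (l1norm x)"
    and off: "\<And>e. e \<in> lattice_edges \<Longrightarrow> e \<notin> nbhd \<sigma> \<Longrightarrow> w' e = w e"
    and on: "\<And>e. e \<in> nbhd \<sigma> \<Longrightarrow> w' e \<in> target s M B \<sigma> e"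
    and L: "(D / \<delta> + 1) / \<kappa> * real_of_int (l1norm x) + 1 \<le> real L"
  shows "success pord x M L \<sigma> w'"
proof -
  let ?\<pi> = "first_geodesic pord w x"
  have wr: "r \<le> w e" if "e \<in> lattice_edges" for e using reg that unfolding regular_def by blast
  then have w0: "0 \<le> w e" if "e \<in> lattice_edges" for e using that r by (meson order_trans)
  have \<sigma>: "sa_path \<sigma>" "2 \<le> length \<sigma>" using sc unfolding shortcut_def by blast+
  have finN: "finite (nbhd \<sigma>)" by (rule card_nbhd_le(1)[OF \<sigma>])
  have w'0: "0 \<le> w' e" if "e \<in> lattice_edges" for e
  proof (cases "e \<in> nbhd \<sigma>")
    case True
    then show ?thesis using on[OF True] pos unfolding target_def by (auto split: if_splits)
  qed (use off w0 that in simp)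
  have shortL: "length p \<le> L" if "real (length p - 1) \<le> (D / \<delta> + 1) / \<kappa> * real_of_int (l1norm x)" for p :: "(int ^ 'd) list"
    using that L by linarith
  have short: "length p \<le> L" if "sa_path p" "hd p = 0" "last p = x" "path_time w p \<le> D * real_of_int (l1norm x)" for p
  proof (rule shortL, rule regular_short[OF reg r pos(1,2) n w0 finite.emptyI _ _ that])
    show "real (card {}) \<le> real_of_int (l1norm x)" by simp
  qed auto
  have short': "length p \<le> L" if "sa_path p" "hd p = 0" "last p = x" "path_time w' p \<le> D * real_of_int (l1norm x)" for p
    by (rule shortL, rule regular_short[OF reg r pos(1,2) n w'0 finN N off that])
  have w0': "\<forall>e\<in>lattice_edges. 0 \<le> w e" using w0 by blast
  have sh: "\<forall>p. sa_path p \<longrightarrow> hd p = 0 \<longrightarrow> last p = x \<longrightarrow> path_time w p \<le> D * real_of_int (l1norm x) \<longrightarrow> length p \<le> L"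
    using short by blast
  note geo = geodesic_exists[OF w0' p0 sh]
  have \<pi>: "geodesic w 0 x ?\<pi>" using geo(1) first_geodesic_geodesic by blast
  then have sa\<pi>: "sa_path ?\<pi>" "hd ?\<pi> = 0" "last ?\<pi> = x" unfolding geodesic_def by auto
  have "\<exists>p. sa_path p \<and> hd p = hd ?\<pi> \<and> last p = last ?\<pi> \<and> path_time w' p < path_time w ?\<pi>"
  proof (rule shortcut_path[OF sa\<pi>(1) sc w'0 pos(3) off])
    have "{\<sigma> ! 0, \<sigma> ! 1} \<in> nbhd \<sigma>" unfolding nbhd_def by simp
    from on[OF this] show "w' {\<sigma> ! 0, \<sigma> ! 1} \<le> B" unfolding target_def by simp
    fix i assume i: "0 < i" "Suc i < length \<sigma>"
    have e: "{\<sigma> ! i, \<sigma> ! Suc i} \<in> path_edges \<sigma>" using i unfolding path_edges_def by blast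
    have "{\<sigma> ! i, \<sigma> ! Suc i} \<noteq> {\<sigma> ! 0, \<sigma> ! Suc 0}"
    proof
      assume "{\<sigma> ! i, \<sigma> ! Suc i} = {\<sigma> ! 0, \<sigma> ! Suc 0}"
      moreover have "i \<in> {..<length \<sigma> - 1}" "0 \<in> {..<length \<sigma> - 1}" using i by auto
      moreover have "distinct \<sigma>" using \<sigma>(1) unfolding sa_path_def by simp
      ultimately have "i = 0" using inj_onD[OF inj_path_edges] by blast
      then show False using i by simp
    qed
    moreover have "{\<sigma> ! i, \<sigma> ! Suc i} \<in> nbhd \<sigma>" using e nbhd_path_edges[OF \<sigma>(2,1)] by blast
    ultimately show "w' {\<sigma> ! i, \<sigma> ! Suc i} \<le> s" using on[of "{\<sigma> ! i, \<sigma> ! Suc i}"] e unfolding target_def by auto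
  qed
  then obtain p where p: "sa_path p" "hd p = 0" "last p = x" "path_time w' p < path_time w ?\<pi>"
    using sa\<pi> by auto
  have "path_time w ?\<pi> \<le> path_time w p0" using geo(3)[OF \<pi> p0(1-3)] .
  then have pA: "path_time w' p \<le> D * real_of_int (l1norm x)" using p(4) p0(4) by linarith
  have w'0': "\<forall>e\<in>lattice_edges. 0 \<le> w' e" using w'0 by blast
  have sh': "\<forall>p. sa_path p \<longrightarrow> hd p = 0 \<longrightarrow> last p = x \<longrightarrow> path_time w' p \<le> D * real_of_int (l1norm x) \<longrightarrow> length p \<le> L"
    using short' by blast
  note geo' = geodesic_exists[OF w'0' p(1-3) pA sh']
  let ?\<pi>' = "first_geodesic pord w' x"
  have \<pi>': "geodesic w' 0 x ?\<pi>'" using geo'(1) first_geodesic_geodesic by blast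
  then have sa\<pi>': "sa_path ?\<pi>'" "hd ?\<pi>' = 0" "last ?\<pi>' = x" unfolding geodesic_def by auto
  have "path_edges ?\<pi>' \<inter> nbhd \<sigma> \<noteq> {}"
  proof
    assume disj: "path_edges ?\<pi>' \<inter> nbhd \<sigma> = {}"
    have "path_time w' ?\<pi>' = path_time w ?\<pi>'"
      unfolding path_time_def
    proof (intro sum.cong refl)
      fix e assume "e \<in> path_edges ?\<pi>'"
      then show "w' e = w e" using disj path_edges_subset[OF sa\<pi>'(1)] by (intro off) auto
    qed
    moreover have "path_time w' ?\<pi>' \<le> path_time w' p" using geo'(3)[OF \<pi>' p(1-3)] .
    moreover have "path_time w ?\<pi> \<le> path_time w ?\<pi>'" using geo(3)[OF \<pi> sa\<pi>'] .
    ultimately show False using p(4) by linarith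
  qed
  then have "\<exists>e\<in>path_edges ?\<pi>' \<inter> nbhd \<sigma>. M \<le> w' e"
  proof (rule heavy_edge_used[OF sa\<pi>(1) sc sa\<pi>'(1), rotated 2])
    fix e assume e: "e \<in> nbhd \<sigma>" and nl: "\<And>i. 0 < i \<Longrightarrow> Suc i < length \<sigma> \<Longrightarrow> e \<noteq> {\<sigma> ! i, \<sigma> ! Suc i}"
    show "M \<le> w' e"
    proof (cases "e = {\<sigma> ! 0, \<sigma> ! 1} \<or> e \<notin> path_edges \<sigma>")
      case True
      then show ?thesis using on[OF e] unfolding target_def by (auto split: if_splits)
    next
      case False
      then obtain i where i: "e = {\<sigma> ! i, \<sigma> ! Suc i}" "Suc i < length \<sigma>" unfolding path_edges_def by auto
      with False have "0 < i" by (cases i) auto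
      with nl[of i] i show ?thesis by simp
    qed
  qed (use sa\<pi> sa\<pi>' in auto)
  then show ?thesis unfolding success_def using \<pi>' geo'(2)[OF \<pi>'] by blast
qed

text \<open>The anchors are counted in a ball that does not depend on w, so that the sum over
  anchors can be exchanged with the expectation.\<close>

lemma regular_many_shortcuts:
  fixes w :: "(int ^ 'd::finite) set \<Rightarrow> real" and x :: "int ^ 'd"
  assumes reg: "regular r \<kappa> \<delta> w" and r: "0 \<le> r" and pos: "0 < \<kappa>" "0 < \<delta>"
    and p0: "sa_path p0" "hd p0 = 0" "last p0 = x" "path_time w p0 \<le> D * real_of_int (l1norm x)"
    and l: "8 \<le> \<kappa> * real l" "16 * real l \<le> \<kappa> * real_of_int (l1norm x)"
    and B: "8 * B < \<delta> * \<kappa> * real l"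
    and L: "(D / \<delta> + 1) / \<kappa> * real_of_int (l1norm x) + 1 \<le> real L"
  shows "\<kappa> * real_of_int (l1norm x) / (2 * real l) \<le>
    real (card {a \<in> near L 0. \<exists>\<sigma>. shortcut w (first_geodesic pord w x) (r + \<delta> * \<kappa> / 8) B \<sigma> \<and> length \<sigma> \<le> Suc l \<and> l1norm (hd \<sigma> - a) \<le> int l})"
proof -
  let ?\<pi> = "first_geodesic pord w x"
  let ?P = "\<lambda>a. \<exists>\<sigma>. shortcut w ?\<pi> (r + \<delta> * \<kappa> / 8) B \<sigma> \<and> length \<sigma> \<le> Suc l \<and> l1norm (hd \<sigma> - a) \<le> int l"
  have wr: "r \<le> w e" if "e \<in> lattice_edges" for e using reg that unfolding regular_def by blast
  then have w0: "0 \<le> w e" if "e \<in> lattice_edges" for e using that r by (meson order_trans)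
  have l0: "0 < l" using l(1) pos(1) by (cases l) auto
  have n: "1 \<le> \<kappa> * real_of_int (l1norm x)" using l(2) l0 by linarith
  have short: "length p \<le> L" if "sa_path p" "hd p = 0" "last p = x" "path_time w p \<le> D * real_of_int (l1norm x)" for p
  proof -
    have "real (length p - 1) \<le> (D / \<delta> + 1) / \<kappa> * real_of_int (l1norm x)"
      by (rule regular_short[OF reg r pos n w0 finite.emptyI _ _ that]) auto
    then show ?thesis using L by linarith
  qed
  have w0': "\<forall>e\<in>lattice_edges. 0 \<le> w e" using w0 by blast
  have sh: "\<forall>p. sa_path p \<longrightarrow> hd p = 0 \<longrightarrow> last p = x \<longrightarrow> path_time w p \<le> D * real_of_int (l1norm x) \<longrightarrow> length p \<le> L"
    using short by blast
  note geo = geodesic_exists[OF w0' p0 sh]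
  have \<pi>: "geodesic w 0 x ?\<pi>" using geo(1) first_geodesic_geodesic by blast
  then have sa\<pi>: "sa_path ?\<pi>" "hd ?\<pi> = 0" "last ?\<pi> = x" unfolding geodesic_def by auto
  have len: "real_of_int (l1norm x) \<le> real (length ?\<pi> - 1)" by (rule path_length_ge[OF sa\<pi>])
  then have klen: "\<kappa> * real_of_int (l1norm x) \<le> \<kappa> * real (length ?\<pi> - 1)" using pos by (intro mult_left_mono) auto
  then have "1 \<le> \<kappa> * real (length ?\<pi> - 1)" using n by linarith
  then obtain J where J: "disjoint_segs ?\<pi> J" "\<kappa> * real (length ?\<pi> - 1) \<le> real (card J)"
    "\<forall>(i, j)\<in>J. r * l1norm (?\<pi> ! i - ?\<pi> ! j) + \<delta> \<le> seg_time w ?\<pi> i j"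
    using reg sa\<pi>(1,2) unfolding regular_def by blast
  have "\<kappa> * real_of_int (l1norm x) / (2 * real l) \<le> \<kappa> * real (length ?\<pi> - 1) / (2 * real l)"
    using klen by (intro divide_right_mono) auto
  also have "\<dots> \<le> real (card {a \<in> set ?\<pi>. ?P a})"
    using J(3) klen l by (intro many_shortcuts[OF sa\<pi>(1) wr r J(1,2) _ pos(2,1) l(1) _ B]) auto
  also have "\<dots> \<le> real (card {a \<in> near L 0. ?P a})"
  proof -
    have "set ?\<pi> \<subseteq> near L 0"
    proof
      fix v assume "v \<in> set ?\<pi>"
      then obtain k where k: "k < length ?\<pi>" "v = ?\<pi> ! k" by (auto simp: in_set_conv_nth)
      have "?\<pi> \<noteq> []" using k(1) by auto
      then have "?\<pi> ! 0 = 0" using sa\<pi>(2) by (simp add: hd_conv_nth)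
      then have "l1norm (v - 0) \<le> int k"
        using l1norm_path_le[OF sa\<pi>(1), of 0 k] k l1norm_minus_commute[of 0 v] by simp
      then show "v \<in> near L 0" using geo(2)[OF \<pi>] k(1) by (intro near_l1norm) auto
    qed
    then show ?thesis by (intro of_nat_mono card_mono) auto
  qed
  finally show ?thesis .
qed

section \<open>Resampling the weights near a shortcut\<close>

lemma Inf_real_unbounded:
  fixes S :: "real set"
  assumes "\<not> bdd_below S"
  shows "Inf S = - (LEAST z :: real. False)"
proof -
  \<comment> \<open>Hence the predicate under \<open>LEAST\<close> in the supremum of the negated
    set is constantly false and no longer mentions S.\<close>
  have "\<not> (\<forall>x\<in>uminus ` S. x \<le> z)" for z
  proof
    assume "\<forall>x\<in>uminus ` S. x \<le> z"
    then have "\<forall>x\<in>S. - z \<le> x" by auto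
    then have "bdd_below S" by (auto simp: bdd_below_def)
    with assms show False by simp
  qed
  then have "(\<lambda>z. \<forall>x\<in>uminus ` S. x \<le> z) = (\<lambda>z. False)" by (intro ext iffI) blast+
  then have "(LEAST z. \<forall>x\<in>uminus ` S. x \<le> z) = (LEAST z. False)" by (rule arg_cong)
  then show ?thesis unfolding Inf_real_def Sup_real_def by (rule arg_cong)
qed

text \<open>If negative weights make the passage times unbounded below, the infimum is an unspecified constant.  This only
  happens on a null set, but the integral in the theorem is meaningful only if the integrand is measurable there too.\<close>
lemma geodesic_iff:
  fixes w :: "(int ^ 'd::finite) set \<Rightarrow> real"
  defines "X \<equiv> \<lambda>x y. {p. sa_path p \<and> hd p = x \<and> last p = y}"
  shows "geodesic w x y p \<longleftrightarrow> p \<in> X x y \<and>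
    (if \<exists>k::nat. \<forall>q. q \<in> X x y \<longrightarrow> - real k \<le> path_time w q then \<forall>q. q \<in> X x y \<longrightarrow> path_time w p \<le> path_time w q
     else path_time w p = - (LEAST z :: real. False))"
proof -
  let ?S = "path_time w ` X x y"
  have pt: "passage_time w x y = Inf ?S"
    unfolding passage_time_def X_def by (rule arg_cong[where f = Inf]) auto
  have bdd: "bdd_below ?S \<longleftrightarrow> (\<exists>k::nat. \<forall>q\<in>X x y. - real k \<le> path_time w q)"
  proof
    assume "bdd_below ?S"
    then obtain m where m: "\<forall>q\<in>X x y. m \<le> path_time w q" unfolding bdd_below_def by auto
    obtain k :: nat where "- m \<le> real k" using real_arch_simple by blast
    then have "\<forall>q\<in>X x y. - real k \<le> path_time w q" using m by force
    then show "\<exists>k::nat. \<forall>q\<in>X x y. - real k \<le> path_time w q" ..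
  qed (auto intro: bdd_belowI2)
  have bdd': "(\<exists>k::nat. \<forall>q. q \<in> X x y \<longrightarrow> - real k \<le> path_time w q) \<longleftrightarrow> bdd_below ?S"
    unfolding bdd Ball_def ..
  show ?thesis
  proof (cases "bdd_below ?S")
    case True
    have "path_time w p = Inf ?S \<longleftrightarrow> (\<forall>q\<in>X x y. path_time w p \<le> path_time w q)" if "p \<in> X x y"
    proof
      assume "path_time w p = Inf ?S"
      then show "\<forall>q\<in>X x y. path_time w p \<le> path_time w q" using True by (auto intro: cInf_lower)
    next
      assume "\<forall>q\<in>X x y. path_time w p \<le> path_time w q"
      then show "path_time w p = Inf ?S" using that by (intro cInf_eq_minimum[symmetric]) auto
    qed
    then show ?thesis using True unfolding geodesic_def pt bdd' by (auto simp: X_def)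
  next
    case False
    then show ?thesis using Inf_real_unbounded[OF False] unfolding geodesic_def pt bdd' by (auto simp: X_def)
  qed
qed

text \<open>Away from the index set all points of the product space take the value
  \<open>undefined\<close>, so these coordinates are constant.\<close>

lemma component_measurable:
  fixes e :: "(int ^ 'd::finite) set"
  assumes "sets \<mu> = sets borel"
  shows "(\<lambda>w. w e) \<in> borel_measurable (fpp_space \<mu>)"
proof (cases "e \<in> lattice_edges")
  case True
  then have "(\<lambda>w. w e) \<in> measurable (fpp_space \<mu>) \<mu>"
    unfolding fpp_space_def by (rule measurable_component_singleton)
  then show ?thesis using assms by (simp cong: measurable_cong_sets)
next
  case False
  have "(\<lambda>w. w e) \<in> borel_measurable (fpp_space \<mu>) \<longleftrightarrow>
      (\<lambda>w. undefined :: real) \<in> borel_measurable (fpp_space \<mu> :: ((int ^ 'd) set \<Rightarrow> real) measure)"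
    using False by (intro measurable_cong) (auto simp: fpp_space_def space_PiM PiE_def extensional_def)
  then show ?thesis by simp
qed

lemma path_time_measurable:
  fixes p :: "(int ^ 'd::finite) list"
  assumes "sets \<mu> = sets borel"
  shows "(\<lambda>w. path_time w p) \<in> borel_measurable (fpp_space \<mu>)"
  unfolding path_time_def using component_measurable[where 'd = 'd, OF assms] by measurable

lemma geodesic_measurable:
  fixes x :: "int ^ 'd::finite"
  assumes "sets \<mu> = sets borel"
  shows "Measurable.pred (fpp_space \<mu>) (\<lambda>w. geodesic w x y p)"
proof -
  note pm = path_time_measurable[where 'd = 'd, OF assms]
  have [measurable]: "Measurable.pred (fpp_space \<mu>) (\<lambda>w. path_time w p \<le> path_time w q)" for p q :: "(int ^ 'd) list"
    unfolding pred_def by (intro borel_measurable_le pm)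
  have [measurable]: "Measurable.pred (fpp_space \<mu>) (\<lambda>w. c \<le> path_time w q)" for c and q :: "(int ^ 'd) list"
    unfolding pred_def by (intro borel_measurable_le borel_measurable_const pm)
  have [measurable]: "Measurable.pred (fpp_space \<mu>) (\<lambda>w. path_time w q = c)" for c and q :: "(int ^ 'd) list"
    unfolding pred_def by (intro borel_measurable_eq borel_measurable_const pm)
  show ?thesis unfolding geodesic_iff by measurable
qed

text \<open>Injectivity of the ordering turns the choice made by \<open>arg_min\<close> into
  countably many comparisons. If no geodesic exists, the choice is a list that does not depend on
  w.\<close>

lemma first_geodesic_eq_iff:
  assumes "inj_on pord {p. sa_path p}"
  shows "first_geodesic pord w x = p \<longleftrightarrow>
    (if \<exists>q. geodesic w 0 x q then geodesic w 0 x p \<and> (\<forall>q. geodesic w 0 x q \<longrightarrow> pord p \<le> pord q)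
     else p = arg_min pord (\<lambda>_. False))"
proof (cases "\<exists>q. geodesic w 0 x q")
  case True
  let ?f = "first_geodesic pord w x"
  have f: "geodesic w 0 x ?f" using True first_geodesic_geodesic by blast
  have le: "pord ?f \<le> pord q" if "geodesic w 0 x q" for q
    unfolding first_geodesic_def using that by (rule arg_min_nat_le)
  have "?f = p" if p: "geodesic w 0 x p" "\<forall>q. geodesic w 0 x q \<longrightarrow> pord p \<le> pord q"
  proof (rule inj_onD[OF assms])
    show "pord ?f = pord p" using le[OF p(1)] p(2) f by (auto intro: antisym)
    show "?f \<in> {p. sa_path p}" "p \<in> {p. sa_path p}" using f p(1) unfolding geodesic_def by auto
  qed
  then show ?thesis using True f le by auto
next
  case False
  then have "geodesic w 0 x = (\<lambda>_. False)" by auto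
  then show ?thesis using False unfolding first_geodesic_def by auto
qed

lemma first_geodesic_measurable:
  fixes x :: "int ^ 'd::finite"
  assumes "sets \<mu> = sets borel" "inj_on pord {p :: (int ^ 'd) list. sa_path p}"
  shows "(\<lambda>w. first_geodesic pord w x) \<in> measurable (fpp_space \<mu>) (count_space UNIV)"
proof -
  note [measurable] = geodesic_measurable[where 'd = 'd, OF assms(1)]
  have "Measurable.pred (fpp_space \<mu>) (\<lambda>w. first_geodesic pord w x = p)" for p
    unfolding first_geodesic_eq_iff[OF assms(2)] by measurable
  then have "(\<lambda>w. first_geodesic pord w x) -` {p} \<inter> space (fpp_space \<mu>) \<in> sets (fpp_space \<mu>)" for p
    unfolding pred_def by (simp add: vimage_def Int_def conj_commute)
  then show ?thesis by (subst measurable_count_space_eq_countable) auto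
qed

lemma empirical_measurable:
  fixes x :: "int ^ 'd::finite"
  assumes "sets \<mu> = sets borel" "inj_on pord {p :: (int ^ 'd) list. sa_path p}"
  shows "(\<lambda>w. empirical pord w x {M..}) \<in> borel_measurable (fpp_space \<mu>)"
proof -
  note [measurable] = component_measurable[where 'd = 'd, OF assms(1)]
  have eq: "real (card {e \<in> path_edges p. w e \<in> {M..}}) = (\<Sum>e\<in>path_edges p. if M \<le> w e then 1 else 0)"
    for p :: "(int ^ 'd) list" and w
    by (simp add: sum.If_cases Int_def conj_commute)
  have "(\<lambda>w. real (card {e \<in> path_edges p. w e \<in> {M..}}) / real (card (path_edges p))) \<in> borel_measurable (fpp_space \<mu>)"
    for p :: "(int ^ 'd) list"
    unfolding eq by measurable
  from measurable_compose_countable[OF this first_geodesic_measurable[OF assms, of x]]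
  show ?thesis unfolding empirical_def Let_def .
qed

lemma empirical_bounds: "0 \<le> empirical pord w x B" "empirical pord w x B \<le> 1"
proof -
  show "0 \<le> empirical pord w x B" unfolding empirical_def Let_def by simp
  let ?p = "first_geodesic pord w x"
  have "card {e \<in> path_edges ?p. w e \<in> B} \<le> card (path_edges ?p)" by (intro card_mono) auto
  then show "empirical pord w x B \<le> 1" unfolding empirical_def Let_def by (simp add: divide_le_eq)
qed

lemma empirical_integrable:
  fixes x :: "int ^ 'd::finite"
  assumes "prob_space \<mu>" "sets \<mu> = sets borel" "inj_on pord {p :: (int ^ 'd) list. sa_path p}"
  shows "integrable (fpp_space \<mu>) (\<lambda>w. empirical pord w x {M..})"
proof -
  interpret P: prob_space "fpp_space \<mu> :: ((int ^ 'd) set \<Rightarrow> real) measure"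
    unfolding fpp_space_def by (intro prob_space_PiM assms(1))
  show ?thesis
    using empirical_bounds[of pord _ x "{M..}"]
    by (intro P.integrable_const_bound[where B = 1] empirical_measurable[OF assms(2,3)]) auto
qed

lemma success_measurable:
  fixes x :: "int ^ 'd::finite"
  assumes "sets \<mu> = sets borel" "inj_on pord {p :: (int ^ 'd) list. sa_path p}"
  shows "{w \<in> space (fpp_space \<mu>). success pord x M L \<sigma> w} \<in> sets (fpp_space \<mu>)"
proof -
  note [measurable] = component_measurable[where 'd = 'd, OF assms(1)] geodesic_measurable[where 'd = 'd, OF assms(1)]
  have "Measurable.pred (fpp_space \<mu>) (\<lambda>w. geodesic w 0 x p \<and> length p \<le> L \<and> (\<exists>e\<in>path_edges p \<inter> nbhd \<sigma>. M \<le> w e))" for p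
    by measurable
  from measurable_compose_countable[OF this first_geodesic_measurable[OF assms, of x]]
  show ?thesis unfolding success_def pred_def .
qed

text \<open>The restriction to \<open>lattice_edges\<close> keeps the result extensional, hence
  inside the product space.\<close>

definition resample :: "(int ^ 'd::finite) set set \<Rightarrow> ((int ^ 'd) set \<Rightarrow> real) \<Rightarrow> ((int ^ 'd) set \<Rightarrow> real) \<Rightarrow> (int ^ 'd) set \<Rightarrow> real" where
  "resample N w v = (\<lambda>e\<in>lattice_edges. if e \<in> N then v e else w e)"

text \<open>On a cylinder set the conditions split into those on edges outside N, read from w, and
  those on edges in N, read from the independent copy v.\<close>

lemma resample_measure:
  fixes \<mu> :: "real measure" and N :: "(int ^ 'd::finite) set set"
  assumes mu: "prob_space \<mu>"
  defines "P \<equiv> fpp_space \<mu> :: ((int ^ 'd) set \<Rightarrow> real) measure"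
  shows "(\<lambda>z. resample N (fst z) (snd z)) \<in> measurable (P \<Otimes>\<^sub>M P) P"
    and "distr (P \<Otimes>\<^sub>M P) P (\<lambda>z. resample N (fst z) (snd z)) = P"
proof -
  interpret mu: prob_space \<mu> by (rule mu)
  interpret PP: product_prob_space "\<lambda>_. \<mu>" "lattice_edges :: (int ^ 'd) set set" by unfold_locales
  interpret P: prob_space P unfolding P_def fpp_space_def by (rule PP.P.prob_space_axioms)
  have comp: "(\<lambda>w. w e) \<in> measurable P \<mu>" if "e \<in> lattice_edges" for e
    unfolding P_def fpp_space_def using that by (rule measurable_component_singleton)
  show meas: "(\<lambda>z. resample N (fst z) (snd z)) \<in> measurable (P \<Otimes>\<^sub>M P) P"
    unfolding P_def fpp_space_def resample_def
  proof (rule measurable_restrict)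
    fix e :: "(int ^ 'd) set" assume e: "e \<in> lattice_edges"
    note [measurable] = comp[OF e, unfolded P_def fpp_space_def]
    show "(\<lambda>z. if e \<in> N then snd z e else fst z e) \<in> Pi\<^sub>M lattice_edges (\<lambda>_. \<mu>) \<Otimes>\<^sub>M Pi\<^sub>M lattice_edges (\<lambda>_. \<mu>) \<rightarrow>\<^sub>M \<mu>"
      by (cases "e \<in> N") simp_all
  qed
  have "distr (P \<Otimes>\<^sub>M P) P (\<lambda>z. resample N (fst z) (snd z)) = PiM lattice_edges (\<lambda>_. \<mu>)"
  proof (rule PP.PiM_eq)
    fix J F assume J: "finite J" "J \<subseteq> (lattice_edges :: (int ^ 'd) set set)" and F: "\<And>j. j \<in> J \<Longrightarrow> F j \<in> sets \<mu>"
    let ?Z = "prod_emb lattice_edges (\<lambda>_. \<mu>) J (\<Pi>\<^sub>E j\<in>J. F j)"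
    let ?A = "\<lambda>K. {w \<in> space P. \<forall>j\<in>K. w j \<in> F j}"
    have Zeq: "?Z = ?A J"
      unfolding P_def fpp_space_def prod_emb_def using J by (auto simp: space_PiM PiE_iff extensional_def)
    have As: "?A K \<in> sets P" if "K \<subseteq> J" for K
      unfolding P_def fpp_space_def using that J F
      by (intro sets.sets_Collect_finite_All sets_Collect_single'[of _ lattice_edges "\<lambda>_. \<mu>" "\<lambda>x. x \<in> F _"])
        (auto intro: finite_subset)
    have Am: "emeasure P (?A K) = (\<Prod>j\<in>K. emeasure \<mu> (F j))" if "K \<subseteq> J" for K
      unfolding P_def fpp_space_def using that J F by (intro PP.emeasure_PiM_Collect) (auto intro: finite_subset)
    have "emeasure (distr (P \<Otimes>\<^sub>M P) P (\<lambda>z. resample N (fst z) (snd z))) ?Z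
      = emeasure (P \<Otimes>\<^sub>M P) ((\<lambda>z. resample N (fst z) (snd z)) -` ?A J \<inter> space (P \<Otimes>\<^sub>M P))"
      unfolding Zeq by (rule emeasure_distr[OF meas As]) simp
    also have "(\<lambda>z. resample N (fst z) (snd z)) -` ?A J \<inter> space (P \<Otimes>\<^sub>M P) = ?A (J - N) \<times> ?A (J \<inter> N)"
    proof -
      have sp: "resample N w v \<in> space P" if "w \<in> space P" "v \<in> space P" for w v
        using measurable_space[OF meas, of "(w, v)"] that by (simp add: space_pair_measure)
      have "resample N w v e = (if e \<in> N then v e else w e)" if "e \<in> J" for w v e
        using that J(2) unfolding resample_def by auto
      then show ?thesis using sp by (auto simp: space_pair_measure)
    qed
    also have "emeasure (P \<Otimes>\<^sub>M P) (?A (J - N) \<times> ?A (J \<inter> N)) = emeasure P (?A (J - N)) * emeasure P (?A (J \<inter> N))"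
      by (intro P.emeasure_pair_measure_Times As) auto
    also have "\<dots> = (\<Prod>j\<in>J. emeasure \<mu> (F j))"
      using J(1) by (simp add: Am prod.Int_Diff[of J _ N] mult.commute)
    finally show "emeasure (distr (P \<Otimes>\<^sub>M P) P (\<lambda>z. resample N (fst z) (snd z))) ?Z = (\<Prod>j\<in>J. emeasure \<mu> (F j))" .
  qed (simp add: P_def fpp_space_def)
  then show "distr (P \<Otimes>\<^sub>M P) P (\<lambda>z. resample N (fst z) (snd z)) = P" by (simp add: P_def fpp_space_def)
qed

text \<open>Fubini: with the old weights w frozen, only the copy v is random. An event is thus
  bounded from below by a conditional probability given w.\<close>

lemma emeasure_resample:
  fixes \<mu> :: "real measure" and N :: "(int ^ 'd::finite) set set"
  assumes mu: "prob_space \<mu>" and H: "H \<in> sets (fpp_space \<mu>)"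
  defines "P \<equiv> fpp_space \<mu> :: ((int ^ 'd) set \<Rightarrow> real) measure"
  shows "(\<lambda>w. emeasure P {v \<in> space P. resample N w v \<in> H}) \<in> borel_measurable P"
    and "emeasure P H = (\<integral>\<^sup>+w. emeasure P {v \<in> space P. resample N w v \<in> H} \<partial>P)"
    and "w \<in> space P \<Longrightarrow> {v \<in> space P. resample N w v \<in> H} \<in> sets P"
proof -
  interpret P: prob_space P unfolding P_def fpp_space_def by (intro prob_space_PiM mu)
  let ?g = "\<lambda>z. resample N (fst z) (snd z)"
  note rm = resample_measure[OF mu, of N, folded P_def]
  let ?Q = "?g -` H \<inter> space (P \<Otimes>\<^sub>M P)"
  have Q: "?Q \<in> sets (P \<Otimes>\<^sub>M P)" using rm(1) H unfolding P_def by (rule measurable_sets)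
  have sec: "Pair w -` ?Q = {v \<in> space P. resample N w v \<in> H}" if "w \<in> space P" for w
    using that by (auto simp: space_pair_measure)
  show "w \<in> space P \<Longrightarrow> {v \<in> space P. resample N w v \<in> H} \<in> sets P"
    using sets_Pair1[OF Q, of w] sec[of w] by simp
  have "(\<lambda>w. emeasure P (Pair w -` ?Q)) \<in> borel_measurable P" by (rule P.measurable_emeasure_Pair[OF Q])
  then show "(\<lambda>w. emeasure P {v \<in> space P. resample N w v \<in> H}) \<in> borel_measurable P"
    by (subst measurable_cong[where g = "\<lambda>w. emeasure P (Pair w -` ?Q)"]) (simp_all only: sec)
  have "emeasure P H = emeasure (distr (P \<Otimes>\<^sub>M P) P ?g) H" using rm(2) by simp
  also have "\<dots> = emeasure (P \<Otimes>\<^sub>M P) ?Q" using rm(1) H unfolding P_def by (rule emeasure_distr)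
  also have "\<dots> = (\<integral>\<^sup>+w. emeasure P (Pair w -` ?Q) \<partial>P)" by (rule P.emeasure_pair_measure_alt[OF Q])
  also have "\<dots> = (\<integral>\<^sup>+w. emeasure P {v \<in> space P. resample N w v \<in> H} \<partial>P)"
    by (intro nn_integral_cong) (simp only: sec)
  finally show "emeasure P H = (\<integral>\<^sup>+w. emeasure P {v \<in> space P. resample N w v \<in> H} \<partial>P)" .
qed

text \<open>Each window except that of the first edge has mass \<open>measure \<mu> {0..s}\<close>
  or \<open>measure \<mu> {M..}\<close>. Replacing either by the product of both makes the bound
  independent of the shape of \<sigma>.\<close>

lemma target_prob:
  fixes \<mu> :: "real measure" and \<sigma> :: "(int ^ 'd::finite) list"
  assumes mu: "prob_space \<mu>" "sets \<mu> = sets borel" and \<sigma>: "sa_path \<sigma>" "2 \<le> length \<sigma>" and K: "card (nbhd \<sigma>) \<le> K"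
  shows "{v \<in> space (fpp_space \<mu>). \<forall>e\<in>nbhd \<sigma>. v e \<in> target s M B \<sigma> e} \<in> sets (fpp_space \<mu>)"
    and "measure \<mu> {M..B} * (measure \<mu> {0..s} * measure \<mu> {M..}) ^ K
      \<le> measure (fpp_space \<mu>) {v \<in> space (fpp_space \<mu>). \<forall>e\<in>nbhd \<sigma>. v e \<in> target s M B \<sigma> e}"
proof -
  interpret mu: prob_space \<mu> by (rule mu(1))
  interpret PP: product_prob_space "\<lambda>_. \<mu>" "lattice_edges :: (int ^ 'd) set set" by unfold_locales
  note fin = card_nbhd_le(1)[OF \<sigma>]
  have T: "target s M B \<sigma> e \<in> sets \<mu>" for e unfolding target_def using mu(2) by simp
  show sets: "{v \<in> space (fpp_space \<mu>). \<forall>e\<in>nbhd \<sigma>. v e \<in> target s M B \<sigma> e} \<in> sets (fpp_space \<mu>)"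
    unfolding fpp_space_def using fin nbhd_subset[OF \<sigma>(2,1)] T
    by (intro sets.sets_Collect_finite_All sets_Collect_single'[of _ lattice_edges "\<lambda>_. \<mu>" "\<lambda>x. x \<in> target s M B \<sigma> _"]) auto
  have "emeasure (fpp_space \<mu>) {v \<in> space (fpp_space \<mu>). \<forall>e\<in>nbhd \<sigma>. v e \<in> target s M B \<sigma> e}
      = (\<Prod>e\<in>nbhd \<sigma>. emeasure \<mu> (target s M B \<sigma> e))"
    unfolding fpp_space_def using fin nbhd_subset[OF \<sigma>(2,1)] T by (intro PP.emeasure_PiM_Collect) auto
  also have "\<dots> = ennreal (\<Prod>e\<in>nbhd \<sigma>. measure \<mu> (target s M B \<sigma> e))"
    by (simp add: mu.emeasure_eq_measure prod_ennreal)
  finally have eq: "measure (fpp_space \<mu>) {v \<in> space (fpp_space \<mu>). \<forall>e\<in>nbhd \<sigma>. v e \<in> target s M B \<sigma> e}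
      = (\<Prod>e\<in>nbhd \<sigma>. measure \<mu> (target s M B \<sigma> e))"
    unfolding measure_def[of "fpp_space \<mu>"] by (simp add: prod_nonneg)
  let ?e1 = "{\<sigma> ! 0, \<sigma> ! 1}" and ?c = "measure \<mu> {0..s} * measure \<mu> {M..}"
  have c: "0 \<le> ?c" "?c \<le> 1" by (auto intro: mult_le_one)
  have e1: "?e1 \<in> nbhd \<sigma>" unfolding nbhd_def by simp
  have "?c ^ K \<le> ?c ^ card (nbhd \<sigma> - {?e1})"
    using c K fin by (intro power_decreasing) (auto intro: order_trans[OF card_Diff1_le])
  also have "\<dots> = (\<Prod>e\<in>nbhd \<sigma> - {?e1}. ?c)" by simp
  also have "\<dots> \<le> (\<Prod>e\<in>nbhd \<sigma> - {?e1}. measure \<mu> (target s M B \<sigma> e))"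
  proof (rule prod_mono)
    fix e assume "e \<in> nbhd \<sigma> - {?e1}"
    then have "target s M B \<sigma> e = {0..s} \<or> target s M B \<sigma> e = {M..}" unfolding target_def by auto
    then show "0 \<le> ?c \<and> ?c \<le> measure \<mu> (target s M B \<sigma> e)"
      using c by (auto simp: mult_left_le mult_right_le_one_le mult_left_le_one_le)
  qed
  finally have "measure \<mu> {M..B} * ?c ^ K \<le> measure \<mu> {M..B} * (\<Prod>e\<in>nbhd \<sigma> - {?e1}. measure \<mu> (target s M B \<sigma> e))"
    by (intro mult_left_mono) auto
  also have "\<dots> = (\<Prod>e\<in>nbhd \<sigma>. measure \<mu> (target s M B \<sigma> e))"
    using fin e1 by (subst prod.remove[of _ ?e1]) (auto simp: target_def)
  finally show "measure \<mu> {M..B} * ?c ^ K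
      \<le> measure (fpp_space \<mu>) {v \<in> space (fpp_space \<mu>). \<forall>e\<in>nbhd \<sigma>. v e \<in> target s M B \<sigma> e}"
    unfolding eq .
qed

section \<open>Counting the shapes of shortcuts\<close>

definition short_paths :: "nat \<Rightarrow> int ^ 'd::finite \<Rightarrow> (int ^ 'd) list set" where
  "short_paths l a = {\<sigma>. sa_path \<sigma> \<and> 2 \<le> length \<sigma> \<and> length \<sigma> \<le> Suc l \<and> l1norm (hd \<sigma> - a) \<le> int l}"

lemma card_paths_from_le:
  fixes h :: "int ^ 'd::finite"
  shows "card {\<sigma>. sa_path \<sigma> \<and> hd \<sigma> = h \<and> length \<sigma> \<le> Suc l} \<le> Suc l * (4 ^ CARD('d)) ^ l"
proof -
  let ?W = "\<lambda>k. {\<sigma>. length \<sigma> = Suc k \<and> hd \<sigma> = h \<and> successively (\<lambda>u v. v \<in> near 2 u) \<sigma>}"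
  have "card {v. v \<in> near 2 (u :: int ^ 'd)} \<le> 4 ^ CARD('d)" for u using card_near_le[of 2 u] by simp
  then have W: "finite (?W k)" "card (?W k) \<le> (4 ^ CARD('d)) ^ k" for k
    using card_walks_le[of "\<lambda>u v. v \<in> near 2 u" "4 ^ CARD('d)" k h] by auto
  have "{\<sigma>. sa_path \<sigma> \<and> hd \<sigma> = h \<and> length \<sigma> \<le> Suc l} \<subseteq> (\<Union>k\<in>{..l}. ?W k)"
  proof safe
    fix \<sigma> :: "(int ^ 'd) list" assume \<sigma>: "sa_path \<sigma>" "length \<sigma> \<le> Suc l" "h = hd \<sigma>"
    have "successively (\<lambda>u v. v \<in> near 2 u) \<sigma>"
      unfolding successively_conv_nth using sa_path_edge[OF \<sigma>(1)] edge_near by auto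
    moreover have "\<sigma> \<noteq> []" using \<sigma>(1) unfolding sa_path_def by simp
    ultimately show "\<sigma> \<in> (\<Union>k\<in>{..l}. {\<sigma>'. length \<sigma>' = Suc k \<and> hd \<sigma>' = hd \<sigma> \<and> successively (\<lambda>u v. v \<in> near 2 u) \<sigma>'})"
      using \<sigma>(2) by (cases "length \<sigma>") auto
  qed
  then have "card {\<sigma>. sa_path \<sigma> \<and> hd \<sigma> = h \<and> length \<sigma> \<le> Suc l} \<le> card (\<Union>k\<in>{..l}. ?W k)"
    using W(1) by (intro card_mono) auto
  also have "\<dots> \<le> (\<Sum>k\<in>{..l}. card (?W k))" by (rule card_UN_le) simp
  also have "\<dots> \<le> (\<Sum>k\<in>{..l}. (4 ^ CARD('d)) ^ l)"
  proof (rule sum_mono)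
    fix k assume "k \<in> {..l}"
    then have "((4::nat) ^ CARD('d)) ^ k \<le> (4 ^ CARD('d)) ^ l" by (intro power_increasing) auto
    then show "card (?W k) \<le> (4 ^ CARD('d)) ^ l" using W(2)[of k] by linarith
  qed
  finally show ?thesis by simp
qed

lemma finite_short_paths [simp]: "finite (short_paths l a)"
proof -
  have "short_paths l a \<subseteq> (\<Union>h\<in>near (Suc l) a. {\<sigma>. sa_path \<sigma> \<and> hd \<sigma> = h \<and> length \<sigma> \<le> Suc l})"
    unfolding short_paths_def by (auto intro!: near_l1norm)
  then show ?thesis by (rule finite_subset) (simp add: finite_bounded_paths)
qed

text \<open>An edge of \<open>nbhd\<close> confines the start of \<sigma> to a ball around the edge,
  and the start confines the anchor to another ball. The number of shapes from a given start is
  exponential in l.\<close>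

lemma multiplicity:
  fixes e :: "(int ^ 'd::finite) set"
  assumes "e \<in> lattice_edges" "finite V"
  shows "card {z \<in> (SIGMA a:V. short_paths l a). e \<in> nbhd (snd z)}
    \<le> (2 * (l + 2)) ^ CARD('d) * ((Suc l * (4 ^ CARD('d)) ^ l) * (2 * (l + 2)) ^ CARD('d))"
proof -
  obtain u u' where e: "e = {u, u'}" "l1norm (u - u') = 1" using assms(1) by (elim lattice_edgeE)
  let ?S = "\<lambda>h. {\<sigma>. sa_path \<sigma> \<and> hd \<sigma> = h \<and> length \<sigma> \<le> Suc l}"
  let ?T = "\<Union>h\<in>near (l + 2) u. near (l + 2) h \<times> ?S h"
  have finT: "finite ?T" by (simp add: finite_bounded_paths)
  have sub: "{z \<in> (SIGMA a:V. short_paths l a). e \<in> nbhd (snd z)} \<subseteq> ?T"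
  proof safe
    fix a \<sigma> assume \<sigma>: "\<sigma> \<in> short_paths l a" and en: "e \<in> nbhd (snd (a, \<sigma>))"
    have s: "sa_path \<sigma>" "2 \<le> length \<sigma>" "length \<sigma> \<le> Suc l" "l1norm (hd \<sigma> - a) \<le> int l"
      using \<sigma> unfolding short_paths_def by auto
    have "e \<in> edges_at (set \<sigma>)" using nbhd_edges_at[OF s(1,2)] en by auto
    then obtain k where k: "k < length \<sigma>" "\<sigma> ! k \<in> e" unfolding edges_at_def by (auto simp: in_set_conv_nth)
    have "\<sigma> \<noteq> []" using s(2) by auto
    then have "l1norm (hd \<sigma> - \<sigma> ! k) \<le> int l"
      using l1norm_path_le[OF s(1), of 0 k] k(1) s(3) by (simp add: hd_conv_nth)
    moreover have "l1norm (\<sigma> ! k - u) \<le> 1" using k(2) e by (auto simp: l1norm_minus_commute)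
    ultimately have "l1norm (hd \<sigma> - u) \<le> int l + 1" using l1norm_triangle_diff[of "hd \<sigma>" u "\<sigma> ! k"] by linarith
    then have "hd \<sigma> \<in> near (l + 2) u" by (intro near_l1norm) simp
    moreover have "a \<in> near (l + 2) (hd \<sigma>)" using s(4) by (intro near_l1norm) (simp add: l1norm_minus_commute)
    ultimately show "(a, \<sigma>) \<in> ?T" using s by auto
  qed
  have "card {z \<in> (SIGMA a:V. short_paths l a). e \<in> nbhd (snd z)} \<le> card ?T"
    by (intro card_mono finT sub)
  also have "\<dots> \<le> (\<Sum>h\<in>near (l + 2) u. card (near (l + 2) h \<times> ?S h))" by (rule card_UN_le) simp
  also have "\<dots> \<le> (\<Sum>h\<in>near (l + 2) u. (Suc l * (4 ^ CARD('d)) ^ l) * (2 * (l + 2)) ^ CARD('d))"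
  proof (rule sum_mono)
    fix h :: "int ^ 'd"
    have "card (near (l + 2) h) * card (?S h) \<le> (2 * (l + 2)) ^ CARD('d) * (Suc l * (4 ^ CARD('d)) ^ l)"
      by (intro mult_mono card_near_le card_paths_from_le) auto
    then show "card (near (l + 2) h \<times> ?S h) \<le> (Suc l * (4 ^ CARD('d)) ^ l) * (2 * (l + 2)) ^ CARD('d)"
      by (simp add: card_cartesian_product mult_ac)
  qed
  also have "\<dots> \<le> (2 * (l + 2)) ^ CARD('d) * ((Suc l * (4 ^ CARD('d)) ^ l) * (2 * (l + 2)) ^ CARD('d))"
    using card_near_le[of "l + 2" u] by (simp del: mult_Suc)
  finally show ?thesis .
qed

section \<open>Lower bound for the density of heavy edges\<close>

text \<open>Double counting: every successful pair has a heavy edge on the geodesic in its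
  \<open>nbhd\<close>, and one edge serves at most m pairs.\<close>

lemma success_count_le:
  fixes w :: "(int ^ 'd::finite) set \<Rightarrow> real"
  assumes fin: "finite V"
    and mult: "\<And>e. e \<in> lattice_edges \<Longrightarrow> card {z \<in> (SIGMA a:V. short_paths l a). e \<in> nbhd (snd z)} \<le> m"
  shows "(\<Sum>z\<in>(SIGMA a:V. short_paths l a). of_bool (success pord x M L (snd z) w)) \<le> real (m * L) * empirical pord w x {M..}"
proof -
  let ?I = "SIGMA a:V. short_paths l a"
  let ?\<pi> = "first_geodesic pord w x"
  let ?H = "{e \<in> path_edges ?\<pi>. w e \<in> {M..}}"
  have finI: "finite ?I" using fin by (intro finite_SigmaI) auto
  show ?thesis
  proof (cases "geodesic w 0 x ?\<pi> \<and> length ?\<pi> \<le> L")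
    case True
    then have \<pi>: "sa_path ?\<pi>" "length ?\<pi> \<le> L" unfolding geodesic_def by auto
    have pe: "card (path_edges ?\<pi>) \<le> L"
      using card_path_edges[of ?\<pi>] \<pi> unfolding sa_path_def by auto
    have "(\<Sum>z\<in>?I. of_bool (success pord x M L (snd z) w)) = real (card {z \<in> ?I. success pord x M L (snd z) w})"
      by (rule sum_of_bool_card[OF finI])
    also have "\<dots> \<le> real (card (\<Union>e\<in>?H. {z \<in> ?I. e \<in> nbhd (snd z)}))"
      using finI unfolding success_def by (intro of_nat_mono card_mono) auto
    also have "\<dots> \<le> real (\<Sum>e\<in>?H. card {z \<in> ?I. e \<in> nbhd (snd z)})"
      by (intro of_nat_mono card_UN_le) simp
    also have "\<dots> \<le> real (\<Sum>e\<in>?H. m)"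
      using path_edges_subset[OF \<pi>(1)] by (intro of_nat_mono sum_mono mult) auto
    also have "\<dots> = real m * real (card ?H)" by simp
    also have "\<dots> \<le> real m * (real L * empirical pord w x {M..})"
    proof (rule mult_left_mono)
      show "real (card ?H) \<le> real L * empirical pord w x {M..}"
      \<comment> \<open>For a geodesic without edges the density is 0 / 0 = 0.\<close>
      proof (cases "card (path_edges ?\<pi>) = 0")
        case True
        then have "path_edges ?\<pi> = {}" by simp
        then show ?thesis using empirical_bounds(1)[of pord w x "{M..}"] by simp
      next
        case False
        have "real (card ?H) = real (card (path_edges ?\<pi>)) * empirical pord w x {M..}"
          unfolding empirical_def Let_def using False by simp
        also have "\<dots> \<le> real L * empirical pord w x {M..}"
          using pe empirical_bounds(1)[of pord w x "{M..}"] by (intro mult_right_mono) auto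
        finally show ?thesis .
      qed
    qed simp
    finally show ?thesis by (simp add: mult_ac)
  next
    case False
    then have "\<not> success pord x M L \<sigma> w" for \<sigma> unfolding success_def by auto
    then show ?thesis using empirical_bounds(1)[of pord w x "{M..}"] by simp
  qed
qed

text \<open>The mean number of successful pairs is estimated twice. Resampling preserves the law, so
  each success probability is the mean of h, which for w in G is at least p for one shape at each of
  g anchors. The upper bound is \<open>success_count_le\<close>.\<close>

lemma averaging:
  fixes \<mu> :: "real measure" and x :: "int ^ 'd::finite" and pord :: "(int ^ 'd) list \<Rightarrow> nat"
  assumes mu: "prob_space \<mu>" "sets \<mu> = sets borel" and pord: "inj_on pord {p. sa_path p}"
    and G: "G \<in> sets (fpp_space \<mu>)" "1 / 2 \<le> measure (fpp_space \<mu>) G" and g: "0 \<le> g"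
    and V: "finite V"
    and many: "\<And>w. w \<in> G \<Longrightarrow> g \<le> real (card {a \<in> V. \<exists>\<sigma>\<in>short_paths l a.
       \<forall>w'. (\<forall>e\<in>lattice_edges. e \<notin> nbhd \<sigma> \<longrightarrow> w' e = w e) \<longrightarrow> (\<forall>e\<in>nbhd \<sigma>. w' e \<in> target s M B \<sigma> e) \<longrightarrow> success pord x M L \<sigma> w'})"
    and mult: "\<And>e. e \<in> lattice_edges \<Longrightarrow> card {z \<in> (SIGMA a:V. short_paths l a). e \<in> nbhd (snd z)} \<le> m"
  shows "g * (measure \<mu> {M..B} * (measure \<mu> {0..s} * measure \<mu> {M..}) ^ (Suc l * 4 ^ CARD('d))) / 2
    \<le> real (m * L) * (\<integral>w. empirical pord w x {M..} \<partial>fpp_space \<mu>)"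
proof -
  let ?P = "fpp_space \<mu> :: ((int ^ 'd) set \<Rightarrow> real) measure"
  interpret mu: prob_space \<mu> by (rule mu(1))
  interpret P: prob_space ?P unfolding fpp_space_def by (intro prob_space_PiM mu(1))
  define p where "p = measure \<mu> {M..B} * (measure \<mu> {0..s} * measure \<mu> {M..}) ^ (Suc l * 4 ^ CARD('d))"
  have p0: "0 \<le> p" unfolding p_def by simp
  define I where "I = (SIGMA a:V. short_paths l a)"
  have finI: "finite I" unfolding I_def using V by (intro finite_SigmaI) auto
  define H where "H \<sigma> = {w \<in> space ?P. success pord x M L \<sigma> w}" for \<sigma>
  have Hs: "H \<sigma> \<in> sets ?P" for \<sigma> unfolding H_def by (rule success_measurable[OF mu(2) pord])
  define h where "h \<sigma> w = emeasure ?P {v \<in> space ?P. resample (nbhd \<sigma>) w v \<in> H \<sigma>}" for \<sigma> w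
  have hm [measurable]: "h \<sigma> \<in> borel_measurable ?P" for \<sigma>
    unfolding h_def by (rule emeasure_resample(1)[OF mu(1) Hs])
  have hH: "emeasure ?P (H \<sigma>) = (\<integral>\<^sup>+w. h \<sigma> w \<partial>?P)" for \<sigma>
    unfolding h_def by (rule emeasure_resample(2)[OF mu(1) Hs])
  have sp: "resample N w v \<in> space ?P" if "w \<in> space ?P" "v \<in> space ?P" for N w v
    using measurable_space[OF resample_measure(1)[OF mu(1), of N], of "(w, v)"] that by (simp add: space_pair_measure)
  have hlow: "ennreal p \<le> h \<sigma> w" if \<sigma>: "\<sigma> \<in> short_paths l a" and w: "w \<in> space ?P"
    and ok: "\<forall>w'. (\<forall>e\<in>lattice_edges. e \<notin> nbhd \<sigma> \<longrightarrow> w' e = w e) \<longrightarrow> (\<forall>e\<in>nbhd \<sigma>. w' e \<in> target s M B \<sigma> e) \<longrightarrow> success pord x M L \<sigma> w'"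
    for \<sigma> a w
  proof -
    have s: "sa_path \<sigma>" "2 \<le> length \<sigma>" "length \<sigma> \<le> Suc l" using \<sigma> unfolding short_paths_def by auto
    have "length \<sigma> * 4 ^ CARD('d) \<le> Suc l * 4 ^ CARD('d)" using s(3) by (rule mult_le_mono1)
    then have K: "card (nbhd \<sigma>) \<le> Suc l * 4 ^ CARD('d)" using card_nbhd_le(2)[OF s(1,2)] by linarith
    let ?T = "{v \<in> space ?P. \<forall>e\<in>nbhd \<sigma>. v e \<in> target s M B \<sigma> e}"
    note T = target_prob[OF mu s(1,2) K, where s = s and M = M and B = B, folded p_def]
    have "ennreal p \<le> emeasure ?P ?T" using T(2) by (simp add: P.emeasure_eq_measure)
    also have "\<dots> \<le> h \<sigma> w"
      unfolding h_def
    proof (rule emeasure_mono)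
      show "?T \<subseteq> {v \<in> space ?P. resample (nbhd \<sigma>) w v \<in> H \<sigma>}"
      proof safe
        fix v assume v: "v \<in> space ?P" "\<forall>e\<in>nbhd \<sigma>. v e \<in> target s M B \<sigma> e"
        have "success pord x M L \<sigma> (resample (nbhd \<sigma>) w v)"
        proof (rule ok[rule_format])
          fix e assume "e \<in> nbhd \<sigma>"
          then show "resample (nbhd \<sigma>) w v e \<in> target s M B \<sigma> e"
            using v(2) nbhd_subset[OF s(2,1)] unfolding resample_def by auto
        qed (simp add: resample_def)
        then show "resample (nbhd \<sigma>) w v \<in> H \<sigma>" unfolding H_def using sp[OF w v(1)] by simp
      qed
      show "{v \<in> space ?P. resample (nbhd \<sigma>) w v \<in> H \<sigma>} \<in> sets ?P"
        by (rule emeasure_resample(3)[OF mu(1) Hs w])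
    qed
    finally show ?thesis .
  qed
  have lower: "ennreal (g * p) \<le> (\<Sum>z\<in>I. h (snd z) w)" if w: "w \<in> G" for w
  proof -
    have wsp: "w \<in> space ?P" using w G(1) sets.sets_into_space by blast
    let ?ok = "\<lambda>\<sigma>. \<forall>w'. (\<forall>e\<in>lattice_edges. e \<notin> nbhd \<sigma> \<longrightarrow> w' e = w e) \<longrightarrow> (\<forall>e\<in>nbhd \<sigma>. w' e \<in> target s M B \<sigma> e) \<longrightarrow> success pord x M L \<sigma> w'"
    let ?A = "{a \<in> V. \<exists>\<sigma>\<in>short_paths l a. ?ok \<sigma>}"
    \<comment> \<open>One shape per anchor suffices: different anchors give different pairs even if
      the shapes agree.\<close>
    have "\<forall>a\<in>?A. \<exists>\<sigma>. \<sigma> \<in> short_paths l a \<and> ?ok \<sigma>" by blast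
    from bchoice[OF this] obtain f where f: "\<forall>a\<in>?A. f a \<in> short_paths l a \<and> ?ok (f a)" by (elim exE)
    have "ennreal (g * p) \<le> ennreal (real (card ?A) * p)"
      using many[OF w] p0 by (intro ennreal_leI mult_right_mono) auto
    also have "\<dots> = (\<Sum>a\<in>?A. ennreal p)"
      using p0 by (simp add: ennreal_mult ennreal_of_nat_eq_real_of_nat)
    also have "\<dots> \<le> (\<Sum>a\<in>?A. h (f a) w)"
    proof (rule sum_mono)
      fix a assume "a \<in> ?A"
      with f have "f a \<in> short_paths l a" "?ok (f a)" by blast+
      then show "ennreal p \<le> h (f a) w" by (rule hlow[OF _ wsp])
    qed
    also have "\<dots> = (\<Sum>z\<in>(\<lambda>a. (a, f a)) ` ?A. h (snd z) w)"
      by (subst sum.reindex) (auto simp: inj_on_def)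
    also have "\<dots> \<le> (\<Sum>z\<in>I. h (snd z) w)"
    proof (rule sum_mono2[OF finI])
      show "(\<lambda>a. (a, f a)) ` ?A \<subseteq> I" unfolding I_def using f by blast
    qed simp
    finally show ?thesis .
  qed
  have "ennreal (g * p / 2) \<le> ennreal (g * p * measure ?P G)"
    using mult_left_mono[OF G(2), of "g * p"] g p0 by (intro ennreal_leI) simp
  also have "\<dots> = ennreal (g * p) * emeasure ?P G"
    using g p0 by (simp add: P.emeasure_eq_measure ennreal_mult)
  also have "\<dots> = (\<integral>\<^sup>+w. ennreal (g * p) * indicator G w \<partial>?P)"
    using G(1) by (rule nn_integral_cmult_indicator[symmetric])
  also have "\<dots> \<le> (\<integral>\<^sup>+w. (\<Sum>z\<in>I. h (snd z) w) \<partial>?P)"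
    using lower by (intro nn_integral_mono) (auto simp: indicator_def)
  also have "\<dots> = (\<Sum>z\<in>I. emeasure ?P (H (snd z)))"
    unfolding hH by (rule nn_integral_sum) simp
  also have "\<dots> = ennreal (\<Sum>z\<in>I. measure ?P (H (snd z)))"
    by (simp add: P.emeasure_eq_measure)
  finally have "g * p / 2 \<le> (\<Sum>z\<in>I. measure ?P (H (snd z)))"
    by (subst (asm) ennreal_le_iff) (auto intro: sum_nonneg)
  also have "\<dots> = (\<Sum>z\<in>I. \<integral>w. indicator (H (snd z)) w \<partial>?P)"
    using Hs sets.sets_into_space by (intro sum.cong refl) (simp add: Int_absorb2)
  also have "\<dots> = (\<integral>w. (\<Sum>z\<in>I. indicator (H (snd z)) w) \<partial>?P)"
    using Hs by (intro Bochner_Integration.integral_sum[symmetric]) (simp add: P.emeasure_eq_measure)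
  also have "\<dots> \<le> (\<integral>w. real (m * L) * empirical pord w x {M..} \<partial>?P)"
  proof (rule integral_mono)
    show "integrable ?P (\<lambda>w. \<Sum>z\<in>I. indicator (H (snd z)) w :: real)"
      using Hs by (intro Bochner_Integration.integrable_sum) (simp add: P.emeasure_eq_measure)
    show "integrable ?P (\<lambda>w. real (m * L) * empirical pord w x {M..})"
      by (intro integrable_mult_right empirical_integrable mu pord)
    fix w assume w: "w \<in> space ?P"
    have "(\<Sum>z\<in>I. indicator (H (snd z)) w :: real) = (\<Sum>z\<in>I. of_bool (success pord x M L (snd z) w))"
      using w unfolding H_def indicator_def by simp
    also have "\<dots> \<le> real (m * L) * empirical pord w x {M..}"
      unfolding I_def by (rule success_count_le[OF V mult])
    finally show "(\<Sum>z\<in>I. indicator (H (snd z)) w :: real) \<le> real (m * L) * empirical pord w x {M..}" .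
  qed
  also have "\<dots> = real (m * L) * (\<integral>w. empirical pord w x {M..} \<partial>?P)"
    by simp
  finally show ?thesis unfolding p_def .
qed

text \<open>The number of anchors is at least \<kappa> |x|_1 / (2 l) and the length bound is at most
  C2 |x|_1, so |x|_1 cancels in \<open>averaging\<close>.\<close>

lemma density_bound:
  fixes \<mu> :: "real measure" and pord :: "(int ^ 'd::finite) list \<Rightarrow> nat"
  assumes d: "CARD('d) \<ge> 2" and mu: "prob_space \<mu>" "sets \<mu> = sets borel" "measure \<mu> {0..} = 1"
    and std: "standing_assumption TYPE('d) \<mu>" and pord: "inj_on pord {p. sa_path p}"
  shows "\<exists>\<kappa> \<eta> s C2. 0 < \<kappa> \<and> 0 < \<eta> \<and> 0 < measure \<mu> {0..s} \<and> 0 < C2 \<and>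
    (\<forall>l M B. \<forall>x :: int ^ 'd. 0 \<le> M \<longrightarrow> 8 \<le> \<kappa> * real l \<longrightarrow> 16 * real l \<le> \<kappa> * real_of_int (l1norm x) \<longrightarrow>
      real (Suc l * 4 ^ CARD('d)) \<le> real_of_int (l1norm x) \<longrightarrow> B < \<eta> * real l \<longrightarrow>
      \<kappa> * (measure \<mu> {M..B} * (measure \<mu> {0..s} * measure \<mu> {M..}) ^ (Suc l * 4 ^ CARD('d))) / (4 * real l)
      \<le> real ((2 * (l + 2)) ^ CARD('d) * ((Suc l * (4 ^ CARD('d)) ^ l) * (2 * (l + 2)) ^ CARD('d))) * C2 *
        (\<integral>w. empirical pord w x {M..} \<partial>fpp_space \<mu>))"
proof -
  let ?P = "fpp_space \<mu> :: ((int ^ 'd) set \<Rightarrow> real) measure"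
  interpret P: prob_space ?P unfolding fpp_space_def by (intro prob_space_PiM mu(1))
  define r where "r = ess_inf_law \<mu>"
  have r: "0 \<le> r" unfolding r_def by (rule ess_inf_law_props(1)[OF mu])
  from many_excess_segments[OF mu std, folded r_def] obtain \<kappa> \<delta> G1 where pos: "0 < \<kappa>" "0 < \<delta>"
    and G1: "G1 \<in> sets ?P" "3 / 4 \<le> measure ?P G1" "\<forall>w\<in>G1. regular r \<kappa> \<delta> w"
    unfolding regular_def[symmetric] by blast
  from linear_passage_time[OF mu(1,2) d] obtain D where D: "0 < D"
    "\<forall>x :: int ^ 'd. \<exists>G\<in>sets ?P. 3 / 4 \<le> measure ?P G \<and>
      (\<forall>w\<in>G. \<exists>p. sa_path p \<and> hd p = 0 \<and> last p = x \<and> path_time w p \<le> D * real_of_int (l1norm x))" by blast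
  \<comment> \<open>These values of s and \<eta> are the even split of the block excess in
    \<open>many_shortcuts\<close>.\<close>
  define s where "s = r + \<delta> * \<kappa> / 8"
  define \<eta> where "\<eta> = \<delta> * \<kappa> / 8"
  \<comment> \<open>The 2 covers the + 1 and the rounding in L, because |x|_1 \<ge> 1.\<close>
  define C2 where "C2 = (D / \<delta> + 1) / \<kappa> + 2"
  have s: "0 \<le> s" "0 < measure \<mu> {0..s}"
    using r pos ess_inf_law_props(3)[OF mu, of "\<delta> * \<kappa> / 8"] unfolding s_def r_def by auto
  have C2: "0 < C2" unfolding C2_def using D(1) pos by (simp add: add_pos_pos)
  have main: "\<kappa> * (measure \<mu> {M..B} * (measure \<mu> {0..s} * measure \<mu> {M..}) ^ (Suc l * 4 ^ CARD('d))) / (4 * real l)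
      \<le> real ((2 * (l + 2)) ^ CARD('d) * ((Suc l * (4 ^ CARD('d)) ^ l) * (2 * (l + 2)) ^ CARD('d))) * C2 *
        (\<integral>w. empirical pord w x {M..} \<partial>?P)"
    if M: "0 \<le> M" and l: "8 \<le> \<kappa> * real l" "16 * real l \<le> \<kappa> * real_of_int (l1norm x)"
      "real (Suc l * 4 ^ CARD('d)) \<le> real_of_int (l1norm x)" and B: "B < \<eta> * real l"
    for l M B and x :: "int ^ 'd"
  proof -
    let ?n = "real_of_int (l1norm x)"
    let ?m = "(2 * (l + 2)) ^ CARD('d) * ((Suc l * (4 ^ CARD('d)) ^ l) * (2 * (l + 2)) ^ CARD('d))"
    let ?p = "measure \<mu> {M..B} * (measure \<mu> {0..s} * measure \<mu> {M..}) ^ (Suc l * 4 ^ CARD('d))"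
    obtain G2 where G2: "G2 \<in> sets ?P" "3 / 4 \<le> measure ?P G2"
      "\<forall>w\<in>G2. \<exists>p. sa_path p \<and> hd p = 0 \<and> last p = x \<and> path_time w p \<le> D * ?n"
      using D(2) by blast
    define G where "G = G1 \<inter> G2"
    have G: "G \<in> sets ?P" "1 / 2 \<le> measure ?P G"
    proof -
      show "G \<in> sets ?P" unfolding G_def using G1(1) G2(1) by auto
      have "measure ?P G1 + measure ?P G2 \<le> measure ?P (G1 \<inter> G2) + 1"
        using P.finite_measure_Union'[OF G1(1) G2(1)] P.finite_measure_Diff'[OF G2(1) G1(1)] P.prob_le_1[of "G1 \<union> G2"]
        by (simp add: Int_commute)
      then show "1 / 2 \<le> measure ?P G" using G1(2) G2(2) unfolding G_def by simp
    qed
    have l0: "0 < l" using l(1) pos(1) by (cases l) auto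
    have n1: "1 \<le> ?n"
    proof -
      have "0 < Suc l * 4 ^ CARD('d)" by (rule mult_pos_pos) simp_all
      then have "Suc 0 \<le> Suc l * 4 ^ CARD('d)" by (rule Suc_leI)
      then have "real (Suc 0) \<le> real (Suc l * 4 ^ CARD('d))" by (rule of_nat_mono)
      from this l(3) have "real (Suc 0) \<le> ?n" by (rule order_trans)
      then show ?thesis by simp
    qed
    define L where "L = nat \<lceil>(D / \<delta> + 1) / \<kappa> * ?n + 1\<rceil>"
    have Lr: "(D / \<delta> + 1) / \<kappa> * ?n + 1 \<le> real L" unfolding L_def by linarith
    have "0 \<le> (D / \<delta> + 1) / \<kappa> * ?n" using D(1) pos n1 by simp
    then have "real L \<le> (D / \<delta> + 1) / \<kappa> * ?n + 2" unfolding L_def by linarith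
    also have "\<dots> \<le> C2 * ?n" unfolding C2_def using n1 by (simp add: algebra_simps)
    finally have LC: "real L \<le> C2 * ?n" .
    have kn: "1 \<le> \<kappa> * ?n" using l(2) l0 by linarith
    have B8: "8 * B < \<delta> * \<kappa> * real l" using B unfolding \<eta>_def by simp
    have "\<kappa> * ?n / (2 * real l) * ?p / 2 \<le> real (?m * L) * (\<integral>w. empirical pord w x {M..} \<partial>?P)"
    proof (rule averaging[OF mu(1,2) pord G _ finite_near[of L 0]])
      show "0 \<le> \<kappa> * ?n / (2 * real l)" using pos n1 by simp
      show "card {z \<in> (SIGMA a:near L 0. short_paths l a). e \<in> nbhd (snd z)} \<le> ?m" if "e \<in> lattice_edges" for e :: "(int ^ 'd) set"
        by (rule multiplicity[OF that]) simp
      fix w assume w: "w \<in> G"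
      have reg: "regular r \<kappa> \<delta> w" using G1(3) w unfolding G_def by blast
      obtain p0 where p0: "sa_path p0" "hd p0 = 0" "last p0 = x" "path_time w p0 \<le> D * ?n"
        using G2(3) w unfolding G_def by blast
      let ?A = "{a \<in> near L 0. \<exists>\<sigma>. shortcut w (first_geodesic pord w x) s B \<sigma> \<and> length \<sigma> \<le> Suc l \<and> l1norm (hd \<sigma> - a) \<le> int l}"
      let ?A' = "{a \<in> near L 0. \<exists>\<sigma>\<in>short_paths l a. \<forall>w'. (\<forall>e\<in>lattice_edges. e \<notin> nbhd \<sigma> \<longrightarrow> w' e = w e) \<longrightarrow>
          (\<forall>e\<in>nbhd \<sigma>. w' e \<in> target s M B \<sigma> e) \<longrightarrow> success pord x M L \<sigma> w'}"
      have "\<kappa> * ?n / (2 * real l) \<le> real (card ?A)"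
        unfolding s_def by (rule regular_many_shortcuts[OF reg r pos p0 l(1,2) B8 Lr])
      also have "\<dots> \<le> real (card ?A')"
      proof (intro of_nat_mono card_mono)
        show "?A \<subseteq> ?A'"
        proof (rule subsetI)
          fix a assume "a \<in> ?A"
          then obtain \<sigma> where a: "a \<in> near L 0" and \<sigma>: "shortcut w (first_geodesic pord w x) s B \<sigma>" "length \<sigma> \<le> Suc l"
            "l1norm (hd \<sigma> - a) \<le> int l" by blast
          have sa: "sa_path \<sigma>" "2 \<le> length \<sigma>" using \<sigma>(1) unfolding shortcut_def by blast+
          have "length \<sigma> * 4 ^ CARD('d) \<le> Suc l * 4 ^ CARD('d)" using \<sigma>(2) by (rule mult_le_mono1)
          then have "card (nbhd \<sigma>) \<le> Suc l * 4 ^ CARD('d)" using card_nbhd_le(2)[OF sa] by linarith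
          then have "real (card (nbhd \<sigma>)) \<le> real (Suc l * 4 ^ CARD('d))" by (rule of_nat_mono)
          then have Nn: "real (card (nbhd \<sigma>)) \<le> ?n" using l(3) by linarith
          have "success pord x M L \<sigma> w'"
            if off: "\<forall>e\<in>lattice_edges. e \<notin> nbhd \<sigma> \<longrightarrow> w' e = w e" and on: "\<forall>e\<in>nbhd \<sigma>. w' e \<in> target s M B \<sigma> e" for w'
            by (rule resample_success[OF reg r pos s(1) M kn p0 \<sigma>(1) Nn off[rule_format] on[rule_format] Lr])
          moreover have "\<sigma> \<in> short_paths l a" unfolding short_paths_def using sa \<sigma> by simp
          ultimately show "a \<in> ?A'" using a by blast
        qed
      qed simp
      finally show "\<kappa> * ?n / (2 * real l) \<le> real (card ?A')" .
    qed
    also have "\<dots> = real ?m * (\<integral>w. empirical pord w x {M..} \<partial>?P) * real L" by simp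
    also have "\<dots> \<le> real ?m * (\<integral>w. empirical pord w x {M..} \<partial>?P) * (C2 * ?n)"
      using LC by (intro mult_left_mono mult_nonneg_nonneg Bochner_Integration.integral_nonneg empirical_bounds(1)) auto
    finally have "?n * (\<kappa> * ?p / (4 * real l)) \<le> ?n * (real ?m * C2 * (\<integral>w. empirical pord w x {M..} \<partial>?P))"
      by (simp add: mult_ac)
    then show ?thesis using n1 by (subst (asm) mult_le_cancel_left_pos) auto
  qed
  show ?thesis
    using pos(1) s(2) C2 main by (intro exI[of _ \<kappa>] exI[of _ \<eta>] exI[of _ s] exI[of _ C2] conjI allI impI)
      (auto simp: \<eta>_def pos simp del: mult_Suc of_nat_mult power_Suc)
qed

section \<open>From the density estimate to the theorem\<close>

lemma empirical_antimono: "M \<le> M' \<Longrightarrow> empirical pord w x {M'..} \<le> empirical pord w x {M..}"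
  unfolding empirical_def Let_def by (intro divide_right_mono of_nat_mono card_mono) auto

lemma tail_small:
  fixes \<mu> :: "real measure"
  assumes "prob_space \<mu>" "sets \<mu> = sets borel" "0 < c"
  shows "\<exists>M0\<ge>1. \<forall>M\<ge>M0. measure \<mu> {M..} \<le> c"
proof -
  interpret prob_space \<mu> by (rule assms(1))
  have "(\<lambda>n. measure \<mu> {real n..}) \<longlonglongrightarrow> measure \<mu> (\<Inter>n. {real n..})"
  proof (rule finite_Lim_measure_decseq)
    show "range (\<lambda>n. {real n..}) \<subseteq> events" by (auto simp: assms(2))
    show "decseq (\<lambda>n. {real n..})" by (auto simp: decseq_def)
  qed
  moreover have "(\<Inter>n. {real n..}) = {}"
  proof -
    have "\<exists>n. \<not> real n \<le> x" for x :: real using reals_Archimedean2[of x] by (auto simp: not_le)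
    then show ?thesis by auto
  qed
  ultimately have "(\<lambda>n. measure \<mu> {real n..}) \<longlonglongrightarrow> 0" by simp
  then have "\<forall>\<^sub>F n in sequentially. measure \<mu> {real n..} < c" using assms(3) by (intro order_tendstoD)
  then obtain n where n: "measure \<mu> {real n..} < c" by (auto simp: eventually_sequentially)
  have "measure \<mu> {M..} \<le> c" if "max 1 (real n) \<le> M" for M
  proof -
    have "measure \<mu> {M..} \<le> measure \<mu> {real n..}" using that assms(2) by (intro finite_measure_mono) auto
    then show ?thesis using n by simp
  qed
  then show ?thesis by (intro exI[of _ "max 1 (real n)"]) auto
qed

text \<open>The exponents add up as 3 d l + l + 2 d l + 3 d l.\<close>

lemma multiplicity_exponential:
  fixes l d :: nat
  assumes "1 \<le> l"
  shows "(2 * (l + 2)) ^ d * ((Suc l * (4 ^ d) ^ l) * (2 * (l + 2)) ^ d) \<le> 2 ^ ((8 * d + 1) * l)"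
proof -
  have "2 * (k + 2) \<le> (2::nat) ^ (k + 2)" for k by (induction k) auto
  then have "2 * (l + 2) \<le> (2::nat) ^ (l + 2)" .
  also have "(2::nat) ^ (l + 2) \<le> 2 ^ (3 * l)" using assms by (intro power_increasing) auto
  finally have "(2 * (l + 2)) ^ d \<le> (2 ^ (3 * l)) ^ d" by (intro power_mono) auto
  then have 1: "(2 * (l + 2)) ^ d \<le> 2 ^ (3 * l * d)" by (simp only: power_mult)
  have 2: "Suc l \<le> 2 ^ l" by (simp add: Suc_leI)
  have "(4::nat) = 2 ^ 2" by simp
  then have 3: "((4::nat) ^ d) ^ l = 2 ^ (2 * d * l)" by (simp only: power_mult)
  have "(2 * (l + 2)) ^ d * ((Suc l * (4 ^ d) ^ l) * (2 * (l + 2)) ^ d)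
      \<le> 2 ^ (3 * l * d) * ((2 ^ l * 2 ^ (2 * d * l)) * 2 ^ (3 * l * d))"
    unfolding 3 using 1 2 by (intro mult_le_mono) auto
  also have "\<dots> = 2 ^ ((8 * d + 1) * l)" by (simp add: power_add[symmetric] algebra_simps)
  finally show ?thesis .
qed

text \<open>The block length l is taken proportional to M, large enough for B = \<gamma> M to be
  affordable. All remaining factors are at most exponential in l, and since
  \<open>measure \<mu> {M..}\<close> is at most 1/2, a power of it absorbs them.\<close>

lemma key_bound:
  fixes \<mu> :: "real measure" and pord :: "(int ^ 'd::finite) list \<Rightarrow> nat" and \<gamma> :: nat
  assumes d: "CARD('d) \<ge> 2" and mu: "prob_space \<mu>" "sets \<mu> = sets borel" "measure \<mu> {0..} = 1"
    and std: "standing_assumption TYPE('d) \<mu>" and pord: "inj_on pord {p. sa_path p}"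
  shows "\<exists>C C' M0 :: real. 1 \<le> C \<and> 1 \<le> C' \<and> 1 \<le> M0 \<and> (\<forall>M\<ge>M0. measure \<mu> {M..} \<le> 1 / 2 \<and>
    (\<forall>x :: int ^ 'd. C' * M \<le> real_of_int (l1norm x) \<longrightarrow>
      measure \<mu> {M..real \<gamma> * M} * measure \<mu> {M..} powr (C * M) \<le> (\<integral>w. empirical pord w x {M..} \<partial>fpp_space \<mu>)))"
proof -
  interpret mu: prob_space \<mu> by (rule mu(1))
  let ?d = "CARD('d)"
  from density_bound[OF d mu std pord] obtain \<kappa> \<eta> s C2 where c: "0 < \<kappa>" "0 < \<eta>" "0 < measure \<mu> {0..s}" "0 < C2"
    and dens: "\<forall>l M B. \<forall>x :: int ^ 'd. 0 \<le> M \<longrightarrow> 8 \<le> \<kappa> * real l \<longrightarrow> 16 * real l \<le> \<kappa> * real_of_int (l1norm x) \<longrightarrow>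
      real (Suc l * 4 ^ ?d) \<le> real_of_int (l1norm x) \<longrightarrow> B < \<eta> * real l \<longrightarrow>
      \<kappa> * (measure \<mu> {M..B} * (measure \<mu> {0..s} * measure \<mu> {M..}) ^ (Suc l * 4 ^ ?d)) / (4 * real l)
      \<le> real ((2 * (l + 2)) ^ ?d * ((Suc l * (4 ^ ?d) ^ l) * (2 * (l + 2)) ^ ?d)) * C2 *
        (\<integral>w. empirical pord w x {M..} \<partial>fpp_space \<mu>)"
    by (elim exE conjE) (rule that)
  obtain M0 where M0: "1 \<le> M0" "\<forall>M\<ge>M0. measure \<mu> {M..} \<le> 1 / 2" using tail_small[OF mu(1,2), of "1 / 2"] by auto
  \<comment> \<open>Chosen so that l \<le> c5 M; the 2 covers the rounding and the + 1 in the
    definition of l.\<close>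
  define c5 where "c5 = 8 / \<kappa> + real \<gamma> / \<eta> + 2"
  have c5: "0 < c5" unfolding c5_def using c by (simp add: add_pos_nonneg)
  define C' where "C' = max 1 (max (16 * c5 / \<kappa>) (2 * c5 * 4 ^ ?d))"
  \<comment> \<open>Powers of 2 that dominate the constants C2 / \<kappa> and 1 /
    \<open>measure \<mu> {0..s}\<close>.\<close>
  obtain j1 where j1: "C2 / \<kappa> < 2 ^ j1" using real_arch_pow[of 2 "C2 / \<kappa>"] by auto
  obtain j2 where j2: "(1 / 2) ^ j2 < measure \<mu> {0..s}" using real_arch_pow_inv[of "measure \<mu> {0..s}" "1 / 2"] c(3) by auto
  \<comment> \<open>The first summand replaces the mass of \<open>{0..s}\<close> by a power of that
    of \<open>{M..}\<close>, for an exponent of at most 2 l 4^d. The terms 3, 8 d + 1 and j1 cancel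
    the factor 4 l, the multiplicity and C2 / \<kappa>.\<close>
  define N where "N = (j2 + 1) * (2 * 4 ^ ?d) + (3 + (8 * ?d + 1) + j1)"
  define C where "C = max 1 (real N * c5)"
  have main: "measure \<mu> {M..real \<gamma> * M} * measure \<mu> {M..} powr (C * M) \<le> (\<integral>w. empirical pord w x {M..} \<partial>fpp_space \<mu>)"
    if M: "M0 \<le> M" and x: "C' * M \<le> real_of_int (l1norm x)" for M and x :: "int ^ 'd"
  proof -
    let ?q = "measure \<mu> {M..}" and ?qa = "measure \<mu> {M..real \<gamma> * M}" and ?k = "measure \<mu> {0..s}"
    define I where "I = (\<integral>w. empirical pord w x {M..} \<partial>fpp_space \<mu>)"
    have I0: "0 \<le> I" unfolding I_def by (intro Bochner_Integration.integral_nonneg empirical_bounds(1))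
    have M1: "1 \<le> M" using M M0(1) by simp
    have q: "0 \<le> ?q" "?q \<le> 1 / 2" using M0(2) M by auto
    have q0q: "?qa \<le> ?q" using mu(2) by (intro mu.finite_measure_mono) auto
    \<comment> \<open>Exceeds both 8 M / \<kappa> and \<gamma> M / \<eta>, which gives the lower
      bounds on l required by \<open>density_bound\<close>.\<close>
    define l where "l = nat \<lceil>(8 / \<kappa> + real \<gamma> / \<eta>) * M\<rceil> + 1"
    have a0: "0 \<le> (8 / \<kappa> + real \<gamma> / \<eta>) * M" using c M1 by (simp add: add_nonneg_nonneg)
    have lr: "(8 / \<kappa> + real \<gamma> / \<eta>) * M < real l" unfolding l_def by linarith
    have "real l \<le> (8 / \<kappa> + real \<gamma> / \<eta>) * M + 2" unfolding l_def using a0 by linarith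
    also have "\<dots> \<le> c5 * M" unfolding c5_def using M1 by (simp add: algebra_simps)
    finally have lc: "real l \<le> c5 * M" .
    have l1: "1 \<le> l" unfolding l_def by simp
    have l8: "8 \<le> \<kappa> * real l"
    proof -
      have "8 / \<kappa> * 1 \<le> 8 / \<kappa> * M" using c M1 by (intro mult_left_mono) auto
      moreover have "0 \<le> real \<gamma> / \<eta> * M" using c M1 by simp
      ultimately have "8 / \<kappa> \<le> real l" using lr by (simp add: distrib_right)
      then show ?thesis using c by (simp add: field_simps)
    qed
    have lB: "real \<gamma> * M < \<eta> * real l"
    proof -
      have "0 \<le> 8 / \<kappa> * M" using c M1 by simp
      then have "real \<gamma> / \<eta> * M < real l" using lr by (simp add: distrib_right)
      then show ?thesis using c by (simp add: field_simps)
    qed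
    have ln: "16 * real l \<le> \<kappa> * real_of_int (l1norm x)"
    proof -
      have "16 * c5 / \<kappa> * M \<le> C' * M" unfolding C'_def using M1 by (intro mult_right_mono) auto
      then have "16 * c5 / \<kappa> * M \<le> real_of_int (l1norm x)" using x by linarith
      then have "16 * (c5 * M) \<le> \<kappa> * real_of_int (l1norm x)" using c by (simp add: field_simps)
      then show ?thesis using lc by linarith
    qed
    have ln2: "real (Suc l * 4 ^ ?d) \<le> real_of_int (l1norm x)"
    proof -
      have "real (Suc l * 4 ^ ?d) \<le> real (2 * l * 4 ^ ?d)" using l1 by (intro of_nat_mono mult_le_mono1) simp
      also have "\<dots> = 2 * 4 ^ ?d * real l" by simp
      also have "\<dots> \<le> 2 * 4 ^ ?d * (c5 * M)" using lc by (intro mult_left_mono) auto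
      also have "\<dots> = 2 * c5 * 4 ^ ?d * M" by simp
      also have "\<dots> \<le> C' * M" unfolding C'_def using M1 by (intro mult_right_mono) auto
      finally show ?thesis using x by linarith
    qed
    let ?A = "Suc l * 4 ^ ?d"
    have "\<kappa> * (?qa * (?k * ?q) ^ ?A) / (4 * real l)
      \<le> real ((2 * (l + 2)) ^ ?d * ((Suc l * (4 ^ ?d) ^ l) * (2 * (l + 2)) ^ ?d)) * C2 * I"
      using dens[rule_format, of M l x "real \<gamma> * M"] M1 l8 ln ln2 lB unfolding I_def by simp
    also have "\<dots> \<le> real (2 ^ ((8 * ?d + 1) * l)) * C2 * I"
      using multiplicity_exponential[OF l1, of ?d] c(4) I0 by (intro mult_right_mono of_nat_mono) auto
    finally have "\<kappa> * (?qa * (?k * ?q) ^ ?A) \<le> 4 * real l * (real (2 ^ ((8 * ?d + 1) * l)) * C2 * I)"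
      using l1 by (simp add: divide_le_eq mult.commute)
    then have "?qa * (?k * ?q) ^ ?A \<le> (4 * real l) * 2 ^ ((8 * ?d + 1) * l) * (C2 / \<kappa>) * I"
      using c(1) by (simp add: field_simps)
    also have "\<dots> \<le> 2 ^ (3 * l) * 2 ^ ((8 * ?d + 1) * l) * 2 ^ (j1 * l) * I"
    proof (intro mult_mono mult_nonneg_nonneg I0)
      have "real l \<le> 2 ^ l" using less_exp[of l] by (metis less_imp_le of_nat_le_iff of_nat_numeral of_nat_power)
      then have "4 * real l \<le> 2 ^ 2 * 2 ^ l" by simp
      also have "\<dots> = (2::real) ^ (2 + l)" by (simp only: power_add)
      also have "\<dots> \<le> 2 ^ (3 * l)" using l1 by (intro power_increasing) auto
      finally show "4 * real l \<le> 2 ^ (3 * l)" .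
      have "(2::real) ^ j1 \<le> 2 ^ (j1 * l)" using l1 by (intro power_increasing) auto
      then show "C2 / \<kappa> \<le> 2 ^ (j1 * l)" using j1 by linarith
    qed (use c in auto)
    also have "\<dots> = 2 ^ ((3 + (8 * ?d + 1) + j1) * l) * I" by (simp add: power_add[symmetric] algebra_simps)
    finally have up: "?qa * (?k * ?q) ^ ?A \<le> 2 ^ ((3 + (8 * ?d + 1) + j1) * l) * I" .
    let ?R = "(3 + (8 * ?d + 1) + j1) * l"
    have kq: "?q ^ (j2 + 1) \<le> ?k * ?q"
    proof -
      have "?q ^ j2 \<le> (1 / 2) ^ j2" using q by (intro power_mono) auto
      then have "?q ^ j2 \<le> ?k" using j2 by linarith
      then show ?thesis using mult_right_mono[OF \<open>?q ^ j2 \<le> ?k\<close> q(1)] by (simp add: mult.commute)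
    qed
    have "?q ^ ((j2 + 1) * (2 * 4 ^ ?d) * l) = (?q ^ (j2 + 1)) ^ (2 * l * 4 ^ ?d)"
      unfolding power_mult[symmetric] by (simp only: mult_ac)
    also have "\<dots> \<le> (?k * ?q) ^ (2 * l * 4 ^ ?d)" using kq q by (intro power_mono) auto
    also have "\<dots> \<le> (?k * ?q) ^ ?A"
    proof (rule power_decreasing)
      show "?A \<le> 2 * l * 4 ^ ?d" using l1 by (intro mult_le_mono1) simp
      show "?k * ?q \<le> 1" using q by (intro mult_le_one) auto
    qed (use q in auto)
    finally have low: "?q ^ ((j2 + 1) * (2 * 4 ^ ?d) * l) \<le> (?k * ?q) ^ ?A" .
    have "?q ^ ?R * 2 ^ ?R \<le> 1"
    proof -
      have "(?q * 2) ^ ?R \<le> 1" using q by (intro power_le_one) auto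
      then show ?thesis by (simp only: power_mult_distrib)
    qed
    have "?qa * ?q ^ (N * l) = ?q ^ ?R * (?qa * ?q ^ ((j2 + 1) * (2 * 4 ^ ?d) * l))"
    proof -
      have "N * l = ?R + (j2 + 1) * (2 * 4 ^ ?d) * l" unfolding N_def by (simp only: distrib_right add.commute)
      then show ?thesis by (simp only: power_add mult_ac)
    qed
    also have "\<dots> \<le> ?q ^ ?R * (?qa * (?k * ?q) ^ ?A)" using low q by (intro mult_left_mono) auto
    also have "\<dots> \<le> ?q ^ ?R * (2 ^ ?R * I)" using up q by (intro mult_left_mono) auto
    also have "\<dots> = ?q ^ ?R * 2 ^ ?R * I" by simp
    also have "\<dots> \<le> 1 * I" using \<open>?q ^ ?R * 2 ^ ?R \<le> 1\<close> I0 by (rule mult_right_mono)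
    finally have fin: "?qa * ?q ^ (N * l) \<le> I" by simp
    show ?thesis
    proof (cases "?q = 0")
      case True
      then show ?thesis using I0 unfolding I_def by simp
    next
      case False
      then have qp: "0 < ?q" using q(1) by linarith
      have "real (N * l) \<le> C * M"
      proof -
        have "real (N * l) \<le> real N * (c5 * M)" using lc by (simp add: mult_left_mono)
        also have "\<dots> \<le> C * M" unfolding C_def mult.assoc[symmetric] using M1 by (intro mult_right_mono) auto
        finally show ?thesis .
      qed
      then have "?q powr (C * M) \<le> ?q powr real (N * l)" using qp q by (intro powr_mono') auto
      also have "\<dots> = ?q ^ (N * l)" using qp by (rule powr_realpow)
      finally have "?qa * ?q powr (C * M) \<le> ?qa * ?q ^ (N * l)" by (intro mult_left_mono) auto
      then show ?thesis using fin unfolding I_def by linarith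
    qed
  qed
  have C1: "1 \<le> C" "1 \<le> C'" unfolding C_def C'_def by auto
  show ?thesis
    by (intro exI[of _ C] exI[of _ C'] exI[of _ M0] conjI allI impI C1 M0(1) M0(2)[rule_format] main)
qed

text \<open>The ordering of the paths is given by an injection \<open>pord\<close> into the
  naturals. On the lattice |x| tends to infinity exactly along the cofinite filter, and \<gamma>
  \<ge> 2 makes the weights of the sum at most geometric with ratio 1/2.\<close>

theorem theorem2p3:
  fixes \<mu> :: "real measure" and pord :: "(int ^ 'd::finite) list \<Rightarrow> nat" and \<gamma> L :: nat
  assumes "CARD('d) \<ge> 2"
    and "prob_space \<mu>" and "sets \<mu> = sets borel" and "measure \<mu> {0..} = 1"
    and "standing_assumption TYPE('d) \<mu>"
    and "inj_on pord {p. sa_path p}"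
    and "\<gamma> \<ge> 2"
  shows "\<exists>C C' M\<^sub>0 :: real. C > 0 \<and> C' > 0 \<and> M\<^sub>0 > 0 \<and>
    (\<forall>M \<ge> M\<^sub>0. \<forall>x :: int ^ 'd. real_of_int (l1norm x) \<ge> C' * M\<^sup>2 \<longrightarrow>
        (\<integral>w. empirical pord w x {M..} \<partial>fpp_space \<mu>) \<ge>
        max (measure \<mu> {M..real \<gamma> * M} powr C * measure \<mu> {M..} powr (C * M))
            (\<Sum>i\<le>L. (1 / real \<gamma> ^ i) *
               measure \<mu> {real \<gamma> ^ i * M .. real \<gamma> ^ (i + 1) * M} powr (C * real \<gamma> ^ i * M))) \<and>
    (\<forall>M \<ge> M\<^sub>0.
        Liminf cofinite (\<lambda>x :: int ^ 'd. ereal (\<integral>w. empirical pord w x {M..} \<partial>fpp_space \<mu>)) \<ge>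
        ereal (max (measure \<mu> {M..real \<gamma> * M} powr C * measure \<mu> {M..} powr (C * M))
            (\<Sum>i. (1 / real \<gamma> ^ i) *
               measure \<mu> {real \<gamma> ^ i * M .. real \<gamma> ^ (i + 1) * M} powr (C * real \<gamma> ^ i * M))))"
proof -
  interpret mu: prob_space \<mu> by (rule assms(2))
  define X where "X M x = (\<integral>w. empirical pord w x {M..} \<partial>fpp_space \<mu>)" for M and x :: "int ^ 'd"
  obtain C0 C0' M0 :: real where C0: "1 \<le> C0" "1 \<le> C0'" "1 \<le> M0"
    and key: "\<forall>M\<ge>M0. measure \<mu> {M..} \<le> 1 / 2 \<and> (\<forall>x :: int ^ 'd. C0' * M \<le> real_of_int (l1norm x) \<longrightarrow>
      measure \<mu> {M..real \<gamma> * M} * measure \<mu> {M..} powr (C0 * M) \<le> X M x)"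
    using key_bound[OF assms(1-6), of \<gamma>, folded X_def] by (elim exE conjE) (rule that)
  \<comment> \<open>In \<open>tbound\<close> the power splits into three: the exponent \<gamma>^i M
    gives a factor at most 1/2, one C0 \<gamma>^i M gives the single factor of the window mass, and
    the other the tail power in \<open>key_bound\<close>.\<close>
  define C where "C = 2 * C0 + 1"
  have X0: "0 \<le> X M x" for M x unfolding X_def by (intro Bochner_Integration.integral_nonneg empirical_bounds(1))
  have Xmono: "X M' x \<le> X M x" if "M \<le> M'" for M M' x
    unfolding X_def using that
    by (intro integral_mono empirical_integrable assms empirical_antimono)
  have g1: "1 \<le> real \<gamma> ^ i" for i using assms(7) by (intro one_le_power) simp
  define T where "T M i = measure \<mu> {real \<gamma> ^ i * M .. real \<gamma> ^ (i + 1) * M} powr (C * real \<gamma> ^ i * M)" for M i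
  define F where "F M = measure \<mu> {M..real \<gamma> * M} powr C * measure \<mu> {M..} powr (C * M)" for M
  have T0: "0 \<le> T M i" "T M i \<le> 1" if "M0 \<le> M" for M i
  proof -
    show "0 \<le> T M i" unfolding T_def by simp
    have "0 \<le> C * real \<gamma> ^ i * M" using C0 that unfolding C_def by (intro mult_nonneg_nonneg) auto
    then show "T M i \<le> 1" unfolding T_def by (intro powr_le1) auto
  qed
  have first: "F M \<le> X M x" if M: "M0 \<le> M" and x: "C0' * M \<le> real_of_int (l1norm x)" for M x
  proof -
    let ?qa = "measure \<mu> {M..real \<gamma> * M}" and ?q = "measure \<mu> {M..}"
    have M1: "1 \<le> M" using M C0 by simp
    have "?qa powr C \<le> ?qa powr 1" unfolding C_def using C0 by (intro powr_mono') auto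
    moreover have "?q powr (C * M) \<le> ?q powr (C0 * M)"
    proof -
      have "C0 * M \<le> C * M" unfolding C_def using C0 M1 by (intro mult_right_mono) auto
      then show ?thesis by (intro powr_mono') auto
    qed
    ultimately have "F M \<le> ?qa powr 1 * ?q powr (C0 * M)" unfolding F_def by (intro mult_mono) auto
    also have "\<dots> = ?qa * ?q powr (C0 * M)" by simp
    also have "\<dots> \<le> X M x" using key M x by blast
    finally show ?thesis .
  qed
  \<comment> \<open>\<open>key_bound\<close> is applied with \<gamma>^i M as the threshold, and the
    density above this level is at most that above M. The factor 1/2 makes room for the geometric
    sum.\<close>
  have tbound: "T M i \<le> X M x / 2" if M: "M0 \<le> M" and x: "C0' * (real \<gamma> ^ i * M) \<le> real_of_int (l1norm x)" for M i x
  proof -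
    define Mi where "Mi = real \<gamma> ^ i * M"
    have "1 * M \<le> Mi" unfolding Mi_def using g1[of i] M C0 by (intro mult_right_mono) auto
    then have Mi: "M0 \<le> Mi" "1 \<le> Mi" "M \<le> Mi" using M C0 by auto
    let ?q = "measure \<mu> {Mi..real \<gamma> * Mi}" and ?Q = "measure \<mu> {Mi..}"
    have qQ: "?q \<le> ?Q" using assms(3) by (intro mu.finite_measure_mono) auto
    have Qh: "?Q \<le> 1 / 2" using key Mi(1) by blast
    have "T M i = ?q powr (Mi + C0 * Mi + C0 * Mi)"
      unfolding T_def Mi_def C_def by (simp add: algebra_simps)
    also have "\<dots> \<le> X Mi x / 2"
    proof (cases "?q = 0")
      case True
      then show ?thesis using X0[of Mi x] by simp
    next
      case False
      then have qp: "0 < ?q" by (simp add: less_le)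
      have "1 \<le> C0 * Mi" using C0 Mi mult_mono[of 1 C0 1 Mi] by simp
      then have "?q powr (C0 * Mi) \<le> ?q powr 1" by (intro powr_mono') auto
      then have a: "?q powr (C0 * Mi) \<le> ?q" by simp
      have "?q powr Mi \<le> ?q powr 1" using Mi by (intro powr_mono') auto
      then have b: "?q powr Mi \<le> 1 / 2" using qQ Qh by simp
      have e: "?q powr (C0 * Mi) \<le> ?Q powr (C0 * Mi)" using qQ \<open>1 \<le> C0 * Mi\<close> by (intro powr_mono2) auto
      have "?q powr (Mi + C0 * Mi + C0 * Mi) = ?q powr Mi * (?q powr (C0 * Mi) * ?q powr (C0 * Mi))"
        by (simp only: powr_add mult.assoc)
      also have "\<dots> \<le> 1 / 2 * (?q * ?Q powr (C0 * Mi))"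
        using a b e by (intro mult_mono) auto
      also have "?q * ?Q powr (C0 * Mi) \<le> X Mi x" using key Mi(1) x unfolding Mi_def by blast
      finally show ?thesis by simp
    qed
    also have "\<dots> \<le> X M x / 2" using Xmono[OF Mi(3), of x] by simp
    finally show ?thesis .
  qed
  have coef: "1 / real \<gamma> ^ i \<le> (1 / 2) ^ i" "0 \<le> 1 / real \<gamma> ^ i" for i
  proof -
    have "(2::real) ^ i \<le> real \<gamma> ^ i" using assms(7) by (intro power_mono) auto
    then have "1 / real \<gamma> ^ i \<le> 1 / 2 ^ i" using assms(7) by (intro divide_left_mono mult_pos_pos zero_less_power) auto
    then show "1 / real \<gamma> ^ i \<le> (1 / 2) ^ i" by (simp add: power_one_over)
  qed simp
  have partial: "(\<Sum>i\<le>n. (1 / real \<gamma> ^ i) * T M i) \<le> X M x"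
    if M: "M0 \<le> M" and x: "C0' * (real \<gamma> ^ n * M) \<le> real_of_int (l1norm x)" for M n x
  proof -
    have "(\<Sum>i\<le>n. (1 / real \<gamma> ^ i) * T M i) \<le> (\<Sum>i\<le>n. (1 / 2) ^ i * (X M x / 2))"
    proof (rule sum_mono)
      fix i assume i: "i \<in> {..n}"
      have "real \<gamma> ^ i \<le> real \<gamma> ^ n" using i assms(7) by (intro power_increasing) auto
      then have "C0' * (real \<gamma> ^ i * M) \<le> C0' * (real \<gamma> ^ n * M)"
        using C0 M by (intro mult_left_mono mult_right_mono) auto
      then have "T M i \<le> X M x / 2" using x by (intro tbound[OF M]) linarith
      then show "(1 / real \<gamma> ^ i) * T M i \<le> (1 / 2) ^ i * (X M x / 2)"
        using coef[of i] T0(1)[OF M, of i] by (intro mult_mono) auto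
    qed
    also have "\<dots> = (\<Sum>i\<le>n. (1 / 2 :: real) ^ i) * (X M x / 2)" by (simp only: sum_distrib_right)
    also have "\<dots> \<le> 2 * (X M x / 2)"
      using X0[of M x] by (intro mult_right_mono) (auto simp: sum_gp0)
    finally show ?thesis by simp
  qed
  \<comment> \<open>The highest level \<gamma>^L M requires |x|_1 \<ge> C0' \<gamma>^L M, and M
    \<le> M^2 because M \<ge> 1.\<close>
  define C' where "C' = C0' * real \<gamma> ^ L"
  have C'p: "0 < C'" unfolding C'_def using C0(2) g1[of L] by (intro mult_pos_pos) linarith+
  have finite_part: "max (F M) (\<Sum>i\<le>L. (1 / real \<gamma> ^ i) * T M i) \<le> X M x"
    if M: "M0 \<le> M" and x: "C' * M\<^sup>2 \<le> real_of_int (l1norm x)" for M x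
  proof -
    have M1: "1 \<le> M" using M C0 by simp
    have "M * 1 \<le> M * M" using M1 by (intro mult_left_mono) auto
    then have "C' * M \<le> C' * M\<^sup>2" using C'p by (intro mult_left_mono) (auto simp: power2_eq_square)
    then have 1: "C0' * (real \<gamma> ^ L * M) \<le> real_of_int (l1norm x)" using x unfolding C'_def by (simp add: mult_ac)
    have "1 * M \<le> real \<gamma> ^ L * M" using g1[of L] M1 by (intro mult_right_mono) auto
    then have "C0' * M \<le> C0' * (real \<gamma> ^ L * M)" using C0 by (intro mult_left_mono) auto
    then show ?thesis using first[OF M, of x] partial[OF M 1] 1 by simp
  qed
  have limit_part: "ereal (max (F M) (\<Sum>i. (1 / real \<gamma> ^ i) * T M i)) \<le> Liminf cofinite (\<lambda>x. ereal (X M x))"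
    if M: "M0 \<le> M" for M
  proof -
    have large: "\<forall>\<^sub>F x in cofinite. R \<le> real_of_int (l1norm (x :: int ^ 'd))" for R
      unfolding eventually_cofinite
    proof (rule finite_subset)
      show "{x :: int ^ 'd. \<not> R \<le> real_of_int (l1norm x)} \<subseteq> near (nat \<lceil>R\<rceil>) 0"
      proof
        fix x :: "int ^ 'd" assume "x \<in> {x. \<not> R \<le> real_of_int (l1norm x)}"
        then have "l1norm x < \<lceil>R\<rceil>" by (simp add: less_ceiling_iff)
        moreover from this have "0 < \<lceil>R\<rceil>" using l1norm_nonneg[of x] by linarith
        ultimately show "x \<in> near (nat \<lceil>R\<rceil>) 0" by (intro near_l1norm) simp
      qed
    qed simp
    have 1: "ereal (F M) \<le> Liminf cofinite (\<lambda>x. ereal (X M x))"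
      by (rule Liminf_bounded, rule eventually_mono[OF large[of "C0' * M"]]) (simp add: first[OF M])
    \<comment> \<open>For each n only finitely many x are lost, so the liminf dominates every
      partial sum; n tends to infinity only after the limit in x.\<close>
    have 2: "ereal (\<Sum>i\<le>n. (1 / real \<gamma> ^ i) * T M i) \<le> Liminf cofinite (\<lambda>x. ereal (X M x))" for n
      by (rule Liminf_bounded, rule eventually_mono[OF large[of "C0' * (real \<gamma> ^ n * M)"]])
        (use partial[OF M] in simp)
    have "summable (\<lambda>i. (1 / real \<gamma> ^ i) * T M i)"
    proof (rule summable_comparison_test')
      show "summable (\<lambda>i. (1 / 2 :: real) ^ i)" by (rule summable_geometric) simp
      fix i
      have "(1 / real \<gamma> ^ i) * T M i \<le> (1 / 2) ^ i * 1"
        using coef[of i] T0[OF M, of i] by (intro mult_mono) auto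
      then show "norm ((1 / real \<gamma> ^ i) * T M i) \<le> (1 / 2) ^ i" using coef(2)[of i] T0(1)[OF M, of i] by simp
    qed
    then have "(\<lambda>n. \<Sum>i\<le>n. (1 / real \<gamma> ^ i) * T M i) \<longlonglongrightarrow> (\<Sum>i. (1 / real \<gamma> ^ i) * T M i)"
      by (rule summable_LIMSEQ')
    then have "(\<lambda>n. ereal (\<Sum>i\<le>n. (1 / real \<gamma> ^ i) * T M i)) \<longlonglongrightarrow> ereal (\<Sum>i. (1 / real \<gamma> ^ i) * T M i)"
      by (intro tendsto_intros)
    then have "ereal (\<Sum>i. (1 / real \<gamma> ^ i) * T M i) \<le> Liminf cofinite (\<lambda>x. ereal (X M x))"
      by (rule LIMSEQ_le_const2) (use 2 in blast)
    with 1 show ?thesis by (simp only: max_def split: if_splits) simp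
  qed
  have pos: "0 < C" "0 < M0" using C0 unfolding C_def by auto
  show ?thesis
    by (intro exI[of _ C] exI[of _ C'] exI[of _ M0] conjI allI impI pos C'p
        finite_part[unfolded X_def F_def T_def] limit_part[unfolded X_def F_def T_def])
qed

end
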